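(* Let $P$ be a non-empty set of prime numbers, $G$ a pro-$P$ group, $\Omega\cong\mathbb Z_P=\prod_{p\in P}\mathbb Z_p$ with a fixed topological generator $\omega$, and $d:G\to\Omega$ a surjective continuous homomorphism. Let $\mathfrak E=\mathrm{Sp}(G)^{\mathrm f}$ and let $C$ be a discrete $G$-module. Let $C_*$ be the cohomological Mackey functor on the open subgroups of $G$ given by $C_*(H)=C^H$ with inclusions as restrictions, norm maps as inductions and the $G$-action as conjugations, and let $v\in\mathrm{Val}_d^{\langle\omega\rangle,\omega}(C_* )$. Suppose that $C_*$ satisfies the class field axiom for all pairs $(H,U)$ with $H$ an open subgroup of $G$ and $U$ an open normal subgroup of $H$ with $I_H\le U$, and for all pairs of open subgroups $U\lhd H$ of $G$ with $H/U$ cyclic of prime order and $f_{H|U}=1$. Then $(C_*,v)$ is a Fesenko--Neukirch datum on $\mathfrak E$ and the Fesenko--Neukirch morphism $\Upsilon:\pi_{\mathfrak K}\to\widehat{\mathrm H}^0_{\mathfrak E}(C_* )$ is a $\mathfrak K$-class field theory for $\mathfrak K=\mathfrak K(G)^{\mathrm f}_{\mathrm{ab}}$.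
   Context: $C$ and the groups $C_*(H)$ are written multiplicatively. ${}^gH=gHg^{-1}$; $\langle h\rangle_{\mathrm c}$ is the closure of $\langle h\rangle$; $\langle\omega\rangle\cong\mathbb Z$ is the abstract subgroup generated by $\omega$. For open subgroups $I\le H$ and $g\in G$: $\mathrm{res}_{I,H}:C^H\to C^I$ is the inclusion, $\mathrm{ind}_{H,I}:C^I\to C^H$, $a\mapsto\prod_{h\in H/I}ha$, is the norm, $\mathrm{con}_{g,H}:C^H\to C^{{}^gH}$, $a\mapsto ga$. Class field axiom for $(H,U)$ ($U\lhd H$ open): $|C^H/\mathrm{ind}_{H,U}C^U|=[H:U]$ and $\ker(\mathrm{ind}_{H,U})$ is generated by the elements $(hx)x^{-1}$, $h\in H$, $x\in C^U$ (i.e. $|\widehat{\mathrm H}^0(H/U,C^U)|=[H:U]$ and $\widehat{\mathrm H}^{-1}(H/U,C^U)=1$ in Tate cohomology). The spectrum $\mathfrak E=\mathrm{Sp}(G)^{\mathrm f}$. $\mathfrak E_{\mathrm b}$ = pairs $(H,U)$ with $H$ an open subgroup of $G$ and $U$ an open normal subgroup of $H$; $\mathfrak E_{\mathrm r}(H,U)$ = pairs $(I,U)\in\mathfrak E_{\mathrm b}$ with $I\le H$; $\mathfrak E_{\mathrm i}(H,U)$ = pairs $(I,V)\in\mathfrak E_{\mathrm b}$ with $I\le H$, $V\le U$. $\mathsf{Fct}(\mathfrak E,\mathsf{Ab})$ is the category of families of abelian groups $\Phi(H,U)$ with transitive, mutually equivariant restriction ($\mathfrak E_{\mathrm r}$),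 induction ($\mathfrak E_{\mathrm i}$) and conjugation maps; morphisms are families of homomorphisms commuting with these. $\pi_{\mathfrak K}(H,U)=(H/U)^{\mathrm{ab}}$ with con induced by conjugation, ind induced by inclusion, res the group-theoretic transfer; $\widehat{\mathrm H}^0_{\mathfrak E}(C_* )(H,U)=C^H/\mathrm{ind}_{H,U}C^U$ with maps induced by those of $C_*$. A morphism $\Upsilon:\pi_{\mathfrak K}\to\widehat{\mathrm H}^0_{\mathfrak E}(C_* )$ is a $\mathfrak K(G)^{\mathrm f}_{\mathrm{ab}}$-class field theory if it is an isomorphism in $\mathsf{Fct}(\mathfrak E,\mathsf{Ab})$ (objects discrete) and for every open $H\le G$ and every set $\mathcal L$ of open normal subgroups $U$ of $H$ with $H/U$ abelian, closed under products and intersections, $U\mapsto\mathrm{ind}_{H,U}C^U$ is an injective lattice morphism from $\mathcal L$ into the subgroups of $C^H$. Ramification and valuations. For closed subgroups $K\le H$ of $G$: $I_H=H\cap\ker d$, $f_{H|K}=[d(H):d(K)]$, $f_H=f_{G|H}$, $e_{H|K}=[I_H:I_K]$. For $H$ open, $d_H=\frac1{f_H}d|_H:H\to\Omega$ is surjective with kernel $I_H$. For $U$ open normal in $H$ with $I_H\le U$ the Frobenius element $\varphi_{H|U}\in H/U$ is the image of any $h\in H$ with $d_H(h)=\omega$. $\mathrm{Val}_d^{\langle\omega\rangle,\omega}(C_* )$ (resp. $\mathrm{Val}_d^{\Omega,\omega}(C_* )$) is the set of families $v=(v_H)$ of homomorphisms $v_H:C^H\to\langle\omega\rangle$ (resp.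 $\Omega$), $H$ open, with $\omega\in\mathrm{im}(v_H)$, $v_{{}^gH}\mathrm{con}_{g,H}=v_H$, $v_K\mathrm{res}_{K,H}=e_{H|K}v_H$, $v_H\mathrm{ind}_{H,K}=f_{H|K}v_K$. A prime element of $C^H$ is $\pi$ with $v_H(\pi)=\omega$. Fesenko--Neukirch datum on $\mathrm{Sp}(G)^{\mathrm f}$: here, the pair $(C_*,v)$ with $v\in\mathrm{Val}_d^{\Omega,\omega}(C_* )$ is one if for all open $H\le G$ and all open normal $U\lhd H$ with $I_H\le U$: (1) $\mathrm{im}(v_H)/[H:U]\,\mathrm{im}(v_U)$ has order $[H:U]$ and is generated by the image of $\omega$; $\mathrm{ind}_{H,U}:\ker v_U\to\ker v_H$ is surjective; $|C^H/\mathrm{ind}_{H,U}C^U|\le[H:U]$; (2) the sequence $1\to\ker v_H\xrightarrow{\mathrm{res}_{U,H}}\ker v_U\xrightarrow{x\mapsto(\varphi x)x^{-1}}\ker v_U\xrightarrow{\mathrm{ind}_{H,U}}\ker v_H\to1$ is exact, with $\varphi$ a representative of $\varphi_{H|U}$. Fesenko--Neukirch morphism. $\Omega^+=\{n\omega:n\in\mathbb N_{>0}\}$, $\mathrm{mult}(n\omega)=n$; for $n=\prod_pp^{n(p)}$, $P'(n)=\prod_{p\notin P}p^{n(p)}$. $\mathrm{Frob}_H=\{h\in H:d_H(h)\in\Omega^+\}$; for $h\in\mathrm{Frob}_H$, $\Sigma_{h,H|U}=\langle h\rangle_{\mathrm c}I_U$, an open subgroup of $H$. For a Fesenko--Neukirch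 datum, $\Upsilon_{(H,U)}:(H/U)^{\mathrm{ab}}\to C^H/\mathrm{ind}_{H,U}C^U$ sends the class of $\bar h\in H/U$ to the class of $\mathrm{ind}_{H,\Sigma_{h,H|U}}(\pi_h)^{P'(\mathrm{mult}(d_H(h)))}$, where $h\in\mathrm{Frob}_H$ lifts $\bar h$ and $\pi_h\in C^{\Sigma_{h,H|U}}$ is a prime element; this is a well-defined homomorphism independent of choices, and $\Upsilon=(\Upsilon_{(H,U)})$ is a morphism $\pi_{\mathfrak K}\to\widehat{\mathrm H}^0_{\mathfrak E}(C_* )$. *)

theory Defs
  imports "HOL-Analysis.Analysis" "HOL-Computational_Algebra.Primes"
    "HOL-Algebra.Group_Action" "HOL-Algebra.Left_Coset" "HOL-Algebra.Product_Groups"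
    "HOL-Algebra.Exact_Sequence" "HOL-Algebra.FiniteProduct"
begin

section \<open>Topological groups, pro-P groups and discrete modules\<close>

record 'a top_group = "'a monoid" +
  topol :: "'a topology"

text \<open>Only the ambient record carries a meaningful topology: in \<open>G\<lparr>carrier := H\<rparr>\<close> the
  field \<open>topol\<close> is still the topology of \<open>G\<close>. Openness and closedness of subgroups are therefore
  always taken in \<open>topol G\<close>.\<close>

locale topological_group = group G for G :: "('a, 'b) top_group_scheme" (structure) +
  assumes topspace_eq: "topspace (topol G) = carrier G"
    and continuous_mult:
      "continuous_map (prod_topology (topol G) (topol G)) (topol G) (\<lambda>(x, y). x \<otimes> y)"
    and continuous_inv: "continuous_map (topol G) (topol G) (\<lambda>x. inv x)"

definition subgroup_index :: "('a, 'b) monoid_scheme \<Rightarrow> 'a set \<Rightarrow> 'a set \<Rightarrow> nat" where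
  "subgroup_index G H K = card (rcosets\<^bsub>G\<lparr>carrier := H\<rparr>\<^esub> K)"

definition open_subgroup :: "'a top_group \<Rightarrow> 'a set \<Rightarrow> bool" where
  "open_subgroup G H \<longleftrightarrow> subgroup H G \<and> openin (topol G) H"

definition open_normal :: "'a top_group \<Rightarrow> 'a set \<Rightarrow> 'a set \<Rightarrow> bool" where
  "open_normal G H U \<longleftrightarrow>
     open_subgroup G H \<and> open_subgroup G U \<and> U \<lhd> G\<lparr>carrier := H\<rparr>"

definition profinite_group :: "'a top_group \<Rightarrow> bool" where
  "profinite_group G \<longleftrightarrow>
     topological_group G \<and> compact_space (topol G) \<and> Hausdorff_space (topol G) \<and>
     (\<forall>S. connectedin (topol G) S \<longrightarrow> (\<exists>a. S \<subseteq> {a}))"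

definition pro_P_group :: "nat set \<Rightarrow> 'a top_group \<Rightarrow> bool" where
  "pro_P_group P G \<longleftrightarrow>
     profinite_group G \<and>
     (\<forall>N. open_normal G (carrier G) N \<longrightarrow> prime_factors (order (G Mod N)) \<subseteq> P)"

definition discrete_module ::
  "'g top_group \<Rightarrow> 'c monoid \<Rightarrow> ('g \<Rightarrow> 'c \<Rightarrow> 'c) \<Rightarrow> bool" where
  "discrete_module G C act \<longleftrightarrow>
     comm_group C \<and> group_action G (carrier C) act \<and>
     (\<forall>g\<in>carrier G. act g \<in> hom C C) \<and>
     continuous_map (prod_topology (topol G) (discrete_topology (carrier C)))
       (discrete_topology (carrier C)) (\<lambda>(g, a). act g a)"

text \<open>The additive group of the \<open>p\<close>-adic integers, as the inverse limit of the groups of integers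
  modulo \<open>p ^ k\<close> with the subspace topology of the product of the discrete topologies.\<close>

definition padic_integers :: "nat \<Rightarrow> (nat \<Rightarrow> int) top_group" where
  "padic_integers p =
     (let A = product_group UNIV (\<lambda>k. integer_mod_group (p ^ k));
          Z = {x \<in> carrier A. \<forall>k. x (Suc k) mod int (p ^ k) = x k}
      in \<lparr>carrier = Z, monoid.mult = monoid.mult A, one = one A,
          topol = subtopology
            (product_topology (\<lambda>k. discrete_topology (carrier (integer_mod_group (p ^ k)))) UNIV) Z\<rparr>)"

definition Z_P :: "nat set \<Rightarrow> (nat \<Rightarrow> nat \<Rightarrow> int) top_group" where
  "Z_P P =
     (let A = product_group P padic_integers
      in \<lparr>carrier = carrier A, monoid.mult = monoid.mult A, one = one A,
          topol = product_topology (\<lambda>p. topol (padic_integers p)) P\<rparr>)"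

definition topologically_isomorphic :: "'a top_group \<Rightarrow> 'b top_group \<Rightarrow> bool" where
  "topologically_isomorphic A B \<longleftrightarrow>
     (\<exists>\<phi>. \<phi> \<in> iso A B \<and> homeomorphic_map (topol A) (topol B) \<phi>)"

definition topological_generator :: "'a top_group \<Rightarrow> 'a \<Rightarrow> bool" where
  "topological_generator A w \<longleftrightarrow>
     w \<in> carrier A \<and> topol A closure_of generate A {w} = carrier A"

section \<open>Functors with conjugation, restriction and induction maps\<close>

text \<open>Argument order follows the subscripts: \<open>con \<Phi> g X\<close> starts at \<open>X\<close>, \<open>res \<Phi> Y X\<close> goes from
  \<open>X\<close> to \<open>Y\<close>, and \<open>ind \<Phi> X Y\<close> goes from \<open>Y\<close> to \<open>X\<close>. All maps are only relevant on carriers.\<close>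

record ('g, 'i, 'm) ric_functor =
  ob :: "'i \<Rightarrow> 'm monoid"
  con :: "'g \<Rightarrow> 'i \<Rightarrow> 'm \<Rightarrow> 'm"
  res :: "'i \<Rightarrow> 'i \<Rightarrow> 'm \<Rightarrow> 'm"
  ind :: "'i \<Rightarrow> 'i \<Rightarrow> 'm \<Rightarrow> 'm"

definition conj_elt :: "('g, 'z) monoid_scheme \<Rightarrow> 'g \<Rightarrow> 'g \<Rightarrow> 'g" where
  "conj_elt G g h = g \<otimes>\<^bsub>G\<^esub> h \<otimes>\<^bsub>G\<^esub> inv\<^bsub>G\<^esub> g"

definition conj_set :: "('g, 'z) monoid_scheme \<Rightarrow> 'g \<Rightarrow> 'g set \<Rightarrow> 'g set" where
  "conj_set G g H = conj_elt G g ` H"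

definition conj_pair ::
  "('g, 'z) monoid_scheme \<Rightarrow> 'g \<Rightarrow> 'g set \<times> 'g set \<Rightarrow> 'g set \<times> 'g set" where
  "conj_pair G g = map_prod (conj_set G g) (conj_set G g)"

definition spec_b :: "'g top_group \<Rightarrow> ('g set \<times> 'g set) set" where
  "spec_b G = {(H, U). open_normal G H U}"

definition spec_r :: "'g top_group \<Rightarrow> 'g set \<times> 'g set \<Rightarrow> ('g set \<times> 'g set) set" where
  "spec_r G X = {(I, V) \<in> spec_b G. I \<subseteq> fst X \<and> V = snd X}"

definition spec_i :: "'g top_group \<Rightarrow> 'g set \<times> 'g set \<Rightarrow> ('g set \<times> 'g set) set" where
  "spec_i G X = {(I, V) \<in> spec_b G. I \<subseteq> fst X \<and> V \<subseteq> snd X}"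

definition fct_object ::
  "'g top_group \<Rightarrow> ('g, 'g set \<times> 'g set, 'm) ric_functor \<Rightarrow> bool" where
  "fct_object G \<Phi> \<longleftrightarrow>
     (\<forall>X\<in>spec_b G. comm_group (ob \<Phi> X) \<and>
       (\<forall>g\<in>carrier G. con \<Phi> g X \<in> hom (ob \<Phi> X) (ob \<Phi> (conj_pair G g X))) \<and>
       (\<forall>Y\<in>spec_r G X. res \<Phi> Y X \<in> hom (ob \<Phi> X) (ob \<Phi> Y)) \<and>
       (\<forall>Y\<in>spec_i G X. ind \<Phi> X Y \<in> hom (ob \<Phi> Y) (ob \<Phi> X))) \<and>
     (\<forall>X\<in>spec_b G. \<forall>a\<in>carrier (ob \<Phi> X).
       con \<Phi> \<one>\<^bsub>G\<^esub> X a = a \<and> res \<Phi> X X a = a \<and> ind \<Phi> X X a = a) \<and>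
     (\<forall>X\<in>spec_b G. \<forall>g\<in>carrier G. \<forall>h\<in>carrier G. \<forall>a\<in>carrier (ob \<Phi> X).
       con \<Phi> g (conj_pair G h X) (con \<Phi> h X a) = con \<Phi> (g \<otimes>\<^bsub>G\<^esub> h) X a) \<and>
     (\<forall>X\<in>spec_b G. \<forall>Y\<in>spec_r G X. \<forall>Z\<in>spec_r G Y. \<forall>a\<in>carrier (ob \<Phi> X).
       res \<Phi> Z Y (res \<Phi> Y X a) = res \<Phi> Z X a) \<and>
     (\<forall>X\<in>spec_b G. \<forall>Y\<in>spec_i G X. \<forall>Z\<in>spec_i G Y. \<forall>a\<in>carrier (ob \<Phi> Z).
       ind \<Phi> X Y (ind \<Phi> Y Z a) = ind \<Phi> X Z a) \<and>
     (\<forall>X\<in>spec_b G. \<forall>Y\<in>spec_r G X. \<forall>g\<in>carrier G. \<forall>a\<in>carrier (ob \<Phi> X).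
       con \<Phi> g Y (res \<Phi> Y X a) = res \<Phi> (conj_pair G g Y) (conj_pair G g X) (con \<Phi> g X a)) \<and>
     (\<forall>X\<in>spec_b G. \<forall>Y\<in>spec_i G X. \<forall>g\<in>carrier G. \<forall>a\<in>carrier (ob \<Phi> Y).
       con \<Phi> g X (ind \<Phi> X Y a) = ind \<Phi> (conj_pair G g X) (conj_pair G g Y) (con \<Phi> g Y a))"

definition fct_morphism ::
  "'g top_group \<Rightarrow> ('g, 'g set \<times> 'g set, 'm) ric_functor \<Rightarrow>
   ('g, 'g set \<times> 'g set, 'n) ric_functor \<Rightarrow> ('g set \<times> 'g set \<Rightarrow> 'm \<Rightarrow> 'n) \<Rightarrow> bool" where
  "fct_morphism G \<Phi> \<Psi> \<eta> \<longleftrightarrow>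
     fct_object G \<Phi> \<and> fct_object G \<Psi> \<and>
     (\<forall>X\<in>spec_b G. \<eta> X \<in> hom (ob \<Phi> X) (ob \<Psi> X)) \<and>
     (\<forall>X\<in>spec_b G. \<forall>g\<in>carrier G. \<forall>a\<in>carrier (ob \<Phi> X).
       \<eta> (conj_pair G g X) (con \<Phi> g X a) = con \<Psi> g X (\<eta> X a)) \<and>
     (\<forall>X\<in>spec_b G. \<forall>Y\<in>spec_r G X. \<forall>a\<in>carrier (ob \<Phi> X).
       \<eta> Y (res \<Phi> Y X a) = res \<Psi> Y X (\<eta> X a)) \<and>
     (\<forall>X\<in>spec_b G. \<forall>Y\<in>spec_i G X. \<forall>a\<in>carrier (ob \<Phi> Y).
       \<eta> X (ind \<Phi> X Y a) = ind \<Psi> X Y (\<eta> Y a))"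

definition fct_isomorphism ::
  "'g top_group \<Rightarrow> ('g, 'g set \<times> 'g set, 'm) ric_functor \<Rightarrow>
   ('g, 'g set \<times> 'g set, 'n) ric_functor \<Rightarrow> ('g set \<times> 'g set \<Rightarrow> 'm \<Rightarrow> 'n) \<Rightarrow> bool" where
  "fct_isomorphism G \<Phi> \<Psi> \<eta> \<longleftrightarrow>
     fct_morphism G \<Phi> \<Psi> \<eta> \<and>
     (\<exists>\<theta>. fct_morphism G \<Psi> \<Phi> \<theta> \<and>
       (\<forall>X\<in>spec_b G. (\<forall>a\<in>carrier (ob \<Phi> X). \<theta> X (\<eta> X a) = a) \<and>
                      (\<forall>b\<in>carrier (ob \<Psi> X). \<eta> X (\<theta> X b) = b)))"

text \<open>The Mackey functor \<open>H \<mapsto> C\<^sup>H\<close> of a discrete module. On \<open>C\<^sup>I\<close>, the value \<open>act h a\<close>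
  depends only on the left coset \<open>hI\<close>.\<close>

definition fixed_points :: "'c monoid \<Rightarrow> ('g \<Rightarrow> 'c \<Rightarrow> 'c) \<Rightarrow> 'g set \<Rightarrow> 'c set" where
  "fixed_points C act H = {a \<in> carrier C. \<forall>h\<in>H. act h a = a}"

definition fixed_point_functor ::
  "'g top_group \<Rightarrow> 'c monoid \<Rightarrow> ('g \<Rightarrow> 'c \<Rightarrow> 'c) \<Rightarrow> ('g, 'g set, 'c) ric_functor" where
  "fixed_point_functor G C act =
     \<lparr>ob = (\<lambda>H. C\<lparr>carrier := fixed_points C act H\<rparr>),
      con = (\<lambda>g H a. act g a),
      res = (\<lambda>I H a. a),
      ind = (\<lambda>H I a. \<Otimes>\<^bsub>C\<^esub>X \<in> lcosets\<^bsub>G\<lparr>carrier := H\<rparr>\<^esub> I. act (SOME h. h \<in> X) a)\<rparr>"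

text \<open>For a homomorphism \<open>f\<close> mapping a normal subgroup of its source into the normal subgroup \<open>N\<close>
  of \<open>A\<close>, the induced map of quotients, with cosets as elements.\<close>

definition induced_map ::
  "('b, 'z) monoid_scheme \<Rightarrow> 'b set \<Rightarrow> ('a \<Rightarrow> 'b) \<Rightarrow> 'a set \<Rightarrow> 'b set" where
  "induced_map A N f X = N <#>\<^bsub>A\<^esub> (f ` X)"

definition norm_subgroup :: "('g, 'g set, 'c) ric_functor \<Rightarrow> 'g set \<Rightarrow> 'g set \<Rightarrow> 'c set" where
  "norm_subgroup M H U = ind M H U ` carrier (ob M U)"

definition tate_H0 ::
  "('g, 'g set, 'c) ric_functor \<Rightarrow> ('g, 'g set \<times> 'g set, 'c set) ric_functor" where
  "tate_H0 M =
     \<lparr>ob = (\<lambda>(H, U). ob M H Mod norm_subgroup M H U),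
      con = (\<lambda>g (H, U). image (con M g H)),
      res = (\<lambda>(I, V) (H, U). induced_map (ob M I) (norm_subgroup M I V) (res M I H)),
      ind = (\<lambda>(H, U) (I, V). induced_map (ob M H) (norm_subgroup M H U) (ind M H I))\<rparr>"

definition abelianization :: "('a, 'z) monoid_scheme \<Rightarrow> 'a set monoid" where
  "abelianization Q = Q Mod derived Q (carrier Q)"

text \<open>The group-theoretic transfer \<open>Q\<^sup>a\<^sup>b \<rightarrow> S\<^sup>a\<^sup>b\<close> for a subgroup \<open>S\<close> of finite index: if \<open>t R\<close>
  is a representative of the right coset \<open>R\<close> of \<open>S\<close>, then the class of \<open>x\<close> goes to the product
  over all \<open>R\<close> of the classes of \<open>t R \<cdot> x \<cdot> (t (R x))\<inverse> \<in> S\<close>.\<close>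

definition transfer_map :: "('a, 'z) monoid_scheme \<Rightarrow> 'a set \<Rightarrow> 'a set \<Rightarrow> 'a set" where
  "transfer_map Q S X =
     (let x = (SOME x. x \<in> X); t = (\<lambda>R. SOME r. r \<in> R)
      in \<Otimes>\<^bsub>abelianization (Q\<lparr>carrier := S\<rparr>)\<^esub>R \<in> rcosets\<^bsub>Q\<^esub> S.
           derived (Q\<lparr>carrier := S\<rparr>) S #>\<^bsub>Q\<^esub> (t R \<otimes>\<^bsub>Q\<^esub> x \<otimes>\<^bsub>Q\<^esub> inv\<^bsub>Q\<^esub> (t (R #>\<^bsub>Q\<^esub> x))))"

text \<open>An element of \<open>(H/U)\<^sup>a\<^sup>b\<close> is a set of cosets of \<open>U\<close>.\<close>

definition quotient_grp :: "('g, 'z) monoid_scheme \<Rightarrow> 'g set \<Rightarrow> 'g set \<Rightarrow> 'g set monoid" where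
  "quotient_grp G H U = G\<lparr>carrier := H\<rparr> Mod U"

definition pi_functor :: "'g top_group \<Rightarrow> ('g, 'g set \<times> 'g set, 'g set set) ric_functor" where
  "pi_functor G =
     \<lparr>ob = (\<lambda>(H, U). abelianization (quotient_grp G H U)),
      con = (\<lambda>g (H, U). image (conj_set G g)),
      res = (\<lambda>(I, V) (H, U). transfer_map (quotient_grp G H U) (carrier (quotient_grp G I U))),
      ind = (\<lambda>(H, U) (I, V).
        induced_map (quotient_grp G H U)
          (derived (quotient_grp G H U) (carrier (quotient_grp G H U)))
          (induced_map G U (\<lambda>x. x)))\<rparr>"

section \<open>Class field axiom and class field theories\<close>

definition class_field_axiom ::
  "'g top_group \<Rightarrow> ('g, 'g set, 'c) ric_functor \<Rightarrow> 'g set \<Rightarrow> 'g set \<Rightarrow> bool" where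
  "class_field_axiom G M H U \<longleftrightarrow>
     order (ob M H Mod norm_subgroup M H U) = subgroup_index G H U \<and>
     kernel (ob M U) (ob M H) (ind M H U) =
       generate (ob M U)
         {con M h U x \<otimes>\<^bsub>ob M U\<^esub> inv\<^bsub>ob M U\<^esub> x | h x. h \<in> H \<and> x \<in> carrier (ob M U)}"

definition abelian_lattice :: "'g top_group \<Rightarrow> 'g set \<Rightarrow> 'g set set \<Rightarrow> bool" where
  "abelian_lattice G H L \<longleftrightarrow>
     (\<forall>U\<in>L. open_normal G H U \<and> comm_group (quotient_grp G H U)) \<and>
     (\<forall>U\<in>L. \<forall>V\<in>L. U <#>\<^bsub>G\<^esub> V \<in> L \<and> U \<inter> V \<in> L)"

text \<open>Joins of subgroups are products, both in the abelian group \<open>C\<^sup>H\<close> and among the normal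
  subgroups of \<open>H\<close>.\<close>

definition class_field_theory ::
  "'g top_group \<Rightarrow> ('g, 'g set, 'c) ric_functor \<Rightarrow>
   ('g set \<times> 'g set \<Rightarrow> 'g set set \<Rightarrow> 'c set) \<Rightarrow> bool" where
  "class_field_theory G M \<Upsilon> \<longleftrightarrow>
     fct_isomorphism G (pi_functor G) (tate_H0 M) \<Upsilon> \<and>
     (\<forall>H L. open_subgroup G H \<longrightarrow> abelian_lattice G H L \<longrightarrow>
        (\<forall>U\<in>L. subgroup (norm_subgroup M H U) (ob M H)) \<and>
        inj_on (norm_subgroup M H) L \<and>
        (\<forall>U\<in>L. \<forall>V\<in>L.
           norm_subgroup M H (U \<inter> V) = norm_subgroup M H U \<inter> norm_subgroup M H V \<and>
           norm_subgroup M H (U <#>\<^bsub>G\<^esub> V) =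
             norm_subgroup M H U <#>\<^bsub>ob M H\<^esub> norm_subgroup M H V))"

section \<open>Ramification and valuations\<close>

definition inertia ::
  "'g top_group \<Rightarrow> 'w top_group \<Rightarrow> ('g \<Rightarrow> 'w) \<Rightarrow> 'g set \<Rightarrow> 'g set" where
  "inertia G \<Omega> d H = H \<inter> kernel G \<Omega> d"

definition inertia_degree ::
  "'w top_group \<Rightarrow> ('g \<Rightarrow> 'w) \<Rightarrow> 'g set \<Rightarrow> 'g set \<Rightarrow> nat" where
  "inertia_degree \<Omega> d H K = subgroup_index \<Omega> (d ` H) (d ` K)"

definition ramification_index ::
  "'g top_group \<Rightarrow> 'w top_group \<Rightarrow> ('g \<Rightarrow> 'w) \<Rightarrow> 'g set \<Rightarrow> 'g set \<Rightarrow> nat" where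
  "ramification_index G \<Omega> d H K = subgroup_index G (inertia G \<Omega> d H) (inertia G \<Omega> d K)"

text \<open>The group \<open>\<Omega>\<close> is written multiplicatively: \<open>\<omega> [^] n\<close> is the multiple \<open>n\<omega>\<close>, and
  \<open>(1/f\<^sub>H) d(h)\<close> is the unique \<open>f\<^sub>H\<close>-th root of \<open>d h\<close> in the torsion-free group \<open>\<Omega>\<close>.\<close>

definition d_rel ::
  "'g top_group \<Rightarrow> 'w top_group \<Rightarrow> ('g \<Rightarrow> 'w) \<Rightarrow> 'g set \<Rightarrow> 'g \<Rightarrow> 'w" where
  "d_rel G \<Omega> d H h =
     (THE x. x \<in> carrier \<Omega> \<and> x [^]\<^bsub>\<Omega>\<^esub> inertia_degree \<Omega> d (carrier G) H = d h)"

definition frobenius ::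
  "'g top_group \<Rightarrow> 'w top_group \<Rightarrow> ('g \<Rightarrow> 'w) \<Rightarrow> 'w \<Rightarrow> 'g set \<Rightarrow> 'g set \<Rightarrow> 'g set" where
  "frobenius G \<Omega> d \<omega> H U = (THE X. \<exists>h\<in>H. d_rel G \<Omega> d H h = \<omega> \<and> X = U #>\<^bsub>G\<^esub> h)"

text \<open>\<open>valuations G \<Omega> d \<omega> M \<Delta>\<close> is the set of valuations with values in the subgroup \<open>\<Delta>\<close>
  of \<open>\<Omega>\<close>.\<close>

definition valuations ::
  "'g top_group \<Rightarrow> 'w top_group \<Rightarrow> ('g \<Rightarrow> 'w) \<Rightarrow> 'w \<Rightarrow> ('g, 'g set, 'c) ric_functor \<Rightarrow>
   'w set \<Rightarrow> ('g set \<Rightarrow> 'c \<Rightarrow> 'w) set" where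
  "valuations G \<Omega> d \<omega> M \<Delta> =
     {v. \<forall>H. open_subgroup G H \<longrightarrow>
        v H \<in> hom (ob M H) (\<Omega>\<lparr>carrier := \<Delta>\<rparr>) \<and>
        \<omega> \<in> v H ` carrier (ob M H) \<and>
        (\<forall>g\<in>carrier G. \<forall>a\<in>carrier (ob M H). v (conj_set G g H) (con M g H a) = v H a) \<and>
        (\<forall>K. open_subgroup G K \<and> K \<subseteq> H \<longrightarrow>
           (\<forall>a\<in>carrier (ob M H).
              v K (res M K H a) = v H a [^]\<^bsub>\<Omega>\<^esub> ramification_index G \<Omega> d H K) \<and>
           (\<forall>a\<in>carrier (ob M K).
              v H (ind M H K a) = v K a [^]\<^bsub>\<Omega>\<^esub> inertia_degree \<Omega> d H K))}"

definition unit_grp ::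
  "'w top_group \<Rightarrow> ('g, 'g set, 'c) ric_functor \<Rightarrow> ('g set \<Rightarrow> 'c \<Rightarrow> 'w) \<Rightarrow> 'g set \<Rightarrow> 'c monoid" where
  "unit_grp \<Omega> M v H = (ob M H)\<lparr>carrier := kernel (ob M H) \<Omega> (v H)\<rparr>"

definition prime_element ::
  "'w \<Rightarrow> ('g, 'g set, 'c) ric_functor \<Rightarrow> ('g set \<Rightarrow> 'c \<Rightarrow> 'w) \<Rightarrow> 'g set \<Rightarrow> 'c \<Rightarrow> bool" where
  "prime_element \<omega> M v H a \<longleftrightarrow> a \<in> carrier (ob M H) \<and> v H a = \<omega>"

section \<open>Fesenko--Neukirch data and morphisms\<close>

text \<open>In the first condition, \<open>N\<close> is \<open>[H:U] im(v\<^sub>U)\<close>, and \<open>N #> \<omega>\<close> is the image of \<open>\<omega>\<close> in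
  \<open>im(v\<^sub>H) / N\<close>. The lists of an \<^const>\<open>exact_seq\<close> start with the last group and the last map.\<close>

definition fesenko_neukirch_datum ::
  "'g top_group \<Rightarrow> 'w top_group \<Rightarrow> ('g \<Rightarrow> 'w) \<Rightarrow> 'w \<Rightarrow> ('g, 'g set, 'c) ric_functor \<Rightarrow>
   ('g set \<Rightarrow> 'c \<Rightarrow> 'w) \<Rightarrow> bool" where
  "fesenko_neukirch_datum G \<Omega> d \<omega> M v \<longleftrightarrow>
     v \<in> valuations G \<Omega> d \<omega> M (carrier \<Omega>) \<and>
     (\<forall>H U. open_normal G H U \<longrightarrow> inertia G \<Omega> d H \<subseteq> U \<longrightarrow>
       (let n = subgroup_index G H U;
            N = (\<lambda>x. x [^]\<^bsub>\<Omega>\<^esub> n) ` v U ` carrier (ob M U);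
            Q = \<Omega>\<lparr>carrier := v H ` carrier (ob M H)\<rparr> Mod N
        in order Q = n \<and> generate Q {N #>\<^bsub>\<Omega>\<^esub> \<omega>} = carrier Q \<and>
           ind M H U ` carrier (unit_grp \<Omega> M v U) = carrier (unit_grp \<Omega> M v H) \<and>
           finite (carrier (ob M H Mod norm_subgroup M H U)) \<and>
           order (ob M H Mod norm_subgroup M H U) \<le> n) \<and>
       (\<forall>\<phi>\<in>frobenius G \<Omega> d \<omega> H U.
          exact_seq
            ([singleton_group \<one>\<^bsub>ob M H\<^esub>, unit_grp \<Omega> M v H, unit_grp \<Omega> M v U,
              unit_grp \<Omega> M v U, unit_grp \<Omega> M v H, singleton_group \<one>\<^bsub>ob M H\<^esub>],
             [\<lambda>_. \<one>\<^bsub>ob M H\<^esub>, ind M H U,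
              \<lambda>x. con M \<phi> U x \<otimes>\<^bsub>ob M U\<^esub> inv\<^bsub>ob M U\<^esub> x,
              res M U H, \<lambda>x. x])))"

definition Omega_mult :: "'w top_group \<Rightarrow> 'w \<Rightarrow> 'w \<Rightarrow> nat" where
  "Omega_mult \<Omega> \<omega> x = (THE n. n > 0 \<and> x = \<omega> [^]\<^bsub>\<Omega>\<^esub> n)"

definition prime_to_P_part :: "nat set \<Rightarrow> nat \<Rightarrow> nat" where
  "prime_to_P_part P n = (\<Prod>p\<in>prime_factors n - P. p ^ multiplicity p n)"

definition Frob ::
  "'g top_group \<Rightarrow> 'w top_group \<Rightarrow> ('g \<Rightarrow> 'w) \<Rightarrow> 'w \<Rightarrow> 'g set \<Rightarrow> 'g set" where
  "Frob G \<Omega> d \<omega> H = {h \<in> H. \<exists>n::nat. n > 0 \<and> d_rel G \<Omega> d H h = \<omega> [^]\<^bsub>\<Omega>\<^esub> n}"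

definition Sigma_grp ::
  "'g top_group \<Rightarrow> 'w top_group \<Rightarrow> ('g \<Rightarrow> 'w) \<Rightarrow> 'g \<Rightarrow> 'g set \<Rightarrow> 'g set" where
  "Sigma_grp G \<Omega> d h U = (topol G closure_of generate G {h}) <#>\<^bsub>G\<^esub> inertia G \<Omega> d U"

text \<open>The Fesenko--Neukirch morphism. The class of \<open>h\<close> in \<open>(H/U)\<^sup>a\<^sup>b\<close> is the set \<open>X\<close> of cosets
  with \<open>U #> h \<in> X\<close>. By the use of a definite description, a value is only specified when it
  does not depend on the choice of \<open>h\<close> and of the prime element.\<close>

definition fesenko_neukirch_morphism ::
  "nat set \<Rightarrow> 'g top_group \<Rightarrow> 'w top_group \<Rightarrow> ('g \<Rightarrow> 'w) \<Rightarrow> 'w \<Rightarrow>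
   ('g, 'g set, 'c) ric_functor \<Rightarrow> ('g set \<Rightarrow> 'c \<Rightarrow> 'w) \<Rightarrow>
   'g set \<times> 'g set \<Rightarrow> 'g set set \<Rightarrow> 'c set" where
  "fesenko_neukirch_morphism P G \<Omega> d \<omega> M v = (\<lambda>(H, U) X.
     THE Y. \<exists>h\<in>Frob G \<Omega> d \<omega> H. \<exists>a.
       U #>\<^bsub>G\<^esub> h \<in> X \<and>
       prime_element \<omega> M v (Sigma_grp G \<Omega> d h U) a \<and>
       Y = norm_subgroup M H U #>\<^bsub>ob M H\<^esub>
             (ind M H (Sigma_grp G \<Omega> d h U) a
                [^]\<^bsub>ob M H\<^esub> prime_to_P_part P (Omega_mult \<Omega> \<omega> (d_rel G \<Omega> d H h))))"

end

theory Submission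
  imports Defs "HOL-Algebra.Multiplicative_Group" "HOL-Algebra.Sylow"
begin

text \<open>The proof follows Neukirch. Over the fixed field of inertia the units are cohomologically trivial, which
  makes the Frobenius prescription multiplicative and independent of the lift; functoriality for the transfer
  comes from decomposing a coset space into orbits of the Frobenius lift. In prime degree the map is bijective:
  the unramified case is a statement on valuations, and in the totally ramified case an element of the kernel
  would, by Hilbert 90 for an extension \<open>\<langle>\<phi>\<^sup>k\<rangle>I\<^sub>H | \<langle>\<phi>\<^sup>k\<rangle>I\<^sub>U\<close>, yield a prime element coming from \<open>H\<close>.
  Surjectivity in general follows from Sylow subgroups, and the kernel is computed by induction on the order of
  an abelian quotient, with the second half of the class field axiom at each step of prime index.\<close>

text \<open>The fixed field of inertia is an infinite extension, so it is reached only through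
  finite layers: an element of \<open>Cb U\<close> is fixed by some open subgroup with the inertia
  of \<open>U\<close>, and cohomological triviality of the units means surjectivity of norms and
  Hilbert 90 for \<open>Sg (h [^] k) U\<close> inside \<open>Sg h U\<close>, with \<open>k\<close> a
  P-number. The same restriction explains the exponent P': if d_H(h) = n omega, the index of Sigma
  in H sees only the P-part of n, and the power with exponent P'(n) restores the product over all n
  powers of a Frobenius element. In this normal form (\<open>rval_formula\<close>) multiplicativity
  is a computation with augmentation elements. The prescription is studied as a relation
  \<open>RR\<close> between elements of H and of C^H, so that products, conjugation, induction and
  transfer can be treated before any class is chosen. Once it is onto, with the commutators as
  kernel, both functors are quotients of C^H by norm groups and the isomorphism compares two
  presentations.\<close>

notation monoid.mult (infixl "*.\<index>" 70)

lemmas sg_mem = subgroup.mem_carrier and sg_inv = subgroup.m_inv_closed and sg_mult = subgroup.m_closed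
 and sg_sub = subgroup.subset and sg_one = subgroup.one_closed

section \<open>Finite products and coset transversals\<close>

context comm_monoid
begin

lemma finprod_Sigma:
 assumes "finite A" "!!a. a : A ==> finite (B a)"
  and "!!a b. a : A ==> b : B a ==> f a b : carrier G"
 shows "(\<Otimes>x\<in>Sigma A B. f (fst x) (snd x)) = (\<Otimes>a\<in>A. \<Otimes>b\<in>B a. f a b)"
proof -
 have *: "Sigma A B = (\<Union>a\<in>A. Pair a ` B a)" by auto
 have "(\<Otimes>x\<in>Sigma A B. f (fst x) (snd x)) = (\<Otimes>a\<in>A. \<Otimes>x\<in>Pair a ` B a. f (fst x) (snd x))"
  unfolding * using assms by (intro finprod_UN_disjoint) (auto simp: pairwise_def disjnt_def)
 also have "... = (\<Otimes>a\<in>A. \<Otimes>b\<in>B a. f a b)"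
 proof (rule finprod_cong', simp, safe)
  fix a assume a: "a : A"
  show "(\<Otimes>b\<in>B a. f a b) : carrier G" using a assms by auto
  show "(\<Otimes>x\<in>Pair a ` B a. f (fst x) (snd x)) = (\<Otimes>b\<in>B a. f a b)"
   using a assms(3) by (subst finprod_reindex) (auto simp: inj_on_def)
 qed
 finally show ?thesis .
qed

lemma finprod_bij_betw:
 assumes "bij_betw h A B" "f : B \<rightarrow> carrier G"
 shows "finprod G (%x. f (h x)) A = finprod G f B" using assms finprod_reindex[of f h A] by (auto simp: bij_betw_def)

lemma finprod_swap:
 assumes "finite A" "finite B" "!!a b. a : A ==> b : B ==> f a b : carrier G"
 shows "(\<Otimes>a\<in>A. \<Otimes>b\<in>B. f a b) = (\<Otimes>b\<in>B. \<Otimes>a\<in>A. f a b)"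
proof -
 have "(\<Otimes>a\<in>A. \<Otimes>b\<in>B. f a b) = (\<Otimes>x\<in>A \<times> B. f (fst x) (snd x))" using assms by (intro finprod_Sigma[symmetric]) auto
 also have "... = (\<Otimes>x\<in>B \<times> A. f (snd x) (fst x))"
 proof -
  have "bij_betw prod.swap (B \<times> A) (A \<times> B)" by (auto simp: bij_betw_def inj_on_def)
  from finprod_bij_betw[OF this, of "%x. f (fst x) (snd x)"] show ?thesis using assms by (simp add: Pi_def)
 qed
 also have "... = (\<Otimes>b\<in>B. \<Otimes>a\<in>A. f a b)" using assms finprod_Sigma[of B "%_. A" "%b a. f a b"] by auto
 finally show ?thesis .
qed

lemma finprod_lessThan_Suc:
 "(!!i. i <= n ==> f i : carrier G) ==> (\<Otimes>i\<in>{..<Suc n}. f i) = f n *. (\<Otimes>i\<in>{..<n}. f i)"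
 by (subst lessThan_Suc, subst finprod_insert) auto

lemma finprod_lessThan_add:
 fixes m n :: nat
 assumes "!!i. i < m + n ==> f i : carrier G"
 shows "(\<Otimes>i\<in>{..<m + n}. f i) = (\<Otimes>i\<in>{..<m}. f i) *. (\<Otimes>i\<in>{..<n}. f (m + i))" using assms
proof (induction n)
 case (Suc n)
 have "(\<Otimes>i\<in>{..<m + Suc n}. f i) = f (m + n) *. (\<Otimes>i\<in>{..<m + n}. f i)"
  using Suc.prems by (simp only: add_Suc_right, subst finprod_lessThan_Suc) auto
 also have "... = f (m + n) *. ((\<Otimes>i\<in>{..<m}. f i) *. (\<Otimes>i\<in>{..<n}. f (m + i)))" using Suc by simp
 also have "... = (\<Otimes>i\<in>{..<m}. f i) *. (f (m + n) *. (\<Otimes>i\<in>{..<n}. f (m + i)))"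
  using Suc.prems by (intro m_lcomm finprod_closed) auto
 also have "... = (\<Otimes>i\<in>{..<m}. f i) *. (\<Otimes>i\<in>{..<Suc n}. f (m + i))" using Suc.prems by (subst finprod_lessThan_Suc) auto
 finally show ?case .
qed simp

lemma finprod_lessThan_mult:
 fixes m n :: nat
 assumes "!!i. i < m * n ==> f i : carrier G"
 shows "(\<Otimes>i\<in>{..<m * n}. f i) = (\<Otimes>j\<in>{..<n}. \<Otimes>i\<in>{..<m}. f (m * j + i))" using assms
proof (induction n)
 case (Suc n)
 have lt: "m * j + i < m * Suc n" if "j < Suc n" "i < m" for i j
 proof -
  have "m * j + i < m * j + m" using that by simp
  also have "... = m * Suc j" by simp
  also have "... <= m * Suc n" using that by (intro mult_le_mono) auto
  finally show ?thesis .
 qed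
 have "(\<Otimes>i\<in>{..<m * Suc n}. f i) = (\<Otimes>i\<in>{..<m * n}. f i) *. (\<Otimes>i\<in>{..<m}. f (m * n + i))"
  using Suc.prems by (subst finprod_lessThan_add[symmetric]) (auto simp: algebra_simps)
 then show ?case using Suc lt by (subst finprod_lessThan_Suc) (auto simp: m_comm Pi_def)
qed simp

end

lemma finprod_hom:
 assumes "comm_monoid A" "comm_monoid B" "h : hom A B" "h \<one>\<^bsub>A\<^esub> = \<one>\<^bsub>B\<^esub>" "f : I \<rightarrow> carrier A"
 shows "h (finprod A f I) = finprod B (%i. h (f i)) I"
proof (cases "finite I")
 case True
 then show ?thesis using assms(5)
 proof (induction I)
  case empty
  show ?case using assms by (simp add: comm_monoid.finprod_empty)
 next
  case (insert i I)
  interpret A: comm_monoid A by fact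
  interpret B: comm_monoid B by fact
  show ?case using insert assms(3) by (simp add: hom_mult Pi_def hom_in_carrier)
 qed
next
 case False
 then show ?thesis using assms by (simp add: comm_monoid.finprod_infinite)
qed

lemma (in comm_group) subgroup_comm_group:
 "subgroup S G ==> comm_group (G(|carrier := S|))"
 by (rule group.group_comm_groupI) (auto intro: subgroup_imp_group m_comm simp: sg_mem)

lemma finprod_subgroup_carrier:
 assumes "comm_group A" "subgroup S A" "f : I \<rightarrow> S"
 shows "finprod (A(|carrier := S|)) f I = finprod A f I"
proof -
 interpret A: comm_group A by fact
 interpret S: comm_group "A(|carrier := S|)" using assms A.subgroup_comm_group by blast
 have "(%x. x) (finprod (A(|carrier := S|)) f I) = finprod A (%i. f i) I" using sg_sub[OF assms(2)] assms(3)
  by (intro finprod_hom) (auto simp: hom_def S.comm_monoid_axioms A.comm_monoid_axioms)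
 then show ?thesis by simp
qed

lemma (in comm_group) finprod_in_subgroup:
 assumes "subgroup S G" "!!i. i : I ==> f i : S"
 shows "finprod G f I : S"
proof -
 interpret S: comm_group "G(|carrier := S|)" using assms subgroup_comm_group by blast
 have "finprod (G(|carrier := S|)) f I : S" using S.finprod_closed[of f I] assms(2) by auto
 then show ?thesis using finprod_subgroup_carrier[OF comm_group_axioms assms(1), of f I] assms(2) by (simp add: Pi_def)
qed

lemma (in group) inv_mult_cancel: "x : carrier G ==> y : carrier G ==> inv x *. (x *. y) = y"
 by (simp add: m_assoc[symmetric])

lemma (in group) mult_inv_cancel: "x : carrier G ==> y : carrier G ==> x *. (inv x *. y) = y"
 by (simp add: m_assoc[symmetric])

lemmas (in group) gnorm = m_assoc inv_mult_group inv_mult_cancel mult_inv_cancel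

section \<open>Cosets and their transversals\<close>

lemma (in group) rcos_eq_iff:
 assumes "subgroup I G" "x : carrier G" "y : carrier G"
 shows "I #> x = I #> y \<longleftrightarrow> x *. inv y : I"
proof
 assume "I #> x = I #> y"
 then have "x : I #> y" using rcos_self assms by auto
 then show "x *. inv y : I" using subgroup.rcos_module[OF assms(1) group_axioms] assms by blast
next
 assume "x *. inv y : I"
 then have "x : I #> y" using subgroup.rcos_module[OF assms(1) group_axioms] assms by blast
 then show "I #> x = I #> y" using repr_independence assms by blast
qed

lemma (in group) lcos_eq_iff:
 assumes "subgroup I G" "x : carrier G" "y : carrier G"
 shows "x <#\<^bsub>G\<^esub> I = y <#\<^bsub>G\<^esub> I \<longleftrightarrow> inv x *. y : I"
proof
 assume "x <#\<^bsub>G\<^esub> I = y <#\<^bsub>G\<^esub> I"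
 then have "y : x <#\<^bsub>G\<^esub> I" using lcos_self assms by auto
 then show "inv x *. y : I" using subgroup.lcos_module_imp[OF assms(1) group_axioms] assms by blast
next
 assume "inv x *. y : I"
 then have "y : x <#\<^bsub>G\<^esub> I" using subgroup.lcos_module_rev[OF assms(1) group_axioms] assms by blast
 then show "x <#\<^bsub>G\<^esub> I = y <#\<^bsub>G\<^esub> I" using l_repr_independence assms by blast
qed

text \<open>An indexed family instead of a set of cosets: norms are products over cosets, and
  towers, conjugates, powers of a Frobenius element and orbits each come with a natural index set.
  The same notion serves for open subgroups, for inertia groups and inside Omega.\<close>

definition left_transversal ::
 "('g, 'z) monoid_scheme => 'g set => 'g set => 'i set => ('i => 'g) => bool" where
 "left_transversal G H I A t \<longleftrightarrow>
  finite A & t : A \<rightarrow> H & (ALL x:H. EX! i. i : A & inv\<^bsub>G\<^esub> (t i) *.\<^bsub>G\<^esub> x : I)"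

lemma ltD:
 assumes "left_transversal G H I A t"
 shows "finite A" "!!i. i : A ==> t i : H"
  "!!x. x : H ==> EX! i. i : A & inv\<^bsub>G\<^esub> (t i) *.\<^bsub>G\<^esub> x : I" using assms by (auto simp: left_transversal_def)

context group
begin

lemma subgroup_mem_inv_iff: "subgroup I G ==> x : carrier G ==> inv x : I \<longleftrightarrow> x : I" by (metis inv_inv sg_inv)

lemma ltI:
 assumes "subgroup H G" "subgroup I G" "finite A" "!!i. i : A ==> t i : H"
  and "!!x. x : H ==> EX i:A. inv (t i) *. x : I"
  and "!!i j. i : A ==> j : A ==> inv (t i) *. t j : I ==> i = j"
 shows "left_transversal G H I A t" unfolding left_transversal_def
proof (intro conjI ballI)
 show "finite A" by (rule assms(3))
 show "t : A \<rightarrow> H" using assms(4) by blast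
 fix x assume x: "x : H"
 have H: "!!y. y : H ==> y : carrier G" by (rule sg_mem[OF assms(1)])
 obtain i where i: "i : A" "inv (t i) *. x : I" using assms(5)[OF x] by auto
 show "EX! i. i : A & inv (t i) *. x : I"
 proof (rule ex1I[of _ i])
  show "i : A & inv (t i) *. x : I" using i by simp
  fix j assume j: "j : A & inv (t j) *. x : I"
  have "(inv (t j) *. x) *. inv (inv (t i) *. x) : I" using i(2) j sg_mult[OF assms(2)] sg_inv[OF assms(2)] by blast
  moreover have "(inv (t j) *. x) *. inv (inv (t i) *. x) = inv (t j) *. t i"
   using H[OF assms(4)[OF i(1)]] H[OF assms(4)[of j]] H[OF x] j by (simp add: gnorm)
  ultimately show "j = i" using assms(6)[of j i] i(1) j by simp
 qed
qed

lemma ltr_uniq: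
 assumes "left_transversal G H I A t" "subgroup H G" "subgroup I G"
  and "i : A" "j : A" "inv (t i) *. t j : I"
 shows "i = j"
proof -
 have tj: "t j : H" using assms ltD by metis
 then have "inv (t j) *. t j : I" using assms by (simp add: sg_mem sg_one)
 then show ?thesis using ltD(3)[OF assms(1) tj] assms by blast
qed

lemma ltr_bij:
 assumes "left_transversal G H I A t" "subgroup H G" "subgroup I G"
 shows "bij_betw (%i. t i <#\<^bsub>G\<^esub> I) A (lcosets\<^bsub>G(|carrier := H|)\<^esub> I)"
proof -
 note t = ltD[OF assms(1)]
 have lc: "x <#\<^bsub>G\<^esub> I = y <#\<^bsub>G\<^esub> I \<longleftrightarrow> inv x *. y : I" if "x : H" "y : H" for x y
  using lcos_eq_iff[OF assms(3)] sg_mem[OF assms(2)] that by simp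
 have eq: "lcosets\<^bsub>G(|carrier := H|)\<^esub> I = (%x. x <#\<^bsub>G\<^esub> I) ` H" by (auto simp: LCOSETS_def l_coset_def)
 show ?thesis unfolding bij_betw_def eq
 proof
  show "inj_on (%i. t i <#\<^bsub>G\<^esub> I) A"
  proof (rule inj_onI)
   fix i j assume "i : A" "j : A" "t i <#\<^bsub>G\<^esub> I = t j <#\<^bsub>G\<^esub> I"
   then show "i = j" using ltr_uniq[OF assms, of i j] lc[OF t(2) t(2), of i j] by simp
  qed
  show "(%i. t i <#\<^bsub>G\<^esub> I) ` A = (%x. x <#\<^bsub>G\<^esub> I) ` H"
  proof (intro subset_antisym subsetI)
   fix X assume "X : (%x. x <#\<^bsub>G\<^esub> I) ` H"
   then obtain x where x: "x : H" "X = x <#\<^bsub>G\<^esub> I" by auto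
   then obtain i where i: "i : A" "inv (t i) *. x : I" using t(3) by blast
   then show "X : (%i. t i <#\<^bsub>G\<^esub> I) ` A" using lc[OF t(2) x(1), OF i(1)] x(2) by auto
  qed (auto intro: t(2))
 qed
qed

text \<open>Inversion exchanges left and right cosets. This links left transversals, over which
  norms are formed, with \<open>subgroup_index\<close>, which counts right cosets.\<close>

lemma ltr_rcosets:
 assumes "left_transversal G H I A t" "subgroup H G" "subgroup I G"
 shows "bij_betw (%i. I #> inv (t i)) A (rcosets\<^bsub>G(|carrier := H|)\<^esub> I)"
proof -
 note t = ltD[OF assms(1)]
 have rc: "I #> inv x = I #> y \<longleftrightarrow> inv x *. inv y : I" if "x : H" "y : H" for x y
  using rcos_eq_iff[OF assms(3)] sg_mem[OF assms(2)] that by simp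
 have eq: "rcosets\<^bsub>G(|carrier := H|)\<^esub> I = (%x. I #> x) ` H" by (auto simp: RCOSETS_def r_coset_def)
 show ?thesis unfolding bij_betw_def eq
 proof
  show "inj_on (%i. I #> inv (t i)) A"
  proof (rule inj_onI)
   fix i j assume ij: "i : A" "j : A" "I #> inv (t i) = I #> inv (t j)"
   then have "t j : H" "inv (t j) : H" "t j : carrier G" "t i : H" using t(2) sg_inv[OF assms(2)] sg_mem[OF assms(2)] by auto
   then show "i = j" using ltr_uniq[OF assms ij(1,2)] rc[of "t i" "inv (t j)"] ij(3) by simp
  qed
  show "(%i. I #> inv (t i)) ` A = (%x. I #> x) ` H"
  proof (intro subset_antisym subsetI)
   fix X assume "X : (%x. I #> x) ` H"
   then obtain x where x: "x : H" "X = I #> x" by auto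
   then obtain i where i: "i : A" "inv (t i) *. inv x : I" using t(3) sg_inv[OF assms(2)] by blast
   then show "X : (%i. I #> inv (t i)) ` A" using rc[OF t(2) x(1), OF i(1)] x(2) by auto
  qed (auto intro: t(2) sg_inv[OF assms(2)])
 qed
qed

lemma idx_eq_card:
 assumes "left_transversal G H I A t" "subgroup H G" "subgroup I G"
 shows "subgroup_index G H I = card A" using bij_betw_same_card[OF ltr_rcosets[OF assms]] by (simp add: subgroup_index_def)

lemma ltr_exists:
 assumes "finite ((%x. x <#\<^bsub>G\<^esub> I) ` H)" "subgroup H G" "subgroup I G"
 shows "EX t. left_transversal G H I {..<subgroup_index G H I} t"
proof -
 have lc: "x <#\<^bsub>G\<^esub> I = y <#\<^bsub>G\<^esub> I \<longleftrightarrow> inv x *. y : I" if "x : H" "y : H" for x y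
  using lcos_eq_iff[OF assms(3)] sg_mem[OF assms(2)] that by simp
 let ?A = "(%x. x <#\<^bsub>G\<^esub> I) ` H"
 obtain n :: nat and f where f: "bij_betw f {..<n} ?A"
  using assms(1) ex_bij_betw_nat_finite[of ?A] by (auto simp: atLeast0LessThan)
 define t where "t i = (SOME x. x : H & x <#\<^bsub>G\<^esub> I = f i)" for i
 have t: "t i : H & t i <#\<^bsub>G\<^esub> I = f i" if "i < n" for i
 proof -
  have "f i : ?A" using f that by (auto simp: bij_betw_def)
  then have "EX x. x : H & x <#\<^bsub>G\<^esub> I = f i" by auto
  then show ?thesis unfolding t_def by (rule someI_ex)
 qed
 have lt: "left_transversal G H I {..<n} t"
 proof (rule ltI[OF assms(2,3)])
  fix x assume x: "x : H"
  then have "x <#\<^bsub>G\<^esub> I : f ` {..<n}" using f by (simp add: bij_betw_def)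
  then obtain i where i: "i < n" "x <#\<^bsub>G\<^esub> I = f i" by auto
  then show "EX i:{..<n}. inv (t i) *. x : I" using t[OF i(1)] lc[of "t i" x] x by (intro bexI[of _ i]) auto
 next
  fix i j assume ij: "i : {..<n}" "j : {..<n}" "inv (t i) *. t j : I"
  then have "f i = f j" using t[of i] t[of j] lc[of "t i" "t j"] by auto
  then show "i = j" using f ij by (auto simp: bij_betw_def inj_on_def)
 qed (use t in auto)
 moreover from this have "subgroup_index G H I = n" using idx_eq_card[OF lt] assms by auto
 ultimately show ?thesis by auto
qed

lemma ltr_finite_lcosets:
 assumes "left_transversal G H I A t" "subgroup H G" "subgroup I G"
 shows "finite ((%x. x <#\<^bsub>G\<^esub> I) ` H)"
proof -
 have "lcosets\<^bsub>G(|carrier := H|)\<^esub> I = (%x. x <#\<^bsub>G\<^esub> I) ` H" by (auto simp: LCOSETS_def l_coset_def)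
 then show ?thesis using ltr_bij[OF assms] ltD(1)[OF assms(1)] by (metis bij_betw_finite)
qed

lemma ltr_tower:
 assumes "left_transversal G H I A s" "left_transversal G I K B t"
  and "subgroup H G" "subgroup I G" "subgroup K G" "I <= H" "K <= I"
 shows "left_transversal G H K (A \<times> B) (%x. s (fst x) *. t (snd x))"
proof (rule ltI[OF assms(3,5)])
 note s = ltD[OF assms(1)] and t = ltD[OF assms(2)]
 have c: "!!i. i : A ==> s i : carrier G" "!!j. j : B ==> t j : carrier G" "!!j. j : B ==> t j : H"
  using s(2) t(2) assms(6) sg_mem[OF assms(3)] by blast+
 show "finite (A \<times> B)" using s t by auto
 show "s (fst x) *. t (snd x) : H" if "x : A \<times> B" for x using that s(2) c(3) sg_mult[OF assms(3)] by (cases x) auto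
 show "EX i:A \<times> B. inv (s (fst i) *. t (snd i)) *. x : K" if x: "x : H" for x
 proof -
  obtain i where i: "i : A" "inv (s i) *. x : I" using s(3) x by blast
  obtain j where j: "j : B" "inv (t j) *. (inv (s i) *. x) : K" using t(3) i by blast
  have "inv (s i *. t j) *. x = inv (t j) *. (inv (s i) *. x)"
   using c(1)[OF i(1)] c(2)[OF j(1)] sg_mem[OF assms(3) x] by (simp add: gnorm)
  then show ?thesis using i j by (intro bexI[of _ "(i, j)"]) auto
 qed
 show "x = y" if xy: "x : A \<times> B" "y : A \<times> B"
  "inv (s (fst x) *. t (snd x)) *. (s (fst y) *. t (snd y)) : K" for x y
 proof -
  obtain i j i' j' where e: "x = (i, j)" "y = (i', j')" by (cases x, cases y)
  have m: "i : A" "i' : A" "j : B" "j' : B" using xy e by auto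
  note cc = c(1)[OF m(1)] c(1)[OF m(2)] c(2)[OF m(3)] c(2)[OF m(4)]
  have K: "inv (t j) *. (inv (s i) *. s i' *. t j') : K" using xy(3) cc by (simp add: e gnorm)
  then have I: "inv (t j) *. (inv (s i) *. s i' *. t j') : I" using assms(7) by blast
  have "t j *. (inv (t j) *. (inv (s i) *. s i' *. t j')) *. inv (t j') : I"
   by (intro sg_mult[OF assms(4)] sg_inv[OF assms(4)] t(2) I m)
  moreover have "t j *. (inv (t j) *. (inv (s i) *. s i' *. t j')) *. inv (t j') = inv (s i) *. s i'"
   using cc by (simp add: gnorm)
  ultimately have "i = i'" using ltr_uniq[OF assms(1,3,4) m(1,2)] by simp
  then have "inv (t j) *. t j' : K" using K cc by simp
  then have "j = j'" by (rule ltr_uniq[OF assms(2,4,5) m(3,4)])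
  then show ?thesis using e \<open>i = i'\<close> by simp
 qed
qed

text \<open>A coset of \<open>U\<close> that meets \<open>I\<close> does so in a single coset of
  \<open>I Int U\<close>. In this way finite index passes from open subgroups to inertia groups,
  which need not be open.\<close>

lemma ltr_Int:
 assumes "left_transversal G H U A t" "subgroup H G" "subgroup U G" "subgroup I G" "I <= H"
 shows "EX B s. B <= A & left_transversal G I (I Int U) B s"
proof -
 have H: "!!y. y : H ==> y : carrier G" by (rule sg_mem[OF assms(2)])
 note t = ltD[OF assms(1)]
 define B where "B = {i : A. EX x:I. inv (t i) *. x : U}"
 define s where "s i = (SOME x. x : I & inv (t i) *. x : U)" for i
 have s: "s i : I & inv (t i) *. s i : U" if "i : B" for i
 proof -
  have "EX x. x : I & inv (t i) *. x : U" using that by (auto simp: B_def)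
  then show ?thesis unfolding s_def by (rule someI_ex)
 qed
 have c: "s i : carrier G" "t i : carrier G" if "i : B" for i
  using s[OF that] H[OF t(2)[of i]] H[of "s i"] that assms(5) by (auto simp: B_def)
 have key: "inv (t i) *. x : U \<longleftrightarrow> inv (s i) *. x : U" if "i : B" "x : carrier G" for i x
 proof -
  have e1: "(inv (t i) *. s i) *. (inv (s i) *. x) = inv (t i) *. x" using that(2) c[OF that(1)] by (simp add: gnorm)
  have e2: "inv (inv (t i) *. s i) *. (inv (t i) *. x) = inv (s i) *. x" using that(2) c[OF that(1)] by (simp add: gnorm)
  have st: "inv (t i) *. s i : U" using s that(1) by blast
  show ?thesis using sg_mult[OF assms(3) st, of "inv (s i) *. x"]
   sg_mult[OF assms(3) sg_inv[OF assms(3) st], of "inv (t i) *. x"] unfolding e1 e2 by blast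
 qed
 have "left_transversal G I (I Int U) B s"
 proof (rule ltI[OF assms(4)])
  show "subgroup (I Int U) G" using assms subgroups_Inter_pair by blast
  show "s i : I" if "i : B" for i using s that by blast
  show "finite B" using t(1) by (simp add: B_def)
  show "EX i:B. inv (s i) *. x : I Int U" if x: "x : I" for x
  proof -
   obtain i where i: "i : A" "inv (t i) *. x : U" using t(3) x assms(5) by blast
   then have iB: "i : B" using x by (auto simp: B_def)
   then have "inv (s i) *. x : U" using key[OF iB] i(2) H[of x] x assms(5) by blast
   moreover have "inv (s i) *. x : I" using s[OF iB] x sg_mult[OF assms(4)] sg_inv[OF assms(4)] by blast
   ultimately show ?thesis using iB by blast
  qed
  show "i = j" if "i : B" "j : B" "inv (s i) *. s j : I Int U" for i j
  proof -
   have "inv (t i) *. s j : U" using that key c by blast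
   moreover have "inv (t j) *. s j : U" using s that by blast
   moreover have "s j : H" using s that assms(5) by blast
   ultimately show ?thesis using t(3)[of "s j"] that by (auto simp: B_def)
  qed
 qed
 moreover have "B <= A" by (auto simp: B_def)
 ultimately show ?thesis by blast
qed

lemma ltr_index_mult:
 assumes "left_transversal G H K A t" "subgroup H G" "subgroup I G" "subgroup K G" "I <= H" "K <= I"
 shows "subgroup_index G H K = subgroup_index G H I * subgroup_index G I K"
  and "finite ((%x. x <#\<^bsub>G\<^esub> I) ` H)" and "finite ((%x. x <#\<^bsub>G\<^esub> K) ` I)"
proof -
 have H: "!!y. y : H ==> y : carrier G" by (rule sg_mem[OF assms(2)])
 note t = ltD[OF assms(1)]
 have "I Int K = K" using assms by auto
 then obtain B s where "B <= A" and B: "left_transversal G I K B s" using ltr_Int[OF assms(1,2,4,3,5)] by metis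
 show fin1: "finite ((%x. x <#\<^bsub>G\<^esub> K) ` I)" using ltr_finite_lcosets[OF B] assms by auto
 have "(%x. x <#\<^bsub>G\<^esub> I) ` H <= (%i. t i <#\<^bsub>G\<^esub> I) ` A"
 proof
  fix X assume "X : (%x. x <#\<^bsub>G\<^esub> I) ` H"
  then obtain x where x: "x : H" "X = x <#\<^bsub>G\<^esub> I" by auto
  then obtain i where i: "i : A" "inv (t i) *. x : K" using t(3) by blast
  then show "X : (%i. t i <#\<^bsub>G\<^esub> I) ` A" using x assms(6) lcos_eq_iff[OF assms(3) H[OF t(2)[OF i(1)]] H[OF x(1)]] by auto
 qed
 then show fin2: "finite ((%x. x <#\<^bsub>G\<^esub> I) ` H)" using t(1) finite_subset by blast
 obtain r where r: "left_transversal G H I {..<subgroup_index G H I} r" using ltr_exists[OF fin2] assms by auto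
 show "subgroup_index G H K = subgroup_index G H I * subgroup_index G I K"
  using idx_eq_card[OF ltr_tower[OF r B]] idx_eq_card[OF B] assms by (auto simp: card_cartesian_product)
qed

lemma idx_self:
 assumes "subgroup H G" shows "subgroup_index G H H = 1" "left_transversal G H H {0::nat} (%_. \<one>)"
proof -
 show *: "left_transversal G H H {0::nat} (%_. \<one>)" using assms by (intro ltI) (auto simp: sg_one sg_mem)
 show "subgroup_index G H H = 1" using idx_eq_card[OF *] assms by simp
qed

lemma idx_eq_1:
 assumes "left_transversal G H I A t" "subgroup H G" "subgroup I G" "I <= H" "subgroup_index G H I = 1"
 shows "I = H"
proof -
 note t = ltD[OF assms(1)]
 have "card A = 1" using idx_eq_card[OF assms(1-3)] assms(5) by simp
 then obtain a where a: "A = {a}" by (auto simp: card_1_singleton_iff)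
 have "x : I" if x: "x : H" for x
 proof -
  have "inv (t a) *. x : I" "inv (t a) *. \<one> : I" using t(3)[OF x] t(3)[of \<one>] a sg_one[OF assms(2)] by auto
  moreover have "t a : carrier G" "x : carrier G" using a t(2) x assms(2) sg_mem by fastforce+
  moreover have "t a : H" using t(2) a by blast
  ultimately have "t a : I" "t a : carrier G" "x : carrier G"
   using assms(3) x sg_mem[OF assms(2)] by (simp_all add: subgroup_mem_inv_iff)
  then have "t a *. (inv (t a) *. x) : I" using \<open>inv (t a) *. x : I\<close> sg_mult[OF assms(3)] by blast
  then show ?thesis using \<open>t a : carrier G\<close> \<open>x : carrier G\<close> by (simp add: gnorm)
 qed
 then show ?thesis using assms(4) by auto
qed

lemma ltr_conj:
 assumes "left_transversal G H I A t" "subgroup H G" "subgroup I G" "I <= H" "g : carrier G"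
 shows "left_transversal G (conj_set G g H) (conj_set G g I) A (%i. conj_elt G g (t i))"
proof -
 have H: "!!y. y : H ==> y : carrier G" by (rule sg_mem[OF assms(2)])
 note t = ltD[OF assms(1)]
 have eq: "inv (conj_elt G g x) *. conj_elt G g y = conj_elt G g (inv x *. y)"
  if "x : carrier G" "y : carrier G" for x y using that assms(5) by (simp add: conj_elt_def gnorm)
 have inj: "conj_elt G g x : conj_set G g I \<longleftrightarrow> x : I" if "x : carrier G" for x using that assms(5) sg_mem[OF assms(3)]
  by (auto simp: conj_set_def conj_elt_def)
 show ?thesis unfolding left_transversal_def
 proof (intro conjI ballI)
  fix y assume "y : conj_set G g H"
  then obtain x where x: "x : H" "y = conj_elt G g x" by (auto simp: conj_set_def)
  have "inv (conj_elt G g (t i)) *. y : conj_set G g I \<longleftrightarrow> inv (t i) *. x : I" if "i : A" for i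
   using eq[OF H[OF t(2)[OF that]] H[OF x(1)]] inj[of "inv (t i) *. x"] H[OF t(2)[OF that]] H[OF x(1)] x(2) by simp
  then show "EX! i. i : A & inv (conj_elt G g (t i)) *. y : conj_set G g I" using t(3)[OF x(1)] by blast
 qed (use t in \<open>auto simp: conj_set_def\<close>)
qed

end

text \<open>Replaces representatives picked by \<open>SOME\<close>, as in the definition of
  \<open>fixed_point_functor\<close>, by those of any transversal.\<close>

lemma (in comm_group) finprod_left_transversal:
 assumes "group K" "left_transversal K H I A t" "subgroup H K" "subgroup I K"
  and F: "!!x. x : H ==> F x : carrier G"
  and inv: "!!x y. x : H ==> y : H ==> inv\<^bsub>K\<^esub> x *.\<^bsub>K\<^esub> y : I ==> F x = F y"
  and "I <= H"
 shows "(\<Otimes>X\<in>lcosets\<^bsub>K(|carrier := H|)\<^esub> I. F (SOME x. x : X)) = (\<Otimes>i\<in>A. F (t i))"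
proof -
 interpret K: group K by fact
 have H: "!!y. y : H ==> y : carrier K" by (rule sg_mem[OF assms(3)])
 note t = ltD[OF assms(2)]
 have some: "(SOME x. x : h <#\<^bsub>K\<^esub> I) : H & inv\<^bsub>K\<^esub> h *.\<^bsub>K\<^esub> (SOME x. x : h <#\<^bsub>K\<^esub> I) : I"
  if "h : H" for h
 proof -
  have "(SOME x. x : h <#\<^bsub>K\<^esub> I) : h <#\<^bsub>K\<^esub> I"
   using K.lcos_self[OF H[OF that] assms(4)] by (rule someI[of "%x. x : h <#\<^bsub>K\<^esub> I"])
  then obtain i where "i : I" "(SOME x. x : h <#\<^bsub>K\<^esub> I) = h *.\<^bsub>K\<^esub> i" by (auto simp: l_coset_def)
  then show ?thesis using that assms(3,7) H by (auto simp: K.m_assoc[symmetric] sg_mult)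
 qed
 have "(\<Otimes>X\<in>lcosets\<^bsub>K(|carrier := H|)\<^esub> I. F (SOME x. x : X)) = (\<Otimes>i\<in>A. F (SOME x. x : t i <#\<^bsub>K\<^esub> I))"
 proof (rule finprod_bij_betw[symmetric, OF K.ltr_bij[OF assms(2-4)]])
  show "(%X. F (SOME x. x : X)) : (lcosets\<^bsub>K(|carrier := H|)\<^esub> I) \<rightarrow> carrier G"
   using some F by (auto simp: LCOSETS_def l_coset_def)
 qed
 also have "... = (\<Otimes>i\<in>A. F (t i))"
 proof (rule finprod_cong', simp)
  show "(%i. F (t i)) : A \<rightarrow> carrier G" using t(2) F by blast
  fix i assume i: "i : A"
  note s = some[OF t(2)[OF i]]
  show "F (SOME x. x : t i <#\<^bsub>K\<^esub> I) = F (t i)" by (rule inv[OF t(2)[OF i] conjunct1[OF s] conjunct2[OF s], symmetric])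
 qed
 finally show ?thesis .
qed

section \<open>Subgroups of prime index and the transfer\<close>

lemma card_image_eq_image:
 assumes "!!x y. x : S ==> y : S ==> f x = f y \<longleftrightarrow> g x = g y"
 shows "card (f ` S) = card (g ` S)"
proof -
 define h where "h z = g (SOME s. s : S & f s = z)" for z
 have h: "h (f s) = g s" if "s : S" for s
 proof -
  have "EX s'. s' : S & f s' = f s" using that by blast
  then have "(SOME s'. s' : S & f s' = f s) : S & f (SOME s'. s' : S & f s' = f s) = f s" by (rule someI_ex)
  then show ?thesis using assms[of _ s] that unfolding h_def by blast
 qed
 have "bij_betw h (f ` S) (g ` S)" unfolding bij_betw_def
 proof
  show "inj_on h (f ` S)"
  proof (rule inj_onI)
   fix a b assume "a : f ` S" "b : f ` S" "h a = h b"
   then obtain x y where "x : S" "y : S" "a = f x" "b = f y" by blast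
   then show "a = b" using \<open>h a = h b\<close> h assms by simp
  qed
  show "h ` f ` S = g ` S" using h by (simp add: image_image)
 qed
 then show ?thesis by (rule bij_betw_same_card)
qed

text \<open>For \<open>x\<close> outside \<open>S\<close>, the right cosets of \<open>S\<close>
  inside the double coset of \<open>inv x\<close> number [S:T], where \<open>T\<close> consists of
  the elements of \<open>S\<close> that \<open>x\<close> conjugates into \<open>S\<close>. This is a
  power of \<open>p\<close>, and it is below \<open>p\<close> because the coset \<open>S\<close>
  itself does not occur among them. Hence it is 1 and \<open>T = S\<close>.\<close>

lemma (in group) prime_power_index_prime_normal:
 assumes fin: "finite (carrier G)" and p: "prime p" and ord: "order G = p ^ Suc a"
  and S: "subgroup S G" and card: "card S = p ^ a"
 shows "S \<lhd> G"
proof -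
 have Sc: "!!s. s : S ==> s : carrier G" by (rule sg_mem[OF S])
 have finS: "finite S" using fin sg_sub[OF S] finite_subset by blast
 have ncos: "card (rcosets S) = p"
 proof -
  have "card (rcosets S) * p ^ a = p * p ^ a" using lagrange[OF S] ord card by simp
  then show ?thesis using p prime_gt_0_nat[of p] by simp
 qed
 have finr: "finite (rcosets S)" using fin by (simp add: RCOSETS_def)
 have main: "inv x *. s *. x : S" if x: "x : carrier G" and s: "s : S" for x s
 proof (cases "x : S")
  case True
  then show ?thesis using S s by (simp add: sg_mult sg_inv)
 next
  case False
  define T where "T = {s : S. inv x *. s *. x : S}"
  have T: "subgroup T (G(|carrier := S|))"
  proof (rule group.subgroupI)
   show "group (G(|carrier := S|))" using S subgroup_imp_group by blast
   have "\<one> : T" using S x by (simp add: T_def sg_one)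
   then show "T ~= {}" by blast
   show "T <= carrier (G(|carrier := S|))" by (auto simp: T_def)
  next
   fix a assume a: "a : T"
   then have aS: "a : S" "inv x *. a *. x : S" by (auto simp: T_def)
   have "inv (inv x *. a *. x) : S" using aS S by (simp add: sg_inv)
   moreover have "inv (inv x *. a *. x) = inv x *. inv a *. x" using x Sc[OF aS(1)] by (simp add: gnorm)
   ultimately show "inv\<^bsub>G(|carrier := S|)\<^esub> a : T" using aS S by (simp add: T_def m_inv_consistent sg_inv)
   fix b assume b: "b : T"
   then have bS: "b : S" "inv x *. b *. x : S" by (auto simp: T_def)
   have "(inv x *. a *. x) *. (inv x *. b *. x) : S" using aS bS S by (simp add: sg_mult)
   moreover have "(inv x *. a *. x) *. (inv x *. b *. x) = inv x *. (a *. b) *. x"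
   using x Sc[OF aS(1)] Sc[OF bS(1)] by (simp add: gnorm)
   ultimately show "a *.\<^bsub>G(|carrier := S|)\<^esub> b : T" using aS bS S by (simp add: T_def sg_mult)
  qed
  have Tg: "subgroup T G" using T S incl_subgroup by blast
  let ?f = "%s. S #> (inv x *. s)"
  have "card (?f ` S) = card ((%s. T #> s) ` S)"
  proof (rule card_image_eq_image)
   fix a b assume ab: "a : S" "b : S"
   have "?f a = ?f b \<longleftrightarrow> (inv x *. a) *. inv (inv x *. b) : S" using ab Sc x by (intro rcos_eq_iff S) auto
   also have "(inv x *. a) *. inv (inv x *. b) = inv x *. (a *. inv b) *. x"
   using x Sc[OF ab(1)] Sc[OF ab(2)] by (simp add: gnorm)
   also have "... : S \<longleftrightarrow> a *. inv b : T" using ab S by (simp add: T_def sg_mult sg_inv)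
   also have "... \<longleftrightarrow> T #> a = T #> b" using ab Sc by (intro rcos_eq_iff[symmetric] Tg) auto
   finally show "?f a = ?f b \<longleftrightarrow> T #> a = T #> b" .
  qed
  also have "(%s. T #> s) ` S = rcosets\<^bsub>G(|carrier := S|)\<^esub> T" by (auto simp: RCOSETS_def r_coset_def)
  finally have c: "card (?f ` S) = card (rcosets\<^bsub>G(|carrier := S|)\<^esub> T)" .
  have lag: "card (rcosets\<^bsub>G(|carrier := S|)\<^esub> T) * card T = p ^ a"
   using group.lagrange[OF subgroup_imp_group[OF S] T] card by (simp add: order_def)
  have "?f ` S <= rcosets S - {S}"
  proof
   fix X assume "X : ?f ` S"
   then obtain s where s: "s : S" "X = S #> (inv x *. s)" by blast
   have "X ~= S"
   proof
   assume "X = S"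
   then have "inv x *. s : S" using s rcos_self[of "inv x *. s" S] S x Sc by auto
   then have "(inv x *. s) *. inv s : S" using s S by (simp add: sg_mult sg_inv)
   then have "inv x : S" using s Sc x by (simp add: gnorm)
   then show False using False x S by (simp add: subgroup_mem_inv_iff)
   qed
   then show "X : rcosets S - {S}" using s x Sc by (auto simp: RCOSETS_def)
  qed
  then have "card (?f ` S) <= card (rcosets S - {S})" using finr by (intro card_mono) auto
  also have "... < p"
  proof -
   have "S : rcosets S" using subgroup.subgroup_in_rcosets[OF S is_group] .
   then show ?thesis using ncos finr prime_gt_0_nat[OF p] by (simp add: card_Diff_singleton)
  qed
  finally have lt: "card (rcosets\<^bsub>G(|carrier := S|)\<^esub> T) < p" using c by simp
  have "card (rcosets\<^bsub>G(|carrier := S|)\<^esub> T) dvd p ^ a" using lag by (metis dvd_triv_left)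
  then obtain i where "card (rcosets\<^bsub>G(|carrier := S|)\<^esub> T) = p ^ i" using divides_primepow_nat[OF p] by blast
  with lt have "card (rcosets\<^bsub>G(|carrier := S|)\<^esub> T) = 1" using prime_gt_1_nat[OF p] by (cases i) auto
  then have "card T = card S" using lag card by simp
  then have "T = S" using finS by (intro card_subset_eq) (auto simp: T_def)
  then show ?thesis using s by (auto simp: T_def)
 qed
 show ?thesis unfolding normal_inv_iff
 proof (intro conjI ballI S)
  fix x h assume "x : carrier G" "h : S"
  then show "x *. h *. inv x : S" using main[of "inv x" h] by simp
 qed
qed

text \<open>A proper subgroup \<open>S\<close> of maximal order works: the quotient contains an
  element \<open>?y\<close> of prime order, and \<open>S\<close> together with a lift of
  \<open>?y\<close> generates a strictly larger subgroup, hence everything. So the quotient is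
  cyclic, generated by \<open>?y\<close>.\<close>

lemma (in comm_group) subgroup_of_prime_index:
 assumes fin: "finite (carrier G)" and "order G ~= 1"
 shows "EX S p. prime p & subgroup S G & card (rcosets S) = p"
proof -
 define \<S> where "\<S> = {S. subgroup S G & S ~= carrier G}"
 have "{\<one>} ~= carrier G"
 proof
  assume "{\<one>} = carrier G"
  then have "order G = card {\<one>}" unfolding order_def by simp
  then show False using assms(2) by simp
 qed
 then have "{\<one>} : \<S>" using triv_subgroup by (simp add: \<S>_def)
 moreover have "finite \<S>" using fin by (rule finite_subset[rotated, OF finite_Pow_iff[THEN iffD2]])
   (auto simp: \<S>_def dest: sg_sub)
 ultimately have "Max (card ` \<S>) : card ` \<S>" "!!T. T : \<S> ==> card T <= Max (card ` \<S>)" by (auto intro!: Max_in)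
 moreover from this(1) obtain S where "S : \<S>" "card S = Max (card ` \<S>)" by (metis imageE)
 ultimately have S: "subgroup S G" "S ~= carrier G"
  and max: "!!T. subgroup T G ==> T ~= carrier G ==> card T <= card S" by (simp_all add: \<S>_def)
 have SN: "S \<lhd> G" by (rule subgroup_imp_normal[OF S(1)])
 let ?B = "G Mod S"
 interpret B: group ?B by (rule normal.factorgroup_is_group[OF SN])
 have finB: "finite (carrier ?B)" using fin by (simp add: FactGroup_def RCOSETS_def)
 obtain x where x: "x : carrier G" "x \<notin> S" using S sg_sub by blast
 let ?b = "S #> x"
 have b: "?b : carrier ?B" using x by (auto simp: carrier_FactGroup)
 have b1: "?b ~= \<one>\<^bsub>?B\<^esub>" using x rcos_self[OF x(1) S(1)] by auto
 have "B.ord ?b ~= 1" using b b1 B.ord_eq_1 by blast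
 then obtain p where p: "prime p" "p dvd B.ord ?b" using prime_factor_nat by blast
 let ?k = "B.ord ?b div p"
 have ordpos: "B.ord ?b > 0" using B.ord_ge_1[OF finB b] by simp
 have k: "?k * p = B.ord ?b" "?k > 0" using p ordpos by (auto simp: dvd_div_eq_0_iff)
 let ?y = "?b [^]\<^bsub>?B\<^esub> ?k"
 have y: "?y : carrier ?B" using b by simp
 have y1: "?y ~= \<one>\<^bsub>?B\<^esub>"
 proof
  assume "?y = \<one>\<^bsub>?B\<^esub>"
  then have "B.ord ?b dvd ?k" using b B.pow_eq_id by blast
  then have "B.ord ?b <= ?k" using k(2) dvd_imp_le by blast
  then show False using k ordpos prime_gt_1_nat[OF p(1)] by (metis div_less_dividend leD)
 qed
 have "?y [^]\<^bsub>?B\<^esub> p = \<one>\<^bsub>?B\<^esub>" using b k by (simp add: B.nat_pow_pow B.pow_ord_eq_1)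
 then have "B.ord ?y dvd p" using y B.pow_eq_id by blast
 then have ordy: "B.ord ?y = p" using p(1) y y1 B.ord_eq_1 by (metis prime_nat_iff)
 obtain z where z: "z : carrier G" "?y = S #> z" using y by (auto simp: carrier_FactGroup)
 let ?T = "S <#> generate G {z}"
 have gz: "subgroup (generate G {z}) G" using z by (intro generate_is_subgroup) auto
 have T: "subgroup ?T G" by (rule mult_subgroups[OF S(1) gz])
 have zT: "z : ?T" using z sg_one[OF S(1)] generate.incl[of z "{z}" G] by (force simp: set_mult_def)
 have ST: "S <= ?T"
 proof
  fix s assume "s : S"
  then show "s : ?T" using generate.one[of G "{z}"] sg_mem[OF S(1)] by (force simp: set_mult_def)
 qed
 have zS: "z \<notin> S" using z y1 coset_join2[OF z(1) S(1)] by auto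
 have finT: "finite ?T" using fin T sg_sub finite_subset by blast
 have "card S < card ?T" using ST zT zS finT by (intro psubset_card_mono) auto
 then have Teq: "?T = carrier G" using max[OF T] by force
 have "carrier ?B <= generate ?B {?y}"
 proof
  fix X assume "X : carrier ?B"
  then obtain g where g: "g : carrier G" "X = S #> g" by (auto simp: carrier_FactGroup)
  then obtain s w where sw: "s : S" "w : generate G {z}" "g = s *. w"
  proof -
   have "g : ?T" using g(1) Teq by simp
   then show ?thesis using that by (auto simp: set_mult_def)
  qed
  obtain k :: int where w: "w = z [^] k" using sw(2) generate_pow[OF z(1)] by auto
  have wc: "w : carrier G" using w z by simp
  have sc: "s : carrier G" using sw S sg_mem by metis
  have "X = S #> w" unfolding g(2) using rcos_eq_iff[OF S(1) g(1) wc] sw sc wc by (simp add: gnorm)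
  also have "... = ?y [^]\<^bsub>?B\<^esub> k" using normal.FactGroup_int_pow[OF SN z(1)] w z(2) by simp
  finally have "X = ?y [^]\<^bsub>?B\<^esub> k" .
  then show "X : generate ?B {?y}" using B.generate_pow[OF y] by auto
 qed
 then have "carrier ?B = generate ?B {?y}" using B.generate_incl[of "{?y}"] y by auto
 then have "card (carrier ?B) = p" using B.generate_pow_card[OF y] ordy by simp
 then show ?thesis using S(1) p(1) by (auto simp: FactGroup_def)
qed

section \<open>The transfer and its evaluation along orbits\<close>

context group
begin

lemma rcosets_repr_eq:
 assumes "subgroup S G" "R : rcosets S" "y : R"
 shows "S #> y = R"
proof -
 obtain z where "z : carrier G" "R = S #> z" using assms(2) by (auto simp: RCOSETS_def)
 then show ?thesis using repr_independence[of y S z] assms by simp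
qed

lemma rcos_act_bij:
 assumes "subgroup S G" "x : carrier G"
 shows "bij_betw (%R. R #> x) (rcosets S) (rcosets S)"
proof (rule bij_betw_byWitness[where f' = "%R. R #> (inv x)"])
 have Sc: "S <= carrier G" using assms sg_sub by blast
 show "ALL R:rcosets S. R #> x #> (inv x) = R" "ALL R:rcosets S. R #> (inv x) #> x = R"
  using assms(2) Sc by (auto simp: RCOSETS_def coset_mult_assoc gnorm)
 show "(%R. R #> x) ` (rcosets S) <= rcosets S" "(%R. R #> (inv x)) ` (rcosets S) <= rcosets S"
  using assms(2) Sc rcosetsI[OF Sc] by (auto simp: RCOSETS_def[of G S] coset_mult_assoc)
qed

lemma transfer_term_closed:
 assumes S: "subgroup S G" and x: "x : carrier G" and t: "!!R. R : rcosets S ==> t R : R"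
  and R: "R : rcosets S"
 shows "t R : carrier G" "t (R #> x) : carrier G" "t R *. x *. inv (t (R #> x)) : S"
proof -
 have Rx: "R #> x : rcosets S" using rcos_act_bij[OF S x] R by (auto simp: bij_betw_def)
 show tc: "t R : carrier G" "t (R #> x) : carrier G" using t R Rx rcosets_part_G[OF S] by blast+
 have "S #> t R = R" using S R t[OF R] by (rule rcosets_repr_eq)
 moreover have "S #> t (R #> x) = R #> x" using S Rx t[OF Rx] by (rule rcosets_repr_eq)
 moreover have "S #> (t R *. x) = S #> t R #> x" using tc x sg_sub[OF S] by (simp add: coset_mult_assoc)
 ultimately have "S #> (t R *. x) = S #> t (R #> x)" by simp
 then show "t R *. x *. inv (t (R #> x)) : S" using tc x rcos_eq_iff[OF S] by simp
qed

text \<open>With \<open>t' R = s R *. t R\<close> the factor at \<open>R\<close> changes by the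
  quotient of \<open>ph (s R)\<close> and \<open>ph (s (R #> x))\<close>. Since
  \<open>R #> x\<close> runs over all cosets along with \<open>R\<close>, these changes cancel in
  the product.\<close>

lemma transfer_indep:
 assumes S: "subgroup S G" and fin: "finite (rcosets S)" and x: "x : carrier G"
  and A: "comm_group A" and ph: "ph : hom (G(|carrier := S|)) A"
  and t: "!!R. R : rcosets S ==> t R : R" and t': "!!R. R : rcosets S ==> t' R : R"
 shows "(\<Otimes>\<^bsub>A\<^esub>R\<in>rcosets S. ph (t R *. x *. inv (t (R #> x)))) =
   (\<Otimes>\<^bsub>A\<^esub>R\<in>rcosets S. ph (t' R *. x *. inv (t' (R #> x))))"
proof -
 interpret A: comm_group A by fact
 have phm: "ph (a *. b) = ph a *.\<^bsub>A\<^esub> ph b" if "a : S" "b : S" for a b using ph that by (auto simp: hom_def)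
 have phc: "ph a : carrier A" if "a : S" for a using ph that by (auto simp: hom_def)
 define s where "s R = t' R *. inv (t R)" for R
 have tR: "t R : carrier G" "t' R : carrier G" if "R : rcosets S" for R using t t' that rcosets_part_G[OF S] by blast+
 have sS: "s R : S" if R: "R : rcosets S" for R
 proof -
  have "S #> t R = R" "S #> t' R = R" using rcosets_repr_eq[OF S R] t[OF R] t'[OF R] by auto
  then show ?thesis using rcos_eq_iff[OF S, of "t' R" "t R"] tR[OF R] by (simp add: s_def)
 qed
 have Rx: "R #> x : rcosets S" if "R : rcosets S" for R using rcos_act_bij[OF S x] that by (auto simp: bij_betw_def)
 let ?u = "%R. t R *. x *. inv (t (R #> x))"
 have uS: "?u R : S" if "R : rcosets S" for R by (rule transfer_term_closed(3)[OF S x t that])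
 have eq: "ph (t' R *. x *. inv (t' (R #> x))) = ph (s R) *.\<^bsub>A\<^esub> ph (?u R) *.\<^bsub>A\<^esub> inv\<^bsub>A\<^esub> (ph (s (R #> x)))"
  if R: "R : rcosets S" for R
 proof -
  have iS: "inv (s (R #> x)) : S" using sS[OF Rx[OF R]] S by (simp add: sg_inv)
  have "t' R *. x *. inv (t' (R #> x)) = s R *. ?u R *. inv (s (R #> x))"
   using tR[OF R] tR[OF Rx[OF R]] x by (simp add: s_def gnorm)
  moreover have "ph (inv (s (R #> x))) = inv\<^bsub>A\<^esub> (ph (s (R #> x)))"
  proof -
   have "ph (inv (s (R #> x))) *.\<^bsub>A\<^esub> ph (s (R #> x)) = ph \<one>"
   using phm[OF iS sS[OF Rx[OF R]]] sg_mem[OF S sS[OF Rx[OF R]]] by simp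
   also have "ph \<one> = \<one>\<^bsub>A\<^esub>" using phm[of \<one> \<one>] phc[of \<one>] sg_one[OF S] A.l_cancel_one by force
   finally show ?thesis using phc[OF iS] phc[OF sS[OF Rx[OF R]]] A.inv_equality by metis
  qed
  ultimately show ?thesis using phm sS[OF R] uS[OF R] iS S by (simp add: sg_mult)
 qed
 let ?P = "finprod A (%R. ph (s R)) (rcosets S)"
 have Pc: "?P : carrier A" using phc sS by (intro A.finprod_closed) auto
 have P2: "finprod A (%R. ph (s (R #> x))) (rcosets S) = ?P"
  using A.finprod_bij_betw[OF rcos_act_bij[OF S x], of "%R. ph (s R)"] phc sS by auto
 have "finprod A (%R. inv\<^bsub>A\<^esub> (ph (s (R #> x)))) (rcosets S) = inv\<^bsub>A\<^esub> ?P"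
 proof -
  have "(%a. inv\<^bsub>A\<^esub> a) (finprod A (%R. ph (s (R #> x))) (rcosets S)) =
   finprod A (%R. inv\<^bsub>A\<^esub> (ph (s (R #> x)))) (rcosets S)" using phc sS Rx by (intro finprod_hom A.comm_monoid_axioms)
   (auto simp: hom_def A.inv_mult)
  then show ?thesis using P2 by simp
 qed
 moreover have "(\<Otimes>\<^bsub>A\<^esub>R\<in>rcosets S. ph (t' R *. x *. inv (t' (R #> x)))) =
  (\<Otimes>\<^bsub>A\<^esub>R\<in>rcosets S. ph (s R) *.\<^bsub>A\<^esub> ph (?u R) *.\<^bsub>A\<^esub> inv\<^bsub>A\<^esub> (ph (s (R #> x))))"
  using phc sS uS Rx eq by (intro A.finprod_cong') auto
 moreover have "... = ?P *.\<^bsub>A\<^esub> (\<Otimes>\<^bsub>A\<^esub>R\<in>rcosets S. ph (?u R)) *.\<^bsub>A\<^esub>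
   finprod A (%R. inv\<^bsub>A\<^esub> (ph (s (R #> x)))) (rcosets S)"
  using phc sS uS Rx by (subst A.finprod_multf, force, force, subst A.finprod_multf) auto
 ultimately have "(\<Otimes>\<^bsub>A\<^esub>R\<in>rcosets S. ph (t' R *. x *. inv (t' (R #> x)))) =
  ?P *.\<^bsub>A\<^esub> (\<Otimes>\<^bsub>A\<^esub>R\<in>rcosets S. ph (?u R)) *.\<^bsub>A\<^esub> inv\<^bsub>A\<^esub> ?P" by simp
 also have "... = (\<Otimes>\<^bsub>A\<^esub>R\<in>rcosets S. ph (?u R))"
 proof -
  have "(\<Otimes>\<^bsub>A\<^esub>R\<in>rcosets S. ph (?u R)) : carrier A" using phc uS by (intro A.finprod_closed) auto
  then show ?thesis using Pc by (simp add: A.m_comm[of ?P] A.m_assoc)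
 qed
 finally show ?thesis by simp
qed

text \<open>With the representatives \<open>r d *. x [^] j\<close> along the orbits of right
  multiplication by \<open>x\<close>, every factor of the transfer is trivial except at the last
  coset of an orbit, where the orbit closes up and leaves
  \<open>r d *. x [^] l d *. inv (r d)\<close>.\<close>

lemma transfer_orbits:
 assumes S: "subgroup S G" and fin: "finite (rcosets S)" and x: "x : carrier G"
  and A: "comm_group A" and ph: "ph : hom (G(|carrier := S|)) A"
  and t: "!!R. R : rcosets S ==> t R : R"
  and D: "finite D" "!!d. d : D ==> r d : carrier G" "!!d. d : D ==> (l d :: nat) > 0"
   "!!d. d : D ==> r d *. x [^] l d *. inv (r d) : S"
  and bij: "bij_betw (%(d, j). S #> (r d *. x [^] j)) (Sigma D (%d. {..<l d})) (rcosets S)"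
 shows "(\<Otimes>\<^bsub>A\<^esub>R\<in>rcosets S. ph (t R *. x *. inv (t (R #> x)))) =
   (\<Otimes>\<^bsub>A\<^esub>d\<in>D. ph (r d *. x [^] l d *. inv (r d)))"
proof -
 interpret A: comm_group A by fact
 have phc: "ph a : carrier A" if "a : S" for a using ph that by (auto simp: hom_def)
 have ph1: "ph \<one> = \<one>\<^bsub>A\<^esub>" using ph phc[of \<one>] sg_one[OF S] A.l_cancel_one[of "ph \<one>" "ph \<one>"] by (force simp: hom_def)
 let ?I = "Sigma D (%d. {..<l d})"
 let ?c = "%(d, j). S #> (r d *. x [^] j)"
 define u where "u R = (let (d, j) = the_inv_into ?I ?c R in r d *. x [^] j)" for R
 have u: "u (S #> (r d *. x [^] j)) = r d *. x [^] j" if "d : D" "j < l d" for d j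
  using the_inv_into_f_f[of ?c ?I "(d, j)"] bij that by (simp add: u_def bij_betw_def)
 have Sc: "S <= carrier G" using S sg_sub by blast
 have uR: "u R : R" if "R : rcosets S" for R
 proof -
  have "R : ?c ` ?I" using bij that by (simp add: bij_betw_def)
  then obtain d j where dj: "d : D" "j < l d" "R = S #> (r d *. x [^] j)" by auto
  then show ?thesis using u rcos_self[OF _ S] x D(2) by simp
 qed
 have trm: "u R *. x *. inv (u (R #> x)) = (if Suc j = l d then r d *. x [^] l d *. inv (r d) else \<one>)"
  if d: "d : D" and j: "j < l d" and R: "R = S #> (r d *. x [^] j)" for d j R
 proof -
  have rd: "r d : carrier G" by (rule D(2)[OF d])
  have Rx: "R #> x = S #> (r d *. x [^] Suc j)" using R rd x Sc by (simp add: coset_mult_assoc m_assoc)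
  show ?thesis
  proof (cases "Suc j = l d")
   case True
   have "S #> (r d *. x [^] l d) = S #> (r d *. x [^] (0::nat))" using rcos_eq_iff[OF S] D(4)[OF d] rd x by simp
   then have "u (R #> x) = r d *. x [^] (0::nat)" using Rx True u[OF d, of 0] D(3)[OF d] by simp
   then have e: "u (R #> x) = r d" using rd by simp
   have "u R *. x = r d *. x [^] l d" using u[OF d j] R True[symmetric] rd x by (simp add: m_assoc)
   then show ?thesis using True e by simp
  next
   case False
   then have "u (R #> x) = r d *. x [^] Suc j" using Rx u[OF d, of "Suc j"] j by simp
   moreover have "u R *. x = r d *. x [^] Suc j" using u[OF d j] R rd x by (simp add: m_assoc)
   ultimately show ?thesis using False rd x by simp
  qed
 qed
 have "(\<Otimes>\<^bsub>A\<^esub>R\<in>rcosets S. ph (t R *. x *. inv (t (R #> x)))) =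
   (\<Otimes>\<^bsub>A\<^esub>R\<in>rcosets S. ph (u R *. x *. inv (u (R #> x))))" by (rule transfer_indep[OF S fin x A ph t uR])
 also have "... = (\<Otimes>\<^bsub>A\<^esub>i\<in>?I. ph (u (?c i) *. x *. inv (u (?c i #> x))))" using transfer_term_closed(3)[OF S x uR] phc
  by (intro A.finprod_bij_betw[OF bij, symmetric]) auto
 also have "... = (\<Otimes>\<^bsub>A\<^esub>i\<in>?I. (%d j. if Suc j = l d then ph (r d *. x [^] l d *. inv (r d)) else \<one>\<^bsub>A\<^esub>) (fst i) (snd i))"
 proof (rule A.finprod_cong', simp)
  fix i assume "i : ?I"
  then obtain d j where i: "i = (d, j)" "d : D" "j < l d" by auto
  show "ph (u (?c i) *. x *. inv (u (?c i #> x))) =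
   (%d j. if Suc j = l d then ph (r d *. x [^] l d *. inv (r d)) else \<one>\<^bsub>A\<^esub>) (fst i) (snd i)"
   using trm[OF i(2,3) refl] i(1) ph1 by simp
 qed (use phc D(4) in auto)
 also have "... = (\<Otimes>\<^bsub>A\<^esub>d\<in>D. \<Otimes>\<^bsub>A\<^esub>j\<in>{..<l d}. if Suc j = l d then ph (r d *. x [^] l d *. inv (r d)) else \<one>\<^bsub>A\<^esub>)"
  using D phc by (intro A.finprod_Sigma) auto
 also have "... = (\<Otimes>\<^bsub>A\<^esub>d\<in>D. ph (r d *. x [^] l d *. inv (r d)))"
 proof (rule A.finprod_cong', simp)
  fix d assume d: "d : D"
  have "(\<Otimes>\<^bsub>A\<^esub>j\<in>{..<l d}. if Suc j = l d then ph (r d *. x [^] l d *. inv (r d)) else \<one>\<^bsub>A\<^esub>) =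
   (\<Otimes>\<^bsub>A\<^esub>j\<in>{..<l d}. if j = l d - 1 then ph (r d *. x [^] l d *. inv (r d)) else \<one>\<^bsub>A\<^esub>)"
   using phc D d by (intro A.finprod_cong') auto
  also have "... = ph (r d *. x [^] l d *. inv (r d))" using phc D d by (intro A.finprod_singleton_swap) auto
  finally show "(\<Otimes>\<^bsub>A\<^esub>j\<in>{..<l d}. if Suc j = l d then ph (r d *. x [^] l d *. inv (r d)) else \<one>\<^bsub>A\<^esub>) =
   ph (r d *. x [^] l d *. inv (r d))" .
 qed (use phc D(4) in auto)
 finally show ?thesis .
qed

text \<open>Orbits are formed with nonnegative powers of \<open>x\<close>; finiteness of the coset
  space makes the powers return, so these are the full orbits. \<open>l d\<close> is the first
  return time of the chosen representative \<open>r d\<close>, which the fifth clause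
  records.\<close>

lemma transfer_orbits_exist:
 assumes S: "subgroup S G" and fin: "finite (rcosets S)" and x: "x : carrier G"
 obtains D :: "'a set set set" and r and l :: "'a set set => nat"
 where "finite D" "!!d. d : D ==> r d : carrier G" "!!d. d : D ==> l d > 0"
  "!!d. d : D ==> r d *. x [^] l d *. inv (r d) : S"
  "!!d j. d : D ==> j < l d ==> r d *. x [^] j *. inv (r d) : S ==> j = 0"
  "bij_betw (%(d, j). S #> (r d *. x [^] j)) (Sigma D (%d. {..<l d})) (rcosets S)"
  "!!d d' j. d : D ==> d' : D ==> S #> (r d *. x [^] (j::nat)) = S #> r d' ==> d = d'"
proof -
 define orb where "orb y = {S #> (y *. x [^] j) | j :: nat. True}" for y
 define D where "D = orb ` carrier G"
 define r where "r d = (SOME y. y : carrier G & orb y = d)" for d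
 define l where "l d = (LEAST l::nat. l > 0 & r d *. x [^] l *. inv (r d) : S)" for d
 have r: "r d : carrier G & orb (r d) = d" if "d : D" for d
 proof -
  have "EX y. y : carrier G & orb y = d" using that by (auto simp: D_def)
  then show ?thesis unfolding r_def by (rule someI_ex)
 qed
 have eqS: "S #> (y *. x [^] i) = S #> (z *. x [^] j) \<longleftrightarrow> y *. x [^] i *. inv (z *. x [^] j) : S"
  if "y : carrier G" "z : carrier G" for y z and i j :: nat using that x by (intro rcos_eq_iff S) auto
 have ex: "EX l::nat. l > 0 & y *. x [^] l *. inv y : S" if y: "y : carrier G" for y
 proof -
  have "range (%j::nat. S #> (y *. x [^] j)) <= rcosets S" using y x rcosetsI[OF sg_sub[OF S]] by auto
  then have "~ inj (%j::nat. S #> (y *. x [^] j))" using fin finite_subset finite_imageD infinite_UNIV_nat by blast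
  then obtain i j :: nat where "i ~= j" "S #> (y *. x [^] i) = S #> (y *. x [^] j)" by (auto simp: inj_def)
  then obtain i j :: nat where ij: "i < j" "S #> (y *. x [^] j) = S #> (y *. x [^] i)" by (metis linorder_neqE_nat)
  have "x [^] j = x [^] (j - i) *. x [^] i" using x ij(1) by (simp add: nat_pow_mult)
  then have "y *. x [^] j *. inv (y *. x [^] i) = y *. x [^] (j - i) *. inv y" using y x by (simp add: gnorm)
  then show ?thesis using eqS[OF y y, of j i] ij by (intro exI[of _ "j - i"]) simp
 qed
 have l: "l d > 0 & r d *. x [^] l d *. inv (r d) : S" if "d : D" for d
  using LeastI_ex[OF ex[OF conjunct1[OF r[OF that]]]] unfolding l_def by simp
 have least: "j = 0" if "d : D" "j < l d" "r d *. x [^] j *. inv (r d) : S" for d j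
  using not_less_Least[of j "%l. l > 0 & r d *. x [^] l *. inv (r d) : S"] that unfolding l_def by auto
 have red: "EX j'<l d. S #> (r d *. x [^] j) = S #> (r d *. x [^] j')" if d: "d : D" for d and j :: nat
 proof (induction j rule: less_induct)
  case (less j)
  show ?case
  proof (cases "j < l d")
   case False
   have rd: "r d : carrier G" using r d by blast
   have "x [^] j = x [^] l d *. x [^] (j - l d)" using x False by (simp add: nat_pow_mult)
   then have "r d *. x [^] j *. inv (r d *. x [^] (j - l d)) = r d *. x [^] l d *. inv (r d)" using rd x by (simp add: gnorm)
   then have "S #> (r d *. x [^] j) = S #> (r d *. x [^] (j - l d))" using eqS[OF rd rd, of j "j - l d"] l[OF d] by simp
   then show ?thesis using less[of "j - l d"] l[OF d] False by simp
  qed blast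
 qed
 have orb_sub: "orb y <= orb z" if y: "y : carrier G" and z: "z : carrier G"
  and e: "S #> y = S #> (z *. x [^] (j::nat))" for y z j
 proof
  fix R assume "R : orb y"
  then obtain i :: nat where "R = S #> (y *. x [^] i)" by (auto simp: orb_def)
  also have "... = S #> y #> x [^] i" using y x sg_sub[OF S] by (simp add: coset_mult_assoc)
  also have "... = S #> (z *. x [^] (j + i))" unfolding e using z x sg_sub[OF S]
   by (simp add: coset_mult_assoc m_assoc nat_pow_mult)
  finally show "R : orb z" by (auto simp: orb_def)
 qed
 have sep: "d = d'" if d: "d : D" "d' : D" and e: "S #> (r d *. x [^] (j::nat)) = S #> r d'" for d d' j
 proof -
  have rd: "r d : carrier G" "r d' : carrier G" using r d by blast+
  have 1: "orb (r d') <= orb (r d)" by (rule orb_sub[OF rd(2,1) e[symmetric]])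
  obtain j' where j': "j' < l d" "S #> (r d *. x [^] j) = S #> (r d *. x [^] j')" using red[OF d(1)] by blast
  \<comment> \<open>Completing the period of length \<open>l d\<close> leads from the coset of
    \<open>r d'\<close> back to that of \<open>r d\<close>, so that the two orbits contain each
    other.\<close>
  have "S #> r d = S #> (r d *. x [^] l d)" using eqS[OF rd(1,1), of "l d" 0] l[OF d(1)] rd x by simp
  also have "... = S #> (r d *. x [^] j') #> x [^] (l d - j')"
   using j' rd x sg_sub[OF S] by (simp add: coset_mult_assoc m_assoc nat_pow_mult)
  also have "... = S #> r d' #> x [^] (l d - j')" using j'(2) e by simp
  also have "... = S #> (r d' *. x [^] (l d - j'))" using rd x sg_sub[OF S] by (simp add: coset_mult_assoc)
  finally have "orb (r d) <= orb (r d')" using orb_sub[OF rd] by blast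
  with 1 show ?thesis using r d by auto
 qed
 have "inj_on (%(d, j). S #> (r d *. x [^] j)) (Sigma D (%d. {..<l d}))"
 proof (rule inj_onI, clarsimp)
  fix d j d' j' assume d: "d : D" "d' : D" and j: "j < l d" "j' < l d'"
   and e: "S #> (r d *. x [^] j) = S #> (r d' *. x [^] j')"
  have rd: "r d : carrier G" "r d' : carrier G" using r d by blast+
  have key: "S #> (r d *. x [^] (j + (l d' - j'))) = S #> r d'"
  proof -
   have "S #> (r d *. x [^] (j + (l d' - j'))) = S #> (r d *. x [^] j) #> x [^] (l d' - j')"
   using rd x sg_sub[OF S] by (simp add: coset_mult_assoc m_assoc nat_pow_mult)
   also have "... = S #> (r d' *. x [^] l d')"
   unfolding e using j rd x sg_sub[OF S] by (simp add: coset_mult_assoc m_assoc nat_pow_mult)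
   also have "... = S #> r d'" using eqS[OF rd(2,2), of "l d'" 0] l[OF d(2)] rd x by simp
   finally show ?thesis .
  qed
  have dd: "d = d'" by (rule sep[OF d key])
  have main: "i = k" if ik: "i <= k" "k < l d" "S #> (r d *. x [^] k) = S #> (r d *. x [^] i)" for i k
  proof -
   have "x [^] k = x [^] (k - i) *. x [^] i" using x ik(1) by (simp add: nat_pow_mult)
   then have "r d *. x [^] k *. inv (r d *. x [^] i) = r d *. x [^] (k - i) *. inv (r d)" using rd x by (simp add: gnorm)
   then have "r d *. x [^] (k - i) *. inv (r d) : S" using eqS[OF rd(1,1), of k i] ik(3) by simp
   moreover have "k - i < l d" using ik(2) by simp
   ultimately have "k - i = 0" using least[OF d(1)] by blast
   then show ?thesis using ik(1) by simp
  qed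
  show "d = d' & j = j'" using dd main[of j j'] main[of j' j] j e by (cases "j <= j'") auto
 qed
 moreover have "(%(d, j). S #> (r d *. x [^] j)) ` (Sigma D (%d. {..<l d})) = rcosets S"
 proof (intro subset_antisym subsetI)
  fix R assume "R : rcosets S"
  then obtain y where y: "y : carrier G" "R = S #> y" by (auto simp: RCOSETS_def)
  have d: "orb y : D" using y by (auto simp: D_def)
  have "S #> (y *. x [^] (0::nat)) : orb y" unfolding orb_def by blast
  then have "R : orb (r (orb y))" using y r[OF d] by simp
  then obtain j :: nat where "R = S #> (r (orb y) *. x [^] j)" by (auto simp: orb_def)
  moreover obtain j' where "j' < l (orb y)" "S #> (r (orb y) *. x [^] j) = S #> (r (orb y) *. x [^] j')"
   using red[OF d] by blast
  ultimately show "R : (%(d, j). S #> (r d *. x [^] j)) ` (Sigma D (%d. {..<l d}))"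
   using d by (intro image_eqI[of _ _ "(orb y, j')"]) auto
 next
  fix R assume "R : (%(d, j). S #> (r d *. x [^] j)) ` (Sigma D (%d. {..<l d}))"
  then obtain d j where "d : D" "R = S #> (r d *. x [^] (j::nat))" by auto
  then show "R : rcosets S" using r x rcosetsI[OF sg_sub[OF S]] by auto
 qed
 moreover have "finite D"
 proof -
  have "D <= Pow (rcosets S)" using x rcosetsI[OF sg_sub[OF S]] by (auto simp: D_def orb_def)
  then show ?thesis using fin finite_subset by blast
 qed
 ultimately show ?thesis using that[of D r l] r l least sep by (simp add: bij_betw_def)
qed

end

section \<open>Compact groups and pro-P groups\<close>

text \<open>P-numbers: the possible indices of open subgroups of a pro-P group, hence the possible
  degrees of the layers obtained by raising a Frobenius lift to a power.\<close>

definition pnum :: "nat set => nat => bool" where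
 "pnum P n \<longleftrightarrow> n > 0 & prime_factors n <= P"

lemma pnum_1 [simp]: "pnum P 1" "pnum P (Suc 0)" by (auto simp: pnum_def)

lemma pnum_pos: "pnum P n ==> n > 0" by (simp add: pnum_def)

lemma pnum_mult: "pnum P m ==> pnum P n ==> pnum P (m * n)" by (auto simp: pnum_def prime_factors_product)

lemma pnum_dvd: "pnum P n ==> m dvd n ==> pnum P m"
 using dvd_prime_factors[of n m] by (auto simp: pnum_def dest: dvd_pos_nat)

text \<open>\<^const>\<open>open_subgroup\<close> needs the record type without extension.\<close>

locale top_grp = topological_group G for G :: "'a top_group" (structure)
begin

abbreviation cG where "cG == carrier G"
abbreviation osub where "osub == open_subgroup G"
abbreviation onorm where "onorm == open_normal G"
abbreviation idx where "idx == subgroup_index G"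
abbreviation ltr where "ltr == left_transversal G"
abbreviation cs where "cs == conj_set G"
abbreviation ce where "ce == conj_elt G"

lemma open_subset_carrier: "openin (topol G) U ==> U <= cG" using openin_subset topspace_eq by metis

lemma closed_subset_carrier: "closedin (topol G) U ==> U <= cG" using closedin_subset topspace_eq by metis

lemma continuous_mult_pair:
 "continuous_map X (topol G) f ==> continuous_map X (topol G) g ==>
  continuous_map X (topol G) (%x. f x *. g x)"
 using continuous_map_compose[OF continuous_map_pairedI continuous_mult] by (simp add: o_def)

lemma continuous_left: "a : cG ==> continuous_map (topol G) (topol G) (%x. a *. x)"
 using continuous_mult_pair[of "topol G" "%_. a" id] by (simp add: topspace_eq id_def)

lemma continuous_right: "a : cG ==> continuous_map (topol G) (topol G) (%x. x *. a)"
 using continuous_mult_pair[of "topol G" id "%_. a"] by (simp add: topspace_eq id_def)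

lemma continuous_pow: "continuous_map (topol G) (topol G) (%x. x [^] (n::nat))"
proof (induction n)
 case 0
 show ?case by (simp add: topspace_eq)
next
 case (Suc n)
 then show ?case using continuous_mult_pair[OF Suc, of id] by (simp add: id_def)
qed

lemma lcos_preimage:
 assumes "a : cG" "U <= cG"
 shows "a <#\<^bsub>G\<^esub> U = {x : topspace (topol G). inv a *. x : U}"
proof (intro Set.set_eqI iffI)
 fix x assume "x : a <#\<^bsub>G\<^esub> U"
 then obtain u where "u : U" "x = a *. u" by (auto simp: l_coset_def)
 then show "x : {x : topspace (topol G). inv a *. x : U}" using assms by (auto simp: topspace_eq gnorm)
next
 fix x assume x: "x : {x : topspace (topol G). inv a *. x : U}"
 then have "x = a *. (inv a *. x)" using assms by (simp add: topspace_eq gnorm)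
 then show "x : a <#\<^bsub>G\<^esub> U" using x by (auto simp: l_coset_def)
qed

lemma openin_lcos: "openin (topol G) U ==> a : cG ==> openin (topol G) (a <#\<^bsub>G\<^esub> U)"
 using openin_continuous_map_preimage[OF continuous_left[of "inv a"], of U]
  lcos_preimage[OF _ open_subset_carrier] by simp

lemma closedin_lcos: "closedin (topol G) U ==> a : cG ==> closedin (topol G) (a <#\<^bsub>G\<^esub> U)"
 using closedin_continuous_map_preimage[OF continuous_left[of "inv a"], of U]
  lcos_preimage[OF _ closed_subset_carrier] by simp

lemma cs_preimage:
 assumes "a : cG" "U <= cG"
 shows "cs a U = {x : topspace (topol G). inv a *. (x *. a) : U}"
proof (intro Set.set_eqI iffI)
 fix x assume "x : cs a U"
 then obtain u where "u : U" "x = a *. u *. inv a" by (auto simp: conj_set_def conj_elt_def)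
 then show "x : {x : topspace (topol G). inv a *. (x *. a) : U}" using assms by (auto simp: topspace_eq gnorm subset_iff)
next
 fix x assume x: "x : {x : topspace (topol G). inv a *. (x *. a) : U}"
 then have "x = ce a (inv a *. (x *. a))" using assms by (simp add: conj_elt_def topspace_eq gnorm)
 then show "x : cs a U" using x by (auto simp: conj_set_def)
qed

lemma continuous_conj: "a : cG ==> continuous_map (topol G) (topol G) (%x. inv a *. (x *. a))"
 using continuous_map_compose[OF continuous_right continuous_left, of a "inv a"] by (simp add: o_def)

lemma openin_conj_set: "openin (topol G) U ==> a : cG ==> openin (topol G) (cs a U)"
 using openin_continuous_map_preimage[OF continuous_conj[of a], of U]
  cs_preimage[OF _ open_subset_carrier] by simp

lemma subgroup_conj_set:
 assumes "subgroup H G" "a : cG" shows "subgroup (cs a H) G"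
proof -
 have hom: "ce a : hom G G" using assms(2) by (auto simp: hom_def conj_elt_def gnorm)
 interpret group_hom G G "ce a" using hom by (simp add: group_hom_def group_hom_axioms_def is_group)
 show ?thesis unfolding conj_set_def by (rule subgroup_img_is_subgroup[OF assms(1)])
qed

lemma osub_conj: "osub H ==> a : cG ==> osub (cs a H)" by (simp add: open_subgroup_def openin_conj_set subgroup_conj_set)

lemma osub_closed:
 assumes "osub H" shows "closedin (topol G) H"
proof -
 have H: "subgroup H G" "openin (topol G) H" using assms by (auto simp: open_subgroup_def)
 have "topspace (topol G) - H = \<Union> ((%a. a <#\<^bsub>G\<^esub> H) ` (cG - H))"
 proof (intro Set.set_eqI iffI)
  fix x assume "x : topspace (topol G) - H"
  then show "x : \<Union> ((%a. a <#\<^bsub>G\<^esub> H) ` (cG - H))" using lcos_self[OF _ H(1)] by (auto simp: topspace_eq)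
 next
  fix x assume "x : \<Union> ((%a. a <#\<^bsub>G\<^esub> H) ` (cG - H))"
  then obtain a h where ah: "a : cG" "a \<notin> H" "h : H" "x = a *. h" by (auto simp: l_coset_def)
  have hc: "h : cG" by (rule sg_mem[OF H(1) ah(3)])
  have "x \<notin> H"
  proof
   assume "x : H"
   then have "x *. inv h : H" using ah H(1) by (simp add: sg_mult sg_inv)
   then show False using ah hc by (simp add: gnorm)
  qed
  then show "x : topspace (topol G) - H" using ah hc by (simp add: topspace_eq)
 qed
 moreover have "openin (topol G) ..." using openin_lcos[OF H(2)] by auto
 ultimately show ?thesis using openin_subset[OF H(2)] by (simp add: closedin_def)
qed

lemma closed_finite_index_open:
 assumes "subgroup H G" "closedin (topol G) H" "ltr cG H A t"
 shows "openin (topol G) H"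
proof -
 note t = ltD[OF assms(3)]
 obtain i0 where i0: "i0 : A" "inv (t i0) *. \<one> : H" using t(3)[of \<one>] by auto
 have ti0: "t i0 : H" using i0 t(2) assms(1) by (simp add: subgroup_mem_inv_iff)
 have "topspace (topol G) - H = \<Union> ((%i. t i <#\<^bsub>G\<^esub> H) ` (A - {i0}))"
 proof (intro Set.set_eqI iffI)
  fix x assume x: "x : topspace (topol G) - H"
  then obtain i where i: "i : A" "inv (t i) *. x : H" using t(3)[of x] by (auto simp: topspace_eq)
  have "i ~= i0"
  proof
   assume "i = i0"
   then have "t i0 *. (inv (t i0) *. x) : H" using i ti0 assms(1) by (simp add: sg_mult)
   then show False using x t(2)[OF i0(1)] by (simp add: topspace_eq gnorm)
  qed
  then show "x : \<Union> ((%i. t i <#\<^bsub>G\<^esub> H) ` (A - {i0}))" using i x t(2)[OF i(1)] lcos_preimage[OF _ sg_sub[OF assms(1)]] by auto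
 next
  fix x assume "x : \<Union> ((%i. t i <#\<^bsub>G\<^esub> H) ` (A - {i0}))"
  then obtain i where i: "i : A" "i ~= i0" "x : t i <#\<^bsub>G\<^esub> H" by auto
  then have x: "x : cG" "inv (t i) *. x : H"
   using lcos_preimage[OF t(2)[OF i(1)] sg_sub[OF assms(1)]] by (auto simp: topspace_eq)
  have "x \<notin> H"
  proof
   assume "x : H"
   then have "inv (t i0) *. x : H" using ti0 assms(1) by (simp add: sg_mult sg_inv)
   then show False using t(3)[OF x(1)] x(2) i i0 by blast
  qed
  then show "x : topspace (topol G) - H" using x by (simp add: topspace_eq)
 qed
 moreover have "closedin (topol G) (\<Union> ((%i. t i <#\<^bsub>G\<^esub> H) ` (A - {i0})))"
  using closedin_lcos[OF assms(2)] t by (intro closedin_Union) auto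
 ultimately have "closedin (topol G) (topspace (topol G) - H)" by simp
 then show ?thesis using closedin_subset[OF assms(2)] by (simp add: openin_closedin_eq)
qed

lemma subgroup_closure:
 assumes "subgroup S G" shows "subgroup (topol G closure_of S) G"
proof (rule subgroupI)
 let ?T = "topol G"
 have sub: "S <= ?T closure_of S" using sg_sub[OF assms] by (intro closure_of_subset) (simp add: topspace_eq)
 show "?T closure_of S <= cG" using closure_of_subset_topspace topspace_eq by metis
 show "?T closure_of S ~= {}" using sub sg_one[OF assms] by blast
 show "inv a : ?T closure_of S" if a: "a : ?T closure_of S" for a
 proof -
  have "inv a : ?T closure_of ((%x. inv x) ` S)"
   using continuous_map_image_closure_subset[OF continuous_inv, of S] a by blast
  moreover have "(%x. inv x) ` S <= S" using sg_inv[OF assms] by blast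
  ultimately show ?thesis using closure_of_mono by blast
 qed
 show "a *. b : ?T closure_of S" if ab: "a : ?T closure_of S" "b : ?T closure_of S" for a b
 proof -
  have "(a, b) : prod_topology ?T ?T closure_of (S \<times> S)" using ab by (simp add: closure_of_Times)
  then have "a *. b : ?T closure_of ((%(x, y). x *. y) ` (S \<times> S))"
   using continuous_map_image_closure_subset[OF continuous_mult, of "S \<times> S"] by fastforce
  moreover have "(%(x, y). x *. y) ` (S \<times> S) <= S" using sg_mult[OF assms] by auto
  ultimately show ?thesis using closure_of_mono by blast
 qed
qed

definition pclosure :: "'a => 'a set" where
 "pclosure h = topol G closure_of generate G {h}"

lemma pclosure_subgroup: "h : cG ==> subgroup (pclosure h) G"
 unfolding pclosure_def by (intro subgroup_closure generate_is_subgroup) auto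

lemma pclosure_closed: "closedin (topol G) (pclosure h)" by (simp add: pclosure_def)

lemma generate_subset_pclosure: "h : cG ==> generate G {h} <= pclosure h" unfolding pclosure_def
 using generate_incl[of "{h}"] by (intro closure_of_subset) (auto simp: topspace_eq)

lemma pclosure_self: "h : cG ==> h : pclosure h" using generate_subset_pclosure generate.incl[of h "{h}" G] by blast

lemma pclosure_minimal:
 assumes "closedin (topol G) S" "subgroup S G" "h : S"
 shows "pclosure h <= S" unfolding pclosure_def
 using generate_subgroup_incl[of "{h}" S] assms by (intro closure_of_minimal) auto

end

locale compact_group = top_grp +
 assumes compact: "compact_space (topol G)" and Hausdorff: "Hausdorff_space (topol G)"
begin

lemma osub_finite_lcosets:
 assumes "osub H" shows "finite ((%x. x <#\<^bsub>G\<^esub> H) ` cG)"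
proof -
 have H: "subgroup H G" "openin (topol G) H" using assms by (auto simp: open_subgroup_def)
 let ?A = "(%x. x <#\<^bsub>G\<^esub> H) ` cG"
 have "ALL U:?A. openin (topol G) U" using openin_lcos[OF H(2)] by auto
 moreover have "topspace (topol G) <= \<Union> ?A" using lcos_self[OF _ H(1)] by (auto simp: topspace_eq)
 ultimately obtain F where F: "finite F" "F <= ?A" "topspace (topol G) <= \<Union> F"
  using compact unfolding compact_space_alt by meson
 have "?A <= F"
 proof
  fix X assume "X : ?A"
  then obtain x where x: "x : cG" "X = x <#\<^bsub>G\<^esub> H" by auto
  then obtain Y where Y: "Y : F" "x : Y" using F(3) by (auto simp: topspace_eq)
  then obtain y where y: "y : cG" "Y = y <#\<^bsub>G\<^esub> H" using F(2) by auto
  then have "Y = X" using l_repr_independence[of x y H] Y x H(1) by auto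
  then show "X : F" using Y by simp
 qed
 then show ?thesis using F(1) finite_subset by blast
qed

lemma osub_transversal:
 assumes "osub K" "subgroup H G" "K <= H"
 shows "EX t. ltr H K {..<idx H K} t"
proof -
 have K: "subgroup K G" using assms by (simp add: open_subgroup_def)
 have "finite ((%x. x <#\<^bsub>G\<^esub> K) ` H)" using osub_finite_lcosets[OF assms(1)] sg_sub[OF assms(2)]
  by (meson finite_subset image_mono)
 then show ?thesis using ltr_exists assms(2) K by blast
qed

text \<open>The conjugate of \<open>S\<close> by \<open>a\<close> depends only on the left coset of
  \<open>a\<close> modulo \<open>S\<close>. Compactness leaves finitely many cosets, so that the
  intersection of all conjugates is open.\<close>

lemma osub_core:
 assumes "osub S"
 shows "EX N. onorm cG N & N <= S"
proof -
 have S: "subgroup S G" "openin (topol G) S" using assms by (auto simp: open_subgroup_def)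
 have cG: "osub cG" using openin_topspace[of "topol G"] by (simp add: open_subgroup_def topspace_eq subgroup_self)
 define N where "N = (\<Inter>a\<in>carrier G. cs a S)"
 have NS: "N <= S"
 proof
  fix x assume "x : N"
  then have "x : cs \<one> S" by (auto simp: N_def)
  then show "x : S" using cs_preimage[OF one_closed sg_sub[OF S(1)]] by (auto simp: topspace_eq)
 qed
 have "subgroup N G" unfolding N_def using subgroup_conj_set[OF S(1)] by (intro subgroups_Inter) auto
 moreover have "openin (topol G) N"
 proof -
  have "cs a S = (%X. {x : carrier G. ALL y:X. inv y *. (x *. y) : S}) (a <#\<^bsub>G\<^esub> S)"
   if a: "a : cG" for a
  proof -
   have "inv a *. (x *. a) : S \<longleftrightarrow> (ALL y:a <#\<^bsub>G\<^esub> S. inv y *. (x *. y) : S)" if x: "x : cG" for x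
   proof
   assume L: "inv a *. (x *. a) : S"
   show "ALL y:a <#\<^bsub>G\<^esub> S. inv y *. (x *. y) : S"
   proof
   fix y assume "y : a <#\<^bsub>G\<^esub> S"
   then obtain s where s: "s : S" "y = a *. s" by (auto simp: l_coset_def)
   have sc: "s : cG" by (rule sg_mem[OF S(1) s(1)])
   have "inv s *. (inv a *. (x *. a)) *. s : S" using s(1) L S(1) by (simp add: sg_mult sg_inv)
   then show "inv y *. (x *. y) : S" using s(2) sc a x by (simp add: gnorm)
   qed
   next
   assume "ALL y:a <#\<^bsub>G\<^esub> S. inv y *. (x *. y) : S"
   then show "inv a *. (x *. a) : S" using lcos_self[OF a S(1)] by blast
   qed
   then show ?thesis unfolding cs_preimage[OF a sg_sub[OF S(1)]] by (auto simp: topspace_eq)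
  qed
  then have "(%a. cs a S) ` cG =
   (%X. {x : carrier G. ALL y:X. inv y *. (x *. y) : S}) ` (%a. a <#\<^bsub>G\<^esub> S) ` cG" by (simp add: image_image)
  then have "finite ((%a. cs a S) ` cG)" using osub_finite_lcosets[OF assms] by simp
  moreover have "(%a. cs a S) ` cG ~= {}" by auto
  ultimately show ?thesis unfolding N_def using openin_conj_set[OF S(2)] by (intro openin_Inter) auto
 qed
 moreover have "N \<lhd> G" unfolding normal_inv_iff
 proof (intro conjI ballI)
  fix g x assume g: "g : cG" and x: "x : N"
  have xc: "x : cG" using x NS sg_mem[OF S(1)] by blast
  show "g *. x *. inv g : N" unfolding N_def
  proof
   fix a assume a: "a : cG"
   have "x : cs (inv g *. a) S" using x g a by (auto simp: N_def)
   then have "inv (inv g *. a) *. (x *. (inv g *. a)) : S"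
   using cs_preimage[OF _ sg_sub[OF S(1)], of "inv g *. a"] g a by auto
   then have "inv a *. ((g *. x *. inv g) *. a) : S" using g a xc by (simp add: gnorm)
   then show "g *. x *. inv g : cs a S" using cs_preimage[OF a sg_sub[OF S(1)]] g xc by (simp add: topspace_eq)
  qed
 qed fact
 ultimately show ?thesis using NS cG by (auto simp: open_normal_def open_subgroup_def)
qed

text \<open>Centralizers are closed by the Hausdorff property, so that commuting with
  \<open>h\<close> extends to the closure of its powers.\<close>

lemma pclosure_commute:
 assumes "h : cG" "g : cG" "g *. h = h *. g" "x : pclosure h"
 shows "g *. x = x *. g"
proof -
 let ?Z = "{x : topspace (topol G). g *. x = x *. g}"
 have "closedin (topol G) ?Z" by (rule closedin_continuous_maps_eq[OF Hausdorff continuous_left[OF assms(2)]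
   continuous_right[OF assms(2)]])
 moreover have "subgroup ?Z G"
 proof (rule subgroupI)
  fix a b assume "a : ?Z" "b : ?Z"
  then have ab: "a : cG" "b : cG" "g *. a = a *. g" "g *. b = b *. g" by (auto simp: topspace_eq)
  have "g *. (a *. b) = a *. b *. g" using ab assms(2) by (metis m_assoc)
  then show "a *. b : ?Z" using ab by (simp add: topspace_eq)
 next
  fix a assume "a : ?Z"
  then have a: "a : cG" "g *. a = a *. g" by (auto simp: topspace_eq)
  have "inv a *. (g *. a) *. inv a = inv a *. (a *. g) *. inv a" using a(2) by simp
  then show "inv a : ?Z" using a(1) assms(2) by (simp add: topspace_eq gnorm)
 next
  show "?Z ~= {}" using assms(2) by (auto simp: topspace_eq intro!: exI[of _ \<one>])
 qed (auto simp: topspace_eq)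
 ultimately have "pclosure h <= ?Z" using assms by (intro pclosure_minimal) (auto simp: topspace_eq)
 then show ?thesis using assms(4) by auto
qed

text \<open>Division with remainder puts the integer powers of \<open>h\<close> into the union of
  the \<open>k\<close> cosets of \<open>pclosure (h [^] k)\<close> by powers of \<open>h\<close>. A
  finite union of closed sets is closed, so it contains the closure as well.\<close>

lemma pclosure_decompose:
 fixes k :: nat
 assumes h: "h : cG" and k: "k > 0" and x: "x : pclosure h"
 shows "EX i<k. EX y:pclosure (h [^] k). x = h [^] i *. y"
proof -
 let ?K = "pclosure (h [^] k)"
 have hk: "h [^] k : cG" using h by simp
 note K = pclosure_subgroup[OF hk]
 let ?U = "\<Union>i<k. h [^] i <#\<^bsub>G\<^esub> ?K"
 have "generate G {h} <= ?U"
 proof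
  fix x assume "x : generate G {h}"
  then obtain j :: int where j: "x = h [^] j" using generate_pow[OF h] by auto
  let ?i = "nat (j mod int k)"
  have i: "?i < k" using k by (simp add: nat_less_iff)
  have "h [^] j = h [^] (int ?i + int k * (j div int k))" using k by simp
  also have "... = h [^] ?i *. (h [^] k) [^] (j div int k)"
   using h by (simp add: int_pow_mult int_pow_int int_pow_pow[symmetric])
  finally have e: "x = h [^] ?i *. (h [^] k) [^] (j div int k)" using j by simp
  have "(h [^] k) [^] (j div int k) : ?K" using generate_pow[OF hk] generate_subset_pclosure[OF hk] by blast
  then have "x : h [^] ?i <#\<^bsub>G\<^esub> ?K" using e by (auto simp: l_coset_def)
  then show "x : ?U" using i by blast
 qed
 moreover have "closedin (topol G) ?U" using closedin_lcos[OF pclosure_closed] h by (intro closedin_Union) auto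
 ultimately have "pclosure h <= ?U" unfolding pclosure_def[of h] by (rule closure_of_minimal)
 then obtain i where "i < k" "x : h [^] i <#\<^bsub>G\<^esub> ?K" using x by blast
 then show ?thesis by (auto simp: l_coset_def)
qed

lemma closedin_set_mult:
 assumes "closedin (topol G) A" "closedin (topol G) B"
 shows "closedin (topol G) (A <#> B)"
proof -
 have "compactin (prod_topology (topol G) (topol G)) (A \<times> B)"
  using assms closedin_compact_space[OF compact] by (simp add: compactin_Times)
 then have "compactin (topol G) ((%(x, y). x *. y) ` (A \<times> B))" by (rule image_compactin[OF _ continuous_mult])
 moreover have "(%(x, y). x *. y) ` (A \<times> B) = A <#> B" by (auto simp: set_mult_def)
 ultimately show ?thesis using compactin_imp_closedin[OF Hausdorff] by simp
qed

end

section \<open>Indices and powers in pro-P groups\<close>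

locale pro_P = compact_group G for P :: "nat set" and G :: "'a top_group" (structure) +
 assumes pro_P: "onorm cG N ==> prime_factors (order (G Mod N)) <= P"
begin

lemma idx_carrier: "idx cG N = order (G Mod N)" by (simp add: subgroup_index_def FactGroup_def order_def)

lemma idx_pos:
 assumes "osub K" "subgroup H G" "K <= H" shows "idx H K > 0"
proof -
 obtain t where t: "ltr H K {..<idx H K} t" using osub_transversal[OF assms] by blast
 then show ?thesis using ltD(3)[OF t sg_one[OF assms(2)]] by auto
qed

text \<open>The pro-P condition speaks of normal subgroups of the whole group; by multiplicativity
  the index divides that of an open normal subgroup contained in \<open>K\<close>.\<close>

lemma pnum_index:
 assumes "osub K" "osub H" "K <= H"
 shows "pnum P (idx H K)"
proof -
 have sub: "subgroup K G" "subgroup H G" using assms by (auto simp: open_subgroup_def)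
 obtain N where N: "onorm cG N" "N <= K" using osub_core[OF assms(1)] by blast
 have oN: "osub N" "subgroup N G" using N by (auto simp: open_normal_def open_subgroup_def)
 have "pnum P (idx cG N)" using pro_P[OF N(1)] idx_pos[OF oN(1) subgroup_self] sg_sub[OF oN(2)]
  by (simp add: pnum_def idx_carrier)
 moreover obtain t where t: "ltr cG N {..<idx cG N} t"
  using osub_transversal[OF oN(1) subgroup_self] sg_sub[OF oN(2)] by blast
 have "idx cG N = idx cG H * idx H N"
  using ltr_index_mult(1)[OF t subgroup_self sub(2) oN(2)] sg_sub[OF sub(2)] N(2) assms(3) by blast
 moreover obtain s where s: "ltr H N {..<idx H N} s" using osub_transversal[OF oN(1) sub(2)] N(2) assms(3) by blast
 have "idx H N = idx H K * idx K N" using ltr_index_mult(1)[OF s sub(2,1) oN(2)] assms(3) N(2) by blast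
 ultimately show ?thesis by (metis pnum_dvd dvd_triv_left dvd_triv_right)
qed

lemma pnum_power_mem:
 assumes "osub S" "g : cG"
 shows "EX k. pnum P k & g [^] k : S"
proof -
 obtain N where N: "onorm cG N" "N <= S" using osub_core[OF assms(1)] by blast
 have oN: "osub N" "subgroup N G" "N \<lhd> G" "osub cG" using N by (auto simp: open_normal_def open_subgroup_def)
 let ?k = "order (G Mod N)"
 have pk: "pnum P ?k" using pnum_index[OF oN(1,4)] sg_sub[OF oN(2)] by (simp add: idx_carrier)
 interpret Q: group "G Mod N" by (rule normal.factorgroup_is_group[OF oN(3)])
 have "N #> (g [^] ?k) = (N #> g) [^]\<^bsub>G Mod N\<^esub> ?k" using normal.FactGroup_pow[OF oN(3) assms(2)] by simp
 also have "... = N" using Q.pow_order_eq_1[of "N #> g"] assms(2) by (simp add: carrier_FactGroup)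
 finally have "g [^] ?k : N" using rcos_self[OF _ oN(2), of "g [^] ?k"] assms(2) by simp
 then show ?thesis using pk N(2) by blast
qed

end

section \<open>The group of P-adic integers\<close>

text \<open>Carries the coordinates of the inverse limits over to \<open>A\<close>:
  \<open>e p k x\<close> is the residue modulo \<open>p ^ k\<close> of the component of
  \<open>x\<close> at \<open>p\<close>.\<close>

lemma Z_P_coordinates:
 assumes "group A" "topologically_isomorphic A (Z_P P)" "ALL p:P. prime p"
 obtains e :: "nat => nat => 'w => int" where
  "!!p k x y. p : P ==> x : carrier A ==> y : carrier A ==>
   e p k (x *.\<^bsub>A\<^esub> y) = (e p k x + e p k y) mod int (p ^ k)"
  "!!p k x. p : P ==> x : carrier A ==> e p (Suc k) x mod int (p ^ k) = e p k x"
  "!!x y. x : carrier A ==> y : carrier A ==> (!!p k. p : P ==> e p k x = e p k y) ==> x = y"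
  "EX x:carrier A. ALL p:P. e p 1 x = 1"
  "Hausdorff_space (topol A)"
proof -
 obtain ph where ph: "ph : iso A (Z_P P)" "homeomorphic_map (topol A) (topol (Z_P P)) ph"
  using assms(2) by (auto simp: topologically_isomorphic_def)
 define e where "e p k x = ph x p k" for p k x
 have p0: "p > 0" if "p : P" for p using assms(3) that prime_gt_0_nat by blast
 have hom: "ph (x *.\<^bsub>A\<^esub> y) = ph x *.\<^bsub>Z_P P\<^esub> ph y" "ph x : carrier (Z_P P)"
  if "x : carrier A" "y : carrier A" for x y using ph(1) that by (auto simp: iso_def hom_def)
 have bij: "bij_betw ph (carrier A) (carrier (Z_P P))" using ph(1) by (simp add: iso_def)
 have car: "z : carrier (Z_P P) \<longleftrightarrow> z : extensional P &
   (ALL p:P. (ALL k. z p k : carrier (integer_mod_group (p ^ k))) & (ALL k. z p (Suc k) mod int (p ^ k) = z p k))" for z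
  by (auto simp: Z_P_def padic_integers_def Let_def PiE_iff)
 show ?thesis
 proof (rule that[of e])
  fix p k x y assume "p : P" "x : carrier A" "y : carrier A"
  then show "e p k (x *.\<^bsub>A\<^esub> y) = (e p k x + e p k y) mod int (p ^ k)"
   using hom by (simp add: e_def Z_P_def padic_integers_def Let_def)
 next
  fix p k x assume "p : P" "x : carrier A"
  then show "e p (Suc k) x mod int (p ^ k) = e p k x" using hom(2)[of x x] car by (simp add: e_def)
 next
  fix x y assume x: "x : carrier A" and y: "y : carrier A"
   and eq: "!!p k. p : P ==> e p k x = e p k y"
  have "ph x = ph y"
  proof (rule extensionalityI)
   show "ph x : extensional P" "ph y : extensional P" using hom(2) x y car by blast+
   fix p assume "p : P"
   then show "ph x p = ph y p" using eq by (auto simp: e_def)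
  qed
  then show "x = y" using bij x y by (auto simp: bij_betw_def inj_on_def)
 next
  let ?z = "\<lambda>p\<in>P. %k. 1 mod int (p ^ k)"
  have "?z : carrier (Z_P P)" unfolding car
  proof (intro conjI ballI allI)
   fix p k assume p: "p : P"
   show "?z p k : carrier (integer_mod_group (p ^ k))" using p0[OF p] p by (simp add: carrier_integer_mod_group)
   show "?z p (Suc k) mod int (p ^ k) = ?z p k" using p by (simp add: mod_mod_cancel)
  qed auto
  then have "?z : ph ` carrier A" using bij by (simp add: bij_betw_def)
  then obtain x where x: "x : carrier A" "ph x = ?z" by (metis imageE)
  have "e p 1 x = 1" if "p : P" for p using x that prime_gt_1_nat[of p] assms(3) by (simp add: e_def)
  then show "EX x:carrier A. ALL p:P. e p 1 x = 1" using x by blast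
 next
  have "Hausdorff_space (topol (padic_integers p))" for p unfolding padic_integers_def Let_def
   by (simp add: Hausdorff_space_subtopology Hausdorff_space_product_topology)
  then have "Hausdorff_space (topol (Z_P P))" by (simp add: Z_P_def Let_def Hausdorff_space_product_topology)
  then show "Hausdorff_space (topol A)"
   using ph(2) homeomorphic_Hausdorff_space homeomorphic_map_imp_homeomorphic_space by blast
 qed
qed

text \<open>Torsion reduces to prime exponents \<open>q\<close>. At \<open>p = q\<close>
  multiplication loses one power of \<open>p\<close>, which the coordinate of level
  \<open>Suc k\<close> makes up for; at other primes multiplication by \<open>q\<close> is injective
  modulo \<open>p ^ k\<close>. An element with residue 1 modulo \<open>p\<close> has no
  \<open>p\<close>-th root, since the residue of a \<open>p\<close>-th power is 0.\<close>

lemma Z_P_torsion_free_nondivisible: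
 assumes A: "group A" and iso: "topologically_isomorphic A (Z_P P)" and P: "ALL p:P. prime p"
 shows "x : carrier A ==> n > 0 ==> x [^]\<^bsub>A\<^esub> (n::nat) = \<one>\<^bsub>A\<^esub> ==> x = \<one>\<^bsub>A\<^esub>"
  and "p : P ==> EX x:carrier A. ALL y:carrier A. y [^]\<^bsub>A\<^esub> p ~= x"
  and "Hausdorff_space (topol A)"
proof -
 interpret group A by fact
 obtain e where e: "!!p k x y. p : P ==> x : carrier A ==> y : carrier A ==>
   e p k (x *.\<^bsub>A\<^esub> y) = (e p k x + e p k y) mod int (p ^ k)"
  and coh: "!!p k x. p : P ==> x : carrier A ==> e p (Suc k) x mod int (p ^ k) = e p k x"
  and inj: "!!x y. x : carrier A ==> y : carrier A ==> (!!p k. p : P ==> e p k x = e p k y) ==> x = y"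
  and ex1: "EX x:carrier A. ALL p:P. e p 1 x = 1" and H: "Hausdorff_space (topol A)"
  using Z_P_coordinates[OF A iso P] by blast
 show "Hausdorff_space (topol A)" by (rule H)
 have red: "e p k x mod int (p ^ k) = e p k x" if "p : P" "x : carrier A" for p k x
  using coh[OF that, of k] by (metis mod_mod_trivial)
 have e1: "e p k \<one>\<^bsub>A\<^esub> = 0" if "p : P" for p k
 proof -
  have "e p k \<one>\<^bsub>A\<^esub> mod int (p ^ k) = (e p k \<one>\<^bsub>A\<^esub> + e p k \<one>\<^bsub>A\<^esub>) mod int (p ^ k)"
   using e[OF that one_closed one_closed, of k] red[OF that one_closed, of k] by simp
  then have "int (p ^ k) dvd e p k \<one>\<^bsub>A\<^esub>" by (simp add: mod_eq_dvd_iff)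
  then show ?thesis using red[OF that one_closed, of k] by (simp add: dvd_imp_mod_0)
 qed
 have pow: "e p k (x [^]\<^bsub>A\<^esub> n) = (int n * e p k x) mod int (p ^ k)" if "p : P" "x : carrier A" for p k x n
 proof (induction n)
  case 0
  show ?case using e1 that by simp
 next
  case (Suc n)
  have "e p k (x [^]\<^bsub>A\<^esub> Suc n) = ((int n * e p k x) mod int (p ^ k) + e p k x) mod int (p ^ k)"
   using Suc e[OF that(1), of "x [^]\<^bsub>A\<^esub> n" x] that(2) by simp
  then show ?case by (simp add: mod_simps algebra_simps)
 qed
 show "EX x:carrier A. ALL y:carrier A. y [^]\<^bsub>A\<^esub> p ~= x" if p: "p : P"
 proof -
  obtain x where x: "x : carrier A" "e p 1 x = 1" using ex1 p by blast
  have "y [^]\<^bsub>A\<^esub> p ~= x" if "y : carrier A" for y using pow[OF p that, of 1 p] x(2) by auto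
  then show ?thesis using x by blast
 qed
 have prime_case: "x = \<one>\<^bsub>A\<^esub>" if x: "x : carrier A" "prime q" "x [^]\<^bsub>A\<^esub> (q::nat) = \<one>\<^bsub>A\<^esub>" for x q
 proof (rule inj[OF x(1) one_closed])
  fix p k assume p: "p : P"
  have pp: "prime p" using p P by blast
  have d: "int (p ^ j) dvd int q * e p j x" for j using pow[OF p x(1), of j q] x(3) e1[OF p] by (simp add: mod_eq_0_iff_dvd)
  have "int (p ^ k) dvd e p k x"
  proof (cases "p = q")
   case True
   have "int p * int (p ^ k) dvd int p * e p (Suc k) x" using d[of "Suc k"] True by simp
   then have "int (p ^ k) dvd e p (Suc k) x" using prime_gt_0_nat[OF pp] by simp
   then have "e p k x = 0" using coh[OF p x(1), of k] by (simp add: dvd_imp_mod_0)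
   then show ?thesis by simp
  next
   case False
   then have "coprime p q" using pp x(2) primes_coprime by blast
   then have "coprime (int (p ^ k)) (int q)" by (simp add: coprime_int_iff del: of_nat_power)
   then show ?thesis using d[of k] by (simp add: coprime_dvd_mult_right_iff)
  qed
  then show "e p k x = e p k \<one>\<^bsub>A\<^esub>" using red[OF p x(1), of k] e1[OF p] by (simp add: dvd_imp_mod_0)
 qed
 show "x = \<one>\<^bsub>A\<^esub>" if "x : carrier A" "n > 0" "x [^]\<^bsub>A\<^esub> (n::nat) = \<one>\<^bsub>A\<^esub>" using that
 proof (induction n arbitrary: x rule: less_induct)
  case (less n)
  show ?case
  proof (cases "n = 1")
   case True
   then show ?thesis using less.prems by simp
  next
   case False
   then obtain q where q: "prime q" "q dvd n" using prime_factor_nat by blast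
   then obtain m where m: "n = m * q" by (metis dvd_def mult.commute)
   have "(x [^]\<^bsub>A\<^esub> m) [^]\<^bsub>A\<^esub> q = \<one>\<^bsub>A\<^esub>" using less.prems m by (simp add: nat_pow_pow)
   then have "x [^]\<^bsub>A\<^esub> m = \<one>\<^bsub>A\<^esub>" using prime_case q(1) less.prems by blast
   moreover have "0 < m" "m < n" using m less.prems(2) prime_gt_1_nat[OF q(1)] by auto
   ultimately show ?thesis using less.IH less.prems(1) by blast
  qed
 qed
qed

text \<open>Of the isomorphism with Z_P only torsion-freeness and the failure of divisibility at the
  primes of P are kept; with compactness and the topological generator they determine the subgroups
  of finite index (\<open>finite_index_eq_pw\<close>).\<close>

locale omega_group = compact_group Om for P :: "nat set" and Om :: "'w top_group" (structure) and om :: 'w +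
 assumes P_ne: "P ~= {}" and P_prime: "!!p. p : P ==> prime p"
  and gen: "topological_generator Om om"
  and torsion_free: "x : carrier Om ==> n > 0 ==> x [^] (n::nat) = \<one> ==> x = \<one>"
  and nondivisible: "p : P ==> EX x:carrier Om. ALL y:carrier Om. y [^] p ~= x"
begin

lemma om_closed [simp]: "om : carrier Om" using gen by (simp add: topological_generator_def)

lemma closed_subgroup_full:
 assumes "closedin (topol Om) S" "subgroup S Om" "om : S" shows "S = carrier Om"
 using pclosure_minimal[OF assms] gen sg_sub[OF assms(2)] by (auto simp: pclosure_def topological_generator_def)

lemma pclosure_om: "pclosure om = carrier Om" using gen by (simp add: pclosure_def topological_generator_def)

text \<open>The closure argument is used twice: \<open>om\<close> commutes with the closure of its
  own powers, and then so does every \<open>x\<close>.\<close>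

lemma Om_comm:
 assumes "x : carrier Om" "y : carrier Om" shows "x *. y = y *. x"
proof -
 have 1: "om *. z = z *. om" if "z : carrier Om" for z using pclosure_commute[of om om z] that by (simp add: pclosure_om)
 show ?thesis using pclosure_commute[of om x y] 1[OF assms(1)] assms by (simp add: pclosure_om)
qed

sublocale Om_comm_group: comm_group Om by (rule group_comm_groupI) (rule Om_comm)

definition pw :: "nat => 'w set" where "pw k = (%x. x [^] k) ` carrier Om"

lemma pwI: "x : carrier Om ==> x [^] k : pw k" by (auto simp: pw_def)

lemma pw_1: "pw 1 = carrier Om" "pw (Suc 0) = carrier Om" by (auto simp: pw_def)

lemma pw_subgroup: "subgroup (pw k) Om"
proof -
 have "(%x. x [^] k) : hom Om Om" by (auto simp: hom_def Om_comm_group.nat_pow_distrib)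
 then interpret group_hom Om Om "%x. x [^] k" by (simp add: group_hom_def group_hom_axioms_def is_group)
 show ?thesis unfolding pw_def by (rule img_is_subgroup)
qed

lemma pw_closed: "closedin (topol Om) (pw k)"
proof -
 have "compactin (topol Om) (carrier Om)" using compact by (simp add: compact_space_def topspace_eq)
 then show ?thesis unfolding pw_def using image_compactin[OF _ continuous_pow] compactin_imp_closedin[OF Hausdorff] by blast
qed

lemma pw_mult_subset: "pw (m * k) <= pw m"
proof
 fix x assume "x : pw (m * k)"
 then obtain y where "y : carrier Om" "x = y [^] (m * k)" by (auto simp: pw_def)
 then have "x = (y [^] k) [^] m" by (simp add: nat_pow_pow mult.commute)
 then show "x : pw m" using \<open>y : carrier Om\<close> by (simp add: pwI)
qed

lemma pw_reps:
 assumes "x : carrier Om" "k > 0" shows "EX i<k. inv (om [^] i) *. x : pw k"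
proof -
 obtain i y where i: "i < k" "y : pclosure (om [^] k)" "x = om [^] i *. y"
  using pclosure_decompose[of om k x] assms by (auto simp: pclosure_om)
 have "pclosure (om [^] k) <= pw k" by (rule pclosure_minimal[OF pw_closed pw_subgroup pwI]) simp
 moreover have "y : carrier Om" using sg_mem[OF pclosure_subgroup i(2)] by simp
 ultimately show ?thesis using i by (intro exI[of _ i]) (auto simp: gnorm)
qed

lemma root_unique:
 assumes "x : carrier Om" "y : carrier Om" "n > 0" "x [^] (n::nat) = y [^] n" shows "x = y"
proof -
 have "(x *. inv y) [^] n = x [^] n *. inv (y [^] n)" using assms by (simp add: Om_comm_group.nat_pow_distrib nat_pow_inv)
 then have "(x *. inv y) [^] n = \<one>" using assms by simp
 then have "x *. inv y = \<one>" using torsion_free[of "x *. inv y" n] assms by simp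
 then show ?thesis using assms by (metis inv_closed inv_equality inv_inv)
qed

lemma om_not_1: "om ~= \<one>"
proof
 assume "om = \<one>"
 then have "pclosure om <= {\<one>}" using closedin_Hausdorff_sing_eq[OF Hausdorff, of \<one>] triv_subgroup
  by (intro pclosure_minimal) (auto simp: topspace_eq)
 then have "carrier Om = {\<one>}" by (auto simp: pclosure_om)
 moreover obtain p where "p : P" using P_ne by blast
 ultimately show False using nondivisible[OF \<open>p : P\<close>] by simp
qed

lemma om_pow_inj:
 assumes "om [^] (m::nat) = om [^] (n::nat)" shows "m = n"
proof -
 have main: "i = j" if "i <= j" "om [^] (i::nat) = om [^] (j::nat)" for i j
 proof (rule ccontr)
  assume "i ~= j"
  have "om [^] i *. om [^] (j - i) = om [^] i *. \<one>" using that(1) that(2)[symmetric] by (simp add: nat_pow_mult)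
  then have "om [^] (j - i) = \<one>" by (metis inv_mult_cancel nat_pow_closed om_closed one_closed)
  then show False using torsion_free[of om "j - i"] om_not_1 \<open>i ~= j\<close> that(1) by simp
 qed
 show ?thesis using main[of m n] main[of n m] assms by (cases "m <= n") auto
qed

lemma om_not_pw: "p : P ==> om \<notin> pw p"
proof
 assume p: "p : P" "om : pw p"
 have "pw p = carrier Om" by (rule closed_subgroup_full[OF pw_closed pw_subgroup p(2)])
 then show False using nondivisible[OF p(1)] by (force simp: pw_def)
qed

text \<open>The gcd of \<open>i\<close> and \<open>k\<close> cancels by uniqueness of roots. A prime
  \<open>p\<close> dividing the remaining \<open>k'\<close> lies in P, and Bezout for the coprime
  numbers \<open>i'\<close> and \<open>p\<close> would make \<open>om\<close> a \<open>p\<close>-th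
  power, contrary to \<open>om_not_pw\<close>.\<close>

lemma om_pow_in_pw:
 assumes "pnum P k" "om [^] i : pw k" shows "k dvd i"
proof -
 obtain z where z: "z : carrier Om" "om [^] i = z [^] k" using assms(2) by (auto simp: pw_def)
 define g where "g = gcd i k"
 have k0: "k > 0" using assms(1) by (simp add: pnum_def)
 have g: "g > 0" using k0 by (simp add: g_def)
 obtain i' k' where ik: "i = i' * g" "k = k' * g" "coprime i' k'" using gcd_coprime_exists[of i k] k0 unfolding g_def by auto
 have "(om [^] i') [^] g = (z [^] k') [^] g" using z by (simp add: nat_pow_pow ik(1,2))
 then have e: "om [^] i' = z [^] k'" using root_unique[OF _ _ g] z(1) by simp
 have "k' = 1"
 proof (rule ccontr)
  assume "k' ~= 1"
  then obtain p where p: "prime p" "p dvd k'" using prime_factor_nat by blast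
  have "pnum P k'" using pnum_dvd[OF assms(1)] ik(2) by simp
  then have "p : P" using p by (auto simp: pnum_def prime_factors_dvd)
  have "coprime i' p" using p ik(3) by (meson coprime_divisors dvd_refl)
  then obtain a b where ab: "a * i' = b * p + 1"
   using coprime_bezout_strong[of i' p] prime_gt_1_nat[OF p(1)] by (auto simp: mult.commute)
  obtain r where r: "k' = p * r" using p(2) by blast
  have "z [^] k' = (z [^] r) [^] p" using r z(1) by (simp add: nat_pow_pow mult.commute)
  then have pwp: "om [^] i' : pw p" using e z(1) by (simp add: pwI)
  have "om [^] (a * i') : pw p"
  proof -
   obtain y where "y : carrier Om" "om [^] i' = y [^] p" using pwp by (auto simp: pw_def)
   moreover have "om [^] (a * i') = (om [^] i') [^] a" by (simp add: nat_pow_pow mult.commute)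
   ultimately have "om [^] (a * i') = (y [^] a) [^] p" by (simp add: nat_pow_pow mult.commute)
   then show ?thesis using \<open>y : carrier Om\<close> by (simp add: pwI)
  qed
  moreover have "om [^] (b * p) : pw p" using pwI[of "om [^] b" p] by (simp add: nat_pow_pow)
  ultimately have "inv (om [^] (b * p)) *. om [^] (a * i') : pw p" using pw_subgroup by (simp add: sg_mult sg_inv)
  moreover have "inv (om [^] (b * p)) *. om [^] (a * i') = om"
   unfolding ab by (simp add: nat_pow_mult[symmetric] gnorm del: nat_pow_Suc)
  ultimately show False using om_not_pw[OF \<open>p : P\<close>] by simp
 qed
 then show ?thesis using ik by simp
qed

lemma pw_finite: "k > 0 ==> finite ((%x. x <#\<^bsub>Om\<^esub> pw k) ` carrier Om)"
 and pw_index_le: "k > 0 ==> subgroup_index Om (carrier Om) (pw k) <= k"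
proof -
 assume k: "k > 0"
 have sub: "(%x. x <#\<^bsub>Om\<^esub> pw k) ` carrier Om <= (%i. om [^] i <#\<^bsub>Om\<^esub> pw k) ` {..<k}"
 proof
  fix X assume "X : (%x. x <#\<^bsub>Om\<^esub> pw k) ` carrier Om"
  then obtain x where x: "x : carrier Om" "X = x <#\<^bsub>Om\<^esub> pw k" by auto
  obtain i where "i < k" "inv (om [^] i) *. x : pw k" using pw_reps[OF x(1) k] by blast
  then show "X : (%i. om [^] i <#\<^bsub>Om\<^esub> pw k) ` {..<k}" using x lcos_eq_iff[OF pw_subgroup, of "om [^] i" x k] by auto
 qed
 then show fin: "finite ((%x. x <#\<^bsub>Om\<^esub> pw k) ` carrier Om)" using finite_subset by blast
 obtain t where t: "left_transversal Om (carrier Om) (pw k) {..<subgroup_index Om (carrier Om) (pw k)} t"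
  using ltr_exists[OF fin subgroup_self pw_subgroup] by blast
 have "card {..<subgroup_index Om (carrier Om) (pw k)} = card ((%x. x <#\<^bsub>Om\<^esub> pw k) ` carrier Om)"
 proof -
  have "lcosets\<^bsub>Om(|carrier := carrier Om|)\<^esub> pw k = (%x. x <#\<^bsub>Om\<^esub> pw k) ` carrier Om" by (auto simp: LCOSETS_def l_coset_def)
  then show ?thesis using bij_betw_same_card[OF ltr_bij[OF t subgroup_self pw_subgroup]] by simp
 qed
 also have "... <= card ((%i. om [^] i <#\<^bsub>Om\<^esub> pw k) ` {..<k})" using sub by (intro card_mono) auto
 also have "... <= k" using card_image_le[of "{..<k}"] by fastforce
 finally show "subgroup_index Om (carrier Om) (pw k) <= k" by simp
qed

text \<open>By Lagrange \<open>D\<close> contains the powers with exponent its index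
  \<open>?k\<close>. These already form a subgroup of index at most \<open>?k\<close>, because the
  first \<open>?k\<close> powers of \<open>om\<close> represent all cosets.\<close>

lemma finite_index_eq_pw:
 assumes D: "subgroup D Om" and t: "left_transversal Om (carrier Om) D A t"
 shows "D = pw (subgroup_index Om (carrier Om) D)" "subgroup_index Om (carrier Om) D > 0"
proof -
 let ?k = "subgroup_index Om (carrier Om) D"
 have kA: "?k = card A" by (rule idx_eq_card[OF t subgroup_self D])
 show k0: "?k > 0" unfolding kA using ltD(1)[OF t] ltD(3)[OF t one_closed] card_gt_0_iff by blast
 have DN: "D \<lhd> Om" by (rule Om_comm_group.subgroup_imp_normal[OF D])
 interpret Q: group "Om Mod D" by (rule normal.factorgroup_is_group[OF DN])
 have "order (Om Mod D) = ?k" by (simp add: subgroup_index_def FactGroup_def order_def)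
 have pwD: "pw ?k <= D"
 proof
  fix x assume "x : pw ?k"
  then obtain y where y: "y : carrier Om" "x = y [^] ?k" by (auto simp: pw_def)
  have "D #> (y [^] ?k) = (D #> y) [^]\<^bsub>Om Mod D\<^esub> ?k" using normal.FactGroup_pow[OF DN y(1)] by simp
  also have "... = D" using Q.pow_order_eq_1[of "D #> y"] y(1) \<open>order (Om Mod D) = ?k\<close> by (simp add: carrier_FactGroup)
  finally show "x : D" using rcos_self[OF _ D, of "y [^] ?k"] y by simp
 qed
 obtain s where s: "left_transversal Om (carrier Om) (pw ?k) {..<subgroup_index Om (carrier Om) (pw ?k)} s"
  using ltr_exists[OF pw_finite[OF k0] subgroup_self pw_subgroup] by blast
 have mult: "subgroup_index Om (carrier Om) (pw ?k) = ?k * subgroup_index Om D (pw ?k)"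
  and fin: "finite ((%x. x <#\<^bsub>Om\<^esub> pw ?k) ` D)"
  using ltr_index_mult[OF s subgroup_self D pw_subgroup sg_sub[OF D] pwD] by auto
 obtain r where r: "left_transversal Om D (pw ?k) {..<subgroup_index Om D (pw ?k)} r"
  using ltr_exists[OF fin D pw_subgroup] by blast
 have "subgroup_index Om D (pw ?k) > 0" using ltD(3)[OF r sg_one[OF D]] by auto
 then have "subgroup_index Om D (pw ?k) = 1" using mult pw_index_le[OF k0] k0 by (simp add: le_less)
 then show "D = pw ?k" using idx_eq_1[OF r D pw_subgroup pwD] by simp
qed

end

section \<open>Ramification\<close>

lemma Ppart_unique:
 assumes "pnum P m" "c > 0" "!!p. p : P ==> ~ p dvd c" "ALL p:P. prime p"
 shows "prime_to_P_part P (m * c) = c"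
proof -
 have m: "m > 0" "prime_factors m <= P" using assms(1) by (auto simp: pnum_def)
 have dis: "prime_factors c Int P = {}" using assms(3) by (auto simp: prime_factors_dvd)
 have "prime_factors (m * c) - P = prime_factors c" using m assms(2) dis by (auto simp: prime_factors_product)
 moreover have "multiplicity p (m * c) = multiplicity p c" if "p : prime_factors c" for p
 proof -
  have "prime p" using that by (rule in_prime_factors_imp_prime)
  moreover have "~ p dvd m"
  proof
   assume "p dvd m"
   then have "p : P" using m \<open>prime p\<close> by (auto simp: prime_factors_dvd)
   then show False using dis that by blast
  qed
  ultimately show ?thesis using m(1) assms(2) by (simp add: prime_elem_multiplicity_mult_distrib not_dvd_imp_multiplicity_0)
 qed
 ultimately have "prime_to_P_part P (m * c) = (\<Prod>p\<in>prime_factors c. p ^ multiplicity p c)" by (simp add: prime_to_P_part_def)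
 also have "... = c" using prime_factorization_nat[OF assms(2)] by simp
 finally show ?thesis .
qed

lemma Ppart_decompose:
 assumes "n > 0" "ALL p:P. prime p"
 obtains m where "pnum P m" "n = m * prime_to_P_part P n" "prime_to_P_part P n > 0"
  "!!p. p : P ==> ~ p dvd prime_to_P_part P n"
proof -
 let ?c = "prime_to_P_part P n"
 let ?m = "\<Prod>p\<in>prime_factors n Int P. p ^ multiplicity p n"
 have "n = (\<Prod>p\<in>prime_factors n. p ^ multiplicity p n)" using prime_factorization_nat[OF assms(1)] .
 also have "... = ?m * ?c" unfolding prime_to_P_part_def by (subst prod.union_disjoint[symmetric]) (auto intro!: prod.cong)
 finally have n: "n = ?m * ?c" .
 have "prime_factors ?m <= P"
 proof
  fix q assume "q : prime_factors ?m"
  then have q: "prime q" "q dvd ?m" by (auto simp: prime_factors_dvd)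
  then obtain p where "p : prime_factors n Int P" "q dvd p ^ multiplicity p n"
   using prime_dvd_prod_iff[of "prime_factors n Int P" q "%p. p ^ multiplicity p n"] by auto
  then show "q : P" using q(1) prime_dvd_power primes_dvd_imp_eq by (metis IntD1 IntD2 in_prime_factors_imp_prime)
 qed
 moreover have "?m > 0" "?c > 0" using n assms(1) by (metis gr0I mult_is_0)+
 moreover have "~ p dvd ?c" if p: "p : P" for p
 proof
  assume "p dvd ?c"
  moreover have pp: "prime p" using p assms(2) by blast
  ultimately obtain q where "q : prime_factors n - P" "p dvd q ^ multiplicity q n"
   using prime_dvd_prod_iff[of "prime_factors n - P" p "%p. p ^ multiplicity p n"] unfolding prime_to_P_part_def by auto
  then show False using pp p prime_dvd_power primes_dvd_imp_eq by (metis DiffD1 DiffD2 in_prime_factors_imp_prime)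
 qed
 ultimately show ?thesis using that[of ?m] n by (simp add: pnum_def)
qed

lemma Ppart_pnum_mult:
 assumes "pnum P k" "n > 0" "ALL p:P. prime p"
 shows "prime_to_P_part P (k * n) = prime_to_P_part P n"
proof -
 obtain m where m: "pnum P m" "n = m * prime_to_P_part P n" "prime_to_P_part P n > 0"
  "!!p. p : P ==> ~ p dvd prime_to_P_part P n" using Ppart_decompose[OF assms(2,3)] by blast
 have "prime_to_P_part P ((k * m) * prime_to_P_part P n) = prime_to_P_part P n"
  by (rule Ppart_unique[OF pnum_mult[OF assms(1) m(1)] m(3,4) assms(3)])
 then show ?thesis using m(2) by (simp add: mult.assoc)
qed

lemma Ppart_pnum: "pnum P k ==> ALL p:P. prime p ==> prime_to_P_part P k = 1"
 using Ppart_unique[of P k 1] by (metis not_prime_1 nat_dvd_1_iff_1 mult.right_neutral zero_less_one)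

locale ramification = pro_P P G + Om: omega_group P Om om
 for P and G :: "'g top_group" (structure) and Om :: "'w top_group" and om +
 fixes d :: "'g => 'w"
 assumes d_hom: "d : hom G Om" and d_cont: "continuous_map (topol G) (topol Om) d"
  and d_surj: "d ` carrier G = carrier Om"
begin

sublocale dh: group_hom G Om d by (simp add: group_hom_def group_hom_axioms_def is_group Om.is_group d_hom)

abbreviation cO where "cO == carrier Om"
abbreviation oW where "oW == \<one>\<^bsub>Om\<^esub>"
abbreviation wpow (infixr "^." 75) where "x ^. n == x [^]\<^bsub>Om\<^esub> n"
abbreviation wmul (infixl "*^" 70) where "x *^ y == x *.\<^bsub>Om\<^esub> y"
abbreviation winv ("'/^ _" [81] 80) where "/^ x == inv\<^bsub>Om\<^esub> x"

abbreviation inert :: "'g set => 'g set" where "inert == inertia G Om d"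
abbreviation fdeg :: "'g set => 'g set => nat" where "fdeg == inertia_degree Om d"
abbreviation dr :: "'g set => 'g => 'w" where "dr == d_rel G Om d"

lemma P_prime': "ALL p:P. prime p" using Om.P_prime by blast

lemma osD:
 assumes "osub H"
 shows "subgroup H G" "openin (topol G) H" "H <= cG" "!!x. x : H ==> x : cG"
  "\<one> : H" "!!x y. x : H ==> y : H ==> x *. y : H" "!!x. x : H ==> inv x : H" using assms sg_sub[of H G]
 by (auto simp: open_subgroup_def sg_one sg_mult sg_inv)

lemma carrier_open: "osub cG" using openin_topspace[of "topol G"] by (simp add: open_subgroup_def topspace_eq subgroup_self)

lemma open_supergroup:
 assumes "osub K" "subgroup I G" "K <= I" shows "osub I"
proof -
 have "I = \<Union> ((%x. x <#\<^bsub>G\<^esub> K) ` I)"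
 proof (intro subset_antisym subsetI)
  fix x assume "x : I"
  then show "x : \<Union> ((%x. x <#\<^bsub>G\<^esub> K) ` I)" using lcos_self[OF sg_mem[OF assms(2)] osD(1)[OF assms(1)]] by blast
 next
  fix x assume "x : \<Union> ((%x. x <#\<^bsub>G\<^esub> K) ` I)"
  then show "x : I" using assms(3) sg_mult[OF assms(2)] by (auto simp: l_coset_def)
 qed
 moreover have "openin (topol G) (\<Union> ((%x. x <#\<^bsub>G\<^esub> K) ` I))"
  using openin_lcos[OF osD(2)[OF assms(1)]] sg_mem[OF assms(2)] by auto
 ultimately show ?thesis using assms(2) by (simp add: open_subgroup_def)
qed

lemma osub_Int: "osub H ==> osub K ==> osub (H Int K)" by (simp add: open_subgroup_def openin_Int subgroups_Inter_pair)

lemma subgroup_dpre: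
 assumes "subgroup H G" "subgroup D Om" shows "subgroup {x : H. d x : D} G"
proof (rule subgroupI)
 have H: "!!x. x : H ==> x : cG" by (rule sg_mem[OF assms(1)])
 show "{x : H. d x : D} <= cG" using H by blast
 show "{x : H. d x : D} ~= {}" using sg_one[OF assms(1)] sg_one[OF assms(2)] dh.hom_one by auto
 show "inv a : {x : H. d x : D}" if "a : {x : H. d x : D}" for a using that H[of a] assms by (simp add: sg_inv)
 show "a *. b : {x : H. d x : D}" if "a : {x : H. d x : D}" "b : {x : H. d x : D}" for a b
  using that H[of a] H[of b] assms by (simp add: sg_mult)
qed

lemma subgroup_dimage: "subgroup H G ==> subgroup (d ` H) Om" by (rule dh.subgroup_img_is_subgroup)

lemma transversal_dimage:
 assumes "ltr H I A t" "subgroup H G" "subgroup D Om" "I = {x : H. d x : D}"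
 shows "left_transversal Om (d ` H) D A (%i. d (t i))"
proof -
 note t = ltD[OF assms(1)]
 have H: "!!x. x : H ==> x : cG" by (rule sg_mem[OF assms(2)])
 show ?thesis unfolding left_transversal_def
 proof (intro conjI ballI)
  fix y assume "y : d ` H"
  then obtain x where x: "x : H" "y = d x" by blast
  have "/^ d (t i) *^ y : D \<longleftrightarrow> inv (t i) *. x : I" if i: "i : A" for i
  proof -
   have "inv (t i) *. x : H" using t(2)[OF i] x(1) assms(2) by (simp add: sg_mult sg_inv)
   moreover have "d (inv (t i) *. x) = /^ d (t i) *^ y" using H[OF t(2)[OF i]] H[OF x(1)] x(2) by simp
   ultimately show ?thesis unfolding assms(4) by simp
  qed
  then show "EX! i. i : A & /^ d (t i) *^ y : D" using t(3)[OF x(1)] by blast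
 qed (use t in auto)
qed

text \<open>\<open>fdeg H K\<close> equals the index in \<open>H\<close> of the group of all
  \<open>x\<close> with d(x) in d(K). That group contains \<open>K\<close>, hence is open, and its
  index is a P-number.\<close>

lemma dimage_transversal:
 assumes "osub H" "osub K" "K <= H"
 shows "EX t. left_transversal Om (d ` H) (d ` K) {..<fdeg H K} t"
  and "idx H K = fdeg H K * idx {x : H. d x : d ` K} K"
  and "pnum P (fdeg H K)"
proof -
 note H = osD[OF assms(1)] and K = osD[OF assms(2)]
 let ?I = "{x : H. d x : d ` K}"
 have I: "subgroup ?I G" by (rule subgroup_dpre[OF H(1) subgroup_dimage[OF K(1)]])
 have KI: "K <= ?I" using assms(3) by blast
 have oI: "osub ?I" by (rule open_supergroup[OF assms(2) I KI])
 obtain t where t: "ltr H ?I {..<idx H ?I} t" using osub_transversal[OF oI H(1)] by blast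
 note t' = transversal_dimage[OF t H(1) subgroup_dimage[OF K(1)] refl]
 have e: "fdeg H K = idx H ?I" using Om.idx_eq_card[OF t' subgroup_dimage[OF H(1)] subgroup_dimage[OF K(1)]]
  by (simp add: inertia_degree_def)
 show "EX t. left_transversal Om (d ` H) (d ` K) {..<fdeg H K} t" using t' e by auto
 obtain s where s: "ltr H K {..<idx H K} s" using osub_transversal[OF assms(2) H(1) assms(3)] by blast
 show "idx H K = fdeg H K * idx ?I K" unfolding e by (rule ltr_index_mult(1)[OF s H(1) I K(1) _ KI]) blast
 show "pnum P (fdeg H K)" unfolding e by (rule pnum_index[OF oI assms(1)]) blast
qed

lemma fdeg_tower:
 assumes "osub H" "osub K" "osub L" "K <= H" "L <= K"
 shows "fdeg H L = fdeg H K * fdeg K L"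
proof -
 obtain t where t: "left_transversal Om (d ` H) (d ` L) {..<fdeg H L} t"
  using dimage_transversal(1)[OF assms(1,3)] assms(4,5) by blast
 show ?thesis unfolding inertia_degree_def by (rule Om.ltr_index_mult(1)[OF t])
   (use assms osD(1) subgroup_dimage in auto)
qed

lemma fdeg_pos: "osub H ==> osub K ==> K <= H ==> fdeg H K > 0" using dimage_transversal(3) pnum_pos by blast

lemma d_image:
 assumes "osub H"
 shows "d ` H = Om.pw (fdeg cG H)" "fdeg cG H > 0"
proof -
 note H = osD[OF assms]
 obtain t where t: "left_transversal Om (d ` cG) (d ` H) {..<fdeg cG H} t"
  using dimage_transversal(1)[OF carrier_open assms H(3)] by blast
 show "d ` H = Om.pw (fdeg cG H)" using Om.finite_index_eq_pw(1)[OF subgroup_dimage[OF H(1)], of "{..<fdeg cG H}" t] t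
  by (simp add: d_surj inertia_degree_def)
 show "fdeg cG H > 0" by (rule fdeg_pos[OF carrier_open assms H(3)])
qed

lemma d_rel_eqI:
 assumes "osub H" "x : cO" "x ^. fdeg cG H = d h"
 shows "dr H h = x" unfolding d_rel_def
proof (rule the_equality)
 fix y assume "y : cO & y ^. fdeg cG H = d h"
 then show "y = x" using Om.root_unique[of y x] d_image(2)[OF assms(1)] assms(2,3) by metis
qed (use assms in simp)

lemma d_rel:
 assumes "osub H" "h : H"
 shows "dr H h : cO" "dr H h ^. fdeg cG H = d h"
proof -
 have "d h : Om.pw (fdeg cG H)" using d_image(1)[OF assms(1)] assms(2) by blast
 then obtain x where x: "x : cO" "x ^. fdeg cG H = d h" by (auto simp: Om.pw_def)
 then show "dr H h : cO" "dr H h ^. fdeg cG H = d h" using d_rel_eqI[OF assms(1) x] by auto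
qed

lemma d_rel_mult:
 assumes "osub H" "h : H" "k : H" shows "dr H (h *. k) = dr H h *^ dr H k"
 using assms d_rel[OF assms(1,2)] d_rel[OF assms(1,3)] osD(4)[OF assms(1)]
 by (intro d_rel_eqI) (auto simp: Om.Om_comm_group.nat_pow_distrib)

lemma d_rel_eq_1:
 assumes "osub H" "h : H" shows "dr H h = oW \<longleftrightarrow> d h = oW"
 using d_rel[OF assms] Om.torsion_free[of "dr H h"] d_image(2)[OF assms(1)] by auto

lemma d_rel_one: "osub H ==> dr H \<one> = oW" using d_rel_eq_1[of H \<one>] osD(5) by simp

lemma d_rel_inv:
 assumes "osub H" "h : H" shows "dr H (inv h) = /^ dr H h" using assms d_rel[OF assms] osD(4)[OF assms(1)]
 by (intro d_rel_eqI) (auto simp: Om.nat_pow_inv)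

lemma osub_pow: "osub H ==> h : H ==> h [^] (k::nat) : H" by (induction k) (auto simp: osD)

lemma d_rel_pow:
 assumes "osub H" "h : H" shows "dr H (h [^] (k::nat)) = dr H h ^. k"
proof (induction k)
 case (Suc k)
 then show ?case using d_rel_mult[OF assms(1) osub_pow[OF assms] assms(2)] by simp
qed (simp add: d_rel_one assms(1))

lemma d_rel_surj:
 assumes "osub H" "x : cO" shows "EX h:H. dr H h = x"
proof -
 have "x ^. fdeg cG H : d ` H" using d_image(1)[OF assms(1)] assms(2) Om.pwI by simp
 then obtain h where "h : H" "x ^. fdeg cG H = d h" by blast
 then show ?thesis using d_rel_eqI[OF assms] by blast
qed

lemma d_rel_sub:
 assumes "osub H" "osub K" "K <= H" "h : K"
 shows "dr H h = dr K h ^. fdeg H K"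
proof (rule d_rel_eqI[OF assms(1)])
 show "dr K h ^. fdeg H K : cO" using d_rel(1)[OF assms(2,4)] by simp
 have "fdeg cG K = fdeg cG H * fdeg H K" using fdeg_tower[OF carrier_open assms(1,2)] assms(3) osD(3)[OF assms(1)] by blast
 then show "(dr K h ^. fdeg H K) ^. fdeg cG H = d h" using d_rel[OF assms(2,4)] by (simp add: Om.nat_pow_pow mult.commute)
qed

lemma d_rel_image:
 assumes "osub H" "osub K" "K <= H"
 shows "dr H ` K = Om.pw (fdeg H K)"
proof (intro subset_antisym subsetI)
 fix x assume "x : dr H ` K"
 then show "x : Om.pw (fdeg H K)" using d_rel_sub[OF assms] d_rel(1)[OF assms(2)] Om.pwI by auto
next
 fix x assume "x : Om.pw (fdeg H K)"
 then obtain y where y: "y : cO" "x = y ^. fdeg H K" by (auto simp: Om.pw_def)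
 obtain k where "k : K" "dr K k = y" using d_rel_surj[OF assms(2) y(1)] by blast
 then have "dr H k = x" using d_rel_sub[OF assms, of k] y(2) by simp
 then show "x : dr H ` K" using \<open>k : K\<close> by blast
qed

lemma fdeg_le_1_iff:
 assumes "osub H" "osub K" "K <= H"
 shows "fdeg H K = 1 \<longleftrightarrow> d ` H = d ` K"
proof
 assume "fdeg H K = 1"
 moreover obtain t where "left_transversal Om (d ` H) (d ` K) {..<fdeg H K} t" using dimage_transversal(1)[OF assms] by blast
 ultimately show "d ` H = d ` K" using Om.idx_eq_1[of "d ` H" "d ` K" "{..<fdeg H K}" t] image_mono[OF assms(3), of d]
   subgroup_dimage osD(1) assms by (simp add: inertia_degree_def)
next
 assume "d ` H = d ` K"
 then show "fdeg H K = 1" using Om.idx_self(1)[OF subgroup_dimage] osD(1) assms(2) by (simp add: inertia_degree_def)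
qed

lemma d_conj: "g : cG ==> h : cG ==> d (ce g h) = d h" by (simp add: conj_elt_def Om.Om_comm[of "d g" "d h"] Om.gnorm)

lemma dimage_conj:
 assumes "g : cG" "H <= cG" shows "d ` cs g H = d ` H"
 using d_conj[OF assms(1)] assms(2) by (force simp: conj_set_def image_image subset_iff)

lemma d_rel_conj:
 assumes "osub H" "h : H" "g : cG"
 shows "dr (cs g H) (ce g h) = dr H h"
proof -
 have "fdeg cG (cs g H) = fdeg cG H" using dimage_conj[OF assms(3) osD(3)[OF assms(1)]] by (simp add: inertia_degree_def)
 then show ?thesis using d_conj[OF assms(3) osD(4)[OF assms(1,2)]] by (simp add: d_rel_def)
qed

section \<open>Inertia groups, open normal subgroups and Frobenius lifts\<close>

lemma inert_iff: "H <= cG ==> x : inert H \<longleftrightarrow> x : H & d x = oW" by (auto simp: inertia_def kernel_def)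

lemma inert_subgroup: "subgroup H G ==> subgroup (inert H) G"
 unfolding inertia_def using subgroups_Inter_pair dh.subgroup_kernel by blast

lemma inert_mono: "K <= H ==> inert K <= inert H" by (auto simp: inertia_def)

lemma inert_subset: "inert H <= H" by (auto simp: inertia_def)

lemma inert_closed: "osub H ==> closedin (topol G) (inert H)"
proof -
 assume H: "osub H"
 have "kernel G Om d = {x : topspace (topol G). d x : {oW}}" by (auto simp: kernel_def topspace_eq)
 moreover have "closedin (topol Om) {oW}" using closedin_Hausdorff_sing_eq[OF Om.Hausdorff] by (simp add: Om.topspace_eq)
 ultimately have "closedin (topol G) (kernel G Om d)" using closedin_continuous_map_preimage[OF d_cont] by metis
 then show ?thesis unfolding inertia_def using osub_closed[OF H] by (rule closedin_Int[rotated])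
qed

lemma onD:
 assumes "onorm H U"
 shows "osub H" "osub U" "U <= H"
  "!!h u. h : H ==> u : U ==> h *. u *. inv h : U" "!!h u. h : H ==> u : U ==> inv h *. u *. h : U"
  "U \<lhd> G(|carrier := H|)"
proof -
 show o: "osub H" "osub U" and N: "U \<lhd> G(|carrier := H|)" using assms by (auto simp: open_normal_def)
 note H = osD[OF o(1)]
 show "U <= H" using sg_sub[OF normal_imp_subgroup[OF N]] by simp
 have grp: "group (G(|carrier := H|))" using H(1) subgroup_imp_group by blast
 show 1: "h *. u *. inv h : U" if "h : H" "u : U" for h u
  using normal.inv_op_closed2[OF N, of h u] that H(1) by (simp add: m_inv_consistent)
 show "inv h *. u *. h : U" if "h : H" "u : U" for h u using 1[of "inv h" u] that H by simp
qed

lemma onI: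
 assumes "osub H" "osub U" "U <= H"
  "!!h u. h : H ==> u : U ==> h *. u *. inv h : U"
 shows "onorm H U"
proof -
 note H = osD[OF assms(1)] and U = osD[OF assms(2)]
 have grp: "group (G(|carrier := H|))" using H(1) subgroup_imp_group by blast
 have "U \<lhd> G(|carrier := H|)" unfolding group.normal_inv_iff[OF grp]
  using assms(4) H(1) subgroup_incl[OF U(1) H(1) assms(3)] by (simp add: m_inv_consistent)
 then show ?thesis using assms by (simp add: open_normal_def)
qed

lemma inert_normal:
 assumes "onorm H U" "h : H" "j : inert U"
 shows "h *. j *. inv h : inert U" "inv h *. j *. h : inert U"
proof -
 note U = onD[OF assms(1)]
 have Us: "U <= cG" by (rule osD(3)[OF U(2)])
 have j: "j : U" "d j = oW" "j : cG" using assms(3) inert_iff[OF Us] Us by auto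
 have h: "h : cG" by (rule osD(4)[OF U(1) assms(2)])
 show "h *. j *. inv h : inert U" "inv h *. j *. h : inert U"
  unfolding inert_iff[OF Us] using U(4,5)[OF assms(2) j(1)] h j by auto
qed

text \<open>By division with remainder the degree of \<open>h\<close> is \<open>om ^. i\<close> up
  to the degree of an element of \<open>U\<close>; a further step of size \<open>fdeg H U\<close>,
  again available in \<open>U\<close>, makes the exponent positive.\<close>

lemma frobenius_lift:
 assumes "osub H" "osub U" "U <= H" "h : H"
 shows "EX u:U. EX n>0. dr H (u *. h) = om ^. (n::nat)"
proof -
 let ?f = "fdeg H U"
 have f: "?f > 0" by (rule fdeg_pos[OF assms(1-3)])
 have dh: "dr H h : cO" by (rule d_rel(1)[OF assms(1,4)])
 obtain i where i: "i < ?f" "/^ (om ^. i) *^ dr H h : Om.pw ?f" using Om.pw_reps[OF dh f] by blast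
 have "/^ (/^ (om ^. i) *^ dr H h) *^ om ^. ?f : Om.pw ?f"
  using i(2) Om.pw_subgroup Om.pwI[OF Om.om_closed] by (simp add: sg_mult sg_inv)
 then obtain u where u: "u : U"
  "dr H u = /^ (/^ (om ^. i) *^ dr H h) *^ om ^. ?f" unfolding d_rel_image[OF assms(1-3), symmetric] by auto
 have "dr H (u *. h) = dr H u *^ dr H h" using d_rel_mult[OF assms(1) _ assms(4)] u(1) assms(3) by blast
 also have "... = /^ dr H h *^ (om ^. i *^ om ^. ?f) *^ dr H h"
  unfolding u(2) using dh by (simp add: Om.gnorm del: Om.nat_pow_mult)
 also have "... = om ^. (i + ?f)" using dh by (simp add: Om.nat_pow_mult Om.Om_comm[of "om ^. (i + ?f)"] Om.gnorm
   Om.m_assoc)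
 finally show ?thesis using u(1) f by (intro bexI[of _ u] exI[of _ "i + ?f"]) auto
qed

text \<open>The preimage of the subgroup \<open>?D\<close> of \<open>c\<close>-th powers is open in
  \<open>G\<close>, so \<open>?D = Om.pw ?j\<close> for a P-number \<open>?j\<close>. Then
  \<open>?j\<close> divides \<open>c\<close>, which is prime to P, and so \<open>?j = 1\<close>. The
  pro-P property of \<open>G\<close> replaces a computation in Z_P.\<close>

lemma pw_coprime:
 assumes "c > 0" "!!p. p : P ==> ~ p dvd c" shows "Om.pw c = cO"
proof -
 let ?D = "Om.pw c"
 obtain t where t: "left_transversal Om cO ?D {..<subgroup_index Om cO ?D} t"
  using Om.ltr_exists[OF Om.pw_finite[OF assms(1)] Om.subgroup_self Om.pw_subgroup] by blast
 let ?K = "{x : carrier G. d x : ?D}"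
 have "openin (topol Om) ?D" by (rule Om.closed_finite_index_open[OF Om.pw_subgroup Om.pw_closed t])
 then have "openin (topol G) {x : topspace (topol G). d x : ?D}" by (rule openin_continuous_map_preimage[OF d_cont])
 then have K: "osub ?K" using subgroup_dpre[OF subgroup_self Om.pw_subgroup] by (simp add: open_subgroup_def topspace_eq)
 have dK: "d ` ?K = ?D"
 proof -
  have "?D <= d ` cG" using sg_sub[OF Om.pw_subgroup] d_surj by blast
  then show ?thesis by blast
 qed
 let ?j = "fdeg cG ?K"
 have j: "?D = Om.pw ?j" "pnum P ?j" using d_image(1)[OF K] dK dimage_transversal(3)[OF carrier_open K] by auto
 have "om ^. c : Om.pw ?j" using Om.pwI[OF Om.om_closed, of c] j(1) by simp
 then have "?j dvd c" by (rule Om.om_pow_in_pw[OF j(2)])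
 have "?j = 1"
 proof (rule ccontr)
  assume "?j ~= 1"
  then obtain p where p: "prime p" "p dvd ?j" using prime_factor_nat by blast
  then have "p : P" using j(2) by (auto simp: pnum_def prime_factors_dvd)
  then show False using assms(2) p(2) \<open>?j dvd c\<close> dvd_trans by blast
 qed
 then show ?thesis using j(1) by (simp add: Om.pw_1)
qed

lemma pw_P_part:
 assumes "n = m * c" "c > 0" "!!p. p : P ==> ~ p dvd c" shows "Om.pw n = Om.pw m"
proof (intro subset_antisym)
 show "Om.pw n <= Om.pw m" unfolding assms(1) by (rule Om.pw_mult_subset)
 show "Om.pw m <= Om.pw n"
 proof
  fix x assume "x : Om.pw m"
  then obtain y where y: "y : cO" "x = y ^. m" by (auto simp: Om.pw_def)
  then have "y : Om.pw c" using pw_coprime[OF assms(2,3)] by simp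
  then obtain z where "z : cO" "y = z ^. c" by (auto simp: Om.pw_def)
  then show "x : Om.pw n" unfolding assms(1) using y(2) Om.pwI[of z "m * c"] by (simp add: Om.nat_pow_pow mult.commute)
 qed
qed

end

section \<open>The subgroups of Frobenius lifts\<close>

context ramification
begin

abbreviation Sg :: "'g => 'g set => 'g set" where "Sg == Sigma_grp G Om d"

text \<open>\<open>n\<close> is mult(d_H(h)), kept as an argument because it is the number of
  factors in the partial norms to come; \<open>U\<close> is recorded since the group Sigma depends
  on it.\<close>

definition frob :: "'g set => 'g set => 'g => nat => bool" where
 "frob H U h n \<longleftrightarrow> onorm H U & h : H & n > 0 & dr H h = om ^. n"

lemma frobD:
 assumes "frob H U h n"
 shows "onorm H U" "osub H" "osub U" "U <= H" "h : H" "h : cG"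
  "n > 0" "dr H h = om ^. n" "U <= cG" using assms onD(1-3)[of H U] osD(3,4)[of H] osD(3)[of U] by (auto simp: frob_def)

lemma frob_pow: "frob H U h n ==> k > 0 ==> frob H U (h [^] k) (n * k)" using osub_pow[of H h k] d_rel_pow[of H h k]
 by (auto simp: frob_def Om.nat_pow_pow dest: onD(1))

lemma frob_d: "frob H U h n ==> d h = om ^. (n * fdeg cG H)"
 using d_rel(2)[of H h] frobD[of H U h n] by (simp add: Om.nat_pow_pow)

lemma pclosure_sub: "osub S ==> h : S ==> pclosure h <= S" by (intro pclosure_minimal osub_closed) (auto simp: osD)

lemma Sg_iff: "x : Sg h U \<longleftrightarrow> (EX y:pclosure h. EX j:inert U. x = y *. j)"
 by (auto simp: Sigma_grp_def pclosure_def set_mult_def)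

lemma Sg_minimal:
 assumes "osub S" "h : S" "inert U <= S" shows "Sg h U <= S"
proof
 fix x assume "x : Sg h U"
 then obtain y j where "y : pclosure h" "j : inert U" "x = y *. j" unfolding Sg_iff by blast
 then show "x : S" using pclosure_sub[OF assms(1,2)] assms(3) osD(6)[OF assms(1), of y j] by blast
qed

lemma inert_one: "osub U ==> \<one> : inert U" using sg_one[OF inert_subgroup] osD(1) by blast

lemma pclosure_subset_Sg: "osub U ==> h : cG ==> pclosure h <= Sg h U"
 using inert_one[of U] sg_mem[OF pclosure_subgroup, of h] by (force simp: Sg_iff)

lemma inert_subset_Sg: "osub U ==> h : cG ==> inert U <= Sg h U"
proof
 fix j assume U: "osub U" and h: "h : cG" and j: "j : inert U"
 have "j : cG" using j inert_subset osD(3)[OF U] by blast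
 then have "j = \<one> *. j" by simp
 then show "j : Sg h U" using j sg_one[OF pclosure_subgroup[OF h]] by (auto simp: Sg_iff)
qed

lemma Sg_self: "osub U ==> h : cG ==> h : Sg h U" using pclosure_subset_Sg pclosure_self by blast

lemma Sg_subset: "frob H U h n ==> Sg h U <= H" using frobD[of H U h n] inert_subset by (intro Sg_minimal) blast+

lemma Sg_subgroup:
 assumes "frob H U h n" shows "subgroup (Sg h U) G"
proof (rule subgroupI)
 note f = frobD[OF assms]
 have pc: "pclosure h <= H" by (rule pclosure_sub[OF f(2,5)])
 note P = pclosure_subgroup[OF f(6)]
 have J: "subgroup (inert U) G" by (rule inert_subgroup[OF osD(1)[OF f(3)]])
 have c: "!!y. y : pclosure h ==> y : cG" "!!j. j : inert U ==> j : cG" by (rule sg_mem[OF P], assumption, rule sg_mem[OF J])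
 show "Sg h U <= cG" using Sg_subset[OF assms] osD(3)[OF f(2)] by blast
 show "Sg h U ~= {}" using Sg_self[OF f(3,6)] by blast
 show "inv x : Sg h U" if x: "x : Sg h U" for x
 proof -
  obtain y j where yj: "y : pclosure h" "j : inert U" "x = y *. j" using x by (auto simp: Sg_iff)
  have "inv x = inv y *. (y *. inv j *. inv y)" using yj(3) c(1)[OF yj(1)] c(2)[OF yj(2)] by (simp add: gnorm)
  moreover have "y *. inv j *. inv y : inert U" using inert_normal(1)[OF f(1)] yj pc sg_inv[OF J] by blast
  ultimately show ?thesis using sg_inv[OF P yj(1)] by (auto simp: Sg_iff)
 qed
 show "x *. x' : Sg h U" if x: "x : Sg h U" "x' : Sg h U" for x x'
 proof -
  obtain y j where yj: "y : pclosure h" "j : inert U" "x = y *. j" using x(1) by (auto simp: Sg_iff)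
  obtain y' j' where yj': "y' : pclosure h" "j' : inert U" "x' = y' *. j'" using x(2) by (auto simp: Sg_iff)
  have "x *. x' = (y *. y') *. ((inv y' *. j *. y') *. j')"
   using yj(3) yj'(3) c(1)[OF yj(1)] c(2)[OF yj(2)] c(1)[OF yj'(1)] c(2)[OF yj'(2)] by (simp add: gnorm)
  moreover have "(inv y' *. j *. y') *. j' : inert U"
   using inert_normal(2)[OF f(1) _ yj(2), of y'] yj'(1,2) pc sg_mult[OF J] by blast
  ultimately show ?thesis using sg_mult[OF P yj(1) yj'(1)] by (auto simp: Sg_iff)
 qed
qed

text \<open>For the larger inclusion, the elements of Omega whose power with exponent
  \<open>?N\<close> lies in the compact image of \<open>pclosure h\<close> form a closed subgroup.
  It contains \<open>om\<close>, hence is everything.\<close>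

lemma pclosure_dimage:
 assumes "frob H U h n" shows "d ` pclosure h = Om.pw (n * fdeg cG H)"
proof (intro subset_antisym)
 note f = frobD[OF assms]
 let ?N = "n * fdeg cG H"
 note P = pclosure_subgroup[OF f(6)]
 have "closedin (topol G) {x : carrier G. d x : Om.pw ?N}"
  using closedin_continuous_map_preimage[OF d_cont Om.pw_closed] by (simp add: topspace_eq)
 then have "pclosure h <= {x : carrier G. d x : Om.pw ?N}"
  using subgroup_dpre[OF subgroup_self Om.pw_subgroup] f(6) frob_d[OF assms] Om.pwI[OF Om.om_closed]
  by (intro pclosure_minimal) auto
 then show "d ` pclosure h <= Om.pw ?N" by blast
 let ?Z = "{z : topspace (topol Om). z ^. ?N : d ` pclosure h}"
 have dP: "subgroup (d ` pclosure h) Om" by (rule subgroup_dimage[OF P])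
 have "compactin (topol G) (pclosure h)" by (rule closedin_compact_space[OF compact pclosure_closed])
 then have "closedin (topol Om) (d ` pclosure h)"
  using image_compactin[OF _ d_cont] compactin_imp_closedin[OF Om.Hausdorff] by blast
 then have "closedin (topol Om) ?Z" by (rule closedin_continuous_map_preimage[OF Om.continuous_pow])
 moreover have "subgroup ?Z Om"
 proof (rule Om.subgroupI)
  have "oW : ?Z" by (simp add: Om.topspace_eq sg_one[OF dP])
  then show "?Z ~= {}" by blast
 next
  fix a assume a: "a : ?Z"
  then show "/^ a : ?Z" using sg_inv[OF dP, of "a ^. ?N"] by (simp add: Om.topspace_eq Om.nat_pow_inv)
  fix b assume "b : ?Z"
  then show "a *^ b : ?Z" using a sg_mult[OF dP, of "a ^. ?N" "b ^. ?N"]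
   by (simp add: Om.topspace_eq Om.Om_comm_group.nat_pow_distrib)
 qed (auto simp: Om.topspace_eq)
 moreover have "om : ?Z" using frob_d[OF assms] pclosure_self[OF f(6)] by (force simp: Om.topspace_eq)
 ultimately have "?Z = cO" by (rule Om.closed_subgroup_full)
 then show "Om.pw ?N <= d ` pclosure h" by (auto simp: Om.pw_def)
qed

lemma Sg_d_inert: "osub U ==> h : cG ==> y : pclosure h ==> j : inert U ==> d (y *. j) = d y"
 using sg_mem[OF pclosure_subgroup, of h y] inert_iff[OF osD(3), of U j]
  osD(4)[of U j] by auto

lemma Sg_dimage:
 assumes "frob H U h n" shows "d ` Sg h U = Om.pw (n * fdeg cG H)"
proof -
 note f = frobD[OF assms]
 have "d ` Sg h U = d ` pclosure h"
 proof (intro subset_antisym subsetI)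
  fix z assume "z : d ` Sg h U"
  then show "z : d ` pclosure h" using Sg_d_inert[OF f(3,6)] by (auto simp: Sg_iff)
 qed (use pclosure_subset_Sg[OF f(3,6)] in blast)
 then show ?thesis using pclosure_dimage[OF assms] by simp
qed

lemma d_in_pw_iff:
 assumes "osub H" "x : H"
 shows "d x : Om.pw (n * fdeg cG H) \<longleftrightarrow> dr H x : Om.pw n"
proof
 assume "d x : Om.pw (n * fdeg cG H)"
 then obtain z where z: "z : cO" "d x = z ^. (n * fdeg cG H)" by (auto simp: Om.pw_def)
 have "dr H x = z ^. n" using d_rel_eqI[OF assms(1), of "z ^. n" x] z by (simp add: Om.nat_pow_pow)
 then show "dr H x : Om.pw n" using z by (simp add: Om.pwI)
next
 assume "dr H x : Om.pw n"
 then obtain z where z: "z : cO" "dr H x = z ^. n" by (auto simp: Om.pw_def)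
 have "d x = z ^. (n * fdeg cG H)" using d_rel(2)[OF assms] z by (simp add: Om.nat_pow_pow)
 then show "d x : Om.pw (n * fdeg cG H)" using z by (simp add: Om.pwI)
qed

lemma Sg_d_rel:
 assumes "frob H U h n" "x : H" "dr H x : Om.pw n"
 shows "EX y:pclosure h. dr H y = dr H x"
proof -
 note f = frobD[OF assms(1)]
 have "d x : d ` pclosure h" using d_in_pw_iff[OF f(2) assms(2)] assms(3) pclosure_dimage[OF assms(1)] by simp
 then obtain y where y: "y : pclosure h" "d x = d y" by blast
 then have "dr H y = dr H x" by (simp add: d_rel_def)
 then show ?thesis using y by blast
qed

lemma Sg_d_rel_in:
 assumes "frob H U h n" "x : Sg h U" shows "dr H x : Om.pw n"
proof -
 have "x : H" using Sg_subset[OF assms(1)] assms(2) by blast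
 then show ?thesis using Sg_dimage[OF assms(1)] assms(2) d_in_pw_iff[OF frobD(2)[OF assms(1)]] by blast
qed

lemma Sg_decompose:
 fixes k :: nat
 assumes "frob H U h n" "k > 0" "x : Sg h U"
 shows "EX i<k. EX y:Sg (h [^] k) U. x = h [^] i *. y"
proof -
 note f = frobD[OF assms(1)]
 obtain y j where yj: "y : pclosure h" "j : inert U" "x = y *. j" using assms(3) by (auto simp: Sg_iff)
 obtain i z where iz: "i < k" "z : pclosure (h [^] k)" "y = h [^] i *. z"
  using pclosure_decompose[OF f(6) assms(2) yj(1)] by blast
 have hk: "h [^] k : cG" using f(6) by simp
 have "z : cG" by (rule sg_mem[OF pclosure_subgroup[OF hk] iz(2)])
 moreover have "j : cG" using yj(2) inert_subset f(9) by blast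
 ultimately have "x = h [^] i *. (z *. j)" using yj(3) iz(3) f(6) by (simp add: m_assoc)
 moreover have "z *. j : Sg (h [^] k) U" using iz(2) yj(2) by (auto simp: Sg_iff)
 ultimately show ?thesis using iz(1) by blast
qed

lemma om_pow_dvd:
 assumes "pnum P k" "n > 0" "om ^. (n * i) : Om.pw (n * k)" shows "k dvd i"
proof -
 obtain z where z: "z : cO" "om ^. (n * i) = z ^. (n * k)" using assms(3) by (auto simp: Om.pw_def)
 then have "(om ^. i) ^. n = (z ^. k) ^. n" by (simp add: Om.nat_pow_pow mult.commute)
 then have "om ^. i = z ^. k" using Om.root_unique[OF _ _ assms(2)] z(1) by simp
 then show ?thesis using Om.om_pow_in_pw[OF assms(1)] Om.pwI[OF z(1)] by simp
qed

lemma Sg_pow_mem: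
 assumes "frob H U h n" "pnum P k" "h [^] i : Sg (h [^] k) U" shows "k dvd i"
proof -
 note f = frobD[OF assms(1)]
 have "dr H (h [^] i) : Om.pw (n * k)" using Sg_d_rel_in[OF frob_pow[OF assms(1) pnum_pos[OF assms(2)]] assms(3)] .
 then have "om ^. (n * i) : Om.pw (n * k)" using d_rel_pow[OF f(2,5), of i] f(8) by (simp add: Om.nat_pow_pow)
 then show ?thesis by (rule om_pow_dvd[OF assms(2) f(7)])
qed

lemma frob_pow_in_U:
 assumes "frob H U h n" shows "EX k. pnum P k & h [^] k : U" using pnum_power_mem[OF frobD(3)[OF assms] frobD(6)[OF assms]] .

text \<open>Choose a P-number \<open>k\<close> with \<open>h [^] k\<close> in \<open>U\<close>. Then
  \<open>x\<close> is \<open>h [^] i *. y\<close> with \<open>i < k\<close> and \<open>y\<close> in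
  \<open>U\<close>, and comparing degrees shows that \<open>k\<close> divides \<open>i\<close>. So
  \<open>i = 0\<close> and \<open>x = y\<close>. Consequently Sigma has the inertia of
  \<open>U\<close>, although it need not be contained in \<open>U\<close>.\<close>

lemma Sg_inert:
 assumes "frob H U h n" "x : Sg h U" "d x = oW" shows "x : inert U"
proof -
 note f = frobD[OF assms(1)]
 obtain k where k: "pnum P k" "h [^] k : U" using frob_pow_in_U[OF assms(1)] by blast
 have k0: "k > 0" by (rule pnum_pos[OF k(1)])
 note fk = frob_pow[OF assms(1) k0]
 obtain i y where iy: "i < k" "y : Sg (h [^] k) U" "x = h [^] i *. y" using Sg_decompose[OF assms(1) k0 assms(2)] by blast
 have yU: "y : U" using Sg_minimal[OF f(3) k(2) inert_subset] iy(2) by blast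
 have yH: "y : H" using yU f(4) by blast
 have xH: "x : H" using Sg_subset[OF assms(1)] assms(2) by blast
 have hi: "h [^] i : H" by (rule osub_pow[OF f(2,5)])
 have dx: "dr H x = oW" using d_rel_eq_1[OF f(2) xH] assms(3) by simp
 have dy: "dr H y : Om.pw (n * k)" by (rule Sg_d_rel_in[OF fk iy(2)])
 have e: "om ^. (n * i) *^ dr H y = oW"
  using dx iy(3) d_rel_mult[OF f(2) hi yH] d_rel_pow[OF f(2,5), of i] f(8) by (simp add: Om.nat_pow_pow)
 then have "om ^. (n * i) = /^ dr H y"
  using d_rel(1)[OF f(2) yH] by (metis Om.inv_equality Om.nat_pow_closed Om.om_closed Om.inv_inv)
 then have "om ^. (n * i) : Om.pw (n * k)" using dy sg_inv[OF Om.pw_subgroup] by simp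
 then have "k dvd i" by (rule om_pow_dvd[OF k(1) f(7)])
 then have "i = 0" using iy(1) by (cases i) (auto dest: dvd_imp_le)
 then have "x = y" using iy(3) osD(4)[OF f(3) yU] by simp
 then show ?thesis using yU assms(3) inert_iff[OF f(9)] by simp
qed

lemma inert_transversal:
 assumes "osub H" "osub U" "U <= H"
 shows "EX A t. ltr (inert H) (inert U) (A :: nat set) t"
proof -
 note H = osD[OF assms(1)]
 obtain s where s: "ltr H U {..<idx H U} s" using osub_transversal[OF assms(2) H(1) assms(3)] by blast
 have "inert H Int U = inert U" using assms(3) by (auto simp: inertia_def)
 then show ?thesis using ltr_Int[OF s H(1) osD(1)[OF assms(2)] inert_subgroup[OF H(1)] inert_subset] by auto
qed

text \<open>The degrees of Sigma are exactly the subgroup appearing here. An element of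
  \<open>H\<close> with such a degree can therefore be divided by an element of Sigma to reach
  inertia, and two representatives congruent modulo Sigma are congruent modulo the inertia of
  \<open>U\<close>.\<close>

lemma Sg_transversal_aux:
 assumes "frob H U h n" and t: "ltr (inert H) (inert U) A t"
 shows "ltr {x : H. d x : Om.pw (n * fdeg cG H)} (Sg h U) A t"
proof -
 note f = frobD[OF assms(1)]
 note H = osD[OF f(2)]
 note t = ltD[OF t]
 have iH: "x : inert H \<longleftrightarrow> x : H & d x = oW" for x by (rule inert_iff[OF H(3)])
 have Js: "inert U <= Sg h U" by (rule inert_subset_Sg[OF f(3,6)])
 have Ss: "subgroup (Sg h U) G" by (rule Sg_subgroup[OF assms(1)])
 show ?thesis
 proof (rule ltI[OF subgroup_dpre[OF H(1) Om.pw_subgroup] Ss t(1)])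
  show "t i : {x : H. d x : Om.pw (n * fdeg cG H)}" if "i : A" for i
   using t(2)[OF that] sg_one[OF Om.pw_subgroup] by (simp add: iH)
  show "EX i:A. inv t i *. x : Sg h U" if x: "x : {x : H. d x : Om.pw (n * fdeg cG H)}" for x
  proof -
   have xH: "x : H" using x by blast
   have "d x : d ` Sg h U" using x Sg_dimage[OF assms(1)] by simp
   then obtain y where y: "y : Sg h U" "d x = d y" by blast
   have yH: "y : H" using Sg_subset[OF assms(1)] y(1) by blast
   have c: "x : cG" "y : cG" using H(4) xH yH by auto
   have "x *. inv y : inert H" using xH yH H c y(2) by (simp add: iH)
   then obtain i where i: "i : A" "inv (t i) *. (x *. inv y) : inert U" using t(3) by blast
   have tc: "t i : cG" using t(2)[OF i(1)] inert_subset H(4) by blast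
   have "inv (t i) *. (x *. inv y) *. y : Sg h U" using i(2) Js y(1) sg_mult[OF Ss] by blast
   then have "inv (t i) *. x : Sg h U" using tc c by (simp add: gnorm)
   then show ?thesis using i(1) by blast
  qed
  show "i = j" if ij: "i : A" "j : A" "inv t i *. t j : Sg h U" for i j
  proof -
   have tj: "t j : inert H" by (rule t(2)[OF ij(2)])
   have c: "t i : cG" "t j : cG" using t(2) ij inert_subset H(4) by blast+
   have "d (inv t i *. t j) = oW" using t(2) ij c iH by simp
   then have "inv t i *. t j : inert U" by (rule Sg_inert[OF assms(1) ij(3)])
   moreover have "inv t j *. t j : inert U" using c inert_one[OF f(3)] by simp
   ultimately show ?thesis using t(3)[OF tj] ij by blast
  qed
 qed
qed

text \<open>Sigma is closed as a product of compact sets, and it has finite index: finite inertia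
  index inside \<open>?L\<close>, which is open as the preimage of an open subgroup of
  Omega.\<close>

lemma Sg_open:
 assumes "frob H U h n" shows "osub (Sg h U)"
proof -
 note f = frobD[OF assms]
 note H = osD[OF f(2)]
 let ?N = "n * fdeg cG H"
 let ?L = "{x : H. d x : Om.pw ?N}"
 have N: "?N > 0" using f(7) d_image(2)[OF f(2)] by simp
 obtain A :: "nat set" and t where t: "ltr (inert H) (inert U) A t" using inert_transversal[OF f(2,3,4)] by blast
 obtain s where s: "left_transversal Om cO (Om.pw ?N) {..<subgroup_index Om cO (Om.pw ?N)} s"
  using Om.ltr_exists[OF Om.pw_finite[OF N] Om.subgroup_self Om.pw_subgroup] by blast
 have "openin (topol Om) (Om.pw ?N)" by (rule Om.closed_finite_index_open[OF Om.pw_subgroup Om.pw_closed s])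
 then have "openin (topol G) {x : topspace (topol G). d x : Om.pw ?N}" by (rule openin_continuous_map_preimage[OF d_cont])
 then have "openin (topol G) (H Int {x : topspace (topol G). d x : Om.pw ?N})" by (rule openin_Int[OF H(2)])
 moreover have "H Int {x : topspace (topol G). d x : Om.pw ?N} = ?L" using H(3) by (auto simp: topspace_eq)
 ultimately have L: "osub ?L" using subgroup_dpre[OF H(1) Om.pw_subgroup] by (simp add: open_subgroup_def)
 obtain r where r: "ltr cG ?L {..<idx cG ?L} r" using osub_transversal[OF L subgroup_self] osD(3)[OF L] by blast
 have sub: "Sg h U <= ?L" using Sg_subset[OF assms] Sg_dimage[OF assms] by blast
 have Ss: "subgroup (Sg h U) G" by (rule Sg_subgroup[OF assms])
 have "closedin (topol G) (Sg h U)" using closedin_set_mult[OF pclosure_closed inert_closed[OF f(3)]]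
  by (simp add: Sigma_grp_def pclosure_def)
 then have "openin (topol G) (Sg h U)"
  by (rule closed_finite_index_open[OF Ss _ ltr_tower[OF r Sg_transversal_aux[OF assms t]
   subgroup_self osD(1)[OF L] Ss osD(3)[OF L] sub]])
 then show ?thesis using Ss by (simp add: open_subgroup_def)
qed

lemma inert_Sg:
 assumes "frob H U h n" shows "inert (Sg h U) = inert U"
proof (intro subset_antisym subsetI)
 note f = frobD[OF assms]
 have c: "Sg h U <= cG" by (rule osD(3)[OF Sg_open[OF assms]])
 show "x : inert U" if "x : inert (Sg h U)" for x using Sg_inert[OF assms] that inert_iff[OF c] by blast
 show "x : inert (Sg h U)" if "x : inert U" for x
  using inert_subset_Sg[OF f(3,6)] that inert_iff[OF c] inert_iff[OF f(9)] by blast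
qed

lemma Sg_pow_subset:
 assumes "frob H U h n" "k > 0" shows "Sg (h [^] (k::nat)) U <= Sg h U"
 using frobD[OF assms(1)] Sg_self osub_pow[OF Sg_open[OF assms(1)]]
 by (intro Sg_minimal Sg_open[OF assms(1)] inert_subset_Sg) auto

text \<open>\<open>h [^] i\<close> centralizes the closure of the powers of \<open>h [^] k\<close>
  and normalizes the inertia of \<open>U\<close>; together with \<open>Sg (h [^] k) U\<close> itself
  these powers exhaust \<open>Sg h U\<close>.\<close>

lemma Sg_pow_normal:
 fixes k :: nat
 assumes "frob H U h n" "k > 0" shows "onorm (Sg h U) (Sg (h [^] k) U)"
proof (rule onI[OF Sg_open[OF assms(1)] Sg_open[OF frob_pow[OF assms]] Sg_pow_subset[OF assms]])
 note f = frobD[OF assms(1)] and fk = frob_pow[OF assms]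
 note S = osD[OF Sg_open[OF fk]]
 have hk: "h [^] k : cG" using f(6) by simp
 have conj: "h [^] i *. z *. inv (h [^] i) : Sg (h [^] k) U" if z: "z : Sg (h [^] k) U" for z and i :: nat
 proof -
  obtain y j where yj: "y : pclosure (h [^] k)" "j : inert U" "z = y *. j" using z by (auto simp: Sg_iff)
  have hi: "h [^] i : H" "h [^] i : cG" using osub_pow[OF f(2,5)] f(6) by auto
  have y: "y : cG" by (rule sg_mem[OF pclosure_subgroup[OF hk] yj(1)])
  have j: "j : cG" using yj(2) inert_subset f(9) by blast
  have "h [^] i *. y = y *. h [^] i" using pclosure_commute[OF hk hi(2) _ yj(1)] f(6) by (simp add: nat_pow_mult add.commute)
  then have "h [^] i *. z *. inv (h [^] i) = y *. (h [^] i *. j *. inv (h [^] i))"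
   using yj(3) y j hi(2) by (metis inv_closed m_assoc m_closed)
  then show ?thesis using yj(1) inert_normal(1)[OF f(1) hi(1) yj(2)] by (auto simp: Sg_iff)
 qed
 fix x u assume x: "x : Sg h U" and u: "u : Sg (h [^] k) U"
 obtain i :: nat and y where iy: "y : Sg (h [^] k) U" "x = h [^] i *. y" using Sg_decompose[OF assms x] by blast
 have "h [^] i *. (y *. u *. inv y) *. inv (h [^] i) : Sg (h [^] k) U" using iy(1) u S by (intro conj) auto
 then show "x *. u *. inv x : Sg (h [^] k) U" using iy(2) S(4)[OF iy(1)] S(4)[OF u] f(6) by (simp add: gnorm)
qed

text \<open>The cyclic layers, generated by \<open>h\<close>. The degree is \<open>k\<close> because
  \<open>k\<close> is a P-number; for an exponent prime to P the two groups coincide.\<close>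

lemma Sg_pow_transversal:
 assumes "frob H U h n" "pnum P k"
 shows "ltr (Sg h U) (Sg (h [^] k) U) {..<k} (%i. h [^] i)"
proof -
 note f = frobD[OF assms(1)] and k = pnum_pos[OF assms(2)]
 note fk = frob_pow[OF assms(1) k]
 note S = osD[OF Sg_open[OF assms(1)]] and S' = osD[OF Sg_open[OF fk]]
 have hS: "h [^] i : Sg h U" for i :: nat by (rule osub_pow[OF Sg_open[OF assms(1)] Sg_self[OF f(3,6)]])
 show ?thesis
 proof (rule ltI[OF S(1) S'(1)])
  show "EX i:{..<k}. inv (h [^] i) *. x : Sg (h [^] k) U" if x: "x : Sg h U" for x
  proof -
   obtain i y where iy: "i < k" "y : Sg (h [^] k) U" "x = h [^] i *. y" using Sg_decompose[OF assms(1) k x] by blast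
   then have "inv (h [^] i) *. x = y" using f(6) S'(4)[OF iy(2)] by (simp add: gnorm)
   then show ?thesis using iy(1,2) by (intro bexI[of _ i]) auto
  qed
  have main: "i = j" if "i < k" "j < k" "i <= j" "inv (h [^] i) *. h [^] j : Sg (h [^] k) U" for i j
  proof -
   have "h [^] j = h [^] i *. h [^] (j - i)" using f(6) that(3) by (simp add: nat_pow_mult)
   then have "inv (h [^] i) *. h [^] j = h [^] (j - i)" using f(6) by (simp add: gnorm)
   then have "k dvd j - i" using Sg_pow_mem[OF assms] that(4) by simp
   moreover have "j - i < k" using that by simp
   ultimately have "j - i = 0" using dvd_imp_le by fastforce
   then show ?thesis using that(3) by simp
  qed
  show "i = j" if ij: "i : {..<k}" "j : {..<k}" "inv (h [^] i) *. h [^] j : Sg (h [^] k) U" for i j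
  proof (cases "i <= j")
   case True
   then show ?thesis using main ij by simp
  next
   case False
   have "inv (inv (h [^] i) *. h [^] j) : Sg (h [^] k) U" using S'(7) ij(3) by blast
   then have "inv (h [^] j) *. h [^] i : Sg (h [^] k) U" using f(6) by (simp add: gnorm)
   then show ?thesis using main[of j i] False ij by simp
  qed
 qed (use hS in auto)
qed

text \<open>Representatives of the inertia groups account for ramification and powers of
  \<open>ph\<close> for the residue degree. Only the P-part \<open>m\<close> of \<open>n\<close>
  counts, because the degrees in Sigma, relative to \<open>H\<close>, form
  \<open>Om.pw n = Om.pw m\<close>.\<close>

lemma Sg_transversal:
 assumes "frob H U h n" and t: "ltr (inert H) (inert U) A t"
  and ph: "ph : H" "dr H ph = om"
  and n: "n = m * c" "pnum P m" "c > 0" "!!p. p : P ==> ~ p dvd c"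
 shows "ltr H (Sg h U) (A \<times> {..<m}) (%x. t (fst x) *. ph [^] (snd x))"
proof -
 note f = frobD[OF assms(1)]
 note H = osD[OF f(2)]
 note t = ltD[OF t]
 note S = osD[OF Sg_open[OF assms(1)]]
 have phc: "ph : cG" using H(4) ph(1) by blast
 have phi: "ph [^] j : H" "dr H (ph [^] j) = om ^. j" for j :: nat
  using osub_pow[OF f(2) ph(1)] d_rel_pow[OF f(2) ph(1)] ph(2) by auto
 have iH: "x : inert H \<longleftrightarrow> x : H & dr H x = oW" for x using inert_iff[OF H(3)] d_rel_eq_1[OF f(2)] by blast
 have pwn: "Om.pw n = Om.pw m" by (rule pw_P_part[OF n(1,3,4)])
 have Js: "inert U <= Sg h U" by (rule inert_subset_Sg[OF f(3,6)])
 have tH: "t i : H" "t i : cG" "dr H (t i) = oW" if "i : A" for i using t(2)[OF that] iH H(4) by auto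
 have m0: "m > 0" by (rule pnum_pos[OF n(2)])
 show ?thesis
 proof (rule ltI[OF H(1) S(1)])
  show "finite (A \<times> {..<m})" using t(1) by simp
  show "t (fst x) *. ph [^] snd x : H" if "x : A \<times> {..<m}" for x using that tH phi H(6) by auto
  show "EX i:A \<times> {..<m}. inv (t (fst i) *. ph [^] snd i) *. x : Sg h U" if x: "x : H" for x
  proof -
   have dx: "dr H x : cO" by (rule d_rel(1)[OF f(2) x])
   obtain j where j: "j < m" "/^ (om ^. j) *^ dr H x : Om.pw m" using Om.pw_reps[OF dx m0] by blast
   have j1: "inv (ph [^] j) *. x : H" by (intro H(6,7) phi x)
   have "dr H (inv (ph [^] j) *. x) : Om.pw n"
   unfolding pwn using j(2) d_rel_mult[OF f(2) H(7)[OF phi(1)] x] d_rel_inv[OF f(2) phi(1)] phi(2) by simp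
   then obtain y where y: "y : pclosure h" "dr H y = dr H (inv (ph [^] j) *. x)" using Sg_d_rel[OF assms(1) j1] by blast
   have yS: "y : Sg h U" using pclosure_subset_Sg[OF f(3,6)] y(1) by blast
   have yH: "y : H" using Sg_subset[OF assms(1)] yS by blast
   have c: "x : cG" "y : cG" "ph [^] j : cG" using x yH H(4) phc by auto
   \<comment> \<open>Dividing \<open>x\<close> by \<open>ph [^] j\<close> and by an element
     \<open>y\<close> of Sigma with the remaining degree leaves an element of inertia.\<close>
   let ?z = "x *. inv y *. inv (ph [^] j)"
   have zH: "?z : H" by (intro H(6,7) phi x yH)
   have "dr H ?z = dr H x *^ /^ dr H y *^ /^ (om ^. j)"
   using d_rel_mult[OF f(2) H(6)[OF x H(7)[OF yH]] H(7)[OF phi(1)]] d_rel_mult[OF f(2) x H(7)[OF yH]]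
   d_rel_inv[OF f(2) yH] d_rel_inv[OF f(2) phi(1)] phi(2) by simp
   also have "dr H y = /^ (om ^. j) *^ dr H x"
   using y(2) d_rel_mult[OF f(2) H(7)[OF phi(1)] x] d_rel_inv[OF f(2) phi(1)] phi(2) by simp
   also have "dr H x *^ /^ (/^ (om ^. j) *^ dr H x) *^ /^ (om ^. j) = oW" using dx by (simp add: Om.gnorm)
   finally have "?z : inert H" using zH iH by simp
   then obtain i where i: "i : A" "inv (t i) *. ?z : inert U" using t(3) by blast
   have "inv (ph [^] j) *. (inv (t i) *. ?z) *. ph [^] j : Sg h U" using inert_normal(2)[OF f(1) phi(1) i(2)] Js by blast
   then have "inv (ph [^] j) *. (inv (t i) *. ?z) *. ph [^] j *. y : Sg h U" using S(6) yS by blast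
   then have "inv (t i *. ph [^] j) *. x : Sg h U" using c tH(2)[OF i(1)] by (simp add: gnorm)
   then show ?thesis using i(1) j(1) by (intro bexI[of _ "(i, j)"]) auto
  qed
  show "x = y" if xy: "x : A \<times> {..<m}" "y : A \<times> {..<m}"
   "inv (t (fst x) *. ph [^] snd x) *. (t (fst y) *. ph [^] snd y) : Sg h U" for x y
  proof -
   obtain i j i' j' where e: "x = (i, j)" "y = (i', j')" by (cases x, cases y)
   have mm: "i : A" "i' : A" "j < m" "j' < m" using xy e by auto
   let ?g = "inv (t i *. ph [^] j) *. (t i' *. ph [^] j')"
   have gS: "?g : Sg h U" using xy(3) e by simp
   have 1: "t i *. ph [^] j : H" "t i' *. ph [^] j' : H" using mm tH phi H(6) by blast+
   have "dr H ?g = /^ (om ^. j) *^ om ^. j'"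
   using d_rel_mult[OF f(2) H(7)[OF 1(1)] 1(2)] d_rel_inv[OF f(2) 1(1)] tH[OF mm(1)] tH[OF mm(2)] phi
   d_rel_mult[OF f(2) tH(1)[OF mm(1)] phi(1)] d_rel_mult[OF f(2) tH(1)[OF mm(2)] phi(1)] by simp
   then have d: "/^ (om ^. j) *^ om ^. j' : Om.pw m" using Sg_d_rel_in[OF assms(1) gS] pwn by simp
   have key: "a = b" if ab: "a <= b" "b < m" "/^ (om ^. a) *^ om ^. b : Om.pw m" for a b :: nat
   proof -
   have "om ^. b = om ^. a *^ om ^. (b - a)" using ab(1) by (simp add: Om.nat_pow_mult)
   then have "/^ (om ^. a) *^ om ^. b = om ^. (b - a)" by (simp add: Om.gnorm)
   then have "m dvd b - a" using Om.om_pow_in_pw[OF n(2)] ab(3) by simp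
   moreover have "b - a < m" using ab by simp
   ultimately have "b - a = 0" using dvd_imp_le by fastforce
   then show ?thesis using ab(1) by simp
   qed
   have jj: "j = j'"
   proof (cases "j <= j'")
   case True
   then show ?thesis using key d mm by blast
   next
   case False
   have "/^ (/^ (om ^. j) *^ om ^. j') : Om.pw m" using d sg_inv[OF Om.pw_subgroup] by blast
   then have "/^ (om ^. j') *^ om ^. j : Om.pw m" by (simp add: Om.gnorm)
   then show ?thesis using key[of j' j] False mm by simp
   qed
   have c: "ph [^] j : cG" "t i : cG" "t i' : cG" using phc tH mm by auto
   have "dr H ?g = oW" using \<open>dr H ?g = /^ (om ^. j) *^ om ^. j'\<close> jj by simp
   then have "d ?g = oW" using d_rel_eq_1[OF f(2) H(6)[OF H(7)[OF 1(1)] 1(2)]] by blast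
   then have "?g : inert U" by (rule Sg_inert[OF assms(1) gS])
   then have "ph [^] j *. ?g *. inv (ph [^] j) : inert U" by (rule inert_normal(1)[OF f(1) phi(1)])
   then have "inv (t i) *. t i' : inert U" using jj c by (simp add: gnorm)
   moreover have "inv (t i') *. t i' : inert U" using c inert_one[OF f(3)] by simp
   ultimately have "i = i'" using t(3)[OF t(2)[OF mm(2)]] mm by blast
   then show ?thesis using e jj by simp
  qed
 qed
qed

section \<open>Conjugation and change of base group for Sigma\<close>

lemma ce_closed: "g : cG ==> x : cG ==> ce g x : cG" by (simp add: conj_elt_def)

lemma ce_mult:
 "g : cG ==> x : cG ==> y : cG ==> ce g (x *. y) = ce g x *. ce g y" by (simp add: conj_elt_def gnorm)

lemma cs_conj_set:
 assumes "g : cG" "h : cG" "H <= cG"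
 shows "cs g (cs h H) = cs (g *. h) H" unfolding conj_set_def image_image
 by (rule image_cong) (use assms in \<open>auto simp: conj_elt_def gnorm subset_iff\<close>)

lemma cs_one: "H <= cG ==> cs \<one> H = H" by (force simp: conj_set_def conj_elt_def image_iff)

lemma pclosure_conj_subset:
 assumes "g : cG" "h : cG"
 shows "cs g (pclosure h) <= pclosure (ce g h)"
proof -
 let ?K = "pclosure (ce g h)"
 have gi: "inv g : cG" using assms by simp
 have K: "subgroup ?K G" by (rule pclosure_subgroup[OF ce_closed[OF assms]])
 have e: "cs (inv g) ?K = {x : topspace (topol G). g *. (x *. inv g) : ?K}"
  using cs_preimage[OF gi sg_sub[OF K]] assms by simp
 have "closedin (topol G) (cs (inv g) ?K)"
  unfolding e using closedin_continuous_map_preimage[OF continuous_conj[OF gi] pclosure_closed] assms by simp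
 moreover have "h : cs (inv g) ?K" unfolding e using assms pclosure_self[OF ce_closed[OF assms]]
  by (simp add: topspace_eq conj_elt_def m_assoc)
 ultimately have "pclosure h <= cs (inv g) ?K" by (intro pclosure_minimal subgroup_conj_set[OF K gi])
 then have "cs g (pclosure h) <= cs g (cs (inv g) ?K)" unfolding conj_set_def by (rule image_mono)
 also have "... = ?K" using cs_conj_set[OF assms(1) gi sg_sub[OF K]] cs_one
   sg_sub[OF K] assms by simp
 finally show ?thesis .
qed

lemma pclosure_conj:
 assumes "g : cG" "h : cG"
 shows "cs g (pclosure h) = pclosure (ce g h)"
proof (rule subset_antisym[OF pclosure_conj_subset[OF assms]])
 have gi: "inv g : cG" using assms by simp
 let ?K = "pclosure (ce g h)"
 have Kc: "?K <= cG" by (rule sg_sub[OF pclosure_subgroup[OF ce_closed[OF assms]]])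
 have "cs (inv g) ?K <= pclosure (ce (inv g) (ce g h))" by (rule pclosure_conj_subset[OF gi ce_closed[OF assms]])
 also have "ce (inv g) (ce g h) = h" using assms by (simp add: conj_elt_def gnorm)
 finally have "cs g (cs (inv g) ?K) <= cs g (pclosure h)" unfolding conj_set_def by (rule image_mono)
 then show "?K <= cs g (pclosure h)" using cs_conj_set[OF assms(1) gi Kc] cs_one[OF Kc] assms by simp
qed

lemma inert_conj:
 assumes "g : cG" "U <= cG"
 shows "inert (cs g U) = cs g (inert U)"
proof -
 have c: "cs g U <= cG" using assms ce_closed by (auto simp: conj_set_def)
 show ?thesis
 proof (intro subset_antisym subsetI)
  fix x assume "x : inert (cs g U)"
  then obtain u where u: "u : U" "x = ce g u" "d x = oW" unfolding inert_iff[OF c] by (auto simp: conj_set_def)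
  then have "u : inert U" using inert_iff[OF assms(2)] d_conj[OF assms(1)] assms(2) by auto
  then show "x : cs g (inert U)" using u by (auto simp: conj_set_def)
 next
  fix x assume "x : cs g (inert U)"
  then obtain u where u: "u : inert U" "x = ce g u" by (auto simp: conj_set_def)
  then show "x : inert (cs g U)" unfolding inert_iff[OF c] using inert_iff[OF assms(2)] d_conj[OF assms(1)] assms(2)
   by (auto simp: conj_set_def)
 qed
qed

lemma Sg_conj:
 assumes "g : cG" "h : cG" "osub U"
 shows "cs g (Sg h U) = Sg (ce g h) (cs g U)"
proof -
 have c: "!!y. y : pclosure h ==> y : cG" "!!j. j : inert U ==> j : cG"
  using sg_mem[OF pclosure_subgroup[OF assms(2)]] inert_subset osD(3)[OF assms(3)] by blast+
 have "cs g (Sg h U) = {ce g (y *. j) | y j. y : pclosure h & j : inert U}" unfolding conj_set_def by (force simp: Sg_iff)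
 also have "... = {ce g y *. ce g j | y j. y : pclosure h & j : inert U}" using ce_mult[OF assms(1) c] by force
 also have "... = Sg (ce g h) (cs g U)" unfolding set_eq_iff Sg_iff pclosure_conj[OF assms(1,2), symmetric]
   inert_conj[OF assms(1) osD(3)[OF assms(3)]] by (auto simp: conj_set_def)
 finally show ?thesis .
qed

lemma cs_iff:
 assumes "g : cG" "H <= cG"
 shows "x : cs g H \<longleftrightarrow> x : cG & inv g *. x *. g : H"
 unfolding cs_preimage[OF assms] using assms by (auto simp: topspace_eq m_assoc)

lemma onorm_conj:
 assumes "onorm H U" "g : cG"
 shows "onorm (cs g H) (cs g U)"
proof (rule onI)
 note U = onD[OF assms(1)]
 show "osub (cs g H)" "osub (cs g U)" using osub_conj U assms(2) by auto
 show "cs g U <= cs g H" unfolding conj_set_def by (rule image_mono[OF U(3)])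
 fix x y assume "x : cs g H" "y : cs g U"
 then obtain h u where hu: "h : H" "x = ce g h" "u : U" "y = ce g u" by (auto simp: conj_set_def)
 have c: "h : cG" "u : cG" using hu osD(4)[OF U(1)] osD(4)[OF U(2)] by auto
 have "x *. y *. inv x = ce g (h *. u *. inv h)" unfolding hu conj_elt_def using c assms(2) by (simp add: gnorm)
 then show "x *. y *. inv x : cs g U" using U(4)[OF hu(1,3)] by (auto simp: conj_set_def)
qed

lemma frob_conj:
 assumes "frob H U h n" "g : cG"
 shows "frob (cs g H) (cs g U) (ce g h) n"
 using assms onorm_conj[OF frobD(1)[OF assms(1)] assms(2)] d_rel_conj[OF frobD(2,5)[OF assms(1)] assms(2)]
 by (auto simp: frob_def conj_set_def)

lemma frob_sub:
 assumes "frob I V h n" "onorm H U" "I <= H"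
 shows "frob H U h (n * fdeg H I)"
proof -
 note f = frobD[OF assms(1)]
 have "dr H h = dr I h ^. fdeg H I" by (rule d_rel_sub[OF onD(1)[OF assms(2)] f(2) assms(3) f(5)])
 moreover have "fdeg H I > 0" by (rule fdeg_pos[OF onD(1)[OF assms(2)] f(2) assms(3)])
 ultimately show ?thesis using assms f by (auto simp: frob_def Om.nat_pow_pow)
qed

end

section \<open>Norms and valuations of a discrete module\<close>

context comm_group
begin

text \<open>A constant of its own, so that \<open>gdiv_simps\<close> can move all divisions outwards
  and decide identities by cross-multiplication. Congruence modulo a subgroup is written as
  membership of such a quotient.\<close>

definition gdiv :: "'a => 'a => 'a" where "gdiv x y = x *. inv y"

lemma gdiv_closed [simp]: "x : carrier G ==> y : carrier G ==> gdiv x y : carrier G" by (simp add: gdiv_def)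

lemma gdiv_eq_iff: "x : carrier G ==> y : carrier G ==> z : carrier G ==> gdiv x y = z \<longleftrightarrow> x = z *. y"
 by (metis gdiv_def inv_closed inv_solve_right')

lemma gdiv_eq_iff':
 "x : carrier G ==> y : carrier G ==> z : carrier G ==> z = gdiv x y \<longleftrightarrow> z *. y = x" using gdiv_eq_iff by metis

lemma gdiv_mult_right: "x : carrier G ==> y : carrier G ==> z : carrier G ==> x *. gdiv y z = gdiv (x *. y) z"
 by (simp add: gdiv_def m_assoc)

lemma gdiv_mult_left: "x : carrier G ==> y : carrier G ==> z : carrier G ==> gdiv x y *. z = gdiv (x *. z) y"
 by (simp add: gdiv_def m_ac)

lemma inv_gdiv: "x : carrier G ==> y : carrier G ==> inv (gdiv x y) = gdiv y x" by (simp add: gdiv_def inv_mult m_comm)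

lemma gdiv_gdiv_left: "x : carrier G ==> y : carrier G ==> z : carrier G ==> gdiv (gdiv x y) z = gdiv x (y *. z)"
 by (simp add: gdiv_def inv_mult m_assoc)

lemma gdiv_gdiv_right: "x : carrier G ==> y : carrier G ==> z : carrier G ==> gdiv x (gdiv y z) = gdiv (x *. z) y"
 by (simp add: gdiv_def inv_mult m_ac)

lemma gdiv_eq_gdiv:
 "x : carrier G ==> y : carrier G ==> z : carrier G ==> w : carrier G ==>
  gdiv x y = gdiv z w \<longleftrightarrow> x *. w = z *. y" by (simp add: gdiv_eq_iff gdiv_mult_left gdiv_eq_iff')

lemma gdiv_self [simp]: "x : carrier G ==> gdiv x x = \<one>" by (simp add: gdiv_def)

lemmas gdiv_simps = gdiv_mult_right gdiv_mult_left inv_gdiv gdiv_gdiv_left gdiv_gdiv_right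
 gdiv_eq_gdiv gdiv_eq_iff gdiv_eq_iff'

lemma gdiv_in_subgroup: "subgroup S G ==> x : S ==> y : S ==> gdiv x y : S" by (simp add: gdiv_def sg_mult sg_inv)

end

locale cft_module = ramification P G Om om d
 for P and G :: "'g top_group" (structure) and Om :: "'w top_group" and om and d +
 fixes C :: "'c monoid" and act :: "'g => 'c => 'c" and v :: "'g set => 'c => 'w"
 assumes module: "discrete_module G C act"
  and valuation: "v : valuations G Om d om (fixed_point_functor G C act) (generate Om {om})"
begin

sublocale C: comm_group C using module by (simp add: discrete_module_def)

sublocale act: group_action G "carrier C" act using module by (simp add: discrete_module_def)

abbreviation cC where "cC == carrier C"
abbreviation oC where "oC == \<one>\<^bsub>C\<^esub>"
abbreviation cpow (infixr "^:" 75) where "x ^: n == x [^]\<^bsub>C\<^esub> n"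
abbreviation cinv ("'/: _" [81] 80) where "/: x == inv\<^bsub>C\<^esub> x"

abbreviation cmul (infixl "*:" 70) where "a *: b == a *.\<^bsub>C\<^esub> b"
abbreviation cdiv (infixl "-." 70) where "a -. b == C.gdiv a b"
abbreviation M where "M == fixed_point_functor G C act"
abbreviation fx where "fx == fixed_points C act"
abbreviation nrm where "nrm == ind M"

lemma act_closed [simp]: "g : cG ==> a : cC ==> act g a : cC" by (rule act.element_image) auto

lemma act_mult: "g : cG ==> h : cG ==> a : cC ==> act (g *. h) a = act g (act h a)"
 using act.composition_rule[of a g h] by simp

lemma act_one [simp]: "a : cC ==> act \<one> a = a" using act.id_eq_one by (metis restrict_apply)

lemma act_hom: "g : cG ==> act g : hom C C" using module by (simp add: discrete_module_def)

lemma act_cmul: "g : cG ==> a : cC ==> b : cC ==> act g (a *: b) = act g a *: act g b" using act_hom by (simp add: hom_def)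

lemma act_group_hom: "g : cG ==> group_hom C C (act g)" by (simp add: group_hom_def group_hom_axioms_def act_hom C.is_group)

lemma act_C_one: "g : cG ==> act g oC = oC" using group_hom.hom_one[OF act_group_hom] .

lemma act_cinv: "g : cG ==> a : cC ==> act g (/: a) = /: (act g a)" using group_hom.hom_inv[OF act_group_hom] .

lemma act_finprod:
 "g : cG ==> f : A \<rightarrow> cC ==> act g (finprod C f A) = finprod C (%i. act g (f i)) A"
 by (rule finprod_hom) (auto intro: act_hom act_C_one C.comm_monoid_axioms)

lemma act_inv_cancel: "g : cG ==> a : cC ==> act (inv g) (act g a) = a" by (simp add: act_mult[symmetric])

lemma act_pow_add:
 "g : cG ==> a : cC ==> act (g [^] (i + j :: nat)) a = act (g [^] i) (act (g [^] j) a)"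
 by (simp add: act_mult[symmetric] nat_pow_mult)

lemma act_pow_fixed:
 assumes "g : cG" "a : cC" "act g a = a" shows "act (g [^] (k::nat)) a = a"
 by (induction k) (use assms in \<open>simp_all add: act_mult\<close>)

lemma act_gdiv: "g : cG ==> a : cC ==> b : cC ==> act g (a -. b) = act g a -. act g b"
 by (simp add: C.gdiv_def act_cmul act_cinv)

definition stab :: "'c => 'g set" where "stab a = {g : carrier G. act g a = a}"

text \<open>Continuity of the action for the discrete topology on the module makes the orbit map of
  \<open>a\<close> continuous into a discrete space.\<close>

lemma stab_open:
 assumes a: "a : cC" shows "osub (stab a)"
proof -
 have "continuous_map (topol G) (discrete_topology cC) (%g. act g a)"
 proof -
  have 1: "continuous_map (topol G) (prod_topology (topol G) (discrete_topology cC)) (%g. (g, a))"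
   using a by (intro continuous_map_pairedI) simp_all
  have 2: "continuous_map (prod_topology (topol G) (discrete_topology cC))
   (discrete_topology cC) (%(g, a). act g a)" using module by (simp add: discrete_module_def)
  show ?thesis using continuous_map_compose[OF 1 2] by (simp add: o_def)
 qed
 then have "openin (topol G) {g : topspace (topol G). act g a : {a}}"
  by (rule openin_continuous_map_preimage) (use a in simp)
 moreover have "subgroup (stab a) G"
 proof (rule subgroupI)
  show "stab a ~= {}" using a by (auto simp: stab_def intro!: exI[of _ \<one>])
  show "inv g : stab a" if "g : stab a" for g using that act_inv_cancel[of g a] a by (auto simp: stab_def)
 qed (auto simp: stab_def act_mult a)
 ultimately show ?thesis by (simp add: open_subgroup_def stab_def topspace_eq)
qed

lemma fx_iff: "a : fx H \<longleftrightarrow> a : cC & (ALL h:H. act h a = a)" by (auto simp: fixed_points_def)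

lemma fxc: "a : fx H ==> a : cC" by (simp add: fx_iff)

lemma fx_mono: "K <= H ==> a : fx H ==> a : fx K" by (auto simp: fx_iff)

lemma fx_subgroup: "H <= cG ==> subgroup (fx H) C"
proof (rule C.subgroupI)
 assume H: "H <= cG"
 have "oC : fx H" using act_C_one H by (auto simp: fx_iff)
 then show "fx H ~= {}" by blast
qed (auto simp: fx_iff act_cinv act_cmul subset_iff)

lemma fx_closed:
 assumes "H <= cG"
 shows "oC : fx H" "!!a b. a : fx H ==> b : fx H ==> a *: b : fx H" "!!a. a : fx H ==> /: a : fx H"
 using fx_subgroup[OF assms] by (auto simp: sg_one sg_mult sg_inv)

lemma fx_pow: "H <= cG ==> a : fx H ==> a ^: (k::nat) : fx H" by (induction k) (auto simp: fx_closed)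

lemma fx_gdiv: "H <= cG ==> a : fx H ==> b : fx H ==> a -. b : fx H" by (rule C.gdiv_in_subgroup[OF fx_subgroup])

lemma fx_act:
 assumes "a : fx H" "g : cG" "H <= cG" shows "act g a : fx (cs g H)"
proof -
 have "act x (act g a) = act g a" if "x : cs g H" for x
 proof -
  have x: "x : cG" "inv g *. x *. g : H" using that cs_iff[OF assms(2,3)] by auto
  have "act x (act g a) = act (g *. (inv g *. x *. g)) a" using x(1) assms(1,2) fxc by (simp add: act_mult[symmetric] gnorm)
  also have "... = act g (act (inv g *. x *. g) a)" using x(1) assms(1,2) fxc by (intro act_mult) auto
  finally show ?thesis using x(2) assms(1) by (simp add: fx_iff)
 qed
 then show ?thesis using assms(1,2) by (simp add: fx_iff)
qed

section \<open>Norm maps on fixed points\<close>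

lemma ob_simps [simp]:
 "carrier (ob M H) = fx H" "monoid.mult (ob M H) = monoid.mult C" "one (ob M H) = one C"
 by (simp_all add: fixed_point_functor_def)

lemma ob_eq: "ob M H = C(|carrier := fx H|)" by (simp add: fixed_point_functor_def)

lemma con_res_simps [simp]: "con M g H a = act g a" "res M I H a = a" by (simp_all add: fixed_point_functor_def)

lemma ob_inv: "H <= cG ==> a : fx H ==> inv\<^bsub>ob M H\<^esub> a = /: a" by (simp add: ob_eq C.m_inv_consistent fx_subgroup)

lemma ob_pow [simp]: "a [^]\<^bsub>ob M H\<^esub> (k::nat) = a ^: k" by (simp add: ob_eq nat_pow_def)

lemma ob_comm_group: "H <= cG ==> comm_group (ob M H)" unfolding ob_eq by (rule C.subgroup_comm_group[OF fx_subgroup])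

text \<open>Finite index without openness: norms are needed between inertia groups as well.\<close>

definition fi :: "'g set => 'g set => bool" where
 "fi H I \<longleftrightarrow> subgroup H G & subgroup I G & I <= H & (EX A t. ltr H I (A :: nat set) t)"

lemma fi_open: "osub H ==> osub I ==> I <= H ==> fi H I" using osub_transversal[of I H] by (auto simp: fi_def dest: osD(1))

lemma fi_inert: "osub H ==> osub I ==> I <= H ==> fi (inert H) (inert I)" using inert_transversal[of H I] inert_mono[of I H]
 by (auto simp: fi_def intro!: inert_subgroup dest: osD(1))

lemma fiD:
 assumes "fi H I"
 shows "subgroup H G" "subgroup I G" "I <= H" "H <= cG" "I <= cG" using assms sg_sub[of H G] by (auto simp: fi_def)

lemma nrm_eq:
 assumes t: "ltr H I A t" and "subgroup H G" "subgroup I G" "I <= H" and a: "a : fx I"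
 shows "nrm H I a = (\<Otimes>\<^bsub>C\<^esub>i\<in>A. act (t i) a)"
proof -
 have H: "!!x. x : H ==> x : cG" by (rule sg_mem[OF assms(2)])
 have "(\<Otimes>\<^bsub>C\<^esub>X\<in>lcosets\<^bsub>G(|carrier := H|)\<^esub> I. (%h. act h a) (SOME h. h : X)) = (\<Otimes>\<^bsub>C\<^esub>i\<in>A. (%h. act h a) (t i))"
 proof (rule C.finprod_left_transversal[OF is_group t assms(2,3)])
  show "act x a : cC" if "x : H" for x using that H a fxc by simp
  fix x y assume xy: "x : H" "y : H" "inv x *. y : I"
  have "act y a = act (x *. (inv x *. y)) a" using H[OF xy(1)] H[OF xy(2)] by (simp add: gnorm)
  also have "... = act x (act (inv x *. y) a)" using H[OF xy(1)] H[OF xy(2)] a fxc by (intro act_mult) auto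
  finally show "act x a = act y a" using a xy(3) by (simp add: fx_iff)
 qed fact
 then show ?thesis by (simp add: fixed_point_functor_def)
qed

lemma nrm_transversal:
 assumes "fi H I"
 shows "EX (A :: nat set) t. ltr H I A t & finite A & (ALL i:A. t i : H) &
  (ALL i:A. t i : cG) & (ALL a:fx I. nrm H I a = (\<Otimes>\<^bsub>C\<^esub>i\<in>A. act (t i) a)) &
  idx H I = card A"
proof -
 obtain A t where t: "ltr H I (A :: nat set) t" using assms by (auto simp: fi_def)
 note F = fiD[OF assms]
 show ?thesis by (intro exI[of _ A] exI[of _ t] conjI ballI t ltD(1,2)[OF t]
   sg_mem[OF F(1) ltD(2)[OF t]]
   nrm_eq[OF t F(1-3)] idx_eq_card[OF t F(1,2)])
qed

text \<open>Left translation by \<open>h\<close> turns one transversal into another, and the norm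
  does not depend on the transversal.\<close>

lemma nrm_closed:
 assumes "fi H I" "a : fx I" shows "nrm H I a : fx H"
proof -
 obtain A :: "nat set" and t where t0: "ltr H I A t" "finite A" "ALL i:A. t i : H"
  "ALL i:A. t i : cG" "ALL a:fx I. nrm H I a = (\<Otimes>\<^bsub>C\<^esub>i\<in>A. act (t i) a)"
  "idx H I = card A" using nrm_transversal[OF assms(1)] by (elim exE conjE) (rule that)
 note t = t0(1,2) bspec[OF t0(3)] bspec[OF t0(4)] and N = bspec[OF t0(5)] and Nc = t0(6)
 note F = fiD[OF assms(1)]
 have ac: "a : cC" using assms(2) fxc by blast
 have "act h (nrm H I a) = nrm H I a" if h: "h : H" for h
 proof -
  have hc: "h : cG" by (rule sg_mem[OF F(1) h])
  have "ltr H I A (%i. h *. t i)" unfolding left_transversal_def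
  proof (intro conjI ballI)
   fix x assume x: "x : H"
   have xc: "x : cG" by (rule sg_mem[OF F(1) x])
   have hx: "inv h *. x : H" using h x F(1) by (simp add: sg_mult sg_inv)
   have "inv (h *. t i) *. x = inv (t i) *. (inv h *. x)" if "i : A" for i using hc xc t(4)[OF that] by (simp add: gnorm)
   then show "EX! i. i : A & inv (h *. t i) *. x : I" using ltD(3)[OF t(1) hx] by auto
  qed (use t h F(1) in \<open>auto simp: sg_mult\<close>)
  then have "nrm H I a = (\<Otimes>\<^bsub>C\<^esub>i\<in>A. act (h *. t i) a)" by (rule nrm_eq[OF _ F(1-3) assms(2)])
  also have "... = (\<Otimes>\<^bsub>C\<^esub>i\<in>A. act h (act (t i) a))" using t(4) hc ac by (intro C.finprod_cong') (auto simp: act_mult)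
  also have "... = act h (nrm H I a)" using N[OF assms(2)] t(4) hc ac by (simp add: act_finprod)
  finally show ?thesis by simp
 qed
 moreover have "nrm H I a : cC" using N[OF assms(2)] t(4) ac by simp
 ultimately show ?thesis by (simp add: fx_iff)
qed

lemma nrm_cmul:
 assumes "fi H I" "a : fx I" "b : fx I" shows "nrm H I (a *: b) = nrm H I a *: nrm H I b"
proof -
 obtain A :: "nat set" and t where t0: "ltr H I A t" "finite A" "ALL i:A. t i : H"
  "ALL i:A. t i : cG" "ALL a:fx I. nrm H I a = (\<Otimes>\<^bsub>C\<^esub>i\<in>A. act (t i) a)"
  "idx H I = card A" using nrm_transversal[OF assms(1)] by (elim exE conjE) (rule that)
 note t = t0(1,2) bspec[OF t0(3)] bspec[OF t0(4)] and N = bspec[OF t0(5)] and Nc = t0(6)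
 have c: "a : cC" "b : cC" "a *: b : fx I" using assms fxc fx_closed[OF fiD(5)[OF assms(1)]] by auto
 have "nrm H I (a *: b) = (\<Otimes>\<^bsub>C\<^esub>i\<in>A. act (t i) a *: act (t i) b)"
  unfolding N[OF c(3)] using t c by (intro C.finprod_cong') (auto simp: act_cmul)
 also have "... = nrm H I a *: nrm H I b" unfolding N[OF assms(2)] N[OF assms(3)] using t c by (intro C.finprod_multf) auto
 finally show ?thesis .
qed

lemma nrm_group_hom: "fi H I ==> group_hom (ob M I) (ob M H) (nrm H I)"
 using comm_group.axioms(2)[OF ob_comm_group[OF fiD(5)]] comm_group.axioms(2)[OF ob_comm_group[OF fiD(4)]]
 by (auto simp: group_hom_def group_hom_axioms_def hom_def nrm_closed nrm_cmul)

lemma nrm_one: "fi H I ==> nrm H I oC = oC" using group_hom.hom_one[OF nrm_group_hom] by simp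

lemma nrm_cinv: "fi H I ==> a : fx I ==> nrm H I (/: a) = /: (nrm H I a)"
 using group_hom.hom_inv[OF nrm_group_hom, of H I a] nrm_closed[of H I a] by (simp add: ob_inv fiD)

lemma nrm_cdiv: "fi H I ==> a : fx I ==> b : fx I ==> nrm H I (a -. b) = nrm H I a -. nrm H I b"
 by (simp add: C.gdiv_def nrm_cmul nrm_cinv fx_closed fiD)

lemma nrm_pow: "fi H I ==> a : fx I ==> nrm H I (a ^: (k::nat)) = nrm H I a ^: k"
 by (induction k) (auto simp: nrm_one nrm_cmul fx_pow fiD)

lemma nrm_finprod:
 assumes "fi H I" "!!i. i : A ==> f i : fx I" "finite A"
 shows "nrm H I (finprod C f A) = finprod C (%i. nrm H I (f i)) A" "finprod C f A : fx I"
proof -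
 show "finprod C f A : fx I" by (rule C.finprod_in_subgroup[OF fx_subgroup[OF fiD(5)[OF assms(1)]] assms(2)])
 have "nrm H I (finprod C f A) = finprod C (%i. nrm H I (f i)) A & finprod C f A : fx I" using assms(3,2)
 proof (induction A)
  case empty
  show ?case using nrm_one[OF assms(1)] fx_closed(1)[OF fiD(5)[OF assms(1)]] by simp
 next
  case (insert x A)
  have c: "f : A \<rightarrow> cC" "f x : cC" using insert.prems fxc by auto
  have c': "(%i. nrm H I (f i)) : A \<rightarrow> cC" "nrm H I (f x) : cC" using insert.prems nrm_closed[OF assms(1)] fxc by auto
  show ?case using insert c c' nrm_cmul[OF assms(1)] fx_closed(2)[OF fiD(5)[OF assms(1)]] by simp
 qed
 then show "nrm H I (finprod C f A) = finprod C (%i. nrm H I (f i)) A" by simp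
qed

lemma nrm_tower:
 assumes "fi H I" "fi I K" "a : fx K" shows "nrm H K a = nrm H I (nrm I K a)"
proof -
 obtain A :: "nat set" and s where s0: "ltr H I A s" "finite A" "ALL i:A. s i : H"
  "ALL i:A. s i : cG" "ALL a:fx I. nrm H I a = (\<Otimes>\<^bsub>C\<^esub>i\<in>A. act (s i) a)"
  "idx H I = card A" using nrm_transversal[OF assms(1)] by (elim exE conjE) (rule that)
 note s = s0(1,2) bspec[OF s0(3)] bspec[OF s0(4)] and N1 = bspec[OF s0(5)] and N1c = s0(6)
 obtain B :: "nat set" and t where t0: "ltr I K B t" "finite B" "ALL i:B. t i : I"
  "ALL i:B. t i : cG" "ALL a:fx K. nrm I K a = (\<Otimes>\<^bsub>C\<^esub>i\<in>B. act (t i) a)"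
  "idx I K = card B" using nrm_transversal[OF assms(2)] by (elim exE conjE) (rule that)
 note t = t0(1,2) bspec[OF t0(3)] bspec[OF t0(4)] and N2 = bspec[OF t0(5)] and N2c = t0(6)
 note F = fiD[OF assms(1)] fiD[OF assms(2)]
 have ac: "a : cC" using assms(3) fxc by blast
 have KH: "K <= H" using F by blast
 have "nrm H K a = (\<Otimes>\<^bsub>C\<^esub>x\<in>A \<times> B. act (s (fst x) *. t (snd x)) a)"
  by (rule nrm_eq[OF ltr_tower[OF s(1) t(1) F(1,2,7,3,8)] F(1,7) KH assms(3)])
 also have "... = (\<Otimes>\<^bsub>C\<^esub>x\<in>A \<times> B. (%i j. act (s i) (act (t j) a)) (fst x) (snd x))"
  using s t ac by (intro C.finprod_cong') (auto simp: act_mult)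
 also have "... = (\<Otimes>\<^bsub>C\<^esub>i\<in>A. \<Otimes>\<^bsub>C\<^esub>j\<in>B. act (s i) (act (t j) a))" using s t ac by (intro C.finprod_Sigma) auto
 also have "... = (\<Otimes>\<^bsub>C\<^esub>i\<in>A. act (s i) (nrm I K a))"
  unfolding N2[OF assms(3)] using s t ac by (intro C.finprod_cong') (auto simp: act_finprod)
 finally show ?thesis using N1[OF nrm_closed[OF assms(2,3)]] by simp
qed

lemma nrm_fixed:
 assumes "fi H I" "a : fx H" shows "nrm H I a = a ^: idx H I"
proof -
 obtain A :: "nat set" and t where t0: "ltr H I A t" "finite A" "ALL i:A. t i : H"
  "ALL i:A. t i : cG" "ALL a:fx I. nrm H I a = (\<Otimes>\<^bsub>C\<^esub>i\<in>A. act (t i) a)"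
  "idx H I = card A" using nrm_transversal[OF assms(1)] by (elim exE conjE) (rule that)
 note t = t0(1,2) bspec[OF t0(3)] bspec[OF t0(4)] and N = bspec[OF t0(5)] and Nc = t0(6)
 have "a : fx I" by (rule fx_mono[OF fiD(3)[OF assms(1)] assms(2)])
 then have "nrm H I a = (\<Otimes>\<^bsub>C\<^esub>i\<in>A. a)"
  unfolding N[OF \<open>a : fx I\<close>] using t(3) assms(2) by (intro C.finprod_cong') (auto simp: fx_iff)
 then show ?thesis using Nc assms(2) fxc C.finprod_const[of a A] by simp
qed

lemma nrm_conj:
 assumes "fi H I" "a : fx I" "g : cG"
 shows "act g (nrm H I a) = nrm (cs g H) (cs g I) (act g a)"
proof -
 obtain A :: "nat set" and t where t0: "ltr H I A t" "finite A" "ALL i:A. t i : H"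
  "ALL i:A. t i : cG" "ALL a:fx I. nrm H I a = (\<Otimes>\<^bsub>C\<^esub>i\<in>A. act (t i) a)"
  "idx H I = card A" using nrm_transversal[OF assms(1)] by (elim exE conjE) (rule that)
 note t = t0(1,2) bspec[OF t0(3)] bspec[OF t0(4)] and N = bspec[OF t0(5)] and Nc = t0(6)
 note F = fiD[OF assms(1)]
 have ac: "a : cC" using assms(2) fxc by blast
 have sub: "cs g I <= cs g H" unfolding conj_set_def by (rule image_mono[OF F(3)])
 have "nrm (cs g H) (cs g I) (act g a) = (\<Otimes>\<^bsub>C\<^esub>i\<in>A. act (ce g (t i)) (act g a))"
  by (rule nrm_eq[OF ltr_conj[OF t(1) F(1-3) assms(3)] subgroup_conj_set[OF F(1) assms(3)]
   subgroup_conj_set[OF F(2) assms(3)] sub fx_act[OF assms(2,3) F(5)]])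
 also have "... = (\<Otimes>\<^bsub>C\<^esub>i\<in>A. act g (act (t i) a))" using t(4) assms(3) ac
  by (intro C.finprod_cong') (auto simp: act_mult[symmetric] conj_elt_def gnorm)
 also have "... = act g (nrm H I a)" unfolding N[OF assms(2)] using t(4) assms(3) ac by (simp add: act_finprod)
 finally show ?thesis by simp
qed

lemma nrm_self: "subgroup H G ==> a : fx H ==> nrm H H a = a" using nrm_eq[OF idx_self(2), of H a] fxc[of a H] by simp

section \<open>Valuations, and their extension over the fixed field of inertia\<close>

lemma v_props:
 assumes "osub H"
 shows "!!a b. a : fx H ==> b : fx H ==> v H (a *: b) = v H a *^ v H b"
  "!!a. a : fx H ==> v H a : generate Om {om}" "EX a:fx H. v H a = om"
  "!!g a. g : cG ==> a : fx H ==> v (cs g H) (act g a) = v H a"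
  "!!K a. osub K ==> K <= H ==> a : fx H ==> v K a = v H a ^. ramification_index G Om d H K"
  "!!K a. osub K ==> K <= H ==> a : fx K ==> v H (nrm H K a) = v K a ^. fdeg H K"
proof -
 note V = mp[OF spec[OF CollectD[OF valuation[unfolded valuations_def]], of H] assms]
 note V1 = conjunct1[OF V] and V2 = conjunct1[OF conjunct2[OF V]]
  and V3 = conjunct1[OF conjunct2[OF conjunct2[OF V]]]
  and V4 = conjunct2[OF conjunct2[OF conjunct2[OF V]]]
 show "v H (a *: b) = v H a *^ v H b" if "a : fx H" "b : fx H" for a b using V1 that by (simp add: hom_def)
 show "v H a : generate Om {om}" if "a : fx H" for a using hom_in_carrier[OF V1, of a] that by simp
 show "EX a:fx H. v H a = om" using V2 by auto
 show "v (cs g H) (act g a) = v H a" if "g : cG" "a : fx H" for g a using V3 that by simp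
 fix K a assume K: "osub K" "K <= H"
 note V5 = mp[OF spec[OF V4, of K] conjI[OF K]]
 show "v K a = v H a ^. ramification_index G Om d H K" if "a : fx H" using conjunct1[OF V5] that by simp
 show "v H (nrm H K a) = v K a ^. fdeg H K" if "a : fx K" using conjunct2[OF V5] that by simp
qed

lemma v_closed: "osub H ==> a : fx H ==> v H a : cO" using v_props(2) Om.generate_in_carrier[of "{om}"] by auto

lemma v_group_hom: "osub H ==> group_hom (ob M H) Om (v H)"
 using comm_group.axioms(2)[OF ob_comm_group[OF osD(3)]] v_props(1) v_closed Om.is_group
 by (auto simp: group_hom_def group_hom_axioms_def hom_def)

lemma v_cinv: "osub H ==> a : fx H ==> v H (/: a) = /^ v H a"
 using group_hom.hom_inv[OF v_group_hom, of H a] by (simp add: ob_inv osD)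

lemma v_one: "osub H ==> v H oC = oW" using group_hom.hom_one[OF v_group_hom, of H] by simp

lemma v_pow: "osub H ==> a : fx H ==> v H (a ^: (k::nat)) = v H a ^. k"
 by (induction k) (auto simp: v_one v_props(1) fx_pow osD)

lemma v_int: "osub H ==> a : fx H ==> EX i::int. v H a = om ^. i" using v_props(2)[of H a] Om.generate_pow[of om] by auto

lemma v_unram:
 assumes "osub H" "osub K" "K <= H" "inert H = inert K" "a : fx H"
 shows "v K a = v H a"
proof -
 have "ramification_index G Om d H K = 1" unfolding ramification_index_def assms(4)
  by (rule idx_self(1)[OF inert_subgroup[OF osD(1)[OF assms(2)]]])
 then show ?thesis using v_props(5)[OF assms(1,2,3,5)] v_closed[OF assms(1,5)] by simp
qed

text \<open>The common extension of the valuations to the elements fixed by the inertia group of \<open>U\<close>.\<close>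

definition vt :: "'g set => 'c => 'w" where "vt U a = v (stab a Int U) a"

text \<open>The analogue of the multiplicative group of the maximal unramified extension of the
  field belonging to \<open>U\<close>.\<close>

abbreviation Cb where "Cb U == fx (inert U)"

lemma Cb_stab:
 assumes "osub U" "a : Cb U"
 shows "osub (stab a Int U)" "inert (stab a Int U) = inert U" "a : fx (stab a Int U)"
proof -
 have ac: "a : cC" using assms(2) by (rule fxc)
 show "osub (stab a Int U)" by (rule osub_Int[OF stab_open[OF ac] assms(1)])
 have "inert U <= stab a" using assms(2) inert_subset osD(3)[OF assms(1)] by (auto simp: stab_def fx_iff)
 then show "inert (stab a Int U) = inert U" by (auto simp: inertia_def)
 show "a : fx (stab a Int U)" using ac by (auto simp: fx_iff stab_def)
qed

text \<open>Unramified restriction leaves \<open>v\<close> unchanged, so \<open>V\<close> and the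
  stabilizer used in \<open>vt\<close> can be compared on their intersection, which has the same
  inertia.\<close>

lemma vt_eq:
 assumes "osub U" "osub V" "inert V = inert U" "a : fx V"
 shows "a : Cb U" "vt U a = v V a"
proof -
 show a: "a : Cb U" using fx_mono[OF inert_subset assms(4)] assms(3) by simp
 note S = Cb_stab[OF assms(1) a]
 let ?W = "V Int (stab a Int U)"
 have W: "osub ?W" by (rule osub_Int[OF assms(2) S(1)])
 have iW: "inert ?W = inert U" using S(2) assms(3) by (auto simp: inertia_def)
 have "v ?W a = v V a" using iW assms(3) by (intro v_unram[OF assms(2) W _ _ assms(4)]) auto
 moreover have "v ?W a = v (stab a Int U) a" using iW S(2) by (intro v_unram[OF S(1) W _ _ S(3)]) auto
 ultimately show "vt U a = v V a" by (simp add: vt_def)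
qed

lemma vt_common:
 assumes "osub U" "a : Cb U" "b : Cb U"
 shows "EX V. osub V & inert V = inert U & V <= U & a : fx V & b : fx V"
proof -
 note A = Cb_stab[OF assms(1,2)] and B = Cb_stab[OF assms(1,3)]
 have "osub ((stab a Int U) Int (stab b Int U))" by (rule osub_Int[OF A(1) B(1)])
 moreover have "inert ((stab a Int U) Int (stab b Int U)) = inert U" using A(2) B(2) by (auto simp: inertia_def)
 moreover have "(stab a Int U) Int (stab b Int U) <= U" by blast
 moreover have "a : fx ((stab a Int U) Int (stab b Int U))" by (rule fx_mono[OF _ A(3)]) blast
 moreover have "b : fx ((stab a Int U) Int (stab b Int U))" by (rule fx_mono[OF _ B(3)]) blast
 ultimately show ?thesis by blast
qed

lemma inert_carrier: "osub U ==> inert U <= cG" using inert_subset osD(3) by blast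

lemma vt_cmul:
 assumes "osub U" "a : Cb U" "b : Cb U" shows "vt U (a *: b) = vt U a *^ vt U b"
proof -
 obtain V where V: "osub V" "inert V = inert U" "a : fx V" "b : fx V"
  using vt_common[OF assms] by (elim exE conjE) (rule that)
 have "a *: b : fx V" by (rule fx_closed(2)[OF osD(3)[OF V(1)] V(3,4)])
 then show ?thesis using vt_eq(2)[OF assms(1) V(1,2)] V v_props(1)[OF V(1)] by simp
qed

lemma vt_closed: "osub U ==> a : Cb U ==> vt U a : cO" unfolding vt_def using v_closed Cb_stab by blast

lemma vt_cinv:
 assumes "osub U" "a : Cb U" shows "vt U (/: a) = /^ vt U a"
proof -
 note S = Cb_stab[OF assms]
 have "/: a : fx (stab a Int U)" by (rule fx_closed(3)[OF osD(3)[OF S(1)] S(3)])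
 then show ?thesis using vt_eq(2)[OF assms(1) S(1,2)] S(3) v_cinv[OF S(1)] by simp
qed

lemma vt_gdiv:
 "osub U ==> a : Cb U ==> b : Cb U ==> vt U (a -. b) = vt U a *^ /^ vt U b"
 by (simp add: C.gdiv_def vt_cmul vt_cinv fx_closed(3)[OF inert_carrier])

lemma vt_one: "osub U ==> vt U oC = oW" using vt_eq(2)[of U U "oC"] v_one fx_closed(1)[OF osD(3)] by simp

lemma cs_self:
 assumes "onorm H U" "h : H"
 shows "cs h U = U" "cs h (inert U) = inert U"
proof -
 note U = onD[OF assms(1)]
 have h: "h : cG" by (rule osD(4)[OF U(1) assms(2)])
 show 1: "cs h U = U"
 proof (rule subset_antisym)
  show "cs h U <= U" using U(4)[OF assms(2)] by (auto simp: conj_set_def conj_elt_def)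
  show "U <= cs h U" using U(5)[OF assms(2)] osD(3)[OF U(2)] cs_iff[OF h osD(3)[OF U(2)]] by blast
 qed
 show "cs h (inert U) = inert U" using inert_conj[OF h osD(3)[OF U(2)]] 1 by simp
qed

lemma Cb_act: "onorm H U ==> h : H ==> a : Cb U ==> act h a : Cb U"
 using fx_act[of a "inert U" h] cs_self(2)[of H U h] inert_carrier[OF onD(2)]
  osD(4)[OF onD(1)] by simp

lemma vt_act:
 assumes "onorm H U" "h : H" "a : Cb U" shows "vt U (act h a) = vt U a"
proof -
 note U = onD[OF assms(1)]
 have h: "h : cG" by (rule osD(4)[OF U(1) assms(2)])
 note S = Cb_stab[OF U(2) assms(3)]
 have "inert (cs h (stab a Int U)) = inert U" using inert_conj[OF h osD(3)[OF S(1)]] S(2) cs_self(2)[OF assms(1,2)] by simp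
 then have "vt U (act h a) = v (cs h (stab a Int U)) (act h a)"
  using vt_eq(2)[OF U(2) osub_conj[OF S(1) h]] fx_act[OF S(3) h osD(3)[OF S(1)]] by simp
 also have "... = v (stab a Int U) a" by (rule v_props(4)[OF S(1) h S(3)])
 finally show ?thesis by (simp add: vt_def)
qed

text \<open>The stabilizer of \<open>a\<close> is open and hence closed, so that it contains the
  closure of the powers of \<open>h\<close> once it contains \<open>h\<close>.\<close>

lemma fx_Sg:
 assumes "frob H U h n" shows "a : fx (Sg h U) \<longleftrightarrow> a : Cb U & act h a = a"
proof
 note f = frobD[OF assms]
 assume "a : fx (Sg h U)"
 then show "a : Cb U & act h a = a" using fx_mono[OF inert_subset_Sg[OF f(3,6)]] Sg_self[OF f(3,6)] by (auto simp: fx_iff)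
next
 note f = frobD[OF assms]
 assume a: "a : Cb U & act h a = a"
 have ac: "a : cC" using a fxc by blast
 have "Sg h U <= stab a" using a f(6) inert_carrier[OF f(3)]
  by (intro Sg_minimal[OF stab_open[OF ac]]) (auto simp: stab_def fx_iff)
 then show "a : fx (Sg h U)" using ac by (auto simp: fx_iff stab_def)
qed

lemma vt_Sg: "frob H U h n ==> a : fx (Sg h U) ==> vt U a = v (Sg h U) a" by (rule vt_eq(2)[OF frobD(3) Sg_open inert_Sg])

text \<open>The norm between the maximal unramified extensions of the fields of \<open>U\<close> and
  \<open>H\<close>.\<close>

abbreviation NN where "NN H U == nrm (inert H) (inert U)"

lemma NN_fi: "onorm H U ==> fi (inert H) (inert U)" by (rule fi_inert[OF onD(1-3)])

lemma onorm_self: "osub H ==> onorm H H" by (rule onI) (auto simp: osD)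

lemma NN_act:
 assumes "onorm H U" "h : H" "a : Cb U" shows "act h (NN H U a) = NN H U (act h a)"
 using nrm_conj[OF NN_fi[OF assms(1)] assms(3) osD(4)[OF onD(1)[OF assms(1)] assms(2)]]
  cs_self(2)[OF assms(1,2)] cs_self(2)[OF onorm_self[OF onD(1)[OF assms(1)]] assms(2)] by simp

lemma NN_inert:
 assumes "onorm H U" "h : inert H" "a : Cb U" shows "NN H U (act h a) = NN H U a"
proof -
 have hH: "h : H" using assms(2) inert_subset by blast
 show ?thesis using NN_act[OF assms(1) hH assms(3)] nrm_closed[OF NN_fi[OF assms(1)] assms(3)] assms(2) by (simp add: fx_iff)
qed

text \<open>The action of the group ring element 1 + g + ... + g^(n-1), written
  multiplicatively.\<close>

definition sm :: "nat => 'g => 'c => 'c" where "sm n g a = (\<Otimes>\<^bsub>C\<^esub>i\<in>{..<n}. act (g [^] i) a)"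

lemma sm_closed [simp]: "g : cG ==> a : cC ==> sm n g a : cC" by (auto simp: sm_def)

lemma sm_Suc: "g : cG ==> a : cC ==> sm (Suc n) g a = act (g [^] n) a *: sm n g a"
 unfolding sm_def by (rule C.finprod_lessThan_Suc) simp

lemma sm_0 [simp]: "sm 0 g a = oC" by (simp add: sm_def)

lemma sm_act:
 assumes "g : cG" "x : cG" "a : cC" "!!i. i < n ==> act (g *. x [^] i) a = act (x [^] i *. g) a"
 shows "act g (sm n x a) = sm n x (act g a)" using assms by (auto simp: sm_def act_finprod act_mult intro!: C.finprod_cong')

text \<open>This is (g - 1)(1 + g + ... + g^(n-1)) = g^n - 1, with the differences moved to the
  other sides.\<close>

lemma sm_telescope:
 assumes "g : cG" "a : cC" shows "act g (sm n g a) *: a = act (g [^] n) a *: sm n g a"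
proof (induction n)
 case 0
 show ?case using assms by (simp add: act_C_one)
next
 case (Suc n)
 have c: "act (g [^] Suc n) a : cC" "act g (sm n g a) : cC" using assms by auto
 have "act g (sm (Suc n) g a) *: a = (act g (act (g [^] n) a) *: act g (sm n g a)) *: a"
  using assms by (simp add: sm_Suc act_cmul)
 also have "act g (act (g [^] n) a) = act (g [^] Suc n) a"
  using assms act_mult[of g "g [^] n" a] by (simp only: nat_pow_closed nat_pow_Suc2)
 also have "act (g [^] Suc n) a *: act g (sm n g a) *: a = act (g [^] Suc n) a *: (act (g [^] n) a *: sm n g a)"
  using Suc c assms by (simp only: C.m_assoc)
 finally show ?case using assms by (simp add: sm_Suc)
qed

lemma sm_cmul:
 "g : cG ==> a : cC ==> b : cC ==> sm n g (a *: b) = sm n g a *: sm n g b"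
 unfolding sm_def by (subst C.finprod_multf[symmetric]) (auto simp: act_cmul intro!: C.finprod_cong')

lemma sm_cinv:
 assumes "g : cG" "a : cC" shows "sm n g (/: a) = /: (sm n g a)"
proof -
 have "sm n g (/: a) *: sm n g a = oC" using assms sm_cmul[of g "/: a" a n] by (simp add: sm_def act_C_one)
 then show ?thesis using assms C.inv_equality[of "sm n g (/: a)" "sm n g a"] by simp
qed

lemma sm_gdiv:
 "g : cG ==> a : cC ==> b : cC ==> sm n g (a -. b) = sm n g a -. sm n g b" by (simp add: C.gdiv_def sm_cmul sm_cinv)

lemma sm_fixed: "g : cG ==> a : cC ==> act g a = a ==> sm n g a = a ^: n"
 using C.finprod_const[of a "{..<n}"] act_pow_fixed[of g a] by (simp add: sm_def cong: C.finprod_cong)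

lemma sm_mult:
 assumes "g : cG" "a : cC" shows "sm (m * n) g a = sm n (g [^] m) (sm m g a)"
proof -
 have "sm (m * n) g a = (\<Otimes>\<^bsub>C\<^esub>j\<in>{..<n}. \<Otimes>\<^bsub>C\<^esub>i\<in>{..<m}. act (g [^] (m * j + i)) a)"
  unfolding sm_def using assms by (intro C.finprod_lessThan_mult) simp
 also have "... = (\<Otimes>\<^bsub>C\<^esub>j\<in>{..<n}. act ((g [^] m) [^] j) (sm m g a))" using assms by (intro C.finprod_cong')
   (auto simp: sm_def act_finprod act_pow_add nat_pow_pow intro!: C.finprod_cong')
 finally show ?thesis by (simp add: sm_def)
qed

lemma sm_Cb:
 assumes "onorm H U" "g : H" "a : Cb U"
 shows "sm n g a : Cb U" "NN H U (sm n g a) = sm n g (NN H U a)" "vt U a = oW ==> vt U (sm n g a) = oW"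
proof -
 note U = onD[OF assms(1)]
 have g: "g : cG" by (rule osD(4)[OF U(1) assms(2)])
 have gi: "g [^] i : H" for i :: nat by (rule osub_pow[OF U(1) assms(2)])
 note A = Cb_act[OF assms(1) gi assms(3)]
 show s: "sm n g a : Cb U" for n unfolding sm_def by (rule nrm_finprod(2)[OF NN_fi[OF assms(1)] A]) auto
 have "NN H U a : cC" using nrm_closed[OF NN_fi[OF assms(1)] assms(3)] fxc by blast
 then show "NN H U (sm n g a) = sm n g (NN H U a)" unfolding sm_def nrm_finprod(1)[OF NN_fi[OF assms(1)] A finite_lessThan]
  using g by (intro C.finprod_cong') (auto simp: NN_act[OF assms(1) gi assms(3), symmetric])
 show "vt U (sm n g a) = oW" if "vt U a = oW"
 proof (induction n)
  case 0
  show ?case using vt_one[OF U(2)] by simp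
 next
  case (Suc n)
  then show ?case using vt_cmul[OF U(2) A s] vt_act[OF assms(1) gi assms(3)] that sm_Suc[OF g fxc[OF assms(3)]] by simp
 qed
qed

end

section \<open>Units in unramified extensions\<close>

locale cft = cft_module P G Om om d C act v
 for P and G :: "'g top_group" (structure) and Om :: "'w top_group" and om and d
  and C :: "'c monoid" and act :: "'g => 'c => 'c" and v :: "'g set => 'c => 'w" +
 assumes cfa_unram:
  "!!H U. onorm H U ==> inertia G Om d H <= U ==> class_field_axiom G (fixed_point_functor G C act) H U"
  and cfa_prime: "!!H U. onorm H U ==> cyclic_group (quotient_grp G H U) ==>
   prime (order (quotient_grp G H U)) ==> inertia_degree Om d H U = 1 ==>
   class_field_axiom G (fixed_point_functor G C act) H U"
begin

abbreviation Nm where "Nm H U == norm_subgroup M H U"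

lemma Nm_eq: "Nm H U = nrm H U ` fx U" by (simp add: norm_subgroup_def)

lemma Nm_subset: "fi H U ==> Nm H U <= fx H" using nrm_closed by (auto simp: Nm_eq)

lemma Nm_subgroup_ob: "fi H U ==> subgroup (Nm H U) (ob M H)"
 using group_hom.img_is_subgroup[OF nrm_group_hom] by (simp add: Nm_eq)

lemma Nm_subgroup: "fi H U ==> subgroup (Nm H U) C"
 using Nm_subgroup_ob C.incl_subgroup[OF fx_subgroup[OF fiD(4)]] by (simp add: ob_eq)

lemma fi_normal: "onorm H U ==> fi H U" by (rule fi_open[OF onD(1-3)])

lemma unram_preimage:
 assumes "onorm H U" "inert H <= U" shows "{x : H. d x : d ` U} = U"
proof (intro subset_antisym subsetI)
 note U = onD[OF assms(1)]
 note Hs = osD[OF U(1)] and Us = osD[OF U(2)]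
 fix x assume "x : {x : H. d x : d ` U}"
 then obtain u where x: "x : H" "u : U" "d x = d u" by blast
 have c: "x : cG" "u : cG" using Hs(4)[OF x(1)] Us(4)[OF x(2)] .
 have "u : H" using x(2) U(3) by blast
 then have "x *. inv u : H" by (intro Hs(6,7) x(1))
 then have "x *. inv u : inert H" using inert_iff[OF Hs(3)] c x(3) by simp
 then have "x *. inv u : U" using assms(2) by blast
 then have "x *. inv u *. u : U" by (rule Us(6)[OF _ x(2)])
 then show "x : U" using c by (simp add: m_assoc)
qed (use onD(3)[OF assms(1)] in blast)

lemma unram_index:
 assumes "onorm H U" "inert H <= U"
 shows "idx H U = fdeg H U" "pnum P (fdeg H U)"
proof -
 note U = onD[OF assms(1)]
 show "idx H U = fdeg H U" using dimage_transversal(2)[OF U(1-3)] unram_preimage[OF assms]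
   idx_self(1)[OF osD(1)[OF U(2)]] by simp
 show "pnum P (fdeg H U)" by (rule dimage_transversal(3)[OF U(1-3)])
qed

lemma unram_mem:
 assumes "onorm H U" "inert H <= U" "x : H"
 shows "x : U \<longleftrightarrow> dr H x : Om.pw (fdeg H U)"
proof -
 note U = onD[OF assms(1)]
 have "dr H x : Om.pw (fdeg H U) ==> x : U"
 proof -
  assume "dr H x : Om.pw (fdeg H U)"
  then obtain u where u: "u : U" "dr H x = dr H u" unfolding d_rel_image[OF U(1-3), symmetric] by blast
  have uH: "u : H" using u(1) U(3) by blast
  have "d x = d u" using d_rel(2)[OF U(1) assms(3)] d_rel(2)[OF U(1) uH] u(2) by simp
  then show "x : U" using unram_preimage[OF assms(1,2)] assms(3) u(1) by blast
 qed
 then show ?thesis using d_rel_image[OF U(1-3)] by blast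
qed

lemma unram_transversal:
 assumes "onorm H U" "inert H <= U" "ph : H" "dr H ph = om"
 shows "ltr H U {..<idx H U} (%i. ph [^] i)"
proof -
 note U = onD[OF assms(1)]
 note Hs = osD[OF U(1)] and Us = osD[OF U(2)]
 let ?n = "fdeg H U"
 have n: "pnum P ?n" "idx H U = ?n" using unram_index[OF assms(1,2)] by auto
 have n0: "?n > 0" by (rule pnum_pos[OF n(1)])
 have ph: "ph [^] i : H" "dr H (ph [^] i) = om ^. i" for i :: nat
  using osub_pow[OF U(1) assms(3)] d_rel_pow[OF U(1) assms(3)] assms(4) by auto
 have mem: "inv (ph [^] i) *. x : U \<longleftrightarrow> /^ (om ^. i) *^ dr H x : Om.pw ?n" if x: "x : H" for x and i :: nat
  using unram_mem[OF assms(1,2) Hs(6)[OF Hs(7)[OF ph(1)] x]]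
   d_rel_mult[OF U(1) Hs(7)[OF ph(1)] x] d_rel_inv[OF U(1) ph(1)] ph(2) by simp
 have main: "i = j" if "i <= j" "j < ?n" "inv (ph [^] i) *. ph [^] j : U" for i j :: nat
 proof -
  have "ph [^] j = ph [^] i *. ph [^] (j - i)" using that(1) Hs(4)[OF assms(3)] by (simp add: nat_pow_mult)
  then have "inv (ph [^] i) *. ph [^] j = ph [^] (j - i)" using Hs(4)[OF assms(3)] by (simp add: gnorm)
  then have "om ^. (j - i) : Om.pw ?n" using that(3) unram_mem[OF assms(1,2) ph(1)] ph(2) by simp
  then have "?n dvd j - i" by (rule Om.om_pow_in_pw[OF n(1)])
  moreover have "j - i < ?n" using that by simp
  ultimately have "j - i = 0" using dvd_imp_le by fastforce
  then show ?thesis using that(1) by simp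
 qed
 have "ltr H U {..<?n} (%i. ph [^] i)"
 proof (rule ltI[OF Hs(1) Us(1)])
  show "EX i:{..<?n}. inv (ph [^] i) *. x : U" if x: "x : H" for x
   using Om.pw_reps[OF d_rel(1)[OF U(1) x] n0] mem[OF x] by auto
  show "i = j" if ij: "i : {..<?n}" "j : {..<?n}" "inv (ph [^] i) *. ph [^] j : U" for i j
  proof (cases "i <= j")
   case True
   then show ?thesis using main ij by simp
  next
   case False
   have "inv (inv (ph [^] i) *. ph [^] j) : U" by (rule Us(7)[OF ij(3)])
   then have "inv (ph [^] j) *. ph [^] i : U" using Hs(4)[OF assms(3)] by (simp add: gnorm)
   then show ?thesis using main[of j i] False ij by simp
  qed
 qed (use ph in auto)
 then show ?thesis using n(2) by simp
qed

lemma om_int_inj: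
 assumes "om ^. (i::int) = om ^. (j::int)" shows "i = j"
proof -
 have main: "k = 0" if "om ^. (k::int) = oW" "k \<ge> 0" for k
 proof -
  have "om ^. (nat k) = om ^. (0::nat)" using that by (simp add: int_pow_int[symmetric])
  then have "nat k = 0" by (rule Om.om_pow_inj)
  then show ?thesis using that(2) by simp
 qed
 have "om ^. (i - j) = oW" using assms by (simp add: Om.int_pow_diff)
 moreover have "om ^. (j - i) = oW" using assms by (simp add: Om.int_pow_diff)
 ultimately show ?thesis using main[of "i - j"] main[of "j - i"] by linarith
qed

lemma int_pow_nat: "(om ^. (z::int)) ^. (n::nat) = om ^. (z * int n)"
 using Om.int_pow_pow[of om z "int n"] by (simp add: int_pow_int)

lemma unram_v_norm:
 assumes "onorm H U" "inert H <= U" "w : fx U"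
 shows "EX z::int. v U w = om ^. z & v H (nrm H U w) = om ^. (z * int (idx H U))"
proof -
 note U = onD[OF assms(1)]
 obtain z :: int where z: "v U w = om ^. z" using v_int[OF U(2) assms(3)] by blast
 then show ?thesis using v_props(6)[OF U(1-3) assms(3)] unram_index(1)[OF assms(1,2)] by (auto simp: int_pow_nat)
qed

lemma cfa_order:
 assumes "class_field_axiom G M H U" shows "order (ob M H Mod Nm H U) = idx H U"
 using assms by (simp add: class_field_axiom_def)

text \<open>Valuations of norms are multiples of the index \<open>?n\<close>, so the first
  \<open>?n\<close> powers of a prime element lie in different norm classes. The class field axiom
  gives exactly \<open>?n\<close> classes, and therefore these are all of them.\<close>

lemma unram_norm_reps:
 assumes "onorm H U" "inert H <= U" and pe: "pe : fx H" "v H pe = om" and u: "u : fx H"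
 shows "EX i<idx H U. EX w:fx U. u = nrm H U w *: pe ^: i"
proof -
 note U = onD[OF assms(1)]
 note Hs = osD[OF U(1)]
 have f: "fi H U" by (rule fi_normal[OF assms(1)])
 let ?n = "idx H U"
 let ?N = "Nm H U"
 interpret OH: comm_group "ob M H" by (rule ob_comm_group[OF Hs(3)])
 have N: "subgroup ?N (ob M H)" by (rule Nm_subgroup_ob[OF f])
 have pei: "pe ^: i : fx H" "v H (pe ^: i) = om ^. i" for i :: nat
  using fx_pow[OF Hs(3) pe(1)] v_pow[OF U(1) pe(1)] pe(2) by auto
 let ?f = "%i. ?N #>\<^bsub>ob M H\<^esub> (pe ^: i)"
 have inj: "inj_on ?f {..<?n}"
 proof (rule inj_onI)
  fix i j assume ij: "i : {..<?n}" "j : {..<?n}" "?f i = ?f j"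
  then have "pe ^: i *.\<^bsub>ob M H\<^esub> inv\<^bsub>ob M H\<^esub> (pe ^: j) : ?N" using OH.rcos_eq_iff[OF N] pei by simp
  then obtain w where w: "w : fx U" "pe ^: i *: /: (pe ^: j) = nrm H U w" using pei Hs(3) by (auto simp: Nm_eq ob_inv)
  obtain z :: int where z: "v H (nrm H U w) = om ^. (z * int ?n)" using unram_v_norm[OF assms(1,2) w(1)] by blast
  have "v H (nrm H U w) = om ^. i *^ /^ (om ^. j)" unfolding w(2)[symmetric]
   using v_props(1)[OF U(1) pei(1) fx_closed(3)[OF Hs(3) pei(1)]] v_cinv[OF U(1) pei(1)] pei(2) by simp
  also have "... = om ^. (int i - int j)" by (simp add: Om.int_pow_diff int_pow_int)
  finally have "int i - int j = z * int ?n" using z om_int_inj by simp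
  then have "int ?n dvd int i - int j" by simp
  then have "int i mod int ?n = int j mod int ?n" by (simp add: mod_eq_dvd_iff)
  then show "i = j" using ij by simp
 qed
 have ord: "card (rcosets\<^bsub>ob M H\<^esub> ?N) = ?n"
  using cfa_order[OF cfa_unram[OF assms(1,2)]] by (simp add: order_def FactGroup_def)
 have n0: "?n > 0" using idx_pos[OF U(2) Hs(1) U(3)] .
 have fin: "finite (rcosets\<^bsub>ob M H\<^esub> ?N)" using ord n0 by (metis card.infinite less_numeral_extra(3))
 have "?f ` {..<?n} = rcosets\<^bsub>ob M H\<^esub> ?N"
 proof (rule card_subset_eq[OF fin])
  show "?f ` {..<?n} <= rcosets\<^bsub>ob M H\<^esub> ?N" using pei(1) by (auto simp: RCOSETS_def)
  show "card (?f ` {..<?n}) = card (rcosets\<^bsub>ob M H\<^esub> ?N)" using card_image[OF inj] ord by simp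
 qed
 moreover have "?N #>\<^bsub>ob M H\<^esub> u : rcosets\<^bsub>ob M H\<^esub> ?N" using u by (auto simp: RCOSETS_def)
 ultimately have "?N #>\<^bsub>ob M H\<^esub> u : ?f ` {..<?n}" by simp
 then obtain i where "i : {..<?n}" and i2: "?N #>\<^bsub>ob M H\<^esub> u = ?f i" by (rule imageE)
 then have i: "i < ?n" "?N #>\<^bsub>ob M H\<^esub> u = ?f i" by simp_all
 have "u : ?f i" using i(2) OH.rcos_self[OF _ N, of u] u by simp
 then obtain w where "w : fx U" "u = nrm H U w *: pe ^: i" by (auto simp: r_coset_def Nm_eq)
 then show ?thesis using i(1) by blast
qed

text \<open>Write the unit as a norm times a power of a prime element with exponent below the index
  \<open>?n\<close>. Trivial valuation forces this exponent to be divisible by \<open>?n\<close>,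
  hence zero, and then the norm is that of a unit.\<close>

lemma unram_norm_unit:
 assumes "onorm H U" "inert H <= U" and u: "u : fx H" "v H u = oW"
 shows "EX w:fx U. v U w = oW & nrm H U w = u"
proof -
 note U = onD[OF assms(1)]
 note Hs = osD[OF U(1)]
 have f: "fi H U" by (rule fi_normal[OF assms(1)])
 let ?n = "idx H U"
 obtain pe where pe: "pe : fx H" "v H pe = om" using v_props(3)[OF U(1)] by blast
 obtain i w where i: "i < ?n" "w : fx U" "u = nrm H U w *: pe ^: i" using unram_norm_reps[OF assms(1,2) pe u(1)] by blast
 obtain z :: int where z: "v U w = om ^. z" "v H (nrm H U w) = om ^. (z * int ?n)"
  using unram_v_norm[OF assms(1,2) i(2)] by blast
 have "v H u = om ^. (z * int ?n) *^ om ^. i"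
  unfolding i(3) using v_props(1)[OF U(1) nrm_closed[OF f i(2)] fx_pow[OF Hs(3) pe(1)]] z v_pow[OF U(1) pe(1)] pe(2) by simp
 also have "... = om ^. (z * int ?n + int i)" by (simp add: Om.int_pow_mult int_pow_int)
 finally have "om ^. (z * int ?n + int i) = om ^. (0::int)" using u(2) by simp
 then have e: "z * int ?n + int i = 0" by (rule om_int_inj)
 then have "int ?n dvd int i" by (metis add.commute dvd_minus_iff dvd_triv_right eq_neg_iff_add_eq_0)
 then have "?n dvd i" by (simp only: int_dvd_int_iff)
 then have "i = 0" using i(1) by (cases i) (auto dest: dvd_imp_le)
 then have "z = 0" using e i(1) by simp
 moreover have "nrm H U w = u" using i(3) \<open>i = 0\<close> nrm_closed[OF f i(2)] fxc by simp
 ultimately show ?thesis using i(2) z(1) by auto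
qed

lemma fx_normal_act: "onorm H U ==> h : H ==> x : fx U ==> act h x : fx U"
 using fx_act[of x U h] cs_self(1)[of H U h] osD(3)[OF onD(2)]
  osD(4)[OF onD(1)] by simp

lemma fx_sm:
 assumes "onorm H U" "h : H" "x : fx U" shows "sm k h x : fx U" unfolding sm_def
 using fx_normal_act[OF assms(1) osub_pow[OF onD(1)[OF assms(1)] assms(2)] assms(3)]
 by (intro C.finprod_in_subgroup[OF fx_subgroup[OF osD(3)[OF onD(2)[OF assms(1)]]]]) auto

text \<open>The axiom supplies generators (g x)/x with arbitrary \<open>g\<close> in
  \<open>H\<close>. Modulo \<open>U\<close> such a \<open>g\<close> is a power of \<open>h\<close>,
  and telescoping rewrites the generator as (h z)/z with \<open>z\<close> a partial norm of
  \<open>x\<close>; elements of this form are closed under products and inverses.\<close>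

lemma cyclic_hilbert_90:
 fixes k :: nat
 assumes "onorm H U" and cfa: "class_field_axiom G M H U"
  and t: "ltr H U {..<k} (%i. h [^] i)" and h: "h : H"
  and y: "y : fx U" "nrm H U y = oC"
 shows "EX z:fx U. y = act h z -. z"
proof -
 note U = onD[OF assms(1)]
 note Hs = osD[OF U(1)] and Us = osD[OF U(2)]
 have hc: "h : cG" by (rule Hs(4)[OF h])
 have fc: "!!x. x : fx U ==> x : cC" by (rule fxc)
 have "y : kernel (ob M U) (ob M H) (nrm H U)" using y by (simp add: kernel_def)
 then have "y : generate (ob M U) {con M g U x *.\<^bsub>ob M U\<^esub> inv\<^bsub>ob M U\<^esub> x | g x. g : H & x : carrier (ob M U)}"
  using cfa by (simp add: class_field_axiom_def)
 then show ?thesis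
 proof (induction y rule: generate.induct)
  case one
  show ?case using fx_closed(1)[OF Us(3)] hc by (intro bexI[of _ "oC"]) (auto simp: act_C_one)
 next
  case (incl y)
  then obtain g x where g: "g : H" "x : fx U" "y = act g x -. x" using Us(3) by (auto simp: ob_inv C.gdiv_def)
  obtain i where i: "i < k" "inv (h [^] i) *. g : U" using ltD(3)[OF t g(1)] by auto
  have gc: "g : cG" by (rule Hs(4)[OF g(1)])
  have "act g x = act (h [^] i *. (inv (h [^] i) *. g)) x" using gc hc by (simp add: gnorm)
  also have "... = act (h [^] i) (act (inv (h [^] i) *. g) x)" using gc hc fc[OF g(2)] by (intro act_mult) auto
  also have "act (inv (h [^] i) *. g) x = x" using g(2) i(2) by (simp add: fx_iff)
  finally have gx: "act g x = act (h [^] i) x" .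
  have s: "sm i h x : fx U" by (rule fx_sm[OF assms(1) h g(2)])
  have "y = act h (sm i h x) -. sm i h x" unfolding g(3) gx using sm_telescope[OF hc fc[OF g(2)], of i] hc fc[OF g(2)]
   by (simp add: C.gdiv_eq_gdiv)
  then show ?case using s by blast
 next
  case (inv y)
  then obtain g x where g: "g : H" "x : fx U" "y = act g x -. x" using Us(3) by (auto simp: ob_inv C.gdiv_def)
  obtain i where i: "i < k" "inv (h [^] i) *. g : U" using ltD(3)[OF t g(1)] by auto
  have gc: "g : cG" by (rule Hs(4)[OF g(1)])
  have "act g x = act (h [^] i *. (inv (h [^] i) *. g)) x" using gc hc by (simp add: gnorm)
  also have "... = act (h [^] i) (act (inv (h [^] i) *. g) x)" using gc hc fc[OF g(2)] by (intro act_mult) auto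
  also have "act (inv (h [^] i) *. g) x = x" using g(2) i(2) by (simp add: fx_iff)
  finally have gx: "act g x = act (h [^] i) x" .
  have s: "/: (sm i h x) : fx U" by (rule fx_closed(3)[OF Us(3) fx_sm[OF assms(1) h g(2)]])
  have yc: "y : fx U" unfolding g(3) by (rule fx_gdiv[OF Us(3) fx_normal_act[OF assms(1) g(1,2)] g(2)])
  have e: "act g x *: sm i h x = act h (sm i h x) *: x" unfolding gx using sm_telescope[OF hc fc[OF g(2)], of i] by simp
  have "inv\<^bsub>ob M U\<^esub> y = /: y" by (rule ob_inv[OF Us(3) yc])
  also have "... = x -. act g x" unfolding g(3) using gc fc[OF g(2)] by (simp add: C.inv_gdiv)
  also have "... = sm i h x -. act h (sm i h x)" using e hc gc fc[OF g(2)] by (simp add: C.gdiv_eq_gdiv C.m_comm)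
  also have "... = act h (/: (sm i h x)) -. /: (sm i h x)" using hc fc[OF g(2)] by (simp add: act_cinv C.gdiv_def C.m_comm)
  finally show ?case using s by blast
 next
  case (eng y y')
  then obtain z z' where z: "z : fx U" "y = act h z -. z" "z' : fx U" "y' = act h z' -. z'" by blast
  have "y *.\<^bsub>ob M U\<^esub> y' = act h (z *: z') -. (z *: z')" using z hc fc by (simp add: act_cmul C.gdiv_simps C.m_ac)
  then show ?case using fx_closed(2)[OF Us(3) z(1,3)] by blast
 qed
qed

text \<open>The witness of Hilbert 90 becomes a unit after division by a power of a prime element of
  C^H: this power is fixed by \<open>h\<close>, and it has the right valuation over \<open>U\<close>
  because the extension is unramified.\<close>

lemma unram_hilbert_90:
 fixes k :: nat
 assumes "onorm H U" "inert H <= U"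
  and t: "ltr H U {..<k} (%i. h [^] i)" and h: "h : H"
  and y: "y : fx U" "nrm H U y = oC"
 shows "EX z:fx U. v U z = oW & y = act h z -. z"
proof -
 note U = onD[OF assms(1)]
 note Hs = osD[OF U(1)] and Us = osD[OF U(2)]
 have hc: "h : cG" by (rule Hs(4)[OF h])
 obtain z where z: "z : fx U" "y = act h z -. z" using cyclic_hilbert_90[OF assms(1) cfa_unram[OF assms(1,2)] t h y] by blast
 obtain j :: int where j: "v U z = om ^. j" using v_int[OF U(2) z(1)] by blast
 obtain pe where pe: "pe : fx H" "v H pe = om" using v_props(3)[OF U(1)] by blast
 have iHU: "inert H = inert U" using assms(2) inert_mono[OF U(3)] by (auto simp: inertia_def)
 have peU: "pe : fx U" "v U pe = om" using fx_mono[OF U(3) pe(1)] v_unram[OF U(1-3) iHU pe(1)] pe(2) by auto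
 let ?p = "pe ^: j"
 have pc: "?p : fx H" "?p : fx U" using C.subgroup_int_pow_closed[OF fx_subgroup] Hs(3) Us(3) pe(1) peU(1) by blast+
 have "v U ?p = om ^. j"
 proof -
  have "pe [^]\<^bsub>ob M U\<^esub> j = ?p" unfolding ob_eq by (rule C.int_pow_consistent[symmetric, OF fx_subgroup[OF Us(3)] peU(1)])
  then show ?thesis using group_hom.hom_int_pow[OF v_group_hom[OF U(2)], of pe j] peU by simp
 qed
 then have "v U (z -. ?p) = oW" unfolding C.gdiv_def
  using v_props(1)[OF U(2) z(1) fx_closed(3)[OF Us(3) pc(2)]] v_cinv[OF U(2) pc(2)] j by simp
 moreover have "z -. ?p : fx U" by (rule fx_gdiv[OF Us(3) z(1) pc(2)])
 moreover have "y = act h (z -. ?p) -. (z -. ?p)"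
 proof -
  have "act h ?p = ?p" using pc(1) h by (simp add: fx_iff)
  then show ?thesis unfolding z(2) using hc fxc[OF z(1)] fxc[OF pc(1)] by (simp add: act_gdiv C.gdiv_simps C.m_ac)
 qed
 ultimately show ?thesis by blast
qed

text \<open>The units of the maximal unramified extension of the field of \<open>U\<close>.\<close>

definition EE where "EE U a \<longleftrightarrow> a : Cb U & vt U a = oW"

lemma Sg_pair:
 assumes "frob H U h n" "pnum P k"
 shows "onorm (Sg h U) (Sg (h [^] k) U)" "inert (Sg h U) <= Sg (h [^] k) U"
  "frob H U (h [^] k) (n * k)"
proof -
 have k: "k > 0" by (rule pnum_pos[OF assms(2)])
 show f: "frob H U (h [^] k) (n * k)" by (rule frob_pow[OF assms(1) k])
 show "onorm (Sg h U) (Sg (h [^] k) U)" by (rule Sg_pow_normal[OF assms(1) k])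
 show "inert (Sg h U) <= Sg (h [^] k) U" unfolding inert_Sg[OF assms(1)] using inert_subset_Sg[OF frobD(3,6)[OF f]] .
qed

lemma Sg_pow_norm:
 assumes "frob H U h n" "pnum P k" "w : fx (Sg (h [^] k) U)"
 shows "nrm (Sg h U) (Sg (h [^] k) U) w = sm k h w"
proof -
 note p = Sg_pair[OF assms(1,2)]
 note N = onD[OF p(1)]
 show ?thesis unfolding sm_def by (rule nrm_eq[OF Sg_pow_transversal[OF assms(1,2)] osD(1)[OF N(1)]
   osD(1)[OF N(2)] N(3) assms(3)])
qed

text \<open>The norm half of cohomological triviality over inertia: surjectivity of norms on units
  for the unramified pair \<open>Sg h U\<close>, \<open>Sg (h [^] k) U\<close>, restated for the
  action of \<open>h\<close>.\<close>

lemma unit_norm: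
 assumes "frob H U h n" "pnum P k" "EE U x" "act h x = x"
 shows "EX y. EE U y & act (h [^] k) y = y & sm k h y = x"
proof -
 note p = Sg_pair[OF assms(1,2)]
 have x: "x : fx (Sg h U)" using fx_Sg[OF assms(1)] assms(3,4) by (simp add: EE_def)
 have "v (Sg h U) x = oW" using vt_Sg[OF assms(1) x] assms(3) by (simp add: EE_def)
 then obtain w where w: "w : fx (Sg (h [^] k) U)" "v (Sg (h [^] k) U) w = oW"
  "nrm (Sg h U) (Sg (h [^] k) U) w = x" using unram_norm_unit[OF p(1,2) x] by blast
 then show ?thesis using Sg_pow_norm[OF assms(1,2) w(1)] fx_Sg[OF p(3)] vt_Sg[OF p(3) w(1)] by (auto simp: EE_def)
qed

text \<open>The counterpart of \<open>unit_norm\<close> in degree -1, with the witness again a unit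
  of the same layer.\<close>

lemma unit_hilbert_90:
 assumes "frob H U h n" "pnum P k" "EE U y" "act (h [^] k) y = y" "sm k h y = oC"
 shows "EX z. EE U z & act (h [^] k) z = z & y = act h z -. z"
proof -
 note p = Sg_pair[OF assms(1,2)] and f = frobD[OF assms(1)]
 have y: "y : fx (Sg (h [^] k) U)" using fx_Sg[OF p(3)] assms(3,4) by (simp add: EE_def)
 have "nrm (Sg h U) (Sg (h [^] k) U) y = oC" using Sg_pow_norm[OF assms(1,2) y] assms(5) by simp
 then obtain z where z: "z : fx (Sg (h [^] k) U)" "v (Sg (h [^] k) U) z = oW" "y = act h z -. z"
  using unram_hilbert_90[OF p(1,2) Sg_pow_transversal[OF assms(1,2)] Sg_self[OF f(3,6)] y] by blast
 then show ?thesis using fx_Sg[OF p(3)] vt_Sg[OF p(3) z(1)] by (auto simp: EE_def)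
qed

text \<open>The norm from Sigma runs over inertia and over \<open>m\<close> powers of
  \<open>ph\<close>, where \<open>m\<close> is the P-part of \<open>n\<close>. The norm of
  \<open>a\<close> over inertia is fixed by \<open>ph [^] m\<close>, so the partial norm over all
  \<open>n\<close> powers is the one over \<open>m\<close> powers raised to the exponent n/m =
  P'(n). This is why the exponent occurs in the definition of the morphism.\<close>

lemma fnorm_formula:
 assumes "frob H U h n" and ph: "ph : H" "dr H ph = om" and a: "a : fx (Sg h U)"
 shows "nrm H (Sg h U) a ^: prime_to_P_part P n = NN H U (sm n ph a)"
  and "NN H U (sm n ph a) : fx H"
proof -
 note f = frobD[OF assms(1)]
 note Hs = osD[OF f(2)]
 have phc: "ph : cG" by (rule Hs(4)[OF ph(1)])
 let ?c = "prime_to_P_part P n"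
 obtain m where m: "pnum P m" "n = m * ?c" "?c > 0" "!!p. p : P ==> ~ p dvd ?c"
  using Ppart_decompose[OF f(7) P_prime'] by blast
 obtain A :: "nat set" and t where t: "ltr (inert H) (inert U) A t" using inert_transversal[OF f(2,3,4)] by blast
 have tr: "ltr H (Sg h U) (A \<times> {..<m}) (%x. t (fst x) *. ph [^] (snd x))"
  by (rule Sg_transversal[OF assms(1) t ph m(2,1,3,4)])
 have aC: "a : Cb U" "act h a = a" using a fx_Sg[OF assms(1)] by auto
 have ac: "a : cC" using fxc[OF a] .
 have tc: "t i : cG" if "i : A" for i using ltD(2)[OF t that] inert_carrier[OF f(2)] by blast
 have fin: "finite A" by (rule ltD(1)[OF t])
 have fS: "fi H (Sg h U)" by (rule fi_open[OF f(2) Sg_open[OF assms(1)] Sg_subset[OF assms(1)]])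
 note NF = fiD[OF NN_fi[OF f(1)]]
 let ?b = "NN H U a"
 have b: "?b : Cb H" by (rule nrm_closed[OF NN_fi[OF f(1)] aC(1)])
 have bc: "?b : cC" by (rule fxc[OF b])
 have smm: "sm k ph a : Cb U" "NN H U (sm k ph a) = sm k ph ?b" for k using sm_Cb(1,2)[OF f(1) ph(1) aC(1)] by auto
 have "nrm H (Sg h U) a = (\<Otimes>\<^bsub>C\<^esub>x\<in>A \<times> {..<m}. act (t (fst x) *. ph [^] (snd x)) a)"
  by (rule nrm_eq[OF tr Hs(1) Sg_subgroup[OF assms(1)] Sg_subset[OF assms(1)] a])
 also have "... = (\<Otimes>\<^bsub>C\<^esub>x\<in>A \<times> {..<m}. (%i j. act (t i) (act (ph [^] j) a)) (fst x) (snd x))"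
  using tc phc ac by (intro C.finprod_cong') (auto simp: act_mult)
 also have "... = (\<Otimes>\<^bsub>C\<^esub>i\<in>A. \<Otimes>\<^bsub>C\<^esub>j\<in>{..<m}. act (t i) (act (ph [^] j) a))" using fin tc phc ac by (intro C.finprod_Sigma) auto
 also have "... = (\<Otimes>\<^bsub>C\<^esub>i\<in>A. act (t i) (sm m ph a))"
  unfolding sm_def using tc phc ac by (intro C.finprod_cong') (auto simp: act_finprod)
 also have "... = NN H U (sm m ph a)" by (rule nrm_eq[OF t NF(1-3) smm(1), symmetric])
 finally have e1: "nrm H (Sg h U) a = sm m ph ?b" using smm(2) by simp
 have hb: "act h ?b = ?b" using NN_act[OF f(1,5) aC(1)] aC(2) by simp
 \<comment> \<open>Some \<open>y\<close> in the closure of the powers of \<open>h\<close> has the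
   degree of \<open>ph [^] m\<close>. It fixes \<open>?b\<close> as \<open>h\<close> does, and the
   remaining factor lies in the inertia of \<open>H\<close>.\<close>
 have phmb: "act (ph [^] m) ?b = ?b"
 proof -
  have phm: "ph [^] m : H" "dr H (ph [^] m) = om ^. m" using osub_pow[OF f(2) ph(1)] d_rel_pow[OF f(2) ph(1)] ph(2) by auto
  have "Om.pw n = Om.pw m" by (rule pw_P_part[OF m(2,3,4)])
  then have "dr H (ph [^] m) : Om.pw n" using phm(2) Om.pwI[of om m] by simp
  then obtain y where y: "y : pclosure h" "dr H y = dr H (ph [^] m)" using Sg_d_rel[OF assms(1) phm(1)] by blast
  have yH: "y : H" using pclosure_sub[OF f(2,5)] y(1) by blast
  have yc: "y : cG" by (rule Hs(4)[OF yH])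
  let ?x = "ph [^] m *. inv y"
  have xH: "?x : H" by (intro Hs(6,7) phm yH)
  have "dr H ?x = oW" using d_rel_mult[OF f(2) phm(1) Hs(7)[OF yH]] d_rel_inv[OF f(2) yH] y(2) phm(2) by simp
  then have xI: "?x : inert H" using inert_iff[OF Hs(3)] xH d_rel_eq_1[OF f(2) xH] by blast
  have "y : stab ?b" using pclosure_sub[OF stab_open[OF bc]] y(1) hb f(6) by (auto simp: stab_def)
  then have yb: "act y ?b = ?b" by (simp add: stab_def)
  have "act (ph [^] m) ?b = act (?x *. y) ?b" using phc yc by (simp add: m_assoc)
  also have "... = act ?x (act y ?b)" using phc yc bc by (intro act_mult) auto
  finally show ?thesis using yb xI b by (simp add: fx_iff)
 qed
 have sc: "sm m ph ?b : cC" using phc bc by simp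
 have "NN H U (sm n ph a) = sm (m * ?c) ph ?b" using smm(2)[of n] m(2) by simp
 also have "... = sm ?c (ph [^] m) (sm m ph ?b)" by (rule sm_mult[OF phc bc])
 also have "act (ph [^] m) (sm m ph ?b) = sm m ph ?b"
 proof -
  have "act (ph [^] m) (sm m ph ?b) = sm m ph (act (ph [^] m) ?b)"
   using phc bc by (intro sm_act) (auto simp: nat_pow_mult add.commute)
  then show ?thesis using phmb by simp
 qed
 then have "sm ?c (ph [^] m) (sm m ph ?b) = sm m ph ?b ^: ?c" using phc sc by (intro sm_fixed) auto
 finally show e2: "nrm H (Sg h U) a ^: ?c = NN H U (sm n ph a)" using e1 by simp
 show "NN H U (sm n ph a) : fx H" unfolding e2[symmetric] by (rule fx_pow[OF Hs(3) nrm_closed[OF fS a]])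
qed

end

section \<open>Multiplicativity of the reciprocity map\<close>

lemma (in group) subgroup_nat_pow: "subgroup S G ==> x : S ==> x [^] (k::nat) : S"
 by (induction k) (auto simp: sg_one sg_mult)

context cft
begin

lemma EE_D: "EE U a ==> a : Cb U" "EE U a ==> vt U a = oW" "EE U a ==> a : cC" by (auto simp: EE_def dest: fxc)

lemma EE_cmul: "osub U ==> EE U a ==> EE U b ==> EE U (a *: b)" by (simp add: EE_def vt_cmul fx_closed(2)[OF inert_carrier])

lemma EE_gdiv: "osub U ==> a : Cb U ==> b : Cb U ==> vt U a = vt U b ==> EE U (a -. b)"
 using vt_closed[of U b] by (simp add: EE_def vt_gdiv fx_gdiv[OF inert_carrier])

lemma EE_act: "onorm H U ==> h : H ==> EE U a ==> EE U (act h a)" by (simp add: EE_def vt_act Cb_act)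

lemma EE_sm: "onorm H U ==> h : H ==> EE U a ==> EE U (sm n h a)" by (simp add: EE_def sm_Cb)

text \<open>The commutator of the two elements lies in \<open>U\<close> by normality and has trivial
  degree; it is thus in the inertia of \<open>U\<close>, which fixes \<open>b\<close>.\<close>

lemma inert_commute:
 assumes "onorm H U" "ta : inert H" "g : U" "b : Cb U"
 shows "act ta (act g b) = act g (act ta b)"
proof -
 note U = onD[OF assms(1)]
 note Hs = osD[OF U(1)] and Us = osD[OF U(2)]
 have taH: "ta : H" using assms(2) inert_subset by blast
 have c: "ta : cG" "g : cG" "b : cC" using Hs(4)[OF taH] Us(4)[OF assms(3)] fxc[OF assms(4)] .
 let ?c = "(inv ta *. inv g *. ta) *. g"
 have dta: "d ta = oW" using assms(2) inert_iff[OF Hs(3)] by blast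
 have "?c : U" by (rule Us(6)[OF U(5)[OF taH Us(7)[OF assms(3)]] assms(3)])
 moreover have "d ?c = oW" using c dta by simp
 ultimately have cI: "?c : inert U" using inert_iff[OF Us(3)] by blast
 have "act (ta *. g) b = act (g *. ta *. ?c) b" using c by (simp add: gnorm)
 also have "... = act (g *. ta) (act ?c b)" using c by (intro act_mult) auto
 also have "act ?c b = b" using cI assms(4) by (simp add: fx_iff)
 finally show ?thesis using c by (simp add: act_mult)
qed

text \<open>In Neukirch's argument, the elements of the augmentation subgroup are lifted along the norm
 of an unramified extension of degree \<open>n\<close>, where \<open>n\<close> must be divisible by some number that
 depends on the element. The predicate expresses that such lifts exist.\<close>

definition QQ :: "'g set => 'g set => 'g => 'c => bool" where
 "QQ H U ph b \<longleftrightarrow> (EX k. pnum P k & (ALL n. pnum P n --> k dvd n -->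
  (EX b'. EE U b' & act (ph [^] (n * n)) b' = b' & NN H U b' = oC & sm n (ph [^] n) b' = b)))"

lemma frob_1:
 assumes "onorm H U" "ph : H" "dr H ph = om" "pnum P n"
 shows "frob H U (ph [^] n) n" "frob H U ph 1"
proof -
 show "frob H U ph 1" using assms by (simp add: frob_def)
 from frob_pow[OF this pnum_pos[OF assms(4)]] show "frob H U (ph [^] n) n" by simp
qed

text \<open>Multiples of \<open>k * l\<close> satisfy both divisibility conditions, and then the two
  lifts can be multiplied.\<close>

lemma QQ_cmul:
 assumes "onorm H U" "ph : H" "QQ H U ph a" "QQ H U ph b" shows "QQ H U ph (a *: b)"
proof -
 note U = onD[OF assms(1)]
 have phc: "ph : cG" by (rule osD(4)[OF U(1) assms(2)])
 obtain k where k: "pnum P k" "!!n. pnum P n ==> k dvd n ==>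
  EX b'. EE U b' & act (ph [^] (n * n)) b' = b' & NN H U b' = oC & sm n (ph [^] n) b' = a"
  using assms(3) unfolding QQ_def by metis
 obtain l where l: "pnum P l" "!!n. pnum P n ==> l dvd n ==>
  EX b'. EE U b' & act (ph [^] (n * n)) b' = b' & NN H U b' = oC & sm n (ph [^] n) b' = b"
  using assms(4) unfolding QQ_def by metis
 show ?thesis unfolding QQ_def
 proof (intro exI[of _ "k * l"] conjI allI impI)
  show "pnum P (k * l)" by (rule pnum_mult[OF k(1) l(1)])
  fix n assume n: "pnum P n" "k * l dvd n"
  obtain a' where a': "EE U a'" "act (ph [^] (n * n)) a' = a'" "NN H U a' = oC" "sm n (ph [^] n) a' = a"
   using k(2)[OF n(1) dvd_mult_left[OF n(2)]] by (elim exE conjE) (rule that)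
  obtain b' where b': "EE U b'" "act (ph [^] (n * n)) b' = b'" "NN H U b' = oC" "sm n (ph [^] n) b' = b"
   using l(2)[OF n(1) dvd_mult_right[OF n(2)]] by (elim exE conjE) (rule that)
  have c: "a' : cC" "b' : cC" using EE_D(3) a'(1) b'(1) by auto
  show "EX b'. EE U b' & act (ph [^] (n * n)) b' = b' & NN H U b' = oC & sm n (ph [^] n) b' = a *: b"
   using a' b' c phc EE_cmul[OF U(2) a'(1) b'(1)] nrm_cmul[OF NN_fi[OF assms(1)] EE_D(1)[OF a'(1)] EE_D(1)[OF b'(1)]]
   by (intro exI[of _ "a' *: b'"]) (simp add: act_cmul sm_cmul)
 qed
qed

lemma stab_pow:
 assumes "a : cC" "g : cG"
 shows "EX k. pnum P k & (ALL n. k dvd n --> act (g [^] n) a = a)"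
proof -
 obtain k where k: "pnum P k" "g [^] k : stab a" using pnum_power_mem[OF stab_open[OF assms(1)] assms(2)] by blast
 have "act (g [^] n) a = a" if kn: "k dvd n" for n
 proof -
  obtain m where "n = k * m" using kn by (rule dvdE)
  then have "g [^] n = (g [^] k) [^] m" using assms(2) by (simp add: nat_pow_pow)
  then show ?thesis using act_pow_fixed[of "g [^] k" a m] k(2) assms by (simp add: stab_def)
 qed
 then show ?thesis using k(1) by blast
qed

lemma U_pow:
 assumes "osub U" "g : cG"
 shows "EX k. pnum P k & (ALL n. k dvd n --> g [^] n : U)"
proof -
 obtain k where k: "pnum P k" "g [^] k : U" using pnum_power_mem[OF assms] by blast
 have "g [^] n : U" if kn: "k dvd n" for n
 proof -
  obtain m where "n = k * m" using kn by (rule dvdE)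
  then have "g [^] n = (g [^] k) [^] m" using assms(2) by (simp add: nat_pow_pow)
  then show ?thesis using osub_pow[OF assms(1) k(2), of m] by simp
 qed
 then show ?thesis using k(1) by blast
qed

text \<open>Let \<open>n\<close> be so divisible that \<open>ph [^] n\<close> fixes \<open>w\<close>
  and lies in \<open>U\<close>. Then \<open>w\<close> is the norm of a unit \<open>x\<close> in the
  layer of degree \<open>n\<close> over \<open>ph [^] n\<close>, and (ta x)/x is the lift:
  \<open>ta\<close> commutes with powers of \<open>ph [^] n\<close> on \<open>x\<close>, and being
  inertial it does not change the norm over inertia.\<close>

lemma QQ_augmentation:
 assumes "onorm H U" "ph : H" "dr H ph = om" "ta : inert H" "EE U w"
 shows "QQ H U ph (act ta w -. w)"
proof -
 note U = onD[OF assms(1)]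
 note Hs = osD[OF U(1)]
 have taH: "ta : H" using assms(4) inert_subset by blast
 have c: "ph : cG" "ta : cG" "w : cC" using Hs(4)[OF assms(2)] Hs(4)[OF taH] EE_D(3)[OF assms(5)] .
 obtain k where k: "pnum P k" "!!n. k dvd n ==> act (ph [^] n) w = w" using stab_pow[OF c(3,1)] by blast
 obtain l where l: "pnum P l" "!!n. l dvd n ==> ph [^] n : U" using U_pow[OF U(2) c(1)] by blast
 show ?thesis unfolding QQ_def
 proof (intro exI[of _ "k * l"] conjI allI impI)
  show "pnum P (k * l)" by (rule pnum_mult[OF k(1) l(1)])
  fix n assume n: "pnum P n" "k * l dvd n"
  have phw: "act (ph [^] n) w = w" by (rule k(2)[OF dvd_mult_left[OF n(2)]])
  have phU: "ph [^] i : U" if "n dvd i" for i by (rule l(2)[OF dvd_trans[OF dvd_mult_right[OF n(2)] that]])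
  obtain x where x: "EE U x" "act ((ph [^] n) [^] n) x = x" "sm n (ph [^] n) x = w"
   using unit_norm[OF frob_1(1)[OF assms(1-3) n(1)] n(1) assms(5) phw] by (elim exE conjE) (rule that)
  have xc: "x : cC" by (rule EE_D(3)[OF x(1)])
  have xC: "x : Cb U" by (rule EE_D(1)[OF x(1)])
  have tax: "EE U (act ta x)" by (rule EE_act[OF assms(1) taH x(1)])
  have fx: "act (ph [^] (n * n)) x = x" using x(2) c(1) by (simp add: nat_pow_pow)
  have comm: "act ta (act (ph [^] i) x) = act (ph [^] i) (act ta x)" if "n dvd i" for i
   by (rule inert_commute[OF assms(1,4) phU[OF that] xC])
  have 1: "EE U (act ta x -. x)" by (rule EE_gdiv[OF U(2) EE_D(1)[OF tax] xC]) (simp add: EE_D(2) tax x(1))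
  have 2: "act (ph [^] (n * n)) (act ta x -. x) = act ta x -. x" using comm[of "n * n"] fx c xc by (simp add: act_gdiv)
  have 3: "NN H U (act ta x -. x) = oC" using nrm_cdiv[OF NN_fi[OF assms(1)] EE_D(1)[OF tax] xC] NN_inert[OF assms(1,4) xC]
   fxc[OF nrm_closed[OF NN_fi[OF assms(1)] xC]] by simp
  have "sm n (ph [^] n) (act ta x) = act ta (sm n (ph [^] n) x)"
  proof -
   have "act (ta *. (ph [^] n) [^] i) x = act ((ph [^] n) [^] i *. ta) x" for i :: nat
   using comm[of "n * i"] c xc by (simp add: act_mult nat_pow_pow)
   then show ?thesis using c xc by (intro sm_act[symmetric]) auto
  qed
  then have 4: "sm n (ph [^] n) (act ta x -. x) = act ta w -. w" using c xc x(3) by (simp add: sm_gdiv)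
  show "EX b'. EE U b' & act (ph [^] (n * n)) b' = b' & NN H U b' = oC & sm n (ph [^] n) b' = act ta w -. w"
   using 1 2 3 4 by blast
 qed
qed

text \<open>An element of degree \<open>om\<close> generates all degrees, so every element of
  \<open>H\<close> differs from the closure of its powers by inertia. With \<open>fx_Sg\<close> this
  recognizes C^H inside \<open>Cb H\<close> as the elements fixed by \<open>ph\<close>.\<close>

lemma Sg_full:
 assumes "frob H H ph 1" shows "Sg ph H = H"
proof (rule subset_antisym[OF Sg_subset[OF assms]])
 note f = frobD[OF assms]
 note Hs = osD[OF f(2)]
 show "H <= Sg ph H"
 proof
  fix x assume x: "x : H"
  have "dr H x : Om.pw 1" using d_rel(1)[OF f(2) x] by (simp add: Om.pw_1)
  then obtain y where y: "y : pclosure ph" "dr H y = dr H x" using Sg_d_rel[OF assms x] by blast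
  have yH: "y : H" using pclosure_sub[OF f(2,5)] y(1) by blast
  have j: "inv y *. x : H" by (intro Hs(6,7) x yH)
  have "dr H (inv y *. x) = oW"
   using d_rel_mult[OF f(2) Hs(7)[OF yH] x] d_rel_inv[OF f(2) yH] y(2) d_rel(1)[OF f(2) x] by simp
  then have "inv y *. x : inert H" using inert_iff[OF Hs(3)] j d_rel_eq_1[OF f(2) j] by blast
  moreover have "x = y *. (inv y *. x)" using Hs(4)[OF x] Hs(4)[OF yH] by (simp add: gnorm)
  ultimately show "x : Sg ph H" using y(1) unfolding Sg_iff by blast
 qed
qed

lemma sm_swap:
 assumes "g : cG" "a : cC"
 shows "sm m (g [^] (k::nat)) (sm n g a) = sm n g (sm m (g [^] k) a)"
proof -
 have "sm m (g [^] k) (sm n g a) = (\<Otimes>\<^bsub>C\<^esub>i\<in>{..<m}. \<Otimes>\<^bsub>C\<^esub>j\<in>{..<n}. act (g [^] (k * i + j)) a)" unfolding sm_def[of m]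
 proof (rule C.finprod_cong', simp)
  fix i assume "i : {..<m}"
  have "act ((g [^] k) [^] i) (sm n g a) = (\<Otimes>\<^bsub>C\<^esub>j\<in>{..<n}. act (g [^] (k * i)) (act (g [^] j) a))"
   using assms by (simp add: sm_def act_finprod nat_pow_pow)
  also have "... = (\<Otimes>\<^bsub>C\<^esub>j\<in>{..<n}. act (g [^] (k * i + j)) a)" using assms by (intro C.finprod_cong') (auto simp: act_pow_add)
  finally show "act ((g [^] k) [^] i) (sm n g a) = (\<Otimes>\<^bsub>C\<^esub>j\<in>{..<n}. act (g [^] (k * i + j)) a)" .
 qed (use assms in auto)
 also have "... = (\<Otimes>\<^bsub>C\<^esub>j\<in>{..<n}. \<Otimes>\<^bsub>C\<^esub>i\<in>{..<m}. act (g [^] (k * i + j)) a)" using assms by (intro C.finprod_swap) auto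
 also have "... = sm n g (sm m (g [^] k) a)" unfolding sm_def[of n]
 proof (rule C.finprod_cong', simp)
  fix j assume "j : {..<n}"
  have "act (g [^] j) (sm m (g [^] k) a) = (\<Otimes>\<^bsub>C\<^esub>i\<in>{..<m}. act (g [^] j) (act (g [^] (k * i)) a))"
   using assms by (simp add: sm_def act_finprod nat_pow_pow)
  also have "... = (\<Otimes>\<^bsub>C\<^esub>i\<in>{..<m}. act (g [^] (k * i + j)) a)"
  proof (rule C.finprod_cong', simp)
   fix i assume "i : {..<m}"
   show "act (g [^] j) (act (g [^] (k * i)) a) = act (g [^] (k * i + j)) a"
   using act_pow_add[OF assms, of j "k * i"] by (simp add: add.commute)
  qed (use assms in auto)
  finally show "(\<Otimes>\<^bsub>C\<^esub>i\<in>{..<m}. act (g [^] (k * i + j)) a) = act (g [^] j) (sm m (g [^] k) a)" by simp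
 qed (use assms in auto)
 finally show ?thesis .
qed

text \<open>Neukirch's central argument. With s = ph^n let x' and b be the lifts of x and of (ph
  x)/x along the partial norm of s. Then (ph x')/(x' b) has trivial s-norm, so it is (s z)/z by
  Hilbert 90, which is (ph t)/t for the partial norm t of z along ph. As b has trivial norm, the
  quotient of the norms of x' and t over inertia is fixed by ph and lies in C^H. Taking s-norms, the
  norm of x is the n-th power of this quotient, a norm since [H:U] divides n, times the s-norm of
  the norm of t, which comes from a subgroup of U.\<close>

lemma norm_of_fixed_class:
 assumes "onorm H U" and ph: "ph : H" "dr H ph = om" and x: "EE U x" and Q: "QQ H U ph (act ph x -. x)"
 shows "NN H U x : Nm H U"
proof -
 note U = onD[OF assms(1)]
 note Hs = osD[OF U(1)] and Us = osD[OF U(2)]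
 note NF = NN_fi[OF assms(1)]
 have phc: "ph : cG" by (rule Hs(4)[OF ph(1)])
 obtain k where k: "pnum P k" "!!n. pnum P n ==> k dvd n ==>
  EX b'. EE U b' & act (ph [^] (n * n)) b' = b' & NN H U b' = oC & sm n (ph [^] n) b' = act ph x -. x"
  using Q unfolding QQ_def by metis
 obtain l where l: "pnum P l" "!!n. l dvd n ==> ph [^] n : U" using U_pow[OF U(2) phc] by blast
 obtain r where r: "pnum P r" "!!n. r dvd n ==> act (ph [^] n) x = x" using stab_pow[OF EE_D(3)[OF x] phc] by blast
 let ?i = "idx H U"
 have i: "pnum P ?i" by (rule pnum_index[OF U(2,1,3)])
 \<comment> \<open>The factors provide for the final \<open>n\<close>-th power to be a norm
   (\<open>?i\<close>), for the lift of the augmentation element (\<open>k\<close>), for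
   \<open>ph [^] n\<close> to lie in \<open>U\<close> (\<open>l\<close>) and for it to fix
   \<open>x\<close> (\<open>r\<close>).\<close>
 define n where "n = ?i * (k * (l * r))"
 have n: "pnum P n" unfolding n_def by (intro pnum_mult i k(1) l(1) r(1))
 have dv: "k dvd n" "l dvd n" "r dvd n" by (auto simp: n_def)
 let ?s = "ph [^] n"
 have sc: "?s : cG" using phc by simp
 have sU: "?s : U" by (rule l(2)[OF dv(2)])
 have sH: "?s : H" using sU U(3) by blast
 have sx: "act ?s x = x" by (rule r(2)[OF dv(3)])
 have fs: "frob H U ?s n" by (rule frob_1(1)[OF assms(1) ph n])
 obtain b where b: "EE U b" "act (ph [^] (n * n)) b = b" "NN H U b = oC" "sm n ?s b = act ph x -. x"
  using k(2)[OF n dv(1)] by (elim exE conjE) (rule that)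
 obtain x' where x': "EE U x'" "act (?s [^] n) x' = x'" "sm n ?s x' = x"
  using unit_norm[OF fs n x sx] by (elim exE conjE) (rule that)
 have cc: "x : cC" "b : cC" "x' : cC" using EE_D(3) x b(1) x'(1) by auto
 have sn: "?s [^] n = ph [^] (n * n)" using phc by (simp add: nat_pow_pow)
 have phx': "EE U (act ph x')" by (rule EE_act[OF assms(1) ph(1) x'(1)])
 have comm: "act (?s [^] i) (act ph x') = act ph (act (?s [^] i) x')" for i :: nat
  using phc cc by (simp add: nat_pow_pow act_mult[symmetric]) (metis nat_pow_Suc nat_pow_Suc2)
 let ?y = "act ph x' -. x' -. b"
 have e1: "EE U (act ph x' -. x')"
  by (rule EE_gdiv[OF U(2) EE_D(1)[OF phx'] EE_D(1)[OF x'(1)]]) (simp add: EE_D(2) phx' x'(1))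
 have yE: "EE U ?y" by (rule EE_gdiv[OF U(2) EE_D(1)[OF e1] EE_D(1)[OF b(1)]]) (simp add: EE_D(2) e1 b(1))
 have yc: "?y : cC" by (rule EE_D(3)[OF yE])
 have ys: "act (?s [^] n) ?y = ?y" using comm[of n] x'(2) b(2) phc cc by (simp add: act_gdiv sn)
 have "sm n ?s (act ph x') = act ph (sm n ?s x')" using phc cc comm by (intro sm_act[symmetric]) (auto simp: act_mult)
 then have "sm n ?s ?y = (act ph x -. x) -. (act ph x -. x)" using phc cc x'(3) b(4) by (simp add: sm_gdiv)
 then have y1: "sm n ?s ?y = oC" using phc cc by simp
 obtain z where z: "EE U z" "act (?s [^] n) z = z" "?y = act ?s z -. z"
  using unit_hilbert_90[OF fs n yE ys y1] by (elim exE conjE) (rule that)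
 have zc: "z : cC" by (rule EE_D(3)[OF z(1)])
 let ?t = "sm n ph z"
 have tE: "EE U ?t" by (rule EE_sm[OF assms(1) ph(1) z(1)])
 have tc: "?t : cC" by (rule EE_D(3)[OF tE])
 have ty: "act ph ?t = ?t *: ?y" using sm_telescope[OF phc zc, of n] phc zc tc by (simp add: z(3) C.gdiv_simps C.m_comm)
 have xy: "act ph x' = x' *: b *: ?y" using phc cc by (simp add: C.gdiv_simps C.m_ac)
 let ?N = "NN H U"
 have NC: "?N a : cC" if "EE U a" for a by (rule fxc[OF nrm_closed[OF NF EE_D(1)[OF that]]])
 have Nt: "act ph (?N ?t) = ?N ?t *: ?N ?y"
  using NN_act[OF assms(1) ph(1) EE_D(1)[OF tE]] ty nrm_cmul[OF NF EE_D(1)[OF tE] EE_D(1)[OF yE]] by simp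
 have xbE: "EE U (x' *: b)" by (rule EE_cmul[OF U(2) x'(1) b(1)])
 have Nx: "act ph (?N x') = ?N x' *: ?N ?y"
  using NN_act[OF assms(1) ph(1) EE_D(1)[OF x'(1)]] xy nrm_cmul[OF NF EE_D(1)[OF xbE] EE_D(1)[OF yE]]
   nrm_cmul[OF NF EE_D(1)[OF x'(1)] EE_D(1)[OF b(1)]] b(3) NC[OF x'(1)] by simp
 let ?z = "?N x' -. ?N ?t"
 have zC: "?z : Cb H"
  by (rule fx_gdiv[OF inert_carrier[OF U(1)] nrm_closed[OF NF EE_D(1)[OF x'(1)]] nrm_closed[OF NF EE_D(1)[OF tE]]])
 have phz: "act ph ?z = ?z" using Nt Nx phc NC[OF x'(1)] NC[OF tE] NC[OF yE] by (simp add: act_gdiv C.gdiv_simps C.m_ac)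
 have fH: "frob H H ph 1" by (rule frob_1(2)[OF onorm_self[OF U(1)] ph n])
 have zH: "?z : fx H" using fx_Sg[OF fH] Sg_full[OF fH] zC phz by simp
 have zcc: "?z : cC" by (rule fxc[OF zH])
 have fU: "fi H U" by (rule fi_normal[OF assms(1)])
 note Ns = Nm_subgroup[OF fU]
 have "?z ^: n : Nm H U"
 proof -
  have "?z ^: ?i : Nm H U" unfolding nrm_fixed[OF fU zH, symmetric] Nm_eq using fx_mono[OF U(3) zH] by blast
  then have "(?z ^: ?i) ^: (k * (l * r)) : Nm H U" by (rule C.subgroup_nat_pow[OF Ns])
  then have "?z ^: (?i * (k * (l * r))) : Nm H U" using zcc by (simp add: C.nat_pow_pow)
  then show ?thesis unfolding n_def[symmetric] .
 qed
 moreover have "sm n ?s (?N ?t) : Nm H U"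
 proof -
  let ?u = "sm n ?s z"
  have uE: "EE U ?u" by (rule EE_sm[OF assms(1) sH z(1)])
  have uc: "?u : cC" by (rule EE_D(3)[OF uE])
  \<comment> \<open>Because \<open>z\<close> is fixed by the \<open>n\<close>-th power of
    \<open>?s\<close>, telescoping shows that its partial norm \<open>?u\<close> is fixed by
    \<open>?s\<close> itself.\<close>
  have "act ?s ?u *: z = z *: ?u" using sm_telescope[OF sc zc, of n] z(2) by simp
  then have "act ?s ?u *: z = ?u *: z" using zc uc by (simp add: C.m_comm)
  then have "act ?s ?u = ?u" using sc zc uc C.right_cancel by simp
  then have u: "?u : fx (Sg ?s U)" using fx_Sg[OF fs] EE_D(1)[OF uE] by blast
  have SU: "Sg ?s U <= U" by (rule Sg_minimal[OF U(2) sU inert_subset])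
  have fS: "fi U (Sg ?s U)" by (rule fi_open[OF U(2) Sg_open[OF fs] SU])
  have "sm n ?s (?N ?t) = ?N (sm n ?s ?t)" by (rule sm_Cb(2)[OF assms(1) sH EE_D(1)[OF tE], symmetric])
  also have "sm n ?s ?t = sm n ph ?u" by (rule sm_swap[OF phc zc])
  also have "?N (sm n ph ?u) = nrm H (Sg ?s U) ?u ^: prime_to_P_part P n" by (rule fnorm_formula(1)[OF fs ph u, symmetric])
  also have "... = nrm H (Sg ?s U) ?u" using Ppart_pnum[OF n P_prime']
   fxc[OF nrm_closed[OF fi_open[OF U(1) Sg_open[OF fs] Sg_subset[OF fs]] u]] by simp
  also have "... = nrm H U (nrm U (Sg ?s U) ?u)" by (rule nrm_tower[OF fU fS u])
  finally show ?thesis unfolding Nm_eq using nrm_closed[OF fS u] by blast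
 qed
 moreover have "?N x = ?z ^: n *: sm n ?s (?N ?t)"
 proof -
  have "?N x = ?N (sm n ?s x')" using x'(3) by simp
  also have "... = sm n ?s (?N x')" by (rule sm_Cb(2)[OF assms(1) sH EE_D(1)[OF x'(1)]])
  also have "?N x' = ?z *: ?N ?t" using NC[OF x'(1)] NC[OF tE] by (simp add: C.gdiv_simps)
  also have "sm n ?s (?z *: ?N ?t) = sm n ?s ?z *: sm n ?s (?N ?t)" by (rule sm_cmul[OF sc zcc NC[OF tE]])
  also have "sm n ?s ?z = ?z ^: n"
  proof (rule sm_fixed[OF sc zcc])
   show "act ?s ?z = ?z" using zH sH by (simp add: fx_iff)
  qed
  finally show ?thesis .
 qed
 ultimately show ?thesis using sg_mult[OF Ns] by simp
qed

text \<open>By \<open>prim_iff\<close> these are the prime elements of C^Sigma, expressed over the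
  fixed field of inertia, where elements belonging to different lifts \<open>h\<close> can be
  compared.\<close>

definition prim :: "'g set => 'g => 'c => bool" where
 "prim U h a \<longleftrightarrow> a : Cb U & act h a = a & vt U a = om"

lemma prim_iff:
 assumes "frob H U h n" shows "prime_element om M v (Sg h U) a \<longleftrightarrow> prim U h a"
proof -
 have "vt U a = v (Sg h U) a" if "a : fx (Sg h U)" by (rule vt_Sg[OF assms that])
 then show ?thesis unfolding prime_element_def prim_def using fx_Sg[OF assms, of a] by auto
qed

lemma prim_exists:
 assumes "frob H U h n" shows "EX a. prim U h a"
 using v_props(3)[OF Sg_open[OF assms]] prim_iff[OF assms] by (auto simp: prime_element_def)

text \<open>The element of C^H whose norm class is the value of the Fesenko-Neukirch morphism;
  \<open>n\<close> stands for mult(d_H(h)).\<close>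

definition rval :: "'g set => 'g set => 'g => nat => 'c => 'c" where
 "rval H U h n a = nrm H (Sg h U) a ^: prime_to_P_part P n"

lemma rval_formula:
 assumes "frob H U h n" "ph : H" "dr H ph = om" "prim U h a"
 shows "rval H U h n a = NN H U (sm n ph a)" "rval H U h n a : fx H"
proof -
 have "a : fx (Sg h U)" using fx_Sg[OF assms(1)] assms(4) by (simp add: prim_def)
 then show "rval H U h n a = NN H U (sm n ph a)" "rval H U h n a : fx H"
  unfolding rval_def using fnorm_formula[OF assms(1-3)] by auto
qed

lemma vt_sm:
 assumes "onorm H U" "g : H" "a : Cb U" shows "vt U (sm n g a) = vt U a ^. n"
proof (induction n)
 case 0
 show ?case using vt_one[OF onD(2)[OF assms(1)]] by simp
next
 case (Suc n)
 note U = onD[OF assms(1)]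
 have g: "g : cG" by (rule osD(4)[OF U(1) assms(2)])
 have gi: "g [^] n : H" by (rule osub_pow[OF U(1) assms(2)])
 show ?case using Suc sm_Suc[OF g fxc[OF assms(3)], of n] vt_act[OF assms(1) gi assms(3)]
   vt_cmul[OF U(2) Cb_act[OF assms(1) gi assms(3)] sm_Cb(1)[OF assms(1,2,3)], of n]
   Om.Om_comm[OF vt_closed[OF U(2) assms(3)], of "vt U a ^. n"] vt_closed[OF U(2) assms(3)] by simp
qed

text \<open>\<open>ph [^] n\<close> and \<open>h\<close> have the same degree. On elements fixed by
  \<open>h\<close> their quotient acts like \<open>ph [^] n\<close>, so the powers of
  \<open>ph\<close> produced by telescoping can be traded for inertia elements.\<close>

lemma frobenius_defect:
 assumes "frob H U h n" "ph : H" "dr H ph = om"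
 shows "ph [^] n *. inv h : inert H"
  and "a : cC ==> act h a = a ==> act (ph [^] n *. inv h) a = act (ph [^] n) a"
proof -
 note f = frobD[OF assms(1)]
 note Hs = osD[OF f(2)]
 have phn: "ph [^] n : H" "dr H (ph [^] n) = om ^. n"
  using osub_pow[OF f(2) assms(2)] d_rel_pow[OF f(2) assms(2)] assms(3) by auto
 have x: "ph [^] n *. inv h : H" by (intro Hs(6,7) phn f(5))
 have "dr H (ph [^] n *. inv h) = oW"
  using d_rel_mult[OF f(2) phn(1) Hs(7)[OF f(5)]] d_rel_inv[OF f(2,5)] phn(2) f(8) by simp
 then show "ph [^] n *. inv h : inert H" using inert_iff[OF Hs(3)] x d_rel_eq_1[OF f(2) x] by blast
 assume a: "a : cC" "act h a = a"
 have "act (inv h) a = a" using act_inv_cancel[OF f(6) a(1)] a(2) by simp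
 then show "act (ph [^] n *. inv h) a = act (ph [^] n) a"
  using act_mult[of "ph [^] n" "inv h" a] Hs(4)[OF phn(1)] f(6) a(1) by simp
qed

lemma frob_mult:
 assumes "frob H U h1 n1" "frob H U h2 n2" shows "frob H U (h1 *. h2) (n1 + n2)"
proof -
 note F1 = frobD[OF assms(1)] and F2 = frobD[OF assms(2)]
 have "dr H (h1 *. h2) = om ^. (n1 + n2)" using d_rel_mult[OF F1(2,5) F2(5)] F1(8) F2(8) by (simp add: Om.nat_pow_mult)
 then show ?thesis using F1 F2 osD(6)[OF F1(2)] by (simp add: frob_def)
qed

text \<open>Compare the partial norms of the three prime elements, the second one twisted by
  \<open>ph [^] n1\<close>. The twist is harmless, since the norm of that element over inertia lies
  in C^H. The quotient \<open>?x\<close> is a unit, and by telescoping (ph x)/x becomes a product of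
  two augmentation elements for inertia, to which \<open>norm_of_fixed_class\<close>
  applies.\<close>

lemma rval_mult:
 assumes f1: "frob H U h1 n1" and f2: "frob H U h2 n2"
  and p1: "prim U h1 a1" and p2: "prim U h2 a2" and p3: "prim U (h1 *. h2) a3"
 shows "rval H U (h1 *. h2) (n1 + n2) a3 -. (rval H U h1 n1 a1 *: rval H U h2 n2 a2) : Nm H U"
proof -
 note F1 = frobD[OF f1] and F2 = frobD[OF f2]
 note Hs = osD[OF F1(2)] and N = F1(1)
 note f3 = frob_mult[OF f1 f2]
 note F3 = frobD[OF f3]
 obtain ph where ph: "ph : H" "dr H ph = om" using d_rel_surj[OF F1(2), of om] by auto
 have phc: "ph : cG" by (rule Hs(4)[OF ph(1)])
 let ?p = "ph [^] n1"
 have pH: "?p : H" by (rule osub_pow[OF F1(2) ph(1)])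
 have pc: "?p : cG" using phc by simp
 have P1: "a1 : Cb U" "act h1 a1 = a1" "vt U a1 = om" "a1 : cC"
  and P2: "a2 : Cb U" "act h2 a2 = a2" "vt U a2 = om" "a2 : cC"
  and P3: "a3 : Cb U" "act (h1 *. h2) a3 = a3" "vt U a3 = om" "a3 : cC" using p1 p2 p3 fxc by (auto simp: prim_def)
 let ?s1 = "sm n1 ph a1" and ?s2 = "sm n2 ph a2" and ?s3 = "sm (n1 + n2) ph a3"
 have sC: "?s1 : Cb U" "?s2 : Cb U" "?s3 : Cb U" using sm_Cb(1)[OF N ph(1)] P1(1) P2(1) P3(1) by auto
 have sc: "?s1 : cC" "?s2 : cC" "?s3 : cC" using sC fxc by auto
 have psC: "act ?p ?s2 : Cb U" by (rule Cb_act[OF N pH sC(2)])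
 let ?x = "?s3 -. (?s1 *: act ?p ?s2)"
 have ssC: "?s1 *: act ?p ?s2 : Cb U" by (rule fx_closed(2)[OF inert_carrier[OF F1(3)] sC(1) psC])
 have vs: "vt U ?s3 = vt U (?s1 *: act ?p ?s2)"
  using vt_sm[OF N ph(1)] P1 P2 P3 vt_cmul[OF F1(3) sC(1) psC] vt_act[OF N pH sC(2)] by (simp add: Om.nat_pow_mult)
 have xE: "EE U ?x" by (rule EE_gdiv[OF F1(3) sC(3) ssC vs])
 let ?t1 = "ph [^] n1 *. inv h1" and ?t2 = "ph [^] n2 *. inv h2" and ?t3 = "ph [^] (n1 + n2) *. inv (h1 *. h2)"
 note D1 = frobenius_defect[OF f1 ph] and D2 = frobenius_defect[OF f2 ph] and D3 = frobenius_defect[OF f3 ph]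
 \<comment> \<open>Conjugating the second defect by \<open>?p\<close> makes the defects
   multiplicative: \<open>?t3 = ?t *. ?t1\<close>.\<close>
 let ?t = "?p *. ?t2 *. inv ?p"
 have tI: "?t : inert H" by (rule inert_normal(1)[OF onorm_self[OF F1(2)] pH D2(1)])
 have tc: "?t1 : cG" "?t2 : cG" "?t : cG" using phc F1(6) F2(6) by auto
 have t3: "?t3 = ?t *. ?t1"
 proof -
  have "ph [^] (n1 + n2) = ?p *. ph [^] n2" using phc by (simp add: nat_pow_mult)
  then show ?thesis using phc F1(6) F2(6) by (simp add: gnorm)
 qed
 let ?A = "act ?t1 a3" and ?B = "act ?p a2"
 have t1H: "?t1 : H" using D1(1) inert_subset by blast
 have AC: "?A : Cb U" by (rule Cb_act[OF N t1H P3(1)])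
 have BC: "?B : Cb U" by (rule Cb_act[OF N pH P2(1)])
 have Ac: "?A : cC" "?B : cC" using AC BC fxc by auto
 have w1: "EE U (?A -. ?B)"
  by (rule EE_gdiv[OF F1(3) AC BC]) (simp add: vt_act[OF N t1H P3(1)] vt_act[OF N pH P2(1)] P2(3) P3(3))
 have w2: "EE U (a3 -. a1)" by (rule EE_gdiv[OF F1(3) P3(1) P1(1)]) (simp add: P1(3) P3(3))
 have q: "QQ H U ph ((act ?t (?A -. ?B) -. (?A -. ?B)) *: (act ?t1 (a3 -. a1) -. (a3 -. a1)))"
  by (rule QQ_cmul[OF N ph(1) QQ_augmentation[OF N ph tI w1] QQ_augmentation[OF N ph D1(1) w2]])
 have T1: "act ph ?s1 = (act ?t1 a1 *: ?s1) -. a1"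
  using sm_telescope[OF phc P1(4), of n1] D1(2)[OF P1(4,2)] phc P1(4) sc tc by (simp add: C.gdiv_simps)
 have T3: "act ph ?s3 = (act ?t ?A *: ?s3) -. a3"
 proof -
  have "act (ph [^] (n1 + n2)) a3 = act ?t ?A" using D3(2)[OF P3(4,2)] t3 act_mult[OF tc(3,1) P3(4)] by simp
  then show ?thesis using sm_telescope[OF phc P3(4), of "n1 + n2"] phc P3(4) sc tc Ac by (simp add: C.gdiv_simps)
 qed
 have T2: "act ph (act ?p ?s2) = (act ?t ?B *: act ?p ?s2) -. ?B"
 proof -
  have e: "act ?t ?B = act ?p (act (ph [^] n2) a2)"
  proof -
   have "act ?t ?B = act (?t *. ?p) a2" by (rule act_mult[OF tc(3) pc P2(4), symmetric])
   also have "?t *. ?p = ?p *. ?t2" using pc tc(2) by (simp add: m_assoc)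
   also have "act (?p *. ?t2) a2 = act ?p (act ?t2 a2)" by (rule act_mult[OF pc tc(2) P2(4)])
   finally show ?thesis using D2(2)[OF P2(4,2)] by simp
  qed
  have "act ph (act ?p ?s2) = act ?p (act ph ?s2)"
  proof -
   have "ph *. ?p = ?p *. ph" by (metis nat_pow_Suc nat_pow_Suc2 phc)
   then show ?thesis using phc pc sc by (simp add: act_mult[symmetric])
  qed
  also have "act ph ?s2 = (act (ph [^] n2) a2 *: ?s2) -. a2"
   using sm_telescope[OF phc P2(4), of n2] phc P2(4) sc by (simp add: C.gdiv_simps)
  also have "act ?p ((act (ph [^] n2) a2 *: ?s2) -. a2) = (act ?t ?B *: act ?p ?s2) -. ?B"
   unfolding e using phc pc sc P2(4) by (simp add: act_gdiv act_cmul)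
  finally show ?thesis .
 qed
 have "act ph ?x -. ?x = (act ?t (?A -. ?B) -. (?A -. ?B)) *: (act ?t1 (a3 -. a1) -. (a3 -. a1))"
 proof -
  \<comment> \<open>With these terms abstracted, the equation is pure cancellation in an abelian
    group.\<close>
  define S1 S2 S3 tA tB ta1 A B where "S1 = ?s1" and "S2 = act ?p ?s2" and "S3 = ?s3"
   and "tA = act ?t ?A" and "tB = act ?t ?B" and "ta1 = act ?t1 a1" and "A = ?A" and "B = ?B"
  have cl: "S1 : cC" "S2 : cC" "S3 : cC" "tA : cC" "tB : cC"
   "ta1 : cC" "A : cC" "B : cC" unfolding S1_def S2_def S3_def tA_def tB_def ta1_def A_def B_def
   using sc Ac tc pc P1(4) by auto
  have l: "act ph (S3 -. (S1 *: S2)) = act ph S3 -. (act ph S1 *: act ph S2)" using cl phc by (simp add: act_gdiv act_cmul)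
  have r: "act ?t (?A -. ?B) = tA -. tB" "act ?t1 (a3 -. a1) = A -. ta1"
   unfolding tA_def tB_def ta1_def A_def using tc Ac P1(4) P3(4) by (simp_all add: act_gdiv)
  have "act ph (S3 -. (S1 *: S2)) -. (S3 -. (S1 *: S2)) = ((tA -. tB) -. (A -. B)) *: ((A -. ta1) -. (a3 -. a1))"
   unfolding l T1[folded S1_def ta1_def] T2[folded S2_def tB_def B_def] T3[folded S3_def tA_def]
   using cl P1(4) P3(4) by (simp add: C.gdiv_simps C.m_ac)
  then show ?thesis unfolding r unfolding S1_def S2_def S3_def A_def B_def .
 qed
 then have "NN H U ?x : Nm H U" using norm_of_fixed_class[OF N ph xE] q by simp
 moreover have "NN H U ?x = NN H U ?s3 -. (NN H U ?s1 *: NN H U (act ?p ?s2))"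
  using nrm_cdiv[OF NN_fi[OF N] sC(3) ssC] nrm_cmul[OF NN_fi[OF N] sC(1) psC] by simp
 moreover have "NN H U (act ?p ?s2) = NN H U ?s2"
  using NN_act[OF N pH sC(2)] rval_formula[OF f2 ph p2] pH by (simp add: fx_iff)
 ultimately show "rval H U (h1 *. h2) (n1 + n2) a3 -. (rval H U h1 n1 a1 *: rval H U h2 n2 a2) : Nm H U"
  using rval_formula(1)[OF f1 ph p1] rval_formula(1)[OF f2 ph p2] rval_formula(1)[OF f3 ph p3] by simp
qed

text \<open>Two prime elements differ by a unit \<open>?w\<close> fixed by \<open>h\<close>.
  Telescoping its partial norm leaves (t w)/w for the inertia element \<open>?t\<close>, so
  \<open>norm_of_fixed_class\<close> applies again.\<close>

lemma rval_indep_prime: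
 assumes f: "frob H U h n" and p: "prim U h a" "prim U h b"
 shows "rval H U h n a -. rval H U h n b : Nm H U"
proof -
 note F = frobD[OF f]
 note Hs = osD[OF F(2)] and N = F(1)
 obtain ph where ph: "ph : H" "dr H ph = om" using d_rel_surj[OF F(2), of om] by auto
 have phc: "ph : cG" by (rule Hs(4)[OF ph(1)])
 have P: "a : Cb U" "act h a = a" "vt U a = om" "a : cC" "b : Cb U" "act h b = b" "vt U b = om" "b : cC"
  using p fxc by (auto simp: prim_def)
 let ?w = "a -. b"
 let ?t = "ph [^] n *. inv h"
 note D = frobenius_defect[OF f ph]
 have tc: "?t : cG" using phc F(6) by simp
 have wE: "EE U ?w" by (rule EE_gdiv[OF F(3) P(1,5)]) (simp add: P)
 have wc: "?w : cC" by (rule EE_D(3)[OF wE])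
 have "act h ?w = ?w" using P F(6) by (simp add: act_gdiv)
 then have tw: "act ?t ?w = act (ph [^] n) ?w" by (rule D(2)[OF wc])
 have xE: "EE U (sm n ph ?w)" by (rule EE_sm[OF N ph(1) wE])
 have "act ph (sm n ph ?w) -. sm n ph ?w = act ?t ?w -. ?w"
  unfolding tw using sm_telescope[OF phc wc, of n] phc wc EE_D(3)[OF xE] by (simp add: C.gdiv_eq_gdiv)
 then have "NN H U (sm n ph ?w) : Nm H U" using norm_of_fixed_class[OF N ph xE] QQ_augmentation[OF N ph D(1) wE] by simp
 moreover have "NN H U (sm n ph ?w) = rval H U h n a -. rval H U h n b"
  unfolding rval_formula(1)[OF f ph p(1)] rval_formula(1)[OF f ph p(2)] sm_gdiv[OF phc P(4,8)]
  by (rule nrm_cdiv[OF NN_fi[OF N] sm_Cb(1)[OF N ph(1) P(1)] sm_Cb(1)[OF N ph(1) P(5)]])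
 ultimately show ?thesis by simp
qed

end

section \<open>The reciprocity relation and its functoriality\<close>

context comm_group
begin

lemma cong_refl: "subgroup S G ==> x : carrier G ==> gdiv x x : S" by (simp add: sg_one)

lemma cong_sym:
 assumes "subgroup S G" "x : carrier G" "y : carrier G" "gdiv x y : S" shows "gdiv y x : S"
 using sg_inv[OF assms(1,4)] assms by (simp add: inv_gdiv)

lemma cong_trans:
 assumes "subgroup S G" "x : carrier G" "y : carrier G" "z : carrier G" "gdiv x y : S" "gdiv y z : S"
 shows "gdiv x z : S"
proof -
 have "gdiv x y *. gdiv y z = gdiv x z" using assms by (simp add: gdiv_simps m_ac)
 then show ?thesis using sg_mult[OF assms(1,5,6)] by simp
qed

lemma cong_mult:
 assumes "subgroup S G" "x : carrier G" "y : carrier G" "z : carrier G" "w : carrier G"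
  "gdiv x y : S" "gdiv z w : S"
 shows "gdiv (x *. z) (y *. w) : S"
proof -
 have "gdiv x y *. gdiv z w = gdiv (x *. z) (y *. w)" using assms by (simp add: gdiv_simps m_ac)
 then show ?thesis using sg_mult[OF assms(1,6,7)] by simp
qed

lemma cong_mem:
 assumes "subgroup S G" "x : carrier G" "y : S" shows "gdiv x y : S \<longleftrightarrow> x : S"
proof
 have y: "y : carrier G" by (rule sg_mem[OF assms(1,3)])
 assume "gdiv x y : S"
 then have "gdiv x y *. y : S" by (rule sg_mult[OF assms(1) _ assms(3)])
 then show "x : S" using assms y by (simp add: gdiv_def m_assoc)
qed (use assms in \<open>simp add: gdiv_in_subgroup\<close>)

end

context cft
begin

text \<open>The graph of the reciprocity map on representatives in H and C^H, saturated modulo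
  \<open>U\<close> and modulo norms. Lift and prime element are existentially quantified; that they
  do not matter is the content of \<open>RR_unique\<close>.\<close>

definition RR :: "'g set => 'g set => 'g => 'c => bool" where
 "RR H U x a \<longleftrightarrow> x : H & a : fx H & (EX h n pe. frob H U h n & prim U h pe & h *. inv x : U &
  a -. rval H U h n pe : Nm H U)"

lemma RR_D: "RR H U x a ==> x : H" "RR H U x a ==> a : fx H" "RR H U x a ==> a : cC" by (auto simp: RR_def dest: fxc)

lemma rval_closed:
 assumes "frob H U h n" "prim U h pe" shows "rval H U h n pe : fx H" "rval H U h n pe : cC"
proof -
 obtain ph where ph: "ph : H" "dr H ph = om" using d_rel_surj[OF frobD(2)[OF assms(1)], of om] by auto
 show "rval H U h n pe : fx H" by (rule rval_formula(2)[OF assms(1) ph assms(2)])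
 then show "rval H U h n pe : cC" by (rule fxc)
qed

lemma Nm_sub: "onorm H U ==> subgroup (Nm H U) C" by (rule Nm_subgroup[OF fi_normal])

lemma Nm_fx: "onorm H U ==> a : Nm H U ==> a : fx H" using Nm_subset[OF fi_normal] by blast

text \<open>For \<open>h\<close> in \<open>U\<close> the group Sigma lies in \<open>U\<close>, and
  the norm from Sigma factors through the norm from \<open>U\<close>.\<close>

lemma rval_in_U:
 assumes "frob H U h n" "prim U h pe" "h : U" shows "rval H U h n pe : Nm H U"
proof -
 note f = frobD[OF assms(1)]
 have SU: "Sg h U <= U" by (rule Sg_minimal[OF f(3) assms(3) inert_subset])
 have p: "pe : fx (Sg h U)" using fx_Sg[OF assms(1)] assms(2) by (simp add: prim_def)
 have fS: "fi U (Sg h U)" by (rule fi_open[OF f(3) Sg_open[OF assms(1)] SU])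
 have "nrm H (Sg h U) pe = nrm H U (nrm U (Sg h U) pe)" by (rule nrm_tower[OF fi_normal[OF f(1)] fS p])
 then have "nrm H (Sg h U) pe : Nm H U" unfolding Nm_eq using nrm_closed[OF fS p] by blast
 then show ?thesis unfolding rval_def by (rule C.subgroup_nat_pow[OF Nm_sub[OF f(1)]])
qed

text \<open>Lifts of equal degree differ by inertia of \<open>U\<close>, so they have common prime
  elements. Otherwise \<open>h'\<close> is \<open>h\<close> times a Frobenius lift inside
  \<open>U\<close> of degree \<open>n' - n\<close>; multiplicativity applies, and the second factor
  contributes a norm by \<open>rval_in_U\<close>.\<close>

lemma rval_indep_lift_le:
 assumes f: "frob H U h n" and f': "frob H U h' n'" and p: "prim U h pe" and p': "prim U h' pe'"
  and hh: "h' *. inv h : U" and le: "n <= n'"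
 shows "rval H U h' n' pe' -. rval H U h n pe : Nm H U"
proof -
 note F = frobD[OF f] and F' = frobD[OF f']
 note Hs = osD[OF F(2)] and Us = osD[OF F(3)]
 note S = Nm_sub[OF F(1)]
 note c = rval_closed[OF f p] and c' = rval_closed[OF f' p']
 obtain ph where ph: "ph : H" "dr H ph = om" using d_rel_surj[OF F(2), of om] by auto
 show ?thesis
 proof (cases "n = n'")
  case True
  have j: "h' *. inv h : H" by (intro Hs(6,7) F(5) F'(5))
  have "dr H (h' *. inv h) = oW" using d_rel_mult[OF F(2) F'(5) Hs(7)[OF F(5)]] d_rel_inv[OF F(2,5)] F(8) F'(8) True by simp
  then have jI: "h' *. inv h : inert U" using inert_iff[OF Us(3)] hh d_rel_eq_1[OF F(2) j] by blast
  have pec: "pe : cC" using p fxc by (auto simp: prim_def)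
  have "act h' pe = act ((h' *. inv h) *. h) pe" using F(6) F'(6) by (simp add: m_assoc)
  also have "... = act (h' *. inv h) (act h pe)" using F(6) F'(6) pec by (intro act_mult) auto
  finally have "act h' pe = pe" using p jI by (simp add: prim_def fx_iff)
  then have p2: "prim U h' pe" using p by (simp add: prim_def)
  have "rval H U h n pe = rval H U h' n' pe" using rval_formula(1)[OF f ph p] rval_formula(1)[OF f' ph p2] True by simp
  then show ?thesis using rval_indep_prime[OF f' p' p2] by simp
 next
  case False
  let ?t = "inv h *. h'"
  have tU: "?t : U"
  proof -
   have "inv h *. (h' *. inv h) *. h : U" by (rule onD(5)[OF F(1,5) hh])
   then show ?thesis using F(6) F'(6) by (simp add: m_assoc)
  qed
  have "dr H ?t = /^ (om ^. n) *^ om ^. n'"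
   using d_rel_mult[OF F(2) Hs(7)[OF F(5)] F'(5)] d_rel_inv[OF F(2,5)] F(8) F'(8) by simp
  also have "om ^. n' = om ^. n *^ om ^. (n' - n)" using le by (simp add: Om.nat_pow_mult)
  finally have "dr H ?t = om ^. (n' - n)" by (simp add: Om.gnorm)
  then have ft: "frob H U ?t (n' - n)" using F(1) tU F(4) le False by (auto simp: frob_def)
  obtain rh where rh: "prim U ?t rh" using prim_exists[OF ft] by blast
  have e: "h *. ?t = h'" "n + (n' - n) = n'" using F(6) F'(6) le by (auto simp: gnorm)
  have "rval H U h' n' pe' -. (rval H U h n pe *: rval H U ?t (n' - n) rh) : Nm H U"
   using rval_mult[OF f ft p rh, of pe'] p' e by simp
  moreover have "rval H U ?t (n' - n) rh : Nm H U" by (rule rval_in_U[OF ft rh tU])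
  moreover note rval_closed[OF ft rh]
  moreover have "rval H U h' n' pe' -. (rval H U h n pe *: rval H U ?t (n' - n) rh) =
   (rval H U h' n' pe' -. rval H U h n pe) -. rval H U ?t (n' - n) rh"
   using c c' rval_closed[OF ft rh] by (simp add: C.gdiv_simps)
  ultimately show ?thesis using C.cong_mem[OF S] c c' by simp
 qed
qed

lemma rval_indep_lift:
 assumes f: "frob H U h n" and f': "frob H U h' n'" and p: "prim U h pe" and p': "prim U h' pe'"
  and hh: "h' *. inv h : U"
 shows "rval H U h' n' pe' -. rval H U h n pe : Nm H U"
proof (cases "n <= n'")
 case True
 then show ?thesis by (rule rval_indep_lift_le[OF assms])
next
 case False
 note F = frobD[OF f] and F' = frobD[OF f']
 have "inv (h' *. inv h) : U" by (rule osD(7)[OF F(3) hh])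
 then have "h *. inv h' : U" using F(6) F'(6) by (simp add: gnorm)
 then have "rval H U h n pe -. rval H U h' n' pe' : Nm H U" using False by (intro rval_indep_lift_le[OF f' f p' p]) auto
 then show ?thesis using C.cong_sym[OF Nm_sub[OF F(1)]] rval_closed(2)[OF f p] rval_closed(2)[OF f' p'] by blast
qed

lemma RR_frob:
 assumes "frob H U h n" "prim U h pe" shows "RR H U h (rval H U h n pe)" unfolding RR_def
 using assms frobD[OF assms(1)] rval_closed[OF assms] osD(5)[of U]
  C.cong_refl[OF Nm_sub[OF frobD(1)[OF assms(1)]]] by (intro conjI exI[of _ h] exI[of _ n] exI[of _ pe]) auto

lemma frob_lift:
 assumes "onorm H U" "x : H" shows "EX h n. frob H U h n & h *. inv x : U"
proof -
 note U = onD[OF assms(1)]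
 obtain u n where u: "u : U" "n > 0" "dr H (u *. x) = om ^. (n::nat)" using frobenius_lift[OF U(1-3) assms(2)] by blast
 have c: "u : cG" "x : cG" using osD(4)[OF U(2) u(1)] osD(4)[OF U(1) assms(2)] .
 have "u *. x : H" using osD(6)[OF U(1) _ assms(2)] u(1) U(3) by blast
 then have "frob H U (u *. x) n" using assms(1) u by (simp add: frob_def)
 moreover have "(u *. x) *. inv x : U" using u(1) c by (simp add: m_assoc)
 ultimately show ?thesis by blast
qed

lemma RR_cong:
 assumes "onorm H U" "RR H U x a" "y : H" "x *. inv y : U" "b : fx H" "b -. a : Nm H U"
 shows "RR H U y b"
proof -
 note U = onD[OF assms(1)]
 obtain h n pe where h: "frob H U h n" "prim U h pe" "h *. inv x : U" "a -. rval H U h n pe : Nm H U"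
  using assms(2) unfolding RR_def by blast
 have c: "x : cG" "y : cG" "h : cG" using osD(4)[OF U(1)] RR_D(1)[OF assms(2)] assms(3) frobD(6)[OF h(1)] by auto
 have "(h *. inv x) *. (x *. inv y) : U" by (rule osD(6)[OF U(2) h(3) assms(4)])
 then have "h *. inv y : U" using c by (simp add: gnorm)
 moreover have "b -. rval H U h n pe : Nm H U"
  by (rule C.cong_trans[OF Nm_sub[OF assms(1)] fxc[OF assms(5)] RR_D(3)[OF assms(2)]
   rval_closed(2)[OF h(1,2)] assms(6) h(4)])
 ultimately show ?thesis unfolding RR_def using assms(3,5) h(1,2) by blast
qed

lemma RR_exists: "onorm H U ==> x : H ==> EX a. RR H U x a"
proof -
 assume N: "onorm H U" and x: "x : H"
 obtain h n where h: "frob H U h n" "h *. inv x : U" using frob_lift[OF N x] by blast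
 obtain pe where pe: "prim U h pe" using prim_exists[OF h(1)] by blast
 note R = RR_frob[OF h(1) pe]
 show ?thesis using RR_cong[OF N R x h(2) RR_D(2)[OF R] C.cong_refl[OF Nm_sub[OF N] RR_D(3)[OF R]]] by blast
qed

lemma RR_unique:
 assumes "onorm H U" "RR H U x a" "RR H U x b" shows "a -. b : Nm H U"
proof -
 note U = onD[OF assms(1)] and S = Nm_sub[OF assms(1)]
 obtain h n pe where h: "frob H U h n" "prim U h pe" "h *. inv x : U" "a -. rval H U h n pe : Nm H U"
  using assms(2) unfolding RR_def by blast
 obtain k m rh where k: "frob H U k m" "prim U k rh" "k *. inv x : U" "b -. rval H U k m rh : Nm H U"
  using assms(3) unfolding RR_def by blast
 have c: "x : cG" "h : cG" "k : cG" using osD(4)[OF U(1)] RR_D(1)[OF assms(2)] frobD(6)[OF h(1)] frobD(6)[OF k(1)] by auto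
 have "(h *. inv x) *. inv (k *. inv x) : U" by (rule osD(6)[OF U(2) h(3) osD(7)[OF U(2) k(3)]])
 then have "h *. inv k : U" using c by (simp add: gnorm)
 then have hk: "rval H U h n pe -. rval H U k m rh : Nm H U" by (rule rval_indep_lift[OF k(1) h(1) k(2) h(2)])
 note rc = rval_closed(2)[OF h(1,2)] rval_closed(2)[OF k(1,2)] RR_D(3)[OF assms(2)] RR_D(3)[OF assms(3)]
 have "rval H U k m rh -. b : Nm H U" by (rule C.cong_sym[OF S rc(4,2) k(4)])
 then show ?thesis by (rule C.cong_trans[OF S rc(3,1,4) h(4) C.cong_trans[OF S rc(1,2,4) hk]])
qed

lemma RR_mult:
 assumes "onorm H U" "RR H U x a" "RR H U y b" shows "RR H U (x *. y) (a *: b)"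
proof -
 note U = onD[OF assms(1)] and S = Nm_sub[OF assms(1)]
 note Hs = osD[OF U(1)]
 obtain h n pe where h: "frob H U h n" "prim U h pe" "h *. inv x : U" "a -. rval H U h n pe : Nm H U"
  using assms(2) unfolding RR_def by blast
 obtain k m rh where k: "frob H U k m" "prim U k rh" "k *. inv y : U" "b -. rval H U k m rh : Nm H U"
  using assms(3) unfolding RR_def by blast
 have xy: "x : H" "y : H" using RR_D(1) assms(2,3) by auto
 have c: "x : cG" "y : cG" "h : cG" "k : cG" using Hs(4) xy frobD(6)[OF h(1)] frobD(6)[OF k(1)] by auto
 note fk = frob_mult[OF h(1) k(1)]
 obtain sg where sg: "prim U (h *. k) sg" using prim_exists[OF fk] by blast
 note R = RR_frob[OF fk sg]
 note rc = rval_closed(2)[OF h(1,2)] rval_closed(2)[OF k(1,2)] RR_D(3)[OF assms(2)] RR_D(3)[OF assms(3)] RR_D(3)[OF R]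
 have "(h *. inv x) *. (x *. (k *. inv y) *. inv x) : U" by (rule osD(6)[OF U(2) h(3) U(4)[OF xy(1) k(3)]])
 then have 1: "(h *. k) *. inv (x *. y) : U" using c by (simp add: gnorm)
 have ab: "a *: b : fx H" by (rule fx_closed(2)[OF Hs(3) RR_D(2)[OF assms(2)] RR_D(2)[OF assms(3)]])
 have 2: "(a *: b) -. (rval H U h n pe *: rval H U k m rh) : Nm H U" by (rule C.cong_mult[OF S rc(3,1,4,2) h(4) k(4)])
 have 3: "(rval H U h n pe *: rval H U k m rh) -. rval H U (h *. k) (n + m) sg : Nm H U"
  using C.cong_sym[OF S rc(5) C.m_closed[OF rc(1,2)] rval_mult[OF h(1) k(1) h(2) k(2) sg]] .
 have "(a *: b) -. rval H U (h *. k) (n + m) sg : Nm H U" by (rule C.cong_trans[OF S _ _ rc(5) 2 3]) (use rc in auto)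
 then show ?thesis by (rule RR_cong[OF assms(1) R Hs(6)[OF xy] 1 ab])
qed

lemma RR_U: "onorm H U ==> x : U ==> RR H U x a \<longleftrightarrow> a : Nm H U"
proof
 assume N: "onorm H U" and x: "x : U"
 note U = onD[OF N]
 have xH: "x : H" and xc: "x : cG" using x U(3) osD(4)[OF U(2)] by auto
 obtain h n where h: "frob H U h n" "h *. inv x : U" using frob_lift[OF N xH] by blast
 obtain pe where pe: "prim U h pe" using prim_exists[OF h(1)] by blast
 have "(h *. inv x) *. x : U" by (rule osD(6)[OF U(2) h(2) x])
 then have "h : U" using xc frobD(6)[OF h(1)] by (simp add: m_assoc)
 then have r: "rval H U h n pe : Nm H U" by (rule rval_in_U[OF h(1) pe])
 note R = RR_frob[OF h(1) pe]
 {
  assume "RR H U x a"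
  moreover have "RR H U x (rval H U h n pe)"
   by (rule RR_cong[OF N R xH h(2) RR_D(2)[OF R] C.cong_refl[OF Nm_sub[OF N] RR_D(3)[OF R]]])
  ultimately have "a -. rval H U h n pe : Nm H U" by (rule RR_unique[OF N])
  then show "a : Nm H U" using C.cong_mem[OF Nm_sub[OF N] RR_D(3)[OF \<open>RR H U x a\<close>] r] by blast
 next
  assume a: "a : Nm H U"
  show "RR H U x a" by (rule RR_cong[OF N R xH h(2) Nm_fx[OF N a] C.gdiv_in_subgroup[OF Nm_sub[OF N] a r]])
 }
qed

lemma RR_pow: "onorm H U ==> RR H U x a ==> RR H U (x [^] (k::nat)) (a ^: k)"
proof (induction k)
 case 0
 then show ?case using RR_U[of H U \<one> "oC"] osD(5)[OF onD(2)] sg_one[OF Nm_sub] by simp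
next
 case (Suc k)
 then show ?case using RR_mult[OF Suc.prems(1) Suc.IH Suc.prems(2)] by simp
qed

lemma RR_change:
 assumes "onorm H U" "RR H U x a" "y : H" "x *. inv y : U" shows "RR H U y a"
 by (rule RR_cong[OF assms RR_D(2)[OF assms(2)] C.cong_refl[OF Nm_sub[OF assms(1)] RR_D(3)[OF assms(2)]]])

lemma RR_inv:
 assumes "onorm H U" "RR H U x a" shows "RR H U (inv x) (/: a)"
proof -
 note U = onD[OF assms(1)]
 note Hs = osD[OF U(1)]
 have xi: "inv x : H" "x : cG" using Hs RR_D(1)[OF assms(2)] by auto
 obtain b where b: "RR H U (inv x) b" using RR_exists[OF assms(1) xi(1)] by blast
 have "RR H U (x *. inv x) (a *: b)" by (rule RR_mult[OF assms b])
 then have ab: "a *: b : Nm H U" using RR_U[OF assms(1) osD(5)[OF U(2)]] xi by simp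
 have c: "a : cC" "b : cC" using RR_D(3) assms(2) b by auto
 have "/: a -. b = /: (a *: b)" using c by (simp add: C.gdiv_def C.inv_mult)
 then have "/: a -. b : Nm H U" using sg_inv[OF Nm_sub[OF assms(1)] ab] by simp
 moreover have "(inv x) *. inv (inv x) : U" using xi osD(5)[OF U(2)] by simp
 ultimately show ?thesis using RR_cong[OF assms(1) b xi(1) _ fx_closed(3)[OF Hs(3) RR_D(2)[OF assms(2)]]] by blast
qed

section \<open>Compatibility with conjugation, induction and transfer\<close>

lemma act_pow: "g : cG ==> a : cC ==> act g (a ^: (k::nat)) = act g a ^: k"
 using group_hom.hom_nat_pow[OF act_group_hom] by auto

lemma vt_conj:
 assumes "osub U" "a : Cb U" "g : cG"
 shows "act g a : Cb (cs g U)" "vt (cs g U) (act g a) = vt U a"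
proof -
 note S = Cb_stab[OF assms(1,2)]
 note Us = osD[OF assms(1)]
 show "act g a : Cb (cs g U)" using fx_act[OF assms(2,3) inert_carrier[OF assms(1)]] inert_conj[OF assms(3) Us(3)] by simp
 have "inert (cs g (stab a Int U)) = inert (cs g U)"
  using inert_conj[OF assms(3) osD(3)[OF S(1)]] inert_conj[OF assms(3) Us(3)] S(2) by simp
 then have "vt (cs g U) (act g a) = v (cs g (stab a Int U)) (act g a)"
  by (intro vt_eq(2) osub_conj assms S(1) fx_act[OF S(3) assms(3) osD(3)[OF S(1)]])
 then show "vt (cs g U) (act g a) = vt U a" using v_props(4)[OF S(1) assms(3) S(3)] by (simp add: vt_def)
qed

lemma Nm_conj:
 assumes "fi H U" "g : cG" "b : Nm H U" shows "act g b : Nm (cs g H) (cs g U)"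
proof -
 obtain w where w: "w : fx U" "b = nrm H U w" using assms(3) by (auto simp: Nm_eq)
 show ?thesis unfolding w(2) nrm_conj[OF assms(1) w(1) assms(2)] Nm_eq
  using fx_act[OF w(1) assms(2) fiD(5)[OF assms(1)]] by blast
qed

lemma RR_conj:
 assumes "onorm H U" "RR H U x a" "g : cG"
 shows "RR (cs g H) (cs g U) (ce g x) (act g a)"
proof -
 note U = onD[OF assms(1)]
 note Hs = osD[OF U(1)]
 let ?H = "cs g H" and ?U = "cs g U"
 obtain h n pe where h: "frob H U h n" "prim U h pe" "h *. inv x : U" "a -. rval H U h n pe : Nm H U"
  using assms(2) unfolding RR_def by blast
 note f' = frob_conj[OF h(1) assms(3)]
 note F = frobD[OF h(1)]
 have x: "x : H" "x : cG" using RR_D(1)[OF assms(2)] Hs(4) by auto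
 have p: "pe : Cb U" "act h pe = pe" "vt U pe = om" "pe : cC" using h(2) fxc by (auto simp: prim_def)
 have pef: "pe : fx (Sg h U)" using fx_Sg[OF h(1)] p by simp
 have "act (ce g h) (act g pe) = act g (act h pe)"
  using F(6) assms(3) p(4) by (simp add: act_mult[symmetric] conj_elt_def gnorm)
 then have p': "prim ?U (ce g h) (act g pe)" using vt_conj[OF U(2) p(1) assms(3)] p(2,3) by (simp add: prim_def)
 have fS: "fi H (Sg h U)" by (rule fi_open[OF U(1) Sg_open[OF h(1)] Sg_subset[OF h(1)]])
 have r: "rval ?H ?U (ce g h) n (act g pe) = act g (rval H U h n pe)"
  unfolding rval_def Sg_conj[OF assms(3) F(6) U(2), symmetric] nrm_conj[OF fS pef assms(3), symmetric]
  by (rule act_pow[OF assms(3) fxc[OF nrm_closed[OF fS pef]], symmetric])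
 have "act g a -. rval ?H ?U (ce g h) n (act g pe) : Nm ?H ?U"
  unfolding r using Nm_conj[OF fi_normal[OF assms(1)] assms(3) h(4)] RR_D(3)[OF assms(2)]
   rval_closed(2)[OF h(1,2)] assms(3) by (simp add: act_gdiv)
 moreover have "ce g h *. inv (ce g x) : ?U"
 proof -
  have "ce g h *. inv (ce g x) = ce g (h *. inv x)" using F(6) x(2) assms(3) by (simp add: conj_elt_def gnorm)
  then show ?thesis using h(3) by (auto simp: conj_set_def)
 qed
 moreover have "ce g x : ?H" using x(1) by (auto simp: conj_set_def)
 moreover have "act g a : fx ?H" by (rule fx_act[OF RR_D(2)[OF assms(2)] assms(3) Hs(3)])
 ultimately show ?thesis unfolding RR_def using f' p' by blast
qed

lemma Nm_ind:
 assumes "onorm H U" "onorm I V" "I <= H" "V <= U" "b : Nm I V"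
 shows "nrm H I b : Nm H U"
proof -
 note U = onD[OF assms(1)] and V = onD[OF assms(2)]
 obtain w where w: "w : fx V" "b = nrm I V w" using assms(5) by (auto simp: Nm_eq)
 have fHI: "fi H I" by (rule fi_open[OF U(1) V(1) assms(3)])
 have fUV: "fi U V" by (rule fi_open[OF U(2) V(2) assms(4)])
 have "nrm H I b = nrm H V w" unfolding w(2) by (rule nrm_tower[OF fHI fi_normal[OF assms(2)] w(1), symmetric])
 also have "... = nrm H U (nrm U V w)" by (rule nrm_tower[OF fi_normal[OF assms(1)] fUV w(1)])
 finally show ?thesis unfolding Nm_eq using nrm_closed[OF fUV w(1)] by blast
qed

text \<open>A lift for \<open>I\<close> is one for \<open>H\<close>, with degree multiplied by the
  P-number \<open>fdeg H I\<close>, so that the exponent P' stays the same. Since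
  \<open>Sg h V\<close> and \<open>Sg h U\<close> have equal images under \<open>d\<close>, the norm
  between them takes prime elements to prime elements.\<close>

lemma RR_ind:
 assumes N: "onorm H U" and N': "onorm I V" and sub: "I <= H" "V <= U" and R: "RR I V x a"
 shows "RR H U x (nrm H I a)"
proof -
 note U = onD[OF N] and V = onD[OF N']
 obtain h n pe where h: "frob I V h n" "prim V h pe" "h *. inv x : V" "a -. rval I V h n pe : Nm I V"
  using R unfolding RR_def by blast
 note F = frobD[OF h(1)]
 let ?f = "fdeg H I"
 have fH: "frob H U h (n * ?f)" by (rule frob_sub[OF h(1) N sub(1)])
 let ?S = "Sg h U" and ?T = "Sg h V"
 have oS: "osub ?S" and oT: "osub ?T" using Sg_open[OF fH] Sg_open[OF h(1)] .
 have "inert V <= ?S" using inert_mono[OF sub(2)] inert_subset_Sg[OF U(2) F(6)] by blast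
 then have TS: "?T <= ?S" by (rule Sg_minimal[OF oS Sg_self[OF U(2) F(6)]])
 have fHI: "fi H I" by (rule fi_open[OF U(1) V(1) sub(1)])
 have fST: "fi ?S ?T" by (rule fi_open[OF oS oT TS])
 have fHS: "fi H ?S" by (rule fi_open[OF U(1) oS Sg_subset[OF fH]])
 have fIT: "fi I ?T" by (rule fi_open[OF V(1) oT Sg_subset[OF h(1)]])
 have pe: "pe : fx ?T" "v ?T pe = om" using fx_Sg[OF h(1)] h(2) vt_Sg[OF h(1), of pe] by (auto simp: prim_def)
 have "fdeg cG I = fdeg cG H * ?f" using fdeg_tower[OF carrier_open U(1) V(1) _ sub(1)] osD(3)[OF U(1)] by blast
 then have "d ` ?S = d ` ?T" using Sg_dimage[OF fH] Sg_dimage[OF h(1)] by (simp add: ac_simps)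
 then have "fdeg ?S ?T = 1" using fdeg_le_1_iff[OF oS oT TS] by blast
 then have v1: "v ?S (nrm ?S ?T pe) = om" using v_props(6)[OF oS oT TS pe(1)] pe(2) by simp
 have cS: "nrm ?S ?T pe : fx ?S" by (rule nrm_closed[OF fST pe(1)])
 then have p: "prim U h (nrm ?S ?T pe)" using fx_Sg[OF fH] vt_Sg[OF fH cS] v1 by (simp add: prim_def)
 have r: "rval H U h (n * ?f) (nrm ?S ?T pe) = nrm H I (rval I V h n pe)"
 proof -
  have pp: "prime_to_P_part P (n * ?f) = prime_to_P_part P n"
   using Ppart_pnum_mult[OF dimage_transversal(3)[OF U(1) V(1) sub(1)] F(7) P_prime'] by (simp add: mult.commute)
  have "nrm H ?S (nrm ?S ?T pe) = nrm H I (nrm I ?T pe)"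
   using nrm_tower[OF fHS fST pe(1)] nrm_tower[OF fHI fIT pe(1)] by simp
  then show ?thesis unfolding rval_def pp using nrm_pow[OF fHI nrm_closed[OF fIT pe(1)]] by simp
 qed
 have rc: "rval I V h n pe : fx I" by (rule rval_closed(1)[OF h(1,2)])
 have aI: "a : fx I" by (rule RR_D(2)[OF R])
 have "nrm H I (a -. rval I V h n pe) : Nm H U" by (rule Nm_ind[OF N N' sub h(4)])
 then have "nrm H I a -. rval H U h (n * ?f) (nrm ?S ?T pe) : Nm H U" unfolding r nrm_cdiv[OF fHI aI rc] .
 moreover have "h *. inv x : U" using h(3) sub(2) by blast
 moreover have "x : H" using RR_D(1)[OF R] sub(1) by blast
 moreover have "nrm H I a : fx H" by (rule nrm_closed[OF fHI aI])
 ultimately show ?thesis unfolding RR_def using fH p by blast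
qed

text \<open>The Frobenius prescription and the transfer decompose along the same orbits, those of
  \<open>h\<close> on the right cosets of \<open>I\<close>: the orbit of \<open>r e\<close>
  contributes the factor \<open>y e\<close> to the transfer and the norm from
  \<open>Sg (y e) U\<close> to the value over \<open>I\<close>. The group \<open>A\<close> with
  \<open>ps\<close> and \<open>ka\<close> is left open, so that the result serves for the quotient
  of C^I by norms, in \<open>Nm_res\<close>, and for the abelianization of I/U, in
  \<open>fib_res\<close>.\<close>

lemma RR_res:
 assumes N: "onorm H U" and oI: "osub I" and sub: "I <= H" "U <= I"
  and R: "RR H U x a" and t: "!!R. R : rcosets\<^bsub>G(|carrier := H|)\<^esub> I ==> t R : R"
  and A: "comm_group A" and ps: "ps : hom (G(|carrier := I|)) A" and ka: "ka : hom (ob M I) A"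
  and pska: "!!y b. RR I U y b ==> ps y = ka b"
 shows "ka a = (\<Otimes>\<^bsub>A\<^esub>R\<in>rcosets\<^bsub>G(|carrier := H|)\<^esub> I. ps (t R *. x *. inv (t (R #> x))))"
proof -
 note U = onD[OF N]
 note Hs = osD[OF U(1)] and Is = osD[OF oI]
 interpret A: comm_group A by fact
 let ?H = "G(|carrier := H|)"
 interpret H: group ?H by (rule subgroup_imp_group[OF Hs(1)])
 have NI: "onorm I U" using sub U by (intro onI[OF oI U(2)]) auto
 have psc: "ps y : carrier A" if "y : I" for y using ps that by (auto simp: hom_def)
 have psm: "ps (y *. z) = ps y *.\<^bsub>A\<^esub> ps z" if "y : I" "z : I" for y z using ps that by (auto simp: hom_def)
 have kac: "ka b : carrier A" if "b : fx I" for b using ka that by (auto simp: hom_def)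
 have kam: "ka (b *: c) = ka b *.\<^bsub>A\<^esub> ka c" if "b : fx I" "c : fx I" for b c using ka that by (auto simp: hom_def)
 have ps1: "ps u = \<one>\<^bsub>A\<^esub>" if "u : U" for u
 proof -
  have r: "RR I U u oC" using RR_U[OF NI that] sg_one[OF Nm_sub[OF NI]] by simp
  have "ka (oC *: oC) = ka oC *.\<^bsub>A\<^esub> ka oC" using kam fx_closed(1)[OF Is(3)] by blast
  then have "ka oC = \<one>\<^bsub>A\<^esub>" using kac[OF fx_closed(1)[OF Is(3)]] A.l_cancel_one[of "ka oC" "ka oC"] by simp
  then show ?thesis using pska[OF r] by simp
 qed
 have kaNm: "ka b = \<one>\<^bsub>A\<^esub>" if b: "b : Nm I U" for b
  using pska[of \<one> b] RR_U[OF NI osD(5)[OF U(2)]] b ps1[OF osD(5)[OF U(2)]] by simp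
 obtain h n pe where h: "frob H U h n" "prim U h pe" "h *. inv x : U" "a -. rval H U h n pe : Nm H U"
  using R unfolding RR_def by blast
 note F = frobD[OF h(1)]
 have xH: "x : H" "x : cG" using RR_D(1)[OF R] Hs(4) by auto
 have IH: "subgroup I ?H" using subgroup_incl[OF Is(1) Hs(1) sub(1)] .
 obtain T where T: "ltr H I {..<idx H I} T" using osub_transversal[OF oI Hs(1) sub(1)] by blast
 have finR: "finite (rcosets\<^bsub>?H\<^esub> I)" using ltr_rcosets[OF T Hs(1) Is(1)] by (simp add: bij_betw_finite[symmetric])
 have psH: "ps : hom (?H(|carrier := I|)) A" using ps by (simp add: hom_def)
 have invH: "inv\<^bsub>?H\<^esub> y = inv y" if "y : H" for y using m_inv_consistent[OF Hs(1) that] .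
 obtain D r l where D: "finite D" "!!e. e : D ==> r e : carrier ?H" "!!e. e : D ==> (l e :: nat) > 0"
  "!!e. e : D ==> r e *.\<^bsub>?H\<^esub> h [^]\<^bsub>?H\<^esub> l e *.\<^bsub>?H\<^esub> inv\<^bsub>?H\<^esub> (r e) : I"
  "!!e j. e : D ==> j < l e ==> r e *.\<^bsub>?H\<^esub> h [^]\<^bsub>?H\<^esub> j *.\<^bsub>?H\<^esub> inv\<^bsub>?H\<^esub> (r e) : I ==> j = 0"
  "bij_betw (%(e, j). I #>\<^bsub>?H\<^esub> (r e *.\<^bsub>?H\<^esub> h [^]\<^bsub>?H\<^esub> j)) (Sigma (D :: 'g set set set) (%e. {..<l e})) (rcosets\<^bsub>?H\<^esub> I)"
  "!!e e' j. e : D ==> e' : D ==> I #>\<^bsub>?H\<^esub> (r e *.\<^bsub>?H\<^esub> h [^]\<^bsub>?H\<^esub> (j::nat)) = I #>\<^bsub>?H\<^esub> r e' ==> e = e'"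
  using H.transfer_orbits_exist[OF IH finR, of h] F(5) by auto
 have hp: "h [^]\<^bsub>?H\<^esub> (j::nat) = h [^] j" for j by (simp add: nat_pow_consistent[symmetric])
 have rH: "r e : H" "r e : cG" if "e : D" for e using D(2)[OF that] Hs(4) by auto
 define y where "y e = r e *. h [^] l e *. inv (r e)" for e
 have yI: "y e : I" if "e : D" for e using D(4)[OF that] rH(1)[OF that] by (simp add: y_def hp invH)
 have least: "j = 0" if "e : D" "j < l e" "r e *. h [^] j *. inv (r e) : I" for e j
  using D(5)[OF that(1,2)] that(3) rH(1)[OF that(1)] by (simp add: hp invH)
 have tH: "t R : H" if "R : rcosets\<^bsub>?H\<^esub> I" for R using t[OF that] H.rcosets_part_G[OF IH] that by auto
 \<comment> \<open>In the transfer \<open>x\<close> may be replaced by its Frobenius lift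
   \<open>h\<close>: each factor changes by an element of the normal subgroup \<open>U\<close>,
   which \<open>ps\<close> kills.\<close>
 have "(\<Otimes>\<^bsub>A\<^esub>R\<in>rcosets\<^bsub>?H\<^esub> I. ps (t R *. x *. inv (t (R #> x)))) =
   (\<Otimes>\<^bsub>A\<^esub>R\<in>rcosets\<^bsub>?H\<^esub> I. ps (t R *. h *. inv (t (R #> h))))"
 proof (rule A.finprod_cong', simp)
  show "(%R. ps (t R *. h *. inv (t (R #> h)))) : (rcosets\<^bsub>?H\<^esub> I) \<rightarrow> carrier A"
  proof
   fix R assume R: "R : rcosets\<^bsub>?H\<^esub> I"
   have "R #>\<^bsub>?H\<^esub> h : rcosets\<^bsub>?H\<^esub> I" using H.rcos_act_bij[OF IH, of h] F(5) R by (auto simp: bij_betw_def)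
   then have "t R *. h *. inv (t (R #> h)) : I"
   using H.transfer_term_closed(3)[OF IH _ t R, of h] F(5) tH[of "R #> h"] by (simp add: invH)
   then show "ps (t R *. h *. inv (t (R #> h))) : carrier A" by (rule psc)
  qed
  fix R assume R: "R : rcosets\<^bsub>?H\<^esub> I"
  obtain z where z: "z : H" "R = I #> z" using R by (auto simp: RCOSETS_def)
  have zc: "z : cG" by (rule Hs(4)[OF z(1)])
  have "z *. h *. inv (z *. x) : I"
  proof -
   have "z *. (h *. inv x) *. inv z : I" using U(4)[OF z(1) h(3)] sub(2) by blast
   then show ?thesis using zc F(6) xH by (simp add: gnorm)
  qed
  then have "I #> (z *. h) = I #> (z *. x)" using rcos_eq_iff[OF Is(1)] zc F(6) xH by simp
  then have Rhx: "R #> h = R #> x" using z(2) zc F(6) xH Is(3) by (simp add: coset_mult_assoc)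
  have Rx: "R #> x : rcosets\<^bsub>?H\<^esub> I" using H.rcos_act_bij[OF IH, of x] xH R by (auto simp: bij_betw_def)
  have tx: "t R *. x *. inv (t (R #> x)) : I"
   using H.transfer_term_closed(3)[OF IH _ t R, of x] xH(1) tH[OF Rx] by (simp add: invH)
  have tc: "t R : cG" "t (R #> x) : cG" using Hs(4) tH[OF R] tH[OF Rx] by auto
  have u: "t R *. (h *. inv x) *. inv (t R) : U" by (rule U(4)[OF tH[OF R] h(3)])
  have "t R *. h *. inv (t (R #> h)) = (t R *. (h *. inv x) *. inv (t R)) *. (t R *. x *. inv (t (R #> x)))"
   unfolding Rhx using tc F(6) xH by (simp add: gnorm)
  then have "ps (t R *. h *. inv (t (R #> h))) =
   ps (t R *. (h *. inv x) *. inv (t R)) *.\<^bsub>A\<^esub> ps (t R *. x *. inv (t (R #> x)))" using psm[OF _ tx] u sub(2) by auto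
  then show "ps (t R *. x *. inv (t (R #> x))) = ps (t R *. h *. inv (t (R #> h)))" using ps1[OF u] psc[OF tx] by simp
 qed
 also have "... = (\<Otimes>\<^bsub>A\<^esub>e\<in>D. ps (y e))"
 proof -
  have "(\<Otimes>\<^bsub>A\<^esub>R\<in>rcosets\<^bsub>?H\<^esub> I. ps (t R *.\<^bsub>?H\<^esub> h *.\<^bsub>?H\<^esub> inv\<^bsub>?H\<^esub> (t (R #>\<^bsub>?H\<^esub> h)))) =
   (\<Otimes>\<^bsub>A\<^esub>e\<in>D. ps (r e *.\<^bsub>?H\<^esub> h [^]\<^bsub>?H\<^esub> l e *.\<^bsub>?H\<^esub> inv\<^bsub>?H\<^esub> (r e)))"
   by (rule H.transfer_orbits[OF IH finR _ A psH t D(1-4,6)]) (use F(5) in simp)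
  moreover have "(\<Otimes>\<^bsub>A\<^esub>e\<in>D. ps (r e *.\<^bsub>?H\<^esub> h [^]\<^bsub>?H\<^esub> l e *.\<^bsub>?H\<^esub> inv\<^bsub>?H\<^esub> (r e))) = (\<Otimes>\<^bsub>A\<^esub>e\<in>D. ps (y e))"
   using rH psc yI by (intro A.finprod_cong') (auto simp: y_def hp invH)
  moreover have "(\<Otimes>\<^bsub>A\<^esub>R\<in>rcosets\<^bsub>?H\<^esub> I. ps (t R *.\<^bsub>?H\<^esub> h *.\<^bsub>?H\<^esub> inv\<^bsub>?H\<^esub> (t (R #>\<^bsub>?H\<^esub> h)))) =
   (\<Otimes>\<^bsub>A\<^esub>R\<in>rcosets\<^bsub>?H\<^esub> I. ps (t R *. h *. inv (t (R #> h))))"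
  proof (rule A.finprod_cong', simp)
   fix R assume R: "R : rcosets\<^bsub>?H\<^esub> I"
   have Rh: "R #>\<^bsub>?H\<^esub> h : rcosets\<^bsub>?H\<^esub> I" using H.rcos_act_bij[OF IH, of h] F(5) R by (auto simp: bij_betw_def)
   show "ps (t R *.\<^bsub>?H\<^esub> h *.\<^bsub>?H\<^esub> inv\<^bsub>?H\<^esub> (t (R #>\<^bsub>?H\<^esub> h))) = ps (t R *. h *. inv (t (R #> h)))"
   using tH[OF Rh] by (simp add: invH)
  next
   show "(%R. ps (t R *. h *. inv (t (R #> h)))) : (rcosets\<^bsub>?H\<^esub> I) \<rightarrow> carrier A"
   proof
   fix R assume R: "R : rcosets\<^bsub>?H\<^esub> I"
   have "R #>\<^bsub>?H\<^esub> h : rcosets\<^bsub>?H\<^esub> I" using H.rcos_act_bij[OF IH, of h] F(5) R by (auto simp: bij_betw_def)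
   then have "t R *. h *. inv (t (R #> h)) : I"
   using H.transfer_term_closed(3)[OF IH _ t R, of h] F(5) tH[of "R #> h"] by (simp add: invH)
   then show "ps (t R *. h *. inv (t (R #> h))) : carrier A" by (rule psc)
   qed
  qed
  ultimately show ?thesis by simp
 qed
 also have "... = ka a"
 proof -
  let ?S = "Sg h U"
  let ?c = "prime_to_P_part P n"
  have oS: "osub ?S" by (rule Sg_open[OF h(1)])
  note Ss = osD[OF oS]
  have pe: "pe : fx ?S" "v ?S pe = om" "pe : cC" using fx_Sg[OF h(1)] h(2) vt_Sg[OF h(1), of pe] fxc by (auto simp: prim_def)
  define h' where "h' e = ce (r e) h" for e
  have hc: "h' e : H" "h' e : cG" if "e : D" for e using Hs(6,7) rH[OF that] F(5,6) by (auto simp: h'_def conj_elt_def)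
  have fh': "frob H U (h' e) n" if "e : D" for e using frob_conj[OF h(1) rH(2)[OF that]] cs_self(1)[OF N rH(1)[OF that]]
   cs_self(1)[OF onorm_self[OF U(1)] rH(1)[OF that]] by (simp add: h'_def)
  have h'p: "h' e [^] (j::nat) = r e *. h [^] j *. inv (r e)" if "e : D" for e j
  proof (induction j)
   case 0
   then show ?case using rH(2)[OF that] by simp
  next
   case (Suc j)
   then show ?case using rH(2)[OF that] F(6) by (simp add: h'_def conj_elt_def gnorm)
  qed
  have h'l: "h' e [^] l e = y e" if "e : D" for e using h'p[OF that] by (simp add: y_def)
  have SgC: "cs (r e) ?S = Sg (h' e) U" if "e : D" for e
   using Sg_conj[OF rH(2)[OF that] F(6) U(2)] cs_self(1)[OF N rH(1)[OF that]] by (simp add: h'_def)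
  have fy: "frob H U (y e) (n * l e)" if "e : D" for e using frob_pow[OF fh'[OF that] D(3)[OF that]] h'l[OF that] by simp
  \<comment> \<open>Some P-number exponent brings \<open>h' e\<close> into \<open>I\<close>; by
    minimality of the return time it is a multiple of \<open>l e\<close>.\<close>
  have lP: "pnum P (l e)" if e: "e : D" for e
  proof -
   obtain k where k: "pnum P k" "h' e [^] k : I" using pnum_power_mem[OF oI hc(2)[OF e]] by blast
   have hk: "h' e [^] (k mod l e) : I"
   proof -
   have "h' e [^] k = h' e [^] (k mod l e) *. (y e) [^] (k div l e)"
   using hc(2)[OF e] by (simp add: h'l[OF e, symmetric] nat_pow_pow nat_pow_mult)
   then have "h' e [^] (k mod l e) = h' e [^] k *. inv ((y e) [^] (k div l e))"
   using hc(2)[OF e] Is(4)[OF yI[OF e]] by (simp add: m_assoc)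
   then show ?thesis using Is(6,7) k(2) osub_pow[OF oI yI[OF e]] by simp
   qed
   have "k mod l e = 0" using least[OF e _ ] hk h'p[OF e] D(3)[OF e] by simp
   then show ?thesis using pnum_dvd[OF k(1)] by (simp add: mod_eq_0_iff_dvd)
  qed
  \<comment> \<open>The local term of the Mackey decomposition: the conjugate of Sigma by
    \<open>r e\<close> meets \<open>I\<close> exactly in the Sigma group of
    \<open>y e\<close>.\<close>
  have SI: "Sg (h' e) U Int I = Sg (y e) U" if e: "e : D" for e
  proof (intro subset_antisym subsetI)
   fix s assume s: "s : Sg (h' e) U Int I"
   obtain i z where iz: "i < l e" "z : Sg (y e) U" "s = h' e [^] i *. z"
   using Sg_decompose[OF fh'[OF e] D(3)[OF e], of s] s h'l[OF e] by auto
   have zI: "z : I" using Sg_minimal[OF oI yI[OF e]] inert_subset[of U] sub(2) iz(2) by blast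
   have "h' e [^] i = s *. inv z" using iz(3) hc(2)[OF e] Is(4)[OF zI] by (simp add: m_assoc)
   then have "h' e [^] i : I" using Is(6,7) zI s by simp
   then have "i = 0" using least[OF e iz(1)] h'p[OF e] by simp
   then show "s : Sg (y e) U" using iz Is(4)[OF zI] by simp
  next
   fix s assume s: "s : Sg (y e) U"
   have "s : I" using Sg_minimal[OF oI yI[OF e]] inert_subset[of U] sub(2) s by blast
   then show "s : Sg (h' e) U Int I" using Sg_pow_subset[OF fh'[OF e] D(3)[OF e]] s h'l[OF e] by auto
  qed
  have oY: "osub (Sg (y e) U)" if "e : D" for e by (rule Sg_open[OF fy[OF that]])
  have YI: "Sg (y e) U <= I" if "e : D" for e using SI[OF that] by blast
  have "EX s. ltr I (Sg (y e) U) {..<idx I (Sg (y e) U)} s" if "e : D" for e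
   by (rule osub_transversal[OF oY[OF that] Is(1) YI[OF that]])
  then obtain s where s: "!!e. e : D ==> ltr I (Sg (y e) U) {..<idx I (Sg (y e) U)} (s e)" by metis
  let ?B = "%e. {..<idx I (Sg (y e) U)}"
  have sI: "s e i : I" if "e : D" "i : ?B e" for e i by (rule ltD(2)[OF s[OF that(1)] that(2)])
  have sc: "s e i : cG" "s e i : H" if "e : D" "i : ?B e" for e i using Is(4)[OF sI[OF that]] sub(1) sI[OF that] by auto
  \<comment> \<open>The orbits index the double cosets of \<open>I\<close> and Sigma in
    \<open>H\<close>; inside the one of \<open>r e\<close>, the cosets of Sigma correspond to those
    of \<open>Sg (y e) U\<close> in \<open>I\<close>.\<close>
  have tr: "ltr H ?S (Sigma D ?B) (%x. s (fst x) (snd x) *. r (fst x))"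
  proof (rule ltI[OF Hs(1) Ss(1)])
   show "finite (Sigma D ?B)" using D(1) by auto
   show "s (fst x) (snd x) *. r (fst x) : H" if "x : Sigma D ?B" for x using that sc(2) rH(1) Hs(6) by auto
   show "EX x:Sigma D ?B. inv (s (fst x) (snd x) *. r (fst x)) *. z : ?S" if z: "z : H" for z
   proof -
   have "I #> z : rcosets\<^bsub>?H\<^esub> I" using z by (auto simp: RCOSETS_def)
   then have "I #> z : (%(e, j). I #>\<^bsub>?H\<^esub> (r e *.\<^bsub>?H\<^esub> h [^]\<^bsub>?H\<^esub> j)) ` Sigma D (%e. {..<l e})"
   using D(6) by (simp add: bij_betw_def)
   then obtain e j where e: "e : D" "I #> z = I #> (r e *. h [^] (j::nat))" by (auto simp: hp)
   have zc: "z : cG" by (rule Hs(4)[OF z])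
   let ?i = "z *. inv (r e *. h [^] j)"
   have iI: "?i : I" using e(2) rcos_eq_iff[OF Is(1)] zc rH(2)[OF e(1)] F(6) by simp
   obtain k where k: "k : ?B e" "inv (s e k) *. ?i : Sg (y e) U" using ltD(3)[OF s[OF e(1)] iI] by blast
   have ic: "?i : cG" by (rule Is(4)[OF iI])
   have "inv (s e k) *. ?i : cs (r e) ?S" using k(2) SI[OF e(1)] SgC[OF e(1)] by blast
   then have q: "inv (r e) *. (inv (s e k) *. ?i) *. r e : ?S" using cs_iff[OF rH(2)[OF e(1)] Ss(3)] by blast
   have "h [^] j : ?S" by (rule osub_pow[OF oS Sg_self[OF U(2) F(6)]])
   then have "(inv (r e) *. (inv (s e k) *. ?i) *. r e) *. h [^] j : ?S" by (rule Ss(6)[OF q])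
   then have "inv (s e k *. r e) *. z : ?S" using sc(1)[OF e(1) k(1)] rH(2)[OF e(1)] zc F(6) by (simp add: gnorm)
   then show ?thesis using e(1) k(1) by (intro bexI[of _ "(e, k)"]) auto
   qed
   show "x = x'" if x: "x : Sigma D ?B" "x' : Sigma D ?B"
   "inv (s (fst x) (snd x) *. r (fst x)) *. (s (fst x') (snd x') *. r (fst x')) : ?S" for x x'
   proof -
   obtain e k e' k' where ek: "x = (e, k)" "x' = (e', k')" by (cases x, cases x')
   have m: "e : D" "e' : D" "k : ?B e" "k' : ?B e'" using x(1,2) ek by auto
   note c = sc(1)[OF m(1,3)] sc(1)[OF m(2,4)] rH(2)[OF m(1)] rH(2)[OF m(2)]
   let ?q = "inv (s e k *. r e) *. (s e' k' *. r e')"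
   have q: "?q : ?S" using x(3) ek by simp
   \<comment> \<open>Modulo \<open>U\<close>, which is normal and contained in \<open>I\<close>, an
     element of Sigma is a power of \<open>h\<close>. Hence it moves a coset of \<open>I\<close>
     only within its orbit.\<close>
   obtain k0 where k0: "pnum P k0" "h [^] k0 : U" using frob_pow_in_U[OF h(1)] by blast
   obtain i z where iz: "z : Sg (h [^] k0) U" "?q = h [^] (i::nat) *. z"
   using Sg_decompose[OF h(1) pnum_pos[OF k0(1)] q] by blast
   have zU: "z : U" using Sg_minimal[OF U(2) k0(2) inert_subset] iz(1) by blast
   have zc: "z : cG" by (rule osD(4)[OF U(2) zU])
   have "s e' k' *. r e' = s e k *. r e *. ?q" using c by (simp add: gnorm)
   then have eq: "s e' k' *. r e' = s e k *. r e *. (h [^] i *. z)" using iz(2) by simp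
   let ?g = "r e *. h [^] i"
   have gH: "?g : H" using Hs(6) rH(1)[OF m(1)] osub_pow[OF F(2,5)] by blast
   have gc: "?g : cG" by (rule Hs(4)[OF gH])
   have uu: "?g *. z *. inv ?g : I" using U(4)[OF gH zU] sub(2) by blast
   have "r e' *. inv ?g = inv (s e' k') *. s e k *. (?g *. z *. inv ?g)"
   proof -
   have "r e' = inv (s e' k') *. (s e k *. r e *. (h [^] i *. z))" unfolding eq[symmetric] using c by (simp add: gnorm)
   then show ?thesis using c F(6) zc by (simp add: gnorm)
   qed
   also have "... : I" by (intro Is(6,7) sI m uu)
   finally have "r e' *. inv ?g : I" .
   then have "I #> r e' = I #> ?g" using rcos_eq_iff[OF Is(1) c(4) gc] by simp
   then have "e = e'" using D(7)[OF m(1,2), of i] by (simp add: hp)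
   moreover have "k = k'"
   proof (rule ltr_uniq[OF s[OF m(1)] Is(1) osD(1)[OF oY[OF m(1)]] m(3)])
   show "k' : ?B e" using m(4) \<open>e = e'\<close> by simp
   have "inv (r e) *. (inv (s e k) *. s e k') *. r e : ?S" using q c \<open>e = e'\<close> by (simp add: gnorm)
   then have "inv (s e k) *. s e k' : cs (r e) ?S" using cs_iff[OF c(3) Ss(3)] c \<open>e = e'\<close> by simp
   moreover have "inv (s e k) *. s e k' : I" using Is(6,7) sI[OF m(1,3)] sI[OF m(2,4)] \<open>e = e'\<close> by simp
   ultimately show "inv (s e k) *. s e k' : Sg (y e) U" using SI[OF m(1)] SgC[OF m(1)] by blast
   qed
   ultimately show ?thesis using ek by simp
   qed
  qed
  have rpe: "act (r e) pe : fx (Sg (h' e) U)" if "e : D" for e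
   using fx_act[OF pe(1) rH(2)[OF that] Ss(3)] SgC[OF that] by simp
  have rpeY: "act (r e) pe : fx (Sg (y e) U)" if "e : D" for e
   by (rule fx_mono[OF _ rpe[OF that]]) (use SI[OF that] in blast)
  have rpec: "act (r e) pe : cC" if "e : D" for e using rH(2)[OF that] pe(3) by simp
  have "nrm H ?S pe = (\<Otimes>\<^bsub>C\<^esub>x\<in>Sigma D ?B. act (s (fst x) (snd x) *. r (fst x)) pe)"
   by (rule nrm_eq[OF tr Hs(1) Ss(1) Sg_subset[OF h(1)] pe(1)])
  also have "... = (\<Otimes>\<^bsub>C\<^esub>x\<in>Sigma D ?B. (%e k. act (s e k) (act (r e) pe)) (fst x) (snd x))"
   using sc(1) rH(2) pe(3) by (intro C.finprod_cong') (auto simp: act_mult)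
  also have "... = (\<Otimes>\<^bsub>C\<^esub>e\<in>D. \<Otimes>\<^bsub>C\<^esub>k\<in>?B e. act (s e k) (act (r e) pe))" using D(1) sc(1) rpec by (intro C.finprod_Sigma) auto
  also have "... = (\<Otimes>\<^bsub>C\<^esub>e\<in>D. nrm I (Sg (y e) U) (act (r e) pe))"
  proof (rule C.finprod_cong', simp)
   fix e assume e: "e : D"
   show "(\<Otimes>\<^bsub>C\<^esub>k\<in>?B e. act (s e k) (act (r e) pe)) = nrm I (Sg (y e) U) (act (r e) pe)"
   by (rule nrm_eq[OF s[OF e] Is(1) osD(1)[OF oY[OF e]] YI[OF e] rpeY[OF e], symmetric])
  next
   show "(%e. nrm I (Sg (y e) U) (act (r e) pe)) : D \<rightarrow> cC" using fxc[OF nrm_closed[OF fi_open[OF oI oY YI] rpeY]] by blast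
  qed
  finally have e1: "nrm H ?S pe = (\<Otimes>\<^bsub>C\<^esub>e\<in>D. nrm I (Sg (y e) U) (act (r e) pe))" .
  have nI: "nrm I (Sg (y e) U) (act (r e) pe) : fx I" if "e : D" for e
   by (rule nrm_closed[OF fi_open[OF oI oY[OF that] YI[OF that]] rpeY[OF that]])
  \<comment> \<open>Relative to \<open>I\<close> the degree of \<open>y e\<close> is
    \<open>m\<close> with \<open>n * l e = fdeg H I * m\<close>. Both \<open>l e\<close> and
    \<open>fdeg H I\<close> are P-numbers, so that \<open>m\<close> and \<open>n\<close> have the
    same prime-to-P part.\<close>
  have key: "ps (y e) = ka (nrm I (Sg (y e) U) (act (r e) pe) ^: ?c)" if e: "e : D" for e
  proof -
   have fdI: "fdeg H I > 0" by (rule fdeg_pos[OF U(1) oI sub(1)])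
   have dHy: "dr H (y e) = dr I (y e) ^. fdeg H I" by (rule d_rel_sub[OF U(1) oI sub(1) yI[OF e]])
   have "d ` I <= d ` H" using sub(1) by blast
   have "dr H (y e) : Om.pw (fdeg H I)" unfolding dHy by (rule Om.pwI[OF d_rel(1)[OF oI yI[OF e]]])
   then have "om ^. (n * l e) : Om.pw (fdeg H I)" using frobD(8)[OF fy[OF e]] by simp
   then have "fdeg H I dvd n * l e" by (rule Om.om_pow_in_pw[OF dimage_transversal(3)[OF U(1) oI sub(1)]])
   then obtain m where m: "n * l e = fdeg H I * m" by (rule dvdE)
   have m0: "m > 0" using m F(7) D(3)[OF e] by (cases m) auto
   have "dr I (y e) ^. fdeg H I = (om ^. m) ^. fdeg H I"
   using dHy frobD(8)[OF fy[OF e]] m by (simp add: Om.nat_pow_pow mult.commute)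
   then have "dr I (y e) = om ^. m" using Om.root_unique[OF _ _ fdI] d_rel(1)[OF oI yI[OF e]] by simp
   then have fI: "frob I U (y e) m" using NI yI[OF e] m0 by (simp add: frob_def)
   have "act (y e) (act (r e) pe) = act (r e) pe" using rpeY[OF e] fx_Sg[OF fI] by blast
   moreover have "vt U (act (r e) pe) = om" using vt_act[OF N rH(1)[OF e]] h(2) by (simp add: prim_def)
   moreover have "act (r e) pe : Cb U" using Cb_act[OF N rH(1)[OF e]] h(2) by (simp add: prim_def)
   ultimately have p: "prim U (y e) (act (r e) pe)" by (simp add: prim_def)
   have "prime_to_P_part P m = prime_to_P_part P (fdeg H I * m)"
   by (rule Ppart_pnum_mult[OF dimage_transversal(3)[OF U(1) oI sub(1)] m0 P_prime', symmetric])
   also have "... = prime_to_P_part P (l e * n)" using m by (simp add: mult.commute)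
   also have "... = ?c" by (rule Ppart_pnum_mult[OF lP[OF e] F(7) P_prime'])
   finally have "rval I U (y e) m (act (r e) pe) = nrm I (Sg (y e) U) (act (r e) pe) ^: ?c" by (simp add: rval_def)
   then show ?thesis using pska[OF RR_frob[OF fI p]] by simp
  qed
  have kafin: "ka (finprod C f E) = finprod A (%e. ka (f e)) E & finprod C f E : fx I"
   if "finite E" "!!e. e : E ==> f e : fx I" for f and E :: "'g set set set" using that
  proof (induction E)
   case empty
   show ?case using kaNm[OF sg_one[OF Nm_sub[OF NI]]] fx_closed(1)[OF Is(3)] by simp
  next
   case (insert e E)
   have "f : E \<rightarrow> cC" "f e : cC" using insert.prems fxc by auto
   moreover have "(%e. ka (f e)) : E \<rightarrow> carrier A" "ka (f e) : carrier A" using insert.prems kac by auto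
   ultimately show ?case using insert kam fx_closed(2)[OF Is(3)] by simp
  qed
  have rI: "rval H U h n pe = (\<Otimes>\<^bsub>C\<^esub>e\<in>D. nrm I (Sg (y e) U) (act (r e) pe) ^: ?c)"
  proof -
   have "(%x. x ^: ?c) (finprod C (%e. nrm I (Sg (y e) U) (act (r e) pe)) D) =
   (\<Otimes>\<^bsub>C\<^esub>e\<in>D. nrm I (Sg (y e) U) (act (r e) pe) ^: ?c)" using nI fxc
   by (intro finprod_hom C.comm_monoid_axioms) (auto simp: hom_def C.nat_pow_distrib)
   then show ?thesis unfolding rval_def e1 by simp
  qed
  have rfx: "rval H U h n pe : fx I" by (rule fx_mono[OF sub(1) rval_closed(1)[OF h(1,2)]])
  have "ka (rval H U h n pe) = (\<Otimes>\<^bsub>A\<^esub>e\<in>D. ka (nrm I (Sg (y e) U) (act (r e) pe) ^: ?c))"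
   unfolding rI using kafin[OF D(1), of "%e. nrm I (Sg (y e) U) (act (r e) pe) ^: ?c"] fx_pow[OF Is(3) nI] by blast
  also have "... = (\<Otimes>\<^bsub>A\<^esub>e\<in>D. ps (y e))" using key psc[OF yI] by (intro A.finprod_cong') auto
  finally have k1: "ka (rval H U h n pe) = (\<Otimes>\<^bsub>A\<^esub>e\<in>D. ps (y e))" .
  have aI: "a : fx I" by (rule fx_mono[OF sub(1) RR_D(2)[OF R]])
  have "a -. rval H U h n pe : Nm I U"
  proof -
   obtain w where w: "w : fx U" "a -. rval H U h n pe = nrm H U w" using h(4) by (auto simp: Nm_eq)
   have wc: "w : cC" by (rule fxc[OF w(1)])
   let ?J = "{..<idx H I}"
   have TH: "T i : H" "T i : cG" if "i : ?J" for i using ltD(2)[OF T that] Hs(4) by auto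
   obtain q where q: "ltr I U {..<idx I U} q" using osub_transversal[OF U(2) Is(1) sub(2)] by blast
   have qI: "q j : I" "q j : cG" if "j < idx I U" for j using ltD(2)[OF q, of j] that Is(4) by auto
   obtain b where b: "ltr H U {..<idx H U} b" using osub_transversal[OF U(2) Hs(1) U(3)] by blast
   \<comment> \<open>As \<open>U\<close> is normal in \<open>H\<close>, the inverses of left coset representatives of \<open>I\<close>
   are right coset representatives.\<close>
   have tr': "ltr H U ({..<idx I U} \<times> ?J) (%x. q (fst x) *. inv (T (snd x)))"
   proof (rule ltI[OF Hs(1) osD(1)[OF U(2)]])
   show "q (fst x) *. inv (T (snd x)) : H" if "x : {..<idx I U} \<times> ?J" for x
   proof -
   from that have x: "fst x < idx I U" "snd x : ?J" by auto
   show ?thesis using Hs(6)[OF subsetD[OF sub(1) qI(1)[OF x(1)]] Hs(7)[OF TH(1)[OF x(2)]]] .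
   qed
   show "EX x:{..<idx I U} \<times> ?J. inv (q (fst x) *. inv (T (snd x))) *. z : U" if z: "z : H" for z
   proof -
   have zc: "z : cG" by (rule Hs(4)[OF z])
   obtain i where i: "i : ?J" "inv (T i) *. inv z : I" using ltD(3)[OF T Hs(7)[OF z]] by blast
   have "inv (inv (T i) *. inv z) : I" by (rule Is(7)[OF i(2)])
   then have zT: "z *. T i : I" using TH(2)[OF i(1)] zc by (simp add: gnorm)
   obtain j where j: "j < idx I U" "inv (q j) *. (z *. T i) : U" using ltD(3)[OF q zT] by auto
   have "T i *. (inv (q j) *. (z *. T i)) *. inv (T i) : U" by (rule U(4)[OF TH(1)[OF i(1)] j(2)])
   then have "inv (q j *. inv (T i)) *. z : U" using TH(2)[OF i(1)] zc qI(2)[OF j(1)] by (simp add: gnorm)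
   then show ?thesis using i(1) j(1) by (intro bexI[of _ "(j, i)"]) auto
   qed
   show "x = x'" if x: "x : {..<idx I U} \<times> ?J" "x' : {..<idx I U} \<times> ?J"
   "inv (q (fst x) *. inv (T (snd x))) *. (q (fst x') *. inv (T (snd x'))) : U" for x x'
   proof -
   obtain j i j' i' where e: "x = (j, i)" "x' = (j', i')" by (cases x, cases x')
   have m: "j < idx I U" "j' < idx I U" "i : ?J" "i' : ?J" using x(1,2) e by auto
   note c = qI(2)[OF m(1)] qI(2)[OF m(2)] TH(2)[OF m(3)] TH(2)[OF m(4)]
   have u: "T i *. inv (q j) *. q j' *. inv (T i') : U" using x(3) e c by (simp add: gnorm)
   have "inv (T i) *. (T i *. inv (q j) *. q j' *. inv (T i')) *. T i : U" by (rule U(5)[OF TH(1)[OF m(3)] u])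
   then have u2: "inv (q j) *. q j' *. (inv (T i') *. T i) : U" using c by (simp add: gnorm)
   have "inv (inv (q j) *. q j') *. (inv (q j) *. q j' *. (inv (T i') *. T i)) : I"
   by (rule Is(6)[OF Is(7)[OF Is(6)[OF Is(7)[OF qI(1)[OF m(1)]] qI(1)[OF m(2)]]] subsetD[OF sub(2) u2]])
   then have "inv (T i') *. T i : I" using c by (simp add: gnorm)
   then have ii: "i' = i" by (rule ltr_uniq[OF T Hs(1) Is(1) m(4,3)])
   then have "inv (q j) *. q j' : U" using u2 c by simp
   then have "j = j'" using ltr_uniq[OF q Is(1) osD(1)[OF U(2)]] m(1,2) by simp
   then show ?thesis using e ii by simp
   qed
   qed auto
   \<comment> \<open>Over the transversal just built, the norm of \<open>w\<close> from
     \<open>U\<close> to \<open>H\<close> becomes the norm to \<open>I\<close> of this product of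
     conjugates.\<close>
   let ?w = "\<Otimes>\<^bsub>C\<^esub>i\<in>?J. act (inv (T i)) w"
   have iw: "act (inv (T i)) w : fx U" if "i : ?J" for i by (rule fx_normal_act[OF N Hs(7)[OF TH(1)[OF that]] w(1)])
   have wU: "?w : fx U" by (rule C.finprod_in_subgroup[OF fx_subgroup[OF osD(3)[OF U(2)]] iw])
   have "nrm H U w = (\<Otimes>\<^bsub>C\<^esub>x\<in>{..<idx I U} \<times> ?J. act (q (fst x) *. inv (T (snd x))) w)"
   by (rule nrm_eq[OF tr' Hs(1) osD(1)[OF U(2)] U(3) w(1)])
   also have "... = (\<Otimes>\<^bsub>C\<^esub>x\<in>{..<idx I U} \<times> ?J. (%j i. act (q j) (act (inv (T i)) w)) (fst x) (snd x))"
   using qI(2) TH(2) wc by (intro C.finprod_cong') (auto simp: act_mult)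
   also have "... = (\<Otimes>\<^bsub>C\<^esub>j\<in>{..<idx I U}. \<Otimes>\<^bsub>C\<^esub>i\<in>?J. act (q j) (act (inv (T i)) w))"
   using qI(2) TH(2) wc by (intro C.finprod_Sigma) auto
   also have "... = (\<Otimes>\<^bsub>C\<^esub>j\<in>{..<idx I U}. act (q j) ?w)"
   using qI(2) TH(2) wc by (intro C.finprod_cong') (auto simp: act_finprod)
   also have "... = nrm I U ?w" by (rule nrm_eq[OF q Is(1) osD(1)[OF U(2)] sub(2) wU, symmetric])
   finally show ?thesis unfolding w(2) Nm_eq using wU by blast
  qed
  then have "ka (a -. rval H U h n pe) = \<one>\<^bsub>A\<^esub>" by (rule kaNm)
  moreover have "ka a = ka (a -. rval H U h n pe) *.\<^bsub>A\<^esub> ka (rval H U h n pe)"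
   using kam[OF fx_gdiv[OF Is(3) aI rfx] rfx] fxc[OF aI] fxc[OF rfx] by (simp add: C.gdiv_def C.m_assoc)
  ultimately show ?thesis using k1 kac[OF rfx] by simp
 qed
 finally show ?thesis by simp
qed

section \<open>Bijectivity\<close>

abbreviation "quo" where "quo H U == quotient_grp G H U"

lemma quo_group: "onorm H U ==> group (quo H U)" unfolding quotient_grp_def by (rule normal.factorgroup_is_group[OF onD(6)])

lemma quo_order: "order (quo H U) = idx H U" by (simp add: quotient_grp_def order_def FactGroup_def subgroup_index_def)

lemma quo_finite:
 assumes "onorm H U" shows "finite (carrier (quo H U))"
proof (rule card_ge_0_finite)
 note U = onD[OF assms]
 show "card (carrier (quo H U)) > 0" using idx_pos[OF U(2) osD(1)[OF U(1)] U(3)] quo_order[of H U] by (simp add: order_def)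
qed

lemma quo_carrier: "carrier (quo H U) = (%x. U #> x) ` H" by (simp add: quotient_grp_def carrier_FactGroup r_coset_def)

lemma quo_mem: "x : H ==> U #> x : carrier (quo H U)" by (simp add: quo_carrier)

lemma quo_one [simp]: "\<one>\<^bsub>quo H U\<^esub> = U" by (simp add: quotient_grp_def)

lemma quo_mult:
 assumes "onorm H U" "x : H" "y : H"
 shows "(U #> x) *.\<^bsub>quo H U\<^esub> (U #> y) = U #> (x *. y)"
proof -
 have e: "r_coset (G(|carrier := H|)) = r_coset G" "set_mult (G(|carrier := H|)) = set_mult G"
  by (simp_all add: fun_eq_iff r_coset_def set_mult_def)
 show ?thesis using normal.rcos_sum[OF onD(6)[OF assms(1)], of x y] assms(2,3) by (simp add: quotient_grp_def e)
qed

lemma quo_inv: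
 assumes "onorm H U" "x : H" shows "inv\<^bsub>quo H U\<^esub> (U #> x) = U #> inv x"
proof -
 note U = onD[OF assms(1)] note Hs = osD[OF U(1)] and Us = osD[OF U(2)]
 interpret Q: group "quo H U" by (rule quo_group[OF assms(1)])
 have "(U #> inv x) *.\<^bsub>quo H U\<^esub> (U #> x) = \<one>\<^bsub>quo H U\<^esub>"
  using quo_mult[OF assms(1) Hs(7)[OF assms(2)] assms(2)] Hs(4)[OF assms(2)] Us(3) by (simp add: coset_mult_one)
 then show ?thesis by (rule Q.inv_equality[OF _ quo_mem[OF assms(2)] quo_mem[OF Hs(7)[OF assms(2)]]])
qed

lemma quo_eq_iff:
 assumes "onorm H U" "x : H" "y : H"
 shows "U #> x = U #> y \<longleftrightarrow> x *. inv y : U"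
proof -
 note U = onD[OF assms(1)]
 show ?thesis by (rule rcos_eq_iff[OF osD(1)[OF U(2)]]) (use assms osD(4)[OF U(1)] in auto)
qed

lemma quo_eq_one:
 assumes "onorm H U" "x : H" shows "U #> x = U \<longleftrightarrow> x : U"
proof -
 note U = onD[OF assms(1)] note Hs = osD[OF U(1)] and Us = osD[OF U(2)]
 show ?thesis using quo_eq_iff[OF assms(1,2) Hs(5)] Hs(4)[OF assms(2)] Us(3) by (simp add: coset_mult_one)
qed

lemma quo_pow:
 assumes "onorm H U" "x : H" shows "(U #> x) [^]\<^bsub>quo H U\<^esub> (k::nat) = U #> (x [^] k)"
proof (induction k)
 case 0
 then show ?case using osD(3)[OF onD(2)[OF assms(1)]] by (simp add: coset_mult_one)
next
 case (Suc k)
 interpret Q: group "quo H U" by (rule quo_group[OF assms(1)])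
 have xk: "x [^] k : H" by (rule osub_pow[OF onD(1)[OF assms(1)] assms(2)])
 have "(U #> x) [^]\<^bsub>quo H U\<^esub> Suc k = (U #> x [^] k) *.\<^bsub>quo H U\<^esub> (U #> x)" by (simp only: Q.nat_pow_Suc Suc.IH)
 also have "... = U #> (x [^] Suc k)" by (simp only: quo_mult[OF assms(1) xk assms(2)] nat_pow_Suc)
 finally show ?case .
qed

text \<open>The correspondence between subgroups of H/U and open groups between \<open>U\<close> and
  \<open>H\<close>, with indices and normality; all inductions on the index pass through it.\<close>

lemma quo_preimage:
 assumes N: "onorm H U" and A: "subgroup A (quo H U)"
 defines "I == {x : H. U #> x : A}"
 shows "osub I" "U <= I" "I <= H" "onorm I U" "idx I U = card A"
  "idx H U = idx H I * idx I U"
  "A \<lhd> quo H U ==> onorm H I"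
proof -
 note U = onD[OF N] note Hs = osD[OF U(1)] and Us = osD[OF U(2)]
 interpret Q: group "quo H U" by (rule quo_group[OF N])
 show UI: "U <= I"
 proof
  fix u assume u: "u : U"
  then have "U #> u = U" using quo_eq_one[OF N] U(3) by blast
  then show "u : I" using u U(3) sg_one[OF A] unfolding I_def by auto
 qed
 show IH: "I <= H" unfolding I_def by blast
 have sI: "subgroup I G"
 proof (rule subgroupI)
  show "I <= cG" using IH Hs(3) by blast
  show "I ~= {}" using UI Us(5) by blast
  show "inv x : I" if "x : I" for x using that Hs(7) sg_inv[OF A, of "U #> x"] unfolding I_def by (simp add: quo_inv[OF N])
  show "x *. y : I" if "x : I" "y : I" for x y
   using that Hs(6) sg_mult[OF A, of "U #> x" "U #> y"] unfolding I_def by (simp add: quo_mult[OF N])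
 qed
 show oI: "osub I" by (rule open_supergroup[OF U(2) sI UI])
 show NI: "onorm I U" by (rule onI[OF oI U(2) UI]) (use U(4) IH in blast)
 have "carrier (quo I U) = A" unfolding quo_carrier using sg_sub[OF A] unfolding I_def quo_carrier by auto
 then show "idx I U = card A" using quo_order[of I U] unfolding order_def by simp
 obtain t where t: "ltr H U {..<idx H U} t" using osub_transversal[OF U(2) Hs(1) U(3)] by blast
 show "idx H U = idx H I * idx I U" by (rule ltr_index_mult(1)[OF t Hs(1) sI Us(1) IH UI])
 show "onorm H I" if nA: "A \<lhd> quo H U"
 proof (rule onI[OF U(1) oI IH])
  fix h x assume h: "h : H" and x: "x : I"
  then have xH: "x : H" "U #> x : A" unfolding I_def by auto
  have "(U #> h) *.\<^bsub>quo H U\<^esub> (U #> x) *.\<^bsub>quo H U\<^esub> inv\<^bsub>quo H U\<^esub> (U #> h) : A"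
   by (rule normal.inv_op_closed2[OF nA quo_mem[OF h] xH(2)])
  then show "h *. x *. inv h : I" using quo_mult[OF N] quo_inv[OF N] Hs(6,7) h xH(1) unfolding I_def by simp
 qed
qed

lemma pidx_transversal:
 assumes N: "onorm H U" and p: "prime (idx H U)" and ta: "ta : H" "ta \<notin> U"
 shows "ltr H U {..<idx H U} (%i. ta [^] i)"
  and "cyclic_group (quo H U)"
proof -
 note U = onD[OF N] note Hs = osD[OF U(1)] and Us = osD[OF U(2)]
 interpret Q: group "quo H U" by (rule quo_group[OF N])
 let ?x = "U #> ta" and ?p = "idx H U"
 have x: "?x : carrier (quo H U)" by (rule quo_mem[OF ta(1)])
 have fin: "finite (carrier (quo H U))" by (rule quo_finite[OF N])
 have "Q.ord ?x dvd ?p" using Q.ord_dvd_group_order[OF x] quo_order[of H U] by simp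
 moreover have "Q.ord ?x ~= 1" using Q.ord_eq_1[OF x] quo_eq_one[OF N ta(1)] ta(2) by simp
 ultimately have ord: "Q.ord ?x = ?p" using p unfolding prime_nat_iff by auto
 have gen: "generate (quo H U) {?x} = carrier (quo H U)"
 proof (rule card_subset_eq[OF fin])
  show "generate (quo H U) {?x} <= carrier (quo H U)" using Q.generate_incl x by blast
  show "card (generate (quo H U) {?x}) = card (carrier (quo H U))"
   using Q.generate_pow_card[OF x] ord quo_order[of H U] unfolding order_def by simp
 qed
 have car: "carrier (quo H U) = {?x [^]\<^bsub>quo H U\<^esub> (k::nat) | k. k : UNIV}"
  using Q.generate_pow_on_finite_carrier[OF fin x] gen by simp
 show "cyclic_group (quo H U)" using gen x unfolding cyclic_group_def subgroup_generated_def by (intro bexI[of _ ?x]) auto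
 have tak: "ta [^] (k::nat) : H" for k by (rule osub_pow[OF U(1) ta(1)])
 have eq: "inv (ta [^] i) *. z : U \<longleftrightarrow> ?x [^]\<^bsub>quo H U\<^esub> i = U #> z" if z: "z : H" for i :: nat and z
 proof -
  have "?x [^]\<^bsub>quo H U\<^esub> i = U #> z \<longleftrightarrow> ta [^] i *. inv z : U" using quo_pow[OF N ta(1)] quo_eq_iff[OF N tak z] by simp
  moreover have "inv (ta [^] i) *. z = inv (inv (ta [^] i) *. (ta [^] i *. inv z) *. ta [^] i)"
   "ta [^] i *. inv z = inv (ta [^] i *. (inv (ta [^] i) *. z) *. inv (ta [^] i))"
   using Hs(4)[OF tak] Hs(4)[OF z] by (simp_all add: gnorm)
  moreover have "inv (ta [^] i *. (inv (ta [^] i) *. z) *. inv (ta [^] i)) : U" if "inv (ta [^] i) *. z : U"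
   by (rule Us(7)[OF U(4)[OF tak that]])
  moreover have "inv (inv (ta [^] i) *. (ta [^] i *. inv z) *. ta [^] i) : U" if "ta [^] i *. inv z : U"
   by (rule Us(7)[OF U(5)[OF tak that]])
  ultimately show ?thesis by argo
 qed
 show "ltr H U {..<?p} (%i. ta [^] i)"
 proof (rule ltI[OF Hs(1) Us(1)])
  show "EX i:{..<?p}. inv (ta [^] i) *. z : U" if z: "z : H" for z
  proof -
   obtain k :: nat where k: "U #> z = ?x [^]\<^bsub>quo H U\<^esub> k" using car quo_mem[OF z] by blast
   have p1: "?x [^]\<^bsub>quo H U\<^esub> ?p = \<one>\<^bsub>quo H U\<^esub>" using Q.pow_ord_eq_1[OF x] ord by simp
   have "?x [^]\<^bsub>quo H U\<^esub> (?p * (k div ?p) + k mod ?p) = ?x [^]\<^bsub>quo H U\<^esub> (k mod ?p)"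
   using Q.nat_pow_mult[OF x, of "?p * (k div ?p)" "k mod ?p", symmetric]
   Q.nat_pow_pow[OF x, of ?p "k div ?p", symmetric] p1 Q.nat_pow_closed[OF x] by (simp del: quo_one)
   then have "?x [^]\<^bsub>quo H U\<^esub> k = ?x [^]\<^bsub>quo H U\<^esub> (k mod ?p)" by simp
   then show ?thesis using eq[OF z, of "k mod ?p"] k p prime_gt_0_nat[OF p] by (intro bexI[of _ "k mod ?p"]) auto
  qed
  show "i = j" if ij: "i : {..<?p}" "j : {..<?p}" "inv (ta [^] i) *. ta [^] j : U" for i j
  proof -
   have "?x [^]\<^bsub>quo H U\<^esub> i = ?x [^]\<^bsub>quo H U\<^esub> j" using eq[OF tak] ij(3) quo_pow[OF N ta(1)] by simp
   moreover have "i : {0..Q.ord ?x - 1}" "j : {0..Q.ord ?x - 1}" using ij(1,2) ord by auto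
   ultimately show ?thesis by (rule inj_onD[OF Q.ord_inj[OF x]])
  qed
 qed (use tak in auto)
qed

section \<open>Extensions of prime degree\<close>

lemma ex_not_mem_of_index:
 assumes "onorm H U" "idx H U ~= 1" shows "EX x:H. x \<notin> U"
proof (rule ccontr)
 assume "~ (EX x:H. x \<notin> U)"
 then have "U = H" using onD(3)[OF assms(1)] by auto
 then show False using idx_self(1)[OF osD(1)[OF onD(1)[OF assms(1)]]] assms(2) by simp
qed

text \<open>The index is \<open>fdeg H U\<close> times the index of \<open>U\<close> in
  \<open>?D\<close>. As \<open>?D\<close> contains the inertia of \<open>H\<close>, it is larger
  than \<open>U\<close>, and primality leaves \<open>fdeg H U = 1\<close>.\<close>

lemma pidx_fdeg:
 assumes N: "onorm H U" and p: "prime (idx H U)" and nr: "~ inert H <= U"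
 shows "fdeg H U = 1"
proof -
 note U = onD[OF N] note Hs = osD[OF U(1)] and Us = osD[OF U(2)]
 let ?D = "{x : H. d x : d ` U}"
 have ix: "idx H U = fdeg H U * idx ?D U" by (rule dimage_transversal(2)[OF U(1,2,3)])
 have sD: "subgroup ?D G" by (rule subgroup_dpre[OF Hs(1) subgroup_dimage[OF Us(1)]])
 have UD: "U <= ?D" using U(3) by auto
 have iD: "inert H <= ?D" using inert_iff[OF Hs(3)] sg_one[OF subgroup_dimage[OF Us(1)]] by auto
 have "idx ?D U ~= 1"
 proof
  assume "idx ?D U = 1"
  moreover obtain t where "ltr ?D U {..<idx ?D U} t" using osub_transversal[OF U(2) sD UD] by blast
  ultimately have "U = ?D" using idx_eq_1[OF _ sD Us(1) UD] by blast
  then show False using iD nr by simp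
 qed
 then show ?thesis using prime_product[of "fdeg H U" "idx ?D U"] p ix by simp
qed

text \<open>In prime index the inertia of \<open>H\<close> is either contained in \<open>U\<close>
  or the residue degree is 1; the two hypotheses on the class field axiom cover these cases.\<close>

lemma pidx_axiom:
 assumes N: "onorm H U" and p: "prime (idx H U)"
 shows "class_field_axiom G M H U"
proof (cases "inert H <= U")
 case True
 then show ?thesis using cfa_unram N by blast
next
 case False
 have "idx H U ~= 1" using p by (metis not_prime_1)
 then obtain ta where "ta : H" "ta \<notin> U" using ex_not_mem_of_index[OF N] by blast
 then have "cyclic_group (quo H U)" by (rule pidx_transversal(2)[OF N p])
 then show ?thesis using cfa_prime[OF N] p pidx_fdeg[OF N p False] quo_order[of H U] by simp
qed

text \<open>For an element of degree \<open>om\<close> the group Sigma is \<open>H\<close>, so its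
  value is a prime element of C^H, whereas valuations of norms are multiples of the index.\<close>

lemma unram_RR_nontrivial:
 assumes N: "onorm H U" and "inert H <= U" and p: "idx H U ~= 1"
 shows "EX x:H. ~ RR H U x oC"
proof -
 note U = onD[OF N] note Hs = osD[OF U(1)] and Us = osD[OF U(2)]
 have iU: "inert U = inert H" using assms(2) U(3) unfolding inertia_def by blast
 obtain ph where ph: "ph : H" "dr H ph = om" using d_rel_surj[OF U(1) Om.om_closed] by blast
 have f: "frob H U ph 1" "frob H H ph 1" using N onorm_self[OF U(1)] ph unfolding frob_def by auto
 have S: "Sg ph U = H" using Sg_full[OF f(2)] unfolding Sigma_grp_def iU .
 obtain pe where pe: "prim U ph pe" using prim_exists[OF f(1)] by blast
 then have vpe: "pe : fx H" "v H pe = om" using prim_iff[OF f(1)] unfolding S prime_element_def by auto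
 have "rval H U ph 1 pe = pe"
  unfolding rval_def S using Ppart_pnum[OF pnum_1(1) P_prime'] nrm_self[OF Hs(1) vpe(1)] fxc[OF vpe(1)] by simp
 then have R: "RR H U ph pe" using RR_frob[OF f(1) pe] by simp
 have "~ RR H U ph oC"
 proof
  assume "RR H U ph oC"
  then have "pe -. oC : Nm H U" by (rule RR_unique[OF N R])
  then have "pe : Nm H U" using fxc[OF vpe(1)] by (simp add: C.gdiv_def)
  then obtain w where w: "w : fx U" "pe = nrm H U w" unfolding Nm_eq by blast
  obtain z :: int where "v H (nrm H U w) = om ^. (z * int (idx H U))" using unram_v_norm[OF N assms(2) w(1)] by blast
  then have "om ^. (1::int) = om ^. (z * int (idx H U))" using vpe(2) w(2) by (simp add: Om.int_pow_1)
  then have "1 = z * int (idx H U)" by (rule om_int_inj)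
  then have "int (idx H U) dvd 1" using dvd_triv_right[of "int (idx H U)" z] by simp
  then show False using p by simp
 qed
 then show ?thesis using ph(1) by blast
qed

text \<open>The element is \<open>sg = ta *. ph\<close> with \<open>ta\<close> inertial outside
  \<open>U\<close> and \<open>ph\<close> in \<open>U\<close>. If its value were the norm of some
  \<open>w\<close> in C^U, the unit \<open>u = pe -. w\<close> would have trivial norm over inertia,
  and Hilbert 90 would give u = (ta a)/a. With b = a/(sg a), a unit, it follows that (ta b)/b = (ta
  w)/w, so w/b is fixed by \<open>ta\<close> and hence by the inertia of \<open>H\<close>. Its
  valuation over \<open>U\<close> would be divisible by the ramification index, yet it is that of
  \<open>w\<close>, namely \<open>om\<close>.\<close>

lemma ramified_RR_nontrivial:
 assumes N: "onorm H U" and p: "prime (idx H U)" and nr: "~ inert H <= U"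
 shows "EX x:H. ~ RR H U x oC"
proof -
 note U = onD[OF N] note Hs = osD[OF U(1)] and Us = osD[OF U(2)]
 let ?p = "idx H U"
 have fd: "fdeg H U = 1" by (rule pidx_fdeg[OF N p nr])
 have dU: "d ` H = d ` U" using fdeg_le_1_iff[OF U(1,2,3)] fd by blast
 obtain ta where ta: "ta : inert H" "ta \<notin> U" using nr by blast
 have taH: "ta : H" "d ta = oW" using ta(1) inert_iff[OF Hs(3)] by auto
 have tac: "ta : cG" by (rule Hs(4)[OF taH(1)])
 have t: "ltr H U {..<?p} (%i. ta [^] i)" by (rule pidx_transversal(1)[OF N p taH(1) ta(2)])
 have tai: "ta [^] (i::nat) : inert H" for i by (rule subgroup_nat_pow[OF inert_subgroup[OF Hs(1)] ta(1)])
 have ti: "ltr (inert H) (inert U) {..<?p} (%i. ta [^] i)"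
 proof (rule ltI[OF inert_subgroup[OF Hs(1)] inert_subgroup[OF Us(1)]])
  show "EX i:{..<?p}. inv (ta [^] i) *. x : inert U" if x: "x : inert H" for x
  proof -
   have "x : H" using x inert_subset by blast
   then obtain i where i: "i : {..<?p}" "inv (ta [^] i) *. x : U" using ltD(3)[OF t] by blast
   have "inv (ta [^] i) *. x : inert H"
   by (intro sg_mult[OF inert_subgroup[OF Hs(1)]] sg_inv[OF inert_subgroup[OF Hs(1)]] tai x)
   then show ?thesis using i unfolding inertia_def by blast
  qed
  show "i = j" if "i : {..<?p}" "j : {..<?p}" "inv (ta [^] i) *. ta [^] j : inert U" for i j
   by (rule ltr_uniq[OF t Hs(1) Us(1) that(1,2)]) (use that(3) inert_subset in blast)
 qed (use tai in auto)
 note iHU = fi_inert[OF U(1,2,3)]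
 have NNt: "NN H U b = sm ?p ta b" if "b : Cb U" for b unfolding sm_def by (rule nrm_eq[OF ti fiD(1,2,3)[OF iHU] that])
 have nrmt: "nrm H U b = sm ?p ta b" if "b : fx U" for b unfolding sm_def by (rule nrm_eq[OF t Hs(1) Us(1) U(3) that])
 have Cbfx: "b : Cb U" if "b : fx U" for b by (rule fx_mono[OF inert_subset that])
 obtain ph where ph: "ph : U" "dr U ph = om" using d_rel_surj[OF U(2) Om.om_closed] by blast
 have phH: "ph : H" "dr H ph = om" using ph U(3) d_rel_sub[OF U(1,2,3) ph(1)] fd by auto
 have phc: "ph : cG" by (rule Hs(4)[OF phH(1)])
 define sg where "sg = ta *. ph"
 have sg: "sg : H" "dr H sg = om"
  using Hs(6)[OF taH(1) phH(1)] d_rel_mult[OF U(1) taH(1) phH(1)] d_rel_eq_1[OF U(1) taH(1)] taH(2) phH(2)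
  unfolding sg_def by auto
 have sgc: "sg : cG" by (rule Hs(4)[OF sg(1)])
 have f: "frob H U sg 1" using N sg unfolding frob_def by simp
 obtain pe where pe: "prim U sg pe" using prim_exists[OF f] by blast
 then have pe': "pe : Cb U" "act sg pe = pe" "vt U pe = om" unfolding prim_def by auto
 have S: "pe : fx (Sg sg U)" "v (Sg sg U) pe = om" using pe prim_iff[OF f] unfolding prime_element_def by auto
 let ?r = "rval H U sg 1 pe"
 have rNN: "?r = NN H U pe" using rval_formula(1)[OF f phH pe] fxc[OF pe'(1)] phc by (simp add: sm_Suc)
 have rn: "?r = nrm H (Sg sg U) pe" unfolding rval_def using Ppart_pnum[OF pnum_1(1) P_prime']
   fxc[OF nrm_closed[OF fi_open[OF U(1) Sg_open[OF f] Sg_subset[OF f]] S(1)]] by simp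
 have "d ` Sg sg U = d ` H" using Sg_dimage[OF f] d_image(1)[OF U(1)] by simp
 then have "fdeg H (Sg sg U) = 1" using fdeg_le_1_iff[OF U(1) Sg_open[OF f] Sg_subset[OF f]] by simp
 then have vr: "v H ?r = om" unfolding rn using v_props(6)[OF U(1) Sg_open[OF f] Sg_subset[OF f] S(1)] S(2) by simp
 have "~ RR H U sg oC"
 proof
  assume "RR H U sg oC"
  then have "?r -. oC : Nm H U" by (rule RR_unique[OF N RR_frob[OF f pe]])
  then have "?r : Nm H U" using rval_closed(2)[OF f pe] by (simp add: C.gdiv_def)
  then obtain w where w: "w : fx U" "?r = nrm H U w" unfolding Nm_eq by blast
  have wc: "w : cC" "pe : cC" using fxc[OF w(1)] fxc[OF pe'(1)] by auto
  have "v U w = om" using vr v_props(6)[OF U(1,2,3) w(1)] fd v_closed[OF U(2) w(1)] w(2) by simp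
  then have vtw: "vt U w = om" using vt_eq(2)[OF U(2) U(2) refl w(1)] by simp
  define u where "u = pe -. w"
  have u: "u : Cb U" "u : cC" unfolding u_def using fx_gdiv[OF inert_carrier[OF U(2)] pe'(1) Cbfx[OF w(1)]] wc by auto
  have "NN H U u = NN H U pe -. NN H U w" unfolding u_def by (rule nrm_cdiv[OF iHU pe'(1) Cbfx[OF w(1)]])
  also have "NN H U pe = NN H U w" using rNN w(2) nrmt[OF w(1)] NNt[OF Cbfx[OF w(1)]] by simp
  finally have NNu: "sm ?p ta u = oC" using NNt[OF u(1)] fxc[OF nrm_closed[OF iHU Cbfx[OF w(1)]]] by simp
  \<comment> \<open>The axiom concerns open subgroups, not inertia groups. Once
    \<open>ph [^] k\<close> fixes \<open>u\<close>, the element \<open>u\<close> lies in the finite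
    layer given by \<open>?A\<close> and \<open>?B\<close>, where Hilbert 90 is available.\<close>
  obtain k where k: "pnum P k" "ALL n. k dvd n --> act (ph [^] n) u = u" using stab_pow[OF u(2) phc] by blast
  have k0: "k > 0" by (rule pnum_pos[OF k(1)])
  let ?ph = "ph [^] k"
  have phk: "?ph : U" "?ph : H" using osub_pow[OF U(2) ph(1)] U(3) by auto
  have f0: "frob H H ?ph k" "frob H U ?ph k" "frob U U ?ph k"
   using frob_1(1)[OF onorm_self[OF U(1)] phH k(1)] frob_1(1)[OF N phH k(1)]
   frob_1(1)[OF onorm_self[OF U(2)] ph k(1)] by auto
  let ?A = "Sg ?ph H" and ?B = "Sg ?ph U"
  have oA: "osub ?A" and oB: "osub ?B" using Sg_open f0 by auto
  have AH: "?A <= H" by (rule Sg_subset[OF f0(1)])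
  note As = osD[OF oA] and Bs = osD[OF oB]
  \<comment> \<open>Because \<open>ph [^] k\<close> lies in \<open>U\<close>, cutting
    \<open>?A\<close> down to \<open>U\<close> affects only its inertia part. So the index stays
    prime and powers of \<open>ta\<close> remain representatives.\<close>
  have AB: "?A Int U = ?B"
  proof
   show "?B <= ?A Int U" using Sg_subset[OF f0(3)]
   Sg_minimal[OF oA Sg_self[OF U(1) Hs(4)[OF phk(2)]]] inert_subset_Sg[OF U(1) Hs(4)[OF phk(2)]] inert_mono[OF U(3)] by blast
   show "?A Int U <= ?B"
   proof
   fix x assume x: "x : ?A Int U"
   then have "x : ?A" by blast
   then obtain y j where y: "y : pclosure ?ph" "j : inert H" "x = y *. j" unfolding Sg_iff by blast
   have yU: "y : U" using pclosure_sub[OF U(2) phk(1)] y(1) by blast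
   have jH: "j : H" "d j = oW" using y(2) inert_iff[OF Hs(3)] by auto
   have "inv y *. x : U" using Us(6,7) yU x by simp
   then have "j : U" using y(3) Us(4)[OF yU] Hs(4)[OF jH(1)] by (simp add: gnorm)
   then have "j : inert U" using inert_iff[OF Us(3)] jH(2) by simp
   then show "x : ?B" using y(1,3) unfolding Sg_iff by blast
   qed
  qed
  have NA: "onorm ?A ?B"
  proof (rule onI[OF oA oB])
   show "?B <= ?A" using AB by blast
   fix h x assume h: "h : ?A" and "x : ?B"
   then have x: "x : ?A" "x : U" using AB by auto
   have "h *. x *. inv h : ?A" by (intro As(6,7) h x)
   moreover have "h *. x *. inv h : U" by (rule U(4)[OF subsetD[OF AH h] x(2)])
   ultimately show "h *. x *. inv h : ?B" using AB by blast
  qed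
  have taA: "ta : ?A" using inert_subset_Sg[OF U(1) Hs(4)[OF phk(2)]] ta(1) by blast
  have takA: "ta [^] (i::nat) : ?A" for i by (rule osub_pow[OF oA taA])
  have tA: "ltr ?A ?B {..<?p} (%i. ta [^] i)"
  proof (rule ltI[OF As(1) Bs(1)])
   show "EX i:{..<?p}. inv (ta [^] i) *. x : ?B" if x: "x : ?A" for x
   proof -
   obtain i where i: "i : {..<?p}" "inv (ta [^] i) *. x : U" using ltD(3)[OF t subsetD[OF AH x]] by blast
   moreover have "inv (ta [^] i) *. x : ?A" by (intro As(6,7) takA x)
   ultimately show ?thesis using AB by blast
   qed
   show "i = j" if "i : {..<?p}" "j : {..<?p}" "inv (ta [^] i) *. ta [^] j : ?B" for i j
   by (rule ltr_uniq[OF t Hs(1) Us(1) that(1,2)]) (use that(3) AB in blast)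
  qed (use takA in auto)
  have ixA: "idx ?A ?B = ?p" using idx_eq_card[OF tA As(1) Bs(1)] by simp
  have pA: "prime (idx ?A ?B)" using p ixA by simp
  have cfa: "class_field_axiom G M ?A ?B" by (rule pidx_axiom[OF NA pA])
  have uB: "u : fx ?B" using fx_Sg[OF f0(2)] u(1) k(2) by simp
  have "nrm ?A ?B u = sm ?p ta u" unfolding sm_def by (rule nrm_eq[OF tA As(1) Bs(1) onD(3)[OF NA] uB])
  then obtain a where a: "a : fx ?B" "u = act ta a -. a" using cyclic_hilbert_90[OF NA cfa tA taA uB] NNu by auto
  have aU: "a : Cb U" "a : cC" using fx_Sg[OF f0(2)] a(1) fxc[OF a(1)] by auto
  define b where "b = a -. act sg a"
  have sga: "act sg a : Cb U" "act sg a : cC" using Cb_act[OF N sg(1) aU(1)] aU(2) sgc by auto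
  have b: "b : Cb U" "b : cC" unfolding b_def using fx_gdiv[OF inert_carrier[OF U(2)] aU(1) sga(1)] aU sga by auto
  have comm: "act ta (act sg a) = act sg (act ta a)"
   unfolding sg_def using inert_commute[OF N ta(1) ph(1) aU(1)] tac phc aU(2) by (simp add: act_mult)
  have "act ta b -. b = u -. act sg u" unfolding b_def a(2) using tac sgc aU(2) comm
   by (simp add: act_gdiv C.gdiv_simps C.m_ac)
  also have "act sg u = pe -. act ta w"
  proof -
   have "act ph w = w" using w(1) ph(1) by (simp add: fx_iff)
   then have "act sg w = act ta w" unfolding sg_def using tac phc wc by (simp add: act_mult)
   then show ?thesis unfolding u_def using pe'(2) sgc wc by (simp add: act_gdiv)
  qed
  also have "u -. (pe -. act ta w) = act ta w -. w" unfolding u_def using wc tac by (simp add: C.gdiv_simps C.m_ac)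
  finally have eq: "act ta b -. b = act ta w -. w" .
  let ?c = "w -. b"
  have c: "?c : Cb U" "?c : cC" using fx_gdiv[OF inert_carrier[OF U(2)] Cbfx[OF w(1)] b(1)] wc(1) b(2) by auto
  have "act ta ?c = ?c" using eq tac wc(1) b(2) by (simp add: act_gdiv C.gdiv_simps C.m_ac)
  then have tac': "act (ta [^] (i::nat)) ?c = ?c" for i by (rule act_pow_fixed[OF tac c(2)])
  have "act x ?c = ?c" if x: "x : inert H" for x
  proof -
   obtain i where "i : {..<?p}" and i: "inv (ta [^] i) *. x : inert U" using ltD(3)[OF ti x] by auto
   have xc: "x : cG" using x inert_carrier[OF U(1)] by blast
   have "act x ?c = act (ta [^] i *. (inv (ta [^] i) *. x)) ?c" using xc tac by (simp add: gnorm)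
   also have "... = act (ta [^] i) (act (inv (ta [^] i) *. x) ?c)" using xc tac c(2) by (intro act_mult) auto
   also have "act (inv (ta [^] i) *. x) ?c = ?c" using c(1) i by (simp add: fx_iff)
   finally show ?thesis using tac' by simp
  qed
  then have cH: "?c : Cb H" using c(2) by (simp add: fx_iff)
  \<comment> \<open>An open subgroup of \<open>H\<close> with full inertia that fixes
    \<open>?c\<close>; passing to its intersection with \<open>U\<close> multiplies the valuation by
    the ramification index \<open>?p\<close>.\<close>
  let ?V = "stab ?c Int H"
  note V = Cb_stab[OF U(1) cH]
  have oVU: "osub (?V Int U)" by (rule osub_Int[OF V(1) U(2)])
  have iVU: "inert (?V Int U) = inert U" using V(2) U(3) unfolding inertia_def by blast
  have cVU: "?c : fx (?V Int U)" by (rule fx_mono[OF _ V(3)]) blast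
  have "vt U ?c = v (?V Int U) ?c" by (rule vt_eq(2)[OF U(2) oVU iVU cVU])
  also have "... = v ?V ?c ^. ramification_index G Om d ?V (?V Int U)" by (rule v_props(5)[OF V(1) oVU _ V(3)]) blast
  also have "ramification_index G Om d ?V (?V Int U) = ?p" unfolding ramification_index_def V(2) iVU
   using idx_eq_card[OF ti inert_subgroup[OF Hs(1)] inert_subgroup[OF Us(1)]] by simp
  finally have e1: "vt U ?c = v ?V ?c ^. ?p" .
  have "vt U b = oW"
   unfolding b_def using vt_gdiv[OF U(2) aU(1) sga(1)] vt_act[OF N sg(1) aU(1)] vt_closed[OF U(2) aU(1)] by simp
  then have "vt U ?c = om" using vt_gdiv[OF U(2) Cbfx[OF w(1)] b(1)] vtw by simp
  moreover obtain z :: int where "v ?V ?c = om ^. z" using v_int[OF V(1,3)] by blast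
  ultimately have "om ^. (1::int) = om ^. (z * int ?p)" using e1 int_pow_nat by (simp add: Om.int_pow_1)
  then have "1 = z * int ?p" by (rule om_int_inj)
  then have "int ?p dvd 1" using dvd_triv_right[of "int ?p" z] by simp
  then show False using p by (simp add: prime_nat_iff)
 qed
 then show ?thesis using sg(1) by blast
qed

text \<open>Triviality of the kernel in H/U itself instead of its abelianization; since commutators
  are always in the kernel, this concerns abelian quotients.\<close>

definition RR_inj :: "'g set => 'g set => bool" where
 "RR_inj H U \<longleftrightarrow> (ALL x. RR H U x oC --> x : U)"

definition RR_surj :: "'g set => 'g set => bool" where
 "RR_surj H U \<longleftrightarrow> (ALL a:fx H. EX x. RR H U x a)"

lemma pidx_RR_nontrivial:
 assumes "onorm H U" "prime (idx H U)"
 shows "EX x:H. ~ RR H U x oC"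
proof (cases "inert H <= U")
 case True
 moreover have "idx H U ~= 1" using assms(2) by (simp add: prime_nat_iff)
 ultimately show ?thesis by (rule unram_RR_nontrivial[OF assms(1)])
qed (rule ramified_RR_nontrivial[OF assms])

lemma RR_mod:
 assumes "onorm H U" "RR H U x a" "b : fx H" "b -. a : Nm H U" shows "RR H U x b"
proof -
 have "x : cG" using osD(4)[OF onD(1)[OF assms(1)]] RR_D(1)[OF assms(2)] by blast
 then have "x *. inv x : U" using osD(5)[OF onD(2)[OF assms(1)]] by simp
 then show ?thesis using RR_cong[OF assms(1,2) RR_D(1)[OF assms(2)] _ assms(3,4)] by blast
qed

lemma RR_1_iff:
 assumes "onorm H U" "RR H U x a" shows "RR H U x oC \<longleftrightarrow> a : Nm H U"
proof
 have ac: "a : cC" using RR_D(3)[OF assms(2)] .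
 assume "RR H U x oC"
 then have "a -. oC : Nm H U" by (rule RR_unique[OF assms])
 then show "a : Nm H U" using ac by (simp add: C.gdiv_def)
next
 assume a: "a : Nm H U"
 have "oC : fx H" by (rule fx_closed(1)[OF osD(3)[OF onD(1)[OF assms(1)]]])
 moreover have "oC -. a : Nm H U" using sg_inv[OF Nm_sub[OF assms(1)] a] RR_D(3)[OF assms(2)] by (simp add: C.gdiv_def)
 ultimately show "RR H U x oC" by (rule RR_mod[OF assms])
qed

text \<open>A nontrivial class in the kernel would generate the group of prime order and thus put
  every class into the kernel, contrary to \<open>pidx_RR_nontrivial\<close>.\<close>

lemma pidx_inj:
 assumes N: "onorm H U" and p: "prime (idx H U)"
 shows "RR_inj H U" unfolding RR_inj_def
proof (intro allI impI)
 fix x assume R: "RR H U x oC"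
 note U = onD[OF N] note Hs = osD[OF U(1)] and Us = osD[OF U(2)]
 have x: "x : H" by (rule RR_D(1)[OF R])
 show "x : U"
 proof (rule ccontr)
  assume xU: "x \<notin> U"
  obtain z where z: "z : H" "~ RR H U z oC" using pidx_RR_nontrivial[OF N p] by blast
  obtain i where "i < idx H U" and i: "inv (x [^] i) *. z : U" using ltD(3)[OF pidx_transversal(1)[OF N p x xU] z(1)] by auto
  have xi: "x [^] i : H" by (rule osub_pow[OF U(1) x])
  have "x [^] i *. (inv (x [^] i) *. z) *. inv (x [^] i) : U" by (rule U(4)[OF xi i])
  then have "z *. inv (x [^] i) : U" using Hs(4)[OF xi] Hs(4)[OF z(1)] by (simp add: gnorm)
  then have "inv (z *. inv (x [^] i)) : U" by (rule Us(7))
  then have "x [^] i *. inv z : U" using Hs(4)[OF xi] Hs(4)[OF z(1)] by (simp add: inv_mult_group)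
  moreover have "RR H U (x [^] i) oC" using RR_pow[OF N R, of i] by simp
  ultimately show False using RR_change[OF N _ z(1)] z(2) by blast
 qed
qed

text \<open>By injectivity the powers of \<open>ta\<close> have values in different norm classes,
  and by the class field axiom there are no more classes than that.\<close>

lemma pidx_surj:
 assumes N: "onorm H U" and p: "prime (idx H U)"
 shows "RR_surj H U" unfolding RR_surj_def
proof
 fix c assume c: "c : fx H"
 note U = onD[OF N] note Hs = osD[OF U(1)] and Us = osD[OF U(2)]
 let ?p = "idx H U" and ?N = "Nm H U"
 interpret A: comm_group "ob M H" by (rule ob_comm_group[OF Hs(3)])
 have sN: "subgroup ?N (ob M H)" by (rule Nm_subgroup_ob[OF fi_normal[OF N]])
 have "?p ~= 1" using p by (simp add: prime_nat_iff)
 then obtain ta where ta: "ta : H" "ta \<notin> U" using ex_not_mem_of_index[OF N] by blast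
 note t = pidx_transversal(1)[OF N p ta]
 obtain a where a: "RR H U ta a" using RR_exists[OF N ta(1)] by blast
 have Ri: "RR H U (ta [^] i) (a ^: i)" for i :: nat by (rule RR_pow[OF N a])
 note ai = RR_D(2)[OF Ri] RR_D(3)[OF Ri]
 have eq: "?N #>\<^bsub>ob M H\<^esub> x = ?N #>\<^bsub>ob M H\<^esub> y \<longleftrightarrow> x -. y : ?N" if "x : fx H" "y : fx H" for x y
  using A.rcos_eq_iff[OF sN, of x y] that ob_inv[OF Hs(3)] by (simp add: C.gdiv_def)
 have taH: "ta [^] (i::nat) : H" for i by (rule osub_pow[OF U(1) ta(1)])
 have inj: "inj_on (%i. ?N #>\<^bsub>ob M H\<^esub> (a ^: i)) {..<?p}"
 proof (rule inj_onI)
  fix i j assume ij: "i : {..<?p}" "j : {..<?p}" "?N #>\<^bsub>ob M H\<^esub> (a ^: i) = ?N #>\<^bsub>ob M H\<^esub> (a ^: j)"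
  have "RR H U (inv (ta [^] j) *. ta [^] i) (/: (a ^: j) *: a ^: i)" by (rule RR_mult[OF N RR_inv[OF N Ri] Ri])
  moreover have "/: (a ^: j) *: a ^: i : ?N" using eq[OF ai(1) ai(1)] ij(3) ai(2) by (simp add: C.gdiv_def C.m_comm)
  ultimately have "RR H U (inv (ta [^] j) *. ta [^] i) oC" using RR_1_iff[OF N] by blast
  then have "inv (ta [^] j) *. ta [^] i : U" using pidx_inj[OF N p] unfolding RR_inj_def by blast
  then show "i = j" using ltr_uniq[OF t Hs(1) Us(1) ij(2,1)] by simp
 qed
 have ord: "card (carrier (ob M H Mod ?N)) = ?p" using cfa_order[OF pidx_axiom[OF N p]] unfolding order_def .
 have "(%i. ?N #>\<^bsub>ob M H\<^esub> (a ^: i)) ` {..<?p} = carrier (ob M H Mod ?N)"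
 proof (rule card_subset_eq)
  show "finite (carrier (ob M H Mod ?N))" by (rule card_ge_0_finite) (use ord p prime_gt_0_nat in simp)
  show "(%i. ?N #>\<^bsub>ob M H\<^esub> (a ^: i)) ` {..<?p} <= carrier (ob M H Mod ?N)" using ai(1) by (auto simp: carrier_FactGroup)
  show "card ((%i. ?N #>\<^bsub>ob M H\<^esub> (a ^: i)) ` {..<?p}) = card (carrier (ob M H Mod ?N))" using card_image[OF inj] ord by simp
 qed
 moreover have "?N #>\<^bsub>ob M H\<^esub> c : carrier (ob M H Mod ?N)" using c by (simp add: carrier_FactGroup)
 ultimately have "?N #>\<^bsub>ob M H\<^esub> c : (%i. ?N #>\<^bsub>ob M H\<^esub> (a ^: i)) ` {..<?p}" by simp
 then obtain i where i: "?N #>\<^bsub>ob M H\<^esub> c = ?N #>\<^bsub>ob M H\<^esub> (a ^: i)" "i : {..<?p}" by (rule imageE)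
 then have "c -. a ^: i : ?N" using eq[OF c ai(1)] by simp
 then show "EX x. RR H U x c" using RR_mod[OF N Ri c] by blast
qed

text \<open>Match \<open>a\<close> over H/I first. The remaining error is the norm of some
  \<open>c\<close> in C^I, which is a value over I/U, and \<open>RR_ind\<close> carries this to
  \<open>H\<close>.\<close>

lemma RR_surj_extension:
 assumes N: "onorm H U" and I: "onorm H I" and UI: "U <= I"
  and "RR_surj H I" "RR_surj I U"
 shows "RR_surj H U" unfolding RR_surj_def
proof
 fix a assume a: "a : fx H"
 note U = onD[OF N] and Is = onD[OF I]
 have NI: "onorm I U" by (rule onI[OF Is(2) U(2) UI]) (use U(4) Is(3) in blast)
 obtain x where x: "RR H I x a" using assms(4) a unfolding RR_surj_def by blast
 obtain b where b: "RR H U x b" using RR_exists[OF N RR_D(1)[OF x]] by blast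
 have bH: "b : fx H" by (rule RR_D(2)[OF b])
 have "RR H I x (nrm H H b)" by (rule RR_ind[OF I N subset_refl UI b])
 then have "RR H I x b" using nrm_self[OF osD(1)[OF U(1)] bH] by simp
 then have "a -. b : Nm H I" by (rule RR_unique[OF I x])
 then obtain c where c: "c : fx I" "a -. b = nrm H I c" unfolding Nm_eq by blast
 obtain y where y: "RR I U y c" using assms(5) c(1) unfolding RR_surj_def by blast
 have "RR H U y (nrm H I c)" by (rule RR_ind[OF N NI Is(3) subset_refl y])
 then have "RR H U (y *. x) ((a -. b) *: b)" unfolding c(2) by (rule RR_mult[OF N _ b])
 moreover have "(a -. b) *: b = a" using fxc[OF a] fxc[OF bH] by (simp add: C.gdiv_def C.m_assoc)
 ultimately show "EX x. RR H U x a" by auto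
qed

lemma sylow_preimage:
 assumes N: "onorm H U" and p: "prime p" and ix: "idx H U = p ^ a * m"
 shows "EX A. subgroup A (quo H U) & card A = p ^ a"
 using sylow_thm[OF p quo_group[OF N] _ quo_finite[OF N], of a m] quo_order[of H U] ix by auto

text \<open>Induction on the index. A p-group has a normal subgroup of index p, which reduces prime
  powers to prime index. Otherwise the exponents of powers of \<open>a\<close> that are values form
  \<open>J\<close>, closed under multiples and differences, hence the multiples of its least
  positive member \<open>k\<close>. If a prime \<open>q\<close> divided \<open>k\<close>, the
  preimage of a Sylow q-subgroup, by induction and \<open>RR_ind\<close>, would contribute its index
  to \<open>J\<close>, which is prime to \<open>q\<close>.\<close>

lemma RR_surj:
 assumes "onorm H U" shows "RR_surj H U" using assms
proof (induction "idx H U" arbitrary: H U rule: less_induct)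
 case less
 note N = less.prems
 note U = onD[OF N] note Hs = osD[OF U(1)] and Us = osD[OF U(2)]
 let ?n = "idx H U"
 have n0: "?n > 0" by (rule idx_pos[OF U(2) Hs(1) U(3)])
 obtain tU where tU: "ltr H U {..<?n} tU" using osub_transversal[OF U(2) Hs(1) U(3)] by blast
 have Nmn: "a ^: ?n : Nm H U" if "a : fx H" for a
  using nrm_fixed[OF fi_normal[OF N] that] fx_mono[OF U(3) that] unfolding Nm_eq by (metis imageI)
 show ?case
 proof (cases "EX p e. prime p & ?n = p ^ Suc e")
  case True
  then obtain p e where p: "prime p" "?n = p ^ Suc e" by blast
  show ?thesis
  proof (cases "e = 0")
   case True
   then show ?thesis using pidx_surj[OF N] p by simp
  next
   case False
   obtain A where A: "subgroup A (quo H U)" "card A = p ^ e"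
   using sylow_preimage[OF N p(1), of e p] p(2) by (auto simp: mult.commute)
   interpret Q: group "quo H U" by (rule quo_group[OF N])
   have nA: "A \<lhd> quo H U"
   by (rule Q.prime_power_index_prime_normal[OF quo_finite[OF N] p(1) _ A]) (use p(2) quo_order[of H U] in simp)
   let ?I = "{x : H. U #> x : A}"
   note I = quo_preimage[OF N A(1)]
   have e1: "idx ?I U = p ^ e" using I(5) A(2) by simp
   have "p ^ e * p = idx H ?I * p ^ e" using I(6) p(2) e1 by (simp add: mult.commute)
   then have e2: "idx H ?I = p" using prime_gt_0_nat[OF p(1)] by simp
   have "idx ?I U < ?n" using e1 p(2) prime_gt_1_nat[OF p(1)] by simp
   then have "RR_surj ?I U" by (rule less.hyps[OF _ I(4)])
   moreover have "RR_surj H ?I" by (rule pidx_surj[OF I(7)[OF nA]]) (use e2 p(1) in simp)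
   ultimately show ?thesis by (intro RR_surj_extension[OF N I(7)[OF nA] I(2)])
  qed
 next
  case False
  show ?thesis unfolding RR_surj_def
  proof
   fix a assume a: "a : fx H"
   have ac: "a : cC" by (rule fxc[OF a])
   define J where "J = {k::nat. EX x. RR H U x (a ^: k)}"
   have nJ: "?n : J" unfolding J_def using RR_U[OF N Us(5)] Nmn[OF a] by blast
   have diff: "j - i : J" if ij: "i : J" "j : J" "i <= j" for i j
   proof -
   obtain x y where xy: "RR H U x (a ^: i)" "RR H U y (a ^: j)" using ij unfolding J_def by blast
   have "a ^: j = a ^: i *: a ^: (j - i)" using ij(3) ac by (simp add: C.nat_pow_mult)
   then have "/: (a ^: i) *: a ^: j = a ^: (j - i)" using ac by (simp add: C.gnorm)
   then show ?thesis using RR_mult[OF N RR_inv[OF N xy(1)] xy(2)] unfolding J_def by auto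
   qed
   have mult: "i * m : J" if i: "i : J" for i m
   proof -
   obtain x where r: "RR H U x (a ^: i)" using i unfolding J_def by blast
   have "RR H U (x [^] m) (a ^: (i * m))" using RR_pow[OF N r, of m] ac by (simp add: C.nat_pow_pow)
   then show ?thesis unfolding J_def by blast
   qed
   define k where "k = (LEAST k. k : J & k > 0)"
   have k: "k : J" "k > 0" using LeastI[of "%k. k : J & k > 0" ?n] nJ n0 unfolding k_def by auto
   have kdvd: "k dvd j" if j: "j : J" for j
   proof -
   have "j - k * (j div k) : J" by (rule diff[OF mult[OF k(1)] j]) simp
   then have "j mod k : J" by (simp add: minus_mult_div_eq_mod)
   moreover have "~ (j mod k : J & j mod k > 0)"
   using not_less_Least[of "j mod k" "%k. k : J & k > 0"] k(2) unfolding k_def by (metis mod_less_divisor)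
   ultimately show ?thesis by (simp add: dvd_eq_mod_eq_0)
   qed
   have "k = 1"
   proof (rule ccontr)
   assume "k ~= 1"
   then obtain q where q: "prime q" "q dvd k" using prime_factor_nat by blast
   let ?e = "multiplicity q ?n"
   obtain m where m: "?n = q ^ ?e * m" using multiplicity_dvd[of q ?n] by (auto elim: dvdE)
   have qm: "~ q dvd m"
   proof
   assume "q dvd m"
   then have "q ^ Suc ?e dvd ?n" using m by (metis dvd_refl mult.commute mult_dvd_mono power_Suc)
   then have "Suc ?e <= ?e"
   using power_dvd_iff_le_multiplicity[where p = q and x = ?n and n = "Suc ?e"] n0 q(1) by (auto simp: prime_nat_iff)
   then show False by simp
   qed
   have "q dvd ?n" using q(2) kdvd[OF nJ] dvd_trans by blast
   then have e0: "?e > 0" using n0 q(1) prime_multiplicity_gt_zero_iff[of q ?n] by simp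
   obtain A where A: "subgroup A (quo H U)" "card A = q ^ ?e" using sylow_preimage[OF N q(1) m] by blast
   let ?I = "{x : H. U #> x : A}"
   note I = quo_preimage[OF N A(1)]
   have e1: "idx ?I U = q ^ ?e" using I(5) A(2) by simp
   have "q ^ ?e * m = idx H ?I * q ^ ?e" using I(6) m e1 by simp
   then have e2: "idx H ?I = m" using prime_gt_0_nat[OF q(1)] by simp
   \<comment> \<open>The index is no prime power in this case, so the Sylow subgroup is proper and
     the induction hypothesis covers its preimage.\<close>
   have "q ^ ?e ~= ?n" using False q(1) e0 by (metis Suc_pred)
   then have "m ~= 1" using m by auto
   moreover have "m ~= 0"
   proof
   assume m0: "m = 0"
   have "?n = q ^ ?e * 0" using m unfolding m0 .
   then show False using n0 by simp
   qed
   ultimately have "q ^ ?e * 1 < q ^ ?e * m" using prime_gt_0_nat[OF q(1)] by simp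
   then have "q ^ ?e < ?n" by (simp only: mult_1_right m[symmetric])
   then have "idx ?I U < ?n" by (simp only: e1)
   then have s: "RR_surj ?I U" by (rule less.hyps[OF _ I(4)])
   obtain y where y: "RR ?I U y a" using s fx_mono[OF I(3) a] unfolding RR_surj_def by blast
   have "RR H U y (nrm H ?I a)" by (rule RR_ind[OF N I(4) I(3) subset_refl y])
   then have "m : J" unfolding J_def using nrm_fixed[OF fi_open[OF U(1) I(1,3)] a] e2 by auto
   then have "k dvd m" by (rule kdvd)
   then show False using q(2) qm dvd_trans by blast
   qed
   then show "EX x. RR H U x a" using k(1) ac unfolding J_def by simp
  qed
 qed
qed

section \<open>Abelian quotients and the kernel of the reciprocity relation\<close>

lemma quo_commI:
 assumes N: "onorm H U" and c: "comm_group (quo H U)" and x: "x : H" and y: "y : H"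
 shows "x *. y *. inv x *. inv y : U"
proof -
 note U = onD[OF N] note Hs = osD[OF U(1)]
 interpret Q: comm_group "quo H U" by (rule c)
 have "U #> (x *. y) = U #> (y *. x)"
  using Q.m_comm[OF quo_mem[OF x] quo_mem[OF y]] quo_mult[OF N x y] quo_mult[OF N y x] by simp
 then have "x *. y *. inv (y *. x) : U" using quo_eq_iff[OF N Hs(6)[OF x y] Hs(6)[OF y x]] by simp
 then show ?thesis using Hs(4)[OF x] Hs(4)[OF y] by (simp add: gnorm)
qed

lemma quo_comm_iff:
 assumes N: "onorm H U"
 shows "comm_group (quo H U) \<longleftrightarrow> (ALL x:H. ALL y:H. x *. y *. inv x *. inv y : U)"
proof
 note U = onD[OF N] note Hs = osD[OF U(1)]
 interpret Q: group "quo H U" by (rule quo_group[OF N])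
 assume c: "ALL x:H. ALL y:H. x *. y *. inv x *. inv y : U"
 show "comm_group (quo H U)"
 proof (rule Q.group_comm_groupI)
  fix X Y assume "X : carrier (quo H U)" "Y : carrier (quo H U)"
  then obtain x y where xy: "x : H" "X = U #> x" "y : H" "Y = U #> y" unfolding quo_carrier by blast
  have "x *. y *. inv (y *. x) : U" using c xy(1,3) Hs(4) by (simp add: gnorm)
  then show "X *.\<^bsub>quo H U\<^esub> Y = Y *.\<^bsub>quo H U\<^esub> X" unfolding xy(2,4) quo_mult[OF N xy(1,3)] quo_mult[OF N xy(3,1)]
   using quo_eq_iff[OF N Hs(6)[OF xy(1,3)] Hs(6)[OF xy(3,1)]] by simp
 qed
qed (use quo_commI[OF N] in blast)

text \<open>Let \<open>?I\<close> have prime index. An \<open>x\<close> in the kernel lies in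
  \<open>?I\<close>; its value \<open>b\<close> there has a norm to \<open>H\<close> that is also
  the norm of some \<open>c\<close> in C^U. Dividing \<open>b\<close> by the norm of
  \<open>c\<close> gives an element of norm 1, hence of the form (ta z)/z. As \<open>z\<close> is
  the value of some \<open>g\<close>, this quotient is a value of the commutator of
  \<open>ta\<close> and \<open>g\<close>, which lies in \<open>U\<close> since H/U is abelian. So
  \<open>b\<close> is a norm from \<open>U\<close>, and the induction hypothesis over
  \<open>?I\<close> applies.\<close>

lemma RR_inj_abelian:
 assumes "onorm H U" "comm_group (quo H U)" shows "RR_inj H U" using assms
proof (induction "idx H U" arbitrary: H U rule: less_induct)
 case less
 note N = less.prems(1)
 note U = onD[OF N] note Hs = osD[OF U(1)] and Us = osD[OF U(2)]
 show ?case
 proof (cases "idx H U = 1")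
  case True
  then have "U = H" using ex_not_mem_of_index
   using osub_transversal[OF U(2) Hs(1) U(3)] idx_eq_1[OF _ Hs(1) Us(1) U(3) True] by auto
  then show ?thesis unfolding RR_inj_def using RR_D(1) by blast
 next
  case False
  interpret Q: comm_group "quo H U" by (rule less.prems(2))
  obtain A p where A: "prime p" "subgroup A (quo H U)" "card (rcosets\<^bsub>quo H U\<^esub> A) = p"
   using Q.subgroup_of_prime_index[OF quo_finite[OF N]] False quo_order[of H U] by auto
  let ?I = "{x : H. U #> x : A}"
  note I = quo_preimage[OF N A(2)]
  have nA: "A \<lhd> quo H U" by (rule Q.subgroup_imp_normal[OF A(2)])
  note NI = I(7)[OF nA]
  have A0: "card A > 0"
   using sg_one[OF A(2)] finite_subset[OF sg_sub[OF A(2)] quo_finite[OF N]] by (auto simp: card_gt_0_iff)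
  have "idx H U = card A * p"
   using Q.lagrange_finite[OF quo_finite[OF N] A(2)] A(3) quo_order[of H U] by (simp add: mult.commute)
  then have ip: "idx H ?I = p" and lt: "idx ?I U < idx H U" using I(5,6) A0 prime_gt_1_nat[OF A(1)] by simp_all
  have pI: "prime (idx H ?I)" using ip A(1) by simp
  have cI: "comm_group (quo ?I U)" unfolding quo_comm_iff[OF I(4)] using quo_commI[OF N less.prems(2)] I(3) by blast
  have inj: "RR_inj ?I U" by (rule less.hyps[OF lt I(4) cI])
  show ?thesis unfolding RR_inj_def
  proof (intro allI impI)
   fix x assume R: "RR H U x oC"
   have xH: "x : H" by (rule RR_D(1)[OF R])
   have one: "oC : fx H" by (rule fx_closed(1)[OF Hs(3)])
   have "RR H ?I x (nrm H H oC)" by (rule RR_ind[OF NI N subset_refl I(2) R])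
   then have "RR H ?I x oC" using nrm_self[OF Hs(1) one] by simp
   then have xI: "x : ?I" using pidx_inj[OF NI pI] unfolding RR_inj_def by blast
   obtain b where b: "RR ?I U x b" using RR_exists[OF I(4) xI] by blast
   have bI: "b : fx ?I" by (rule RR_D(2)[OF b])
   have "RR H U x (nrm H ?I b)" by (rule RR_ind[OF N I(4) I(3) subset_refl b])
   then have "nrm H ?I b : Nm H U" using RR_1_iff[OF N] R by blast
   then obtain c where c: "c : fx U" "nrm H ?I b = nrm H U c" unfolding Nm_eq by blast
   have fHI: "fi H ?I" and fIU: "fi ?I U" using fi_normal NI I(4) by auto
   have ncI: "nrm ?I U c : fx ?I" by (rule nrm_closed[OF fIU c(1)])
   let ?y = "b -. nrm ?I U c"
   have y: "?y : fx ?I" by (rule fx_gdiv[OF osD(3)[OF I(1)] bI ncI])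
   have "nrm H ?I ?y = nrm H ?I b -. nrm H ?I (nrm ?I U c)" by (rule nrm_cdiv[OF fHI bI ncI])
   also have "... = oC" unfolding c(2) nrm_tower[OF fHI fIU c(1), symmetric]
   using fxc[OF nrm_closed[OF fi_normal[OF N] c(1)]] by simp
   finally have ny: "nrm H ?I ?y = oC" .
   have "idx H ?I ~= 1" using pI by (simp add: prime_nat_iff)
   then obtain ta where ta: "ta : H" "ta \<notin> ?I" using ex_not_mem_of_index[OF NI] by blast
   obtain z where z: "z : fx ?I" "?y = act ta z -. z"
   using cyclic_hilbert_90[OF NI pidx_axiom[OF NI pI] pidx_transversal(1)[OF NI pI ta] ta(1) y ny] by blast
   obtain g where g: "RR ?I U g z" using RR_surj[OF I(4)] z(1) unfolding RR_surj_def by blast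
   have gI: "g : ?I" by (rule RR_D(1)[OF g])
   have gH: "g : H" using gI by blast
   have tac: "ta : cG" and gc: "g : cG" using Hs(4) ta(1) gH by auto
   have "RR (cs ta ?I) (cs ta U) (ce ta g) (act ta z)" by (rule RR_conj[OF I(4) g tac])
   then have cg: "RR ?I U (ta *. g *. inv ta) (act ta z)"
   unfolding cs_self(1)[OF NI ta(1)] cs_self(1)[OF N ta(1)] conj_elt_def .
   have "ta *. g *. inv ta *. inv g : U" by (rule quo_commI[OF N less.prems(2) ta(1) gH])
   then have "RR ?I U g (act ta z)" by (rule RR_change[OF I(4) cg gI])
   then have "act ta z -. z : Nm ?I U" using RR_unique[OF I(4) _ g] by blast
   then have yN: "?y : Nm ?I U" using z(2) by simp
   have bc: "b : cC" "nrm ?I U c : cC" using fxc[OF bI] fxc[OF ncI] by auto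
   have "nrm ?I U c : Nm ?I U" unfolding Nm_eq using c(1) by blast
   then have "?y *: nrm ?I U c : Nm ?I U" by (rule sg_mult[OF Nm_sub[OF I(4)] yN])
   moreover have "?y *: nrm ?I U c = b" using bc by (simp add: C.gdiv_def C.m_assoc)
   ultimately have "RR ?I U x oC" using RR_1_iff[OF I(4) b] by simp
   then show "x : U" using inj unfolding RR_inj_def by blast
  qed
 qed
qed

text \<open>Commutators are in the kernel because the values commute. Conversely the kernel is
  mapped into the quotient by the preimage \<open>?I\<close> of the commutator subgroup, where
  \<open>RR_inj_abelian\<close> holds.\<close>

lemma RR_kernel:
 assumes N: "onorm H U" and x: "x : H"
 shows "RR H U x oC \<longleftrightarrow> U #> x : derived (quo H U) (carrier (quo H U))"
proof
 note U = onD[OF N] note Hs = osD[OF U(1)] and Us = osD[OF U(2)]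
 interpret Q: group "quo H U" by (rule quo_group[OF N])
 let ?D = "derived (quo H U) (carrier (quo H U))"
 have comm: "RR H U (a *. b *. inv a *. inv b) oC" if ab: "a : H" "b : H" for a b
 proof -
  obtain al bt where R: "RR H U a al" "RR H U b bt" using RR_exists[OF N ab(1)] RR_exists[OF N ab(2)] by blast
  have "RR H U (a *. b *. inv a *. inv b) (al *: bt *: /: al *: /: bt)" by (intro RR_mult[OF N] RR_inv[OF N] R)
  moreover have "al *: bt *: /: al *: /: bt = oC"
   using C.inv_mult[OF RR_D(3)[OF R(1)] RR_D(3)[OF R(2)]] C.r_inv[of "al *: bt"] RR_D(3)[OF R(1)] RR_D(3)[OF R(2)]
   by (simp add: C.m_assoc)
  ultimately show ?thesis by simp
 qed
 {
  assume D: "U #> x : ?D"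
  have "ALL y:H. U #> y = X --> RR H U y oC" if "X : ?D" for X using that unfolding derived_def
  proof (induction X rule: generate.induct)
   case one
   show ?case using quo_eq_one[OF N] RR_U[OF N] sg_one[OF Nm_sub[OF N]] by simp
  next
   case (incl X)
   then obtain A B where AB: "A : carrier (quo H U)" "B : carrier (quo H U)"
   "X = A *.\<^bsub>quo H U\<^esub> B *.\<^bsub>quo H U\<^esub> inv\<^bsub>quo H U\<^esub> A *.\<^bsub>quo H U\<^esub> inv\<^bsub>quo H U\<^esub> B" by blast
   obtain a b where ab: "a : H" "A = U #> a" "b : H" "B = U #> b" using AB(1,2) unfolding quo_carrier by blast
   have h: "a *. b : H" "a *. b *. inv a : H" "a *. b *. inv a *. inv b : H" using Hs(6,7) ab(1,3) by auto
   have X: "X = U #> (a *. b *. inv a *. inv b)"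
   unfolding AB(3) ab(2,4) quo_inv[OF N ab(1)] quo_inv[OF N ab(3)] quo_mult[OF N ab(1,3)]
   quo_mult[OF N h(1) Hs(7)[OF ab(1)]] quo_mult[OF N h(2) Hs(7)[OF ab(3)]] ..
   show ?case
   proof (intro ballI impI)
   fix y assume y: "y : H" "U #> y = X"
   then have "a *. b *. inv a *. inv b *. inv y : U" using quo_eq_iff[OF N h(3) y(1)] X by simp
   then show "RR H U y oC" by (rule RR_change[OF N comm[OF ab(1,3)] y(1)])
   qed
  next
   case (inv X)
   then obtain A B where AB: "A : carrier (quo H U)" "B : carrier (quo H U)"
   "X = A *.\<^bsub>quo H U\<^esub> B *.\<^bsub>quo H U\<^esub> inv\<^bsub>quo H U\<^esub> A *.\<^bsub>quo H U\<^esub> inv\<^bsub>quo H U\<^esub> B" by blast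
   obtain a b where ab: "a : H" "A = U #> a" "b : H" "B = U #> b" using AB(1,2) unfolding quo_carrier by blast
   have h: "a *. b : H" "a *. b *. inv a : H" "a *. b *. inv a *. inv b : H" using Hs(6,7) ab(1,3) by auto
   have X: "inv\<^bsub>quo H U\<^esub> X = U #> inv (a *. b *. inv a *. inv b)"
   unfolding AB(3) ab(2,4) quo_inv[OF N ab(1)] quo_inv[OF N ab(3)] quo_mult[OF N ab(1,3)]
   quo_mult[OF N h(1) Hs(7)[OF ab(1)]] quo_mult[OF N h(2) Hs(7)[OF ab(3)]] quo_inv[OF N h(3)] ..
   have R: "RR H U (inv (a *. b *. inv a *. inv b)) oC" using RR_inv[OF N comm[OF ab(1,3)]] by simp
   show ?case
   proof (intro ballI impI)
   fix y assume y: "y : H" "U #> y = inv\<^bsub>quo H U\<^esub> X"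
   then have "inv (a *. b *. inv a *. inv b) *. inv y : U" using quo_eq_iff[OF N Hs(7)[OF h(3)] y(1)] X by simp
   then show "RR H U y oC" by (rule RR_change[OF N R y(1)])
   qed
  next
   case (eng X Y)
   have "X : ?D" "Y : ?D" using eng.hyps unfolding derived_def by auto
   then have "X : carrier (quo H U)" "Y : carrier (quo H U)" using Q.derived_in_carrier[OF subset_refl] by auto
   then obtain a b where ab: "a : H" "X = U #> a" "b : H" "Y = U #> b" unfolding quo_carrier by blast
   have "RR H U a oC" "RR H U b oC" using eng.IH ab by auto
   then have R: "RR H U (a *. b) oC" using RR_mult[OF N] by fastforce
   show ?case
   proof (intro ballI impI)
   fix y assume y: "y : H" "U #> y = X *.\<^bsub>quo H U\<^esub> Y"
   then have "a *. b *. inv y : U" using quo_eq_iff[OF N Hs(6)[OF ab(1,3)] y(1)] ab quo_mult[OF N ab(1,3)] by simp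
   then show "RR H U y oC" by (rule RR_change[OF N R y(1)])
   qed
  qed
  then show "RR H U x oC" using D x by blast
 }
 assume R: "RR H U x oC"
 have nD: "?D \<lhd> quo H U" by (rule Q.derived_self_is_normal)
 have sD: "subgroup ?D (quo H U)" by (rule normal_imp_subgroup[OF nD])
 let ?I = "{x : H. U #> x : ?D}"
 note I = quo_preimage[OF N sD] note NI = I(7)[OF nD]
 have "RR H ?I x (nrm H H oC)" by (rule RR_ind[OF NI N subset_refl I(2) R])
 then have RI: "RR H ?I x oC" using nrm_self[OF Hs(1) fx_closed(1)[OF Hs(3)]] by simp
 have "comm_group (quo H ?I)" unfolding quo_comm_iff[OF NI]
 proof (intro ballI)
  fix a b assume ab: "a : H" "b : H"
  have h: "a *. b : H" "a *. b *. inv a : H" "a *. b *. inv a *. inv b : H" using Hs(6,7) ab by auto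
  have "(U #> a) *.\<^bsub>quo H U\<^esub> (U #> b) *.\<^bsub>quo H U\<^esub> inv\<^bsub>quo H U\<^esub> (U #> a) *.\<^bsub>quo H U\<^esub> inv\<^bsub>quo H U\<^esub> (U #> b) : ?D"
   unfolding derived_def by (rule generate.incl) (use quo_mem ab in blast)
  then show "a *. b *. inv a *. inv b : ?I" unfolding quo_inv[OF N ab(1)] quo_inv[OF N ab(2)] quo_mult[OF N ab]
   quo_mult[OF N h(1) Hs(7)[OF ab(1)]] quo_mult[OF N h(2) Hs(7)[OF ab(2)]] using h(3) by blast
 qed
 then have "RR_inj H ?I" by (rule RR_inj_abelian[OF NI])
 then show "U #> x : ?D" using RI unfolding RR_inj_def by blast
qed

section \<open>The Fesenko-Neukirch datum\<close>

lemma valuation_Om: "v : valuations G Om d om M cO"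
proof -
 have h: "v H : hom (ob M H) (Om(|carrier := cO|))" if "osub H" for H
  using v_closed[OF that] v_props(1)[OF that] by (auto simp: hom_def)
 show ?thesis unfolding valuations_def mem_Collect_eq
  by (intro allI impI, rule conjI[OF h conjunct2[OF mp[OF spec[OF valuation[unfolded valuations_def mem_Collect_eq]]]]],
   assumption, assumption)
qed

text \<open>With \<open>v_image\<close> this yields the first condition of the datum: im(v_H) is the
  infinite cyclic group \<open>Z\<close> generated by \<open>om\<close>, and \<open>N\<close> is
  [H:U] im(v_U) for n = [H:U].\<close>

lemma om_powers_quotient:
 fixes n :: nat
 assumes n0: "n > 0"
 defines "Z == range (%z::int. om ^. z)" and "N == range (%z::int. om ^. (z * int n))"
 shows "order (Om(|carrier := Z|) Mod N) = n"
  and "generate (Om(|carrier := Z|) Mod N) {N #>\<^bsub>Om\<^esub> om} = carrier (Om(|carrier := Z|) Mod N)"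
proof -
 have ip: "om ^. (a::int) *^ om ^. (b::int) = om ^. (a + b)" "/^ (om ^. a) = om ^. (- a)"
  "om ^. a : cO" for a b using Om.int_pow_mult[OF Om.om_closed] Om.int_pow_neg[OF Om.om_closed] by auto
 have sub: "subgroup (range (%z::int. om ^. (z * int m))) Om" for m
 proof (rule Om.subgroupI)
  show "/^ x : range (%z::int. om ^. (z * int m))" if x: "x : range (%z::int. om ^. (z * int m))" for x
  proof -
   obtain z where "x = om ^. (z * int m)" using x by blast
   then have "/^ x = om ^. (- z * int m)" using ip(2) by simp
   then show ?thesis by blast
  qed
  show "x *^ y : range (%z::int. om ^. (z * int m))"
   if xy: "x : range (%z::int. om ^. (z * int m))" "y : range (%z::int. om ^. (z * int m))" for x y
  proof -
   obtain a b where "x = om ^. (a * int m)" "y = om ^. (b * int m)" using xy by blast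
   then have "x *^ y = om ^. ((a + b) * int m)" using ip(1) by (simp add: distrib_right)
   then show ?thesis by blast
  qed
 qed (use ip(3) in auto)
 have sZ: "subgroup Z Om" using sub[of 1] unfolding Z_def by simp
 have sN: "subgroup N Om" using sub[of n] unfolding N_def .
 have NZ: "N <= Z" unfolding N_def Z_def by blast
 let ?A = "Om(|carrier := Z|)" and ?Q = "Om(|carrier := Z|) Mod N"
 have diff: "/^ (om ^. i) *^ om ^. (z::int) = om ^. (z - int i)" for i :: nat and z
  using ip(1,2)[of "int i"] ip(1)[of "- int i" z] by (simp add: int_pow_int add.commute)
 have tr: "left_transversal Om Z N {..<n} (%i. om ^. i)"
 proof (rule Om.ltI[OF sZ sN])
  show "om ^. i : Z" if "i : {..<n}" for i :: nat unfolding Z_def by (rule range_eqI[of _ _ "int i"]) (simp add: int_pow_int)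
  show "EX i:{..<n}. /^ (om ^. i) *^ x : N" if x: "x : Z" for x
  proof -
   obtain z :: int where z: "x = om ^. z" using x unfolding Z_def by blast
   let ?i = "nat (z mod int n)"
   have i: "int ?i = z mod int n" "?i < n" using n0 by (auto simp: nat_less_iff)
   have "z - int ?i = z div int n * int n" unfolding i(1) by (simp add: minus_mod_eq_div_mult)
   then have "/^ (om ^. ?i) *^ x : N" unfolding z diff N_def by (metis rangeI)
   then show ?thesis using i(2) by blast
  qed
  show "i = j" if ij: "i : {..<n}" "j : {..<n}" "/^ (om ^. i) *^ om ^. j : N" for i j :: nat
  proof -
   have "/^ (om ^. i) *^ om ^. j = om ^. (int j - int i)" using diff[of i "int j"] by (simp add: int_pow_int)
   then obtain z :: int where "om ^. (int j - int i) = om ^. (z * int n)" using ij(3) unfolding N_def by auto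
   then have "int j - int i = z * int n" by (rule om_int_inj)
   then have "int n dvd int j - int i" by simp
   then have "int j mod int n = int i mod int n" by (simp add: mod_eq_dvd_iff)
   then show "i = j" using ij(1,2) by (simp flip: zmod_int)
  qed
 qed simp
 show "order ?Q = n" using Om.idx_eq_card[OF tr sZ sN] by (simp add: order_def FactGroup_def subgroup_index_def)
 interpret A: comm_group ?A by (rule Om.Om_comm_group.subgroup_comm_group[OF sZ])
 have NA: "N \<lhd> ?A" by (rule A.subgroup_imp_normal[OF Om.subgroup_incl[OF sN sZ NZ]])
 interpret Q: group ?Q by (rule normal.factorgroup_is_group[OF NA])
 have rc: "N #>\<^bsub>?A\<^esub> x = N #>\<^bsub>Om\<^esub> x" for x by (simp add: r_coset_def)
 have omZ: "om : Z" unfolding Z_def by (rule range_eqI[of _ _ 1]) (simp add: Om.int_pow_1)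
 have omQ: "N #>\<^bsub>Om\<^esub> om : carrier ?Q" using omZ rc by (auto simp: carrier_FactGroup)
 show "generate ?Q {N #>\<^bsub>Om\<^esub> om} = carrier ?Q"
 proof
  show "generate ?Q {N #>\<^bsub>Om\<^esub> om} <= carrier ?Q" by (rule Q.generate_incl) (use omQ in simp)
  show "carrier ?Q <= generate ?Q {N #>\<^bsub>Om\<^esub> om}"
  proof
   fix X assume "X : carrier ?Q"
   then obtain x where x: "x : Z" "X = N #>\<^bsub>Om\<^esub> x" using rc by (auto simp: carrier_FactGroup)
   obtain i where i: "i : {..<n}" "/^ (om ^. i) *^ x : N" using ltD(3)[OF tr x(1)] by auto
   have xc: "x : cO" by (rule sg_mem[OF sZ x(1)])
   have "x *^ /^ (om ^. i) : N" using i(2) xc by (simp add: Om.Om_comm)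
   then have "X = N #>\<^bsub>Om\<^esub> (om ^. i)" unfolding x(2) using Om.rcos_eq_iff[OF sN xc] by simp
   also have "... = (N #>\<^bsub>Om\<^esub> om) [^]\<^bsub>?Q\<^esub> i"
   using normal.FactGroup_pow[OF NA, of om i] omZ rc Om.nat_pow_consistent[of om i Z] by simp
   finally show "X : generate ?Q {N #>\<^bsub>Om\<^esub> om}"
   using Q.subgroup_nat_pow[OF Q.generate_is_subgroup generate.incl, of "{N #>\<^bsub>Om\<^esub> om}" "N #>\<^bsub>Om\<^esub> om" i] omQ by simp
  qed
 qed
qed

lemma v_image:
 assumes "osub H" shows "v H ` fx H = range (%z::int. om ^. z)"
proof
 show "v H ` fx H <= range (%z::int. om ^. z)" using v_int[OF assms] by blast
 have "subgroup (v H ` fx H) Om" using group_hom.img_is_subgroup[OF v_group_hom[OF assms]] by simp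
 moreover obtain pe where "pe : fx H" "v H pe = om" using v_props(3)[OF assms] by auto
 ultimately have "generate Om {om} <= v H ` fx H" by (intro Om.generate_subgroup_incl) auto
 then show "range (%z::int. om ^. z) <= v H ` fx H" using Om.generate_pow[OF Om.om_closed] by auto
qed

lemma unit_grp_simps [simp]:
 "carrier (unit_grp Om M v H) = {a : fx H. v H a = oW}"
 "monoid.mult (unit_grp Om M v H) = monoid.mult C" "one (unit_grp Om M v H) = one C"
 by (simp_all add: unit_grp_def kernel_def)

lemma unit_grp_group:
 assumes "osub H" shows "group (unit_grp Om M v H)" unfolding unit_grp_def
 by (rule group.subgroup_imp_group[OF comm_group.axioms(2)[OF ob_comm_group[OF osD(3)[OF assms]]]
   group_hom.subgroup_kernel[OF v_group_hom[OF assms]]])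

text \<open>All elements of \<open>H\<close> of degree \<open>om\<close> lie in one coset of
  \<open>U\<close>, so any fixed one of them can stand for every member of \<open>frobenius\<close>
  when acting on C^U.\<close>

lemma frobenius_mem:
 assumes N: "onorm H U" and ur: "inert H <= U" and ph: "ph : frobenius G Om d om H U"
 shows "ph : H" "dr H ph' = om ==> ph' : H ==> x : fx U ==> act ph x = act ph' x"
proof -
 note U = onD[OF N] note Hs = osD[OF U(1)] and Us = osD[OF U(2)]
 have eq: "U #> h = U #> h'" if h: "h : H" "dr H h = om" "h' : H" "dr H h' = om" for h h'
 proof -
  have m: "h *. inv h' : H" using Hs(6,7) h by blast
  have "dr H (h *. inv h') = oW" using d_rel_mult[OF U(1) h(1) Hs(7)[OF h(3)]] d_rel_inv[OF U(1) h(3)] h by simp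
  then have "d (h *. inv h') = oW" using d_rel_eq_1[OF U(1) m] by simp
  then have "h *. inv h' : U" using inert_iff[OF Hs(3)] m ur by blast
  then show ?thesis using quo_eq_iff[OF N h(1,3)] by simp
 qed
 have fr: "frobenius G Om d om H U = U #> h" if h: "h : H" "dr H h = om" for h
  unfolding frobenius_def by (rule the_equality) (use h eq in blast)+
 obtain h0 where h0: "h0 : H" "dr H h0 = om" using d_rel_surj[OF U(1) Om.om_closed] by blast
 then obtain u0 where u0: "u0 : U" "ph = u0 *. h0" using ph fr[OF h0] unfolding r_coset_def by auto
 show "ph : H" unfolding u0(2) using u0(1) U(3) Hs(6) h0(1) by blast
 assume ph': "dr H ph' = om" "ph' : H" and x: "x : fx U"
 then obtain u where u: "u : U" "ph = u *. ph'" using ph fr[of ph'] unfolding r_coset_def by auto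
 have c: "u : cG" "ph' : cG" using Us(4) u(1) Hs(4) ph'(2) by auto
 have iu: "inv ph' *. u *. ph' : U" by (rule U(5)[OF ph'(2) u(1)])
 have "ph = ph' *. (inv ph' *. u *. ph')" unfolding u(2) using c by (simp add: gnorm)
 then have "act ph x = act ph' (act (inv ph' *. u *. ph') x)"
  using act_mult[of ph' "inv ph' *. u *. ph'" x] c fxc[OF x] by simp
 then show "act ph x = act ph' x" using x iu by (simp add: fx_iff)
qed

text \<open>Powers of a Frobenius element represent H/U. Therefore fixed by Frobenius means fixed by
  \<open>H\<close>, and Hilbert 90, with a unit as witness, describes the kernel of the norm.
  Exactness at the end is the surjectivity of norms on units.\<close>

lemma unit_exact_seq:
 assumes N: "onorm H U" and ur: "inert H <= U" and ph: "ph : frobenius G Om d om H U"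
 shows "exact_seq
  ([singleton_group \<one>\<^bsub>ob M H\<^esub>, unit_grp Om M v H, unit_grp Om M v U, unit_grp Om M v U, unit_grp Om M v H,
   singleton_group \<one>\<^bsub>ob M H\<^esub>],
  [%_. \<one>\<^bsub>ob M H\<^esub>, ind M H U, %x. con M ph U x *.\<^bsub>ob M U\<^esub> inv\<^bsub>ob M U\<^esub> x, res M U H, %x. x])"
proof -
 note U = onD[OF N] note Hs = osD[OF U(1)] and Us = osD[OF U(2)]
 note phH = frobenius_mem(1)[OF N ur ph]
 have phc: "ph : cG" by (rule Hs(4)[OF phH])
 obtain ph' where ph': "ph' : H" "dr H ph' = om" using d_rel_surj[OF U(1) Om.om_closed] by blast
 have ph'c: "ph' : cG" by (rule Hs(4)[OF ph'(1)])
 have act_eq: "act ph x = act ph' x" if "x : fx U" for x by (rule frobenius_mem(2)[OF N ur ph ph'(2,1) that])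
 note t = unram_transversal[OF N ur ph']
 note gH = unit_grp_group[OF U(1)] and gU = unit_grp_group[OF U(2)]
 note f = fi_normal[OF N]
 let ?S = "singleton_group \<one>\<^bsub>ob M H\<^esub>" and ?EH = "unit_grp Om M v H" and ?EU = "unit_grp Om M v U"
 let ?f = "%x. con M ph U x *.\<^bsub>ob M U\<^esub> inv\<^bsub>ob M U\<^esub> x"
 have f_eq: "?f x = act ph x -. x" if "x : fx U" for x using that by (simp add: ob_inv[OF Us(3)] C.gdiv_def)
 have fc: "x : fx U ==> x : cC" for x by (rule fxc)
 have iU: "inert H = inert U" using ur U(3) unfolding inertia_def by blast
 have vUH: "v U a = v H a" if "a : fx H" for a by (rule v_unram[OF U(1,2,3) iU that])
 have av: "act ph x : fx U" "v U (act ph x) = v U x" if x: "x : fx U" for x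
  using fx_normal_act[OF N phH x] v_props(4)[OF U(2) phc x] cs_self(1)[OF N phH] by auto
 have "(%x. x) : hom ?S ?EH" using v_one[OF U(1)] fx_closed(1)[OF Hs(3)] by (auto simp: hom_def singleton_group_def)
 then have "group_hom ?S ?EH (%x. x)" by (intro group_hom.intro group_hom_axioms.intro singleton_group gH)
 then have e1: "exact_seq ([?EH, ?S], [%x. x])" by (rule exact_seq.unity)
 have e2: "exact_seq ([?EU, ?EH, ?S], [res M U H, %x. x])"
 proof (rule exact_seq.extension[OF e1 gU])
  show "res M U H : hom ?EH ?EU" using fx_mono[OF U(3)] vUH by (auto simp: hom_def)
  show "kernel ?EH ?EU (res M U H) = (%x. x) ` carrier ?S"
   using v_one[OF U(1)] fx_closed(1)[OF Hs(3)] by (auto simp: kernel_def)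
 qed
 have e3: "exact_seq ([?EU, ?EU, ?EH, ?S], [?f, res M U H, %x. x])"
 proof (rule exact_seq.extension[OF e2 gU])
  show "?f : hom ?EU ?EU"
  proof (rule homI)
   fix x assume "x : carrier ?EU"
   then have x: "x : fx U" "v U x = oW" by auto
   have "v U (act ph x -. x) = oW" unfolding C.gdiv_def
   using v_props(1)[OF U(2) av(1)[OF x(1)] fx_closed(3)[OF Us(3) x(1)]] v_cinv[OF U(2) x(1)] av(2)[OF x(1)] x(2) by simp
   then show "?f x : carrier ?EU" using fx_gdiv[OF Us(3) av(1)[OF x(1)] x(1)] f_eq[OF x(1)] by simp
  next
   fix x y assume "x : carrier ?EU" "y : carrier ?EU"
   then have xy: "x : fx U" "y : fx U" by auto
   have "?f (x *: y) = act ph (x *: y) -. (x *: y)" by (rule f_eq[OF fx_closed(2)[OF Us(3) xy]])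
   also have "... = (act ph x -. x) *: (act ph y -. y)"
   using fc[OF xy(1)] fc[OF xy(2)] phc by (simp add: act_cmul C.gdiv_simps C.m_ac)
   also have "... = ?f x *: ?f y" using f_eq xy by simp
   finally show "?f (x *.\<^bsub>?EU\<^esub> y) = ?f x *.\<^bsub>?EU\<^esub> ?f y" by simp
  qed
  show "kernel ?EU ?EU ?f = res M U H ` carrier ?EH"
  proof
   show "kernel ?EU ?EU ?f <= res M U H ` carrier ?EH"
   proof
   fix x assume "x : kernel ?EU ?EU ?f"
   then have x: "x : fx U" "v U x = oW" "?f x = oC" by (auto simp: kernel_def)
   have xc: "x : cC" by (rule fc[OF x(1)])
   have "act ph x -. x = oC" using x(3) f_eq[OF x(1)] by simp
   then have "act ph x = oC *: x" using C.gdiv_eq_iff[of "act ph x" x "oC"] xc phc by simp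
   then have "act ph x = x" using xc by simp
   then have fixd: "act ph' x = x" using act_eq[OF x(1)] by simp
   have "act g x = x" if g: "g : H" for g
   proof -
   obtain i where "i : {..<idx H U}" and i: "inv (ph' [^] i) *. g : U" using ltD(3)[OF t g] by auto
   have gc: "g : cG" by (rule Hs(4)[OF g])
   have "act g x = act (ph' [^] i *. (inv (ph' [^] i) *. g)) x" using gc ph'c by (simp add: gnorm)
   also have "... = act (ph' [^] i) (act (inv (ph' [^] i) *. g) x)" using gc ph'c xc by (intro act_mult) auto
   also have "act (inv (ph' [^] i) *. g) x = x" using x(1) i by (simp add: fx_iff)
   finally show ?thesis using act_pow_fixed[OF ph'c xc fixd] by simp
   qed
   then have "x : fx H" using xc by (simp add: fx_iff)
   then show "x : res M U H ` carrier ?EH" using x(2) vUH by auto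
   qed
   show "res M U H ` carrier ?EH <= kernel ?EU ?EU ?f"
   proof
   fix x assume "x : res M U H ` carrier ?EH"
   then have x: "x : fx H" "v H x = oW" by auto
   have xU: "x : fx U" by (rule fx_mono[OF U(3) x(1)])
   have "act ph x = x" using x(1) phH by (simp add: fx_iff)
   then have "?f x = oC" using f_eq[OF xU] fc[OF xU] by simp
   then show "x : kernel ?EU ?EU ?f" using xU vUH[OF x(1)] x(2) by (simp add: kernel_def)
   qed
  qed
 qed
 have nv: "v H (nrm H U x) = oW" if "x : fx U" "v U x = oW" for x using v_props(6)[OF U(1,2,3) that(1)] that(2) by simp
 have e4: "exact_seq ([?EH, ?EU, ?EU, ?EH, ?S], [ind M H U, ?f, res M U H, %x. x])"
 proof (rule exact_seq.extension[OF e3 gH])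
  show "ind M H U : hom ?EU ?EH" using nrm_closed[OF f] nv nrm_cmul[OF f] by (auto simp: hom_def)
  show "kernel ?EU ?EH (ind M H U) = ?f ` carrier ?EU"
  proof
   show "kernel ?EU ?EH (ind M H U) <= ?f ` carrier ?EU"
   proof
   fix y assume "y : kernel ?EU ?EH (ind M H U)"
   then have y: "y : fx U" "nrm H U y = oC" by (auto simp: kernel_def)
   obtain z where z: "z : fx U" "v U z = oW" "y = act ph' z -. z" using unram_hilbert_90[OF N ur t ph'(1) y] by blast
   then have "y = ?f z" using f_eq act_eq by simp
   then show "y : ?f ` carrier ?EU" using z(1,2) by (intro image_eqI[of _ _ z]) auto
   qed
   show "?f ` carrier ?EU <= kernel ?EU ?EH (ind M H U)"
   proof
   fix y assume "y : ?f ` carrier ?EU"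
   then obtain x where x: "x : carrier ?EU" "y = ?f x" by (rule imageE)
   then have xU: "x : fx U" "v U x = oW" by auto
   have y: "y = act ph x -. x" using x(2) f_eq[OF xU(1)] by simp
   have yU: "y : fx U" unfolding y by (rule fx_gdiv[OF Us(3) av(1)[OF xU(1)] xU(1)])
   have "v U y = oW" unfolding y C.gdiv_def
   using v_props(1)[OF U(2) av(1)[OF xU(1)] fx_closed(3)[OF Us(3) xU(1)]] v_cinv[OF U(2) xU(1)] av(2)[OF xU(1)] xU(2) by simp
   moreover have nH: "nrm H U x : fx H" by (rule nrm_closed[OF f xU(1)])
   have "act ph (nrm H U x) = nrm H U (act ph x)"
   using nrm_conj[OF f xU(1) phc] cs_self(1)[OF N phH] cs_self(1)[OF onorm_self[OF U(1)] phH] by simp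
   moreover have "act ph (nrm H U x) = nrm H U x" using nH phH by (simp add: fx_iff)
   ultimately have "nrm H U y = oC" unfolding y using nrm_cdiv[OF f av(1)[OF xU(1)] xU(1)] fxc[OF nH] by simp
   then show "y : kernel ?EU ?EH (ind M H U)" using yU \<open>v U y = oW\<close> by (simp add: kernel_def)
   qed
  qed
 qed
 show ?thesis
 proof (rule exact_seq.extension[OF e4])
  show "(%_. \<one>\<^bsub>ob M H\<^esub>) : hom ?EH ?S" by (auto simp: hom_def singleton_group_def)
  show "kernel ?EH ?S (%_. \<one>\<^bsub>ob M H\<^esub>) = ind M H U ` carrier ?EU"
  proof
   show "kernel ?EH ?S (%_. \<one>\<^bsub>ob M H\<^esub>) <= ind M H U ` carrier ?EU"
   proof
   fix u assume "u : kernel ?EH ?S (%_. \<one>\<^bsub>ob M H\<^esub>)"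
   then have u: "u : fx H" "v H u = oW" by (auto simp: kernel_def)
   obtain w where "w : fx U" "v U w = oW" "nrm H U w = u" using unram_norm_unit[OF N ur u] by blast
   then show "u : ind M H U ` carrier ?EU" by (intro image_eqI[of _ _ w]) auto
   qed
   show "ind M H U ` carrier ?EU <= kernel ?EH ?S (%_. \<one>\<^bsub>ob M H\<^esub>)"
   using nrm_closed[OF f] nv by (auto simp: kernel_def singleton_group_def)
  qed
 qed simp
qed

lemma fesenko_neukirch_datum: "fesenko_neukirch_datum G Om d om M v" unfolding fesenko_neukirch_datum_def
proof (intro conjI allI impI valuation_Om)
 fix H U assume N: "onorm H U" and ur: "inert H <= U"
 note U = onD[OF N] note Hs = osD[OF U(1)]
 note f = fi_normal[OF N]
 let ?n = "idx H U"
 have n0: "?n > 0" by (rule idx_pos[OF U(2) Hs(1) U(3)])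
 have N': "(%x. x ^. ?n) ` v U ` carrier (ob M U) = range (%z::int. om ^. (z * int ?n))"
  using v_image[OF U(2)] by (simp add: image_image int_pow_nat)
 have Z': "v H ` carrier (ob M H) = range (%z::int. om ^. z)" using v_image[OF U(1)] by simp
 have cfa: "order (ob M H Mod Nm H U) = ?n" by (rule cfa_order[OF cfa_unram[OF N ur]])
 then have fin: "finite (carrier (ob M H Mod Nm H U))" using n0 by (intro card_ge_0_finite) (simp add: order_def)
 have im: "ind M H U ` carrier (unit_grp Om M v U) = carrier (unit_grp Om M v H)"
 proof
  show "ind M H U ` carrier (unit_grp Om M v U) <= carrier (unit_grp Om M v H)"
   using nrm_closed[OF f] v_props(6)[OF U(1,2,3)] by auto
  show "carrier (unit_grp Om M v H) <= ind M H U ` carrier (unit_grp Om M v U)"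
  proof
   fix u assume "u : carrier (unit_grp Om M v H)"
   then have u: "u : fx H" "v H u = oW" by auto
   obtain w where "w : fx U" "v U w = oW" "nrm H U w = u" using unram_norm_unit[OF N ur u] by blast
   then show "u : ind M H U ` carrier (unit_grp Om M v U)" by (intro image_eqI[of _ _ w]) auto
  qed
 qed
 show "let n = ?n; N = (%x. x ^. n) ` v U ` carrier (ob M U);
   Q = Om(|carrier := v H ` carrier (ob M H)|) Mod N
   in order Q = n & generate Q {N #>\<^bsub>Om\<^esub> om} = carrier Q &
   ind M H U ` carrier (unit_grp Om M v U) = carrier (unit_grp Om M v H) &
   finite (carrier (ob M H Mod Nm H U)) & order (ob M H Mod Nm H U) <= n"
  unfolding Let_def N' Z' using om_powers_quotient[OF n0] im fin cfa by simp
 show "ALL ph:frobenius G Om d om H U. exact_seq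
  ([singleton_group \<one>\<^bsub>ob M H\<^esub>, unit_grp Om M v H, unit_grp Om M v U, unit_grp Om M v U, unit_grp Om M v H,
   singleton_group \<one>\<^bsub>ob M H\<^esub>],
  [%_. \<one>\<^bsub>ob M H\<^esub>, ind M H U, %x. con M ph U x *.\<^bsub>ob M U\<^esub> inv\<^bsub>ob M U\<^esub> x, res M U H, %x. x])"
  using unit_exact_seq[OF N ur] by blast
qed

end

section \<open>The isomorphism of functors\<close>

lemma induced_map_coset:
 assumes "group A" and "group B" and NA: "subgroup NA A" and NB: "subgroup NB B"
  and f: "f : hom A B" and sub: "f ` NA <= NB" and a: "a : carrier A"
 shows "induced_map B NB f (NA #>\<^bsub>A\<^esub> a) = NB #>\<^bsub>B\<^esub> f a"
proof
 interpret A: group A by fact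
 interpret B: group B by fact
 have fa: "f a : carrier B" by (rule hom_in_carrier[OF f a])
 show "induced_map B NB f (NA #>\<^bsub>A\<^esub> a) <= NB #>\<^bsub>B\<^esub> f a"
 proof
  fix z assume "z : induced_map B NB f (NA #>\<^bsub>A\<^esub> a)"
  then obtain n m where nm: "n : NB" "m : NA" "z = n *.\<^bsub>B\<^esub> f (m *.\<^bsub>A\<^esub> a)"
   unfolding induced_map_def set_mult_def r_coset_def by auto
  have mc: "m : carrier A" by (rule sg_mem[OF NA nm(2)])
  have fm: "f m : NB" using sub nm(2) by blast
  have c: "n : carrier B" "f m : carrier B" using sg_mem[OF NB nm(1)] sg_mem[OF NB fm] by auto
  have "z = (n *.\<^bsub>B\<^esub> f m) *.\<^bsub>B\<^esub> f a" unfolding nm(3) hom_mult[OF f mc a] using c fa by (simp add: B.m_assoc)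
  then show "z : NB #>\<^bsub>B\<^esub> f a" unfolding r_coset_def using sg_mult[OF NB nm(1) fm] by blast
 qed
 show "NB #>\<^bsub>B\<^esub> f a <= induced_map B NB f (NA #>\<^bsub>A\<^esub> a)"
 proof
  fix z assume "z : NB #>\<^bsub>B\<^esub> f a"
  then obtain n where "n : NB" "z = n *.\<^bsub>B\<^esub> f a" unfolding r_coset_def by blast
  moreover have "f a : f ` (NA #>\<^bsub>A\<^esub> a)" by (rule imageI[OF A.rcos_self[OF a NA]])
  ultimately show "z : induced_map B NB f (NA #>\<^bsub>A\<^esub> a)" unfolding induced_map_def set_mult_def by blast
 qed
qed

context cft
begin

text \<open>Both functors of the theorem arise from \<open>H \<mapsto> C\<^sup>H\<close> by passing to the quotients by the norm
 subgroups. A presentation by surjections \<open>c H U\<close> determines such a functor up to isomorphism, so that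
 all functoriality statements follow from those for fixed points.\<close>

definition presents ::
 "('g, 'g set \<times> 'g set, 'm) ric_functor => ('g set => 'g set => 'c => 'm) => bool" where
 "presents Fu c \<longleftrightarrow>
  (ALL H U. onorm H U -->
   comm_group (ob Fu (H, U)) & c H U ` fx H = carrier (ob Fu (H, U)) &
   (ALL a:fx H. ALL b:fx H. c H U (a *: b) = c H U a *.\<^bsub>ob Fu (H, U)\<^esub> c H U b) &
   (ALL a:fx H. ALL b:fx H. c H U a = c H U b \<longleftrightarrow> a -. b : Nm H U) &
   (ALL g:carrier G. ALL a:fx H. con Fu g (H, U) (c H U a) = c (cs g H) (cs g U) (act g a))) &
  (ALL H U I. onorm H U --> onorm I U --> I <= H -->
   (ALL a:fx H. res Fu (I, U) (H, U) (c H U a) = c I U a)) &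
  (ALL H U I V. onorm H U --> onorm I V --> I <= H --> V <= U -->
   (ALL a:fx I. ind Fu (H, U) (I, V) (c I V a) = c H U (nrm H I a)))"

lemma presentsD:
 assumes "presents Fu c" "onorm H U"
 shows "comm_group (ob Fu (H, U))" "c H U ` fx H = carrier (ob Fu (H, U))"
  "!!a. a : fx H ==> c H U a : carrier (ob Fu (H, U))"
  "!!a b. a : fx H ==> b : fx H ==> c H U (a *: b) = c H U a *.\<^bsub>ob Fu (H, U)\<^esub> c H U b"
  "!!a b. a : fx H ==> b : fx H ==> c H U a = c H U b \<longleftrightarrow> a -. b : Nm H U"
  "!!g a. g : cG ==> a : fx H ==>
   con Fu g (H, U) (c H U a) = c (cs g H) (cs g U) (act g a)"
  "!!I a. onorm I U ==> I <= H ==> a : fx H ==> res Fu (I, U) (H, U) (c H U a) = c I U a"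
  "!!I V a. onorm I V ==> I <= H ==> V <= U ==> a : fx I ==>
   ind Fu (H, U) (I, V) (c I V a) = c H U (nrm H I a)"
proof -
 show *: "c H U ` fx H = carrier (ob Fu (H, U))" using assms unfolding presents_def by simp
 show "!!a. a : fx H ==> c H U a : carrier (ob Fu (H, U))" using imageI[of _ "fx H" "c H U"] unfolding * .
qed (use assms in \<open>simp_all add: presents_def\<close>)

lemma presents_hom:
 assumes p: "presents Fu c" and q: "presents Fv c'" and N: "onorm H U" and N': "onorm H' U'"
  and f: "!!a. a : fx H ==> f a : fx H'" "!!a b. a : fx H ==> b : fx H ==> f (a *: b) = f a *: f b"
  and F: "!!a. a : fx H ==> F (c H U a) = c' H' U' (f a)"
 shows "F : hom (ob Fu (H, U)) (ob Fv (H', U'))"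
proof (rule homI)
 note P = presentsD[OF p N] and Q = presentsD[OF q N']
 have Hc: "H <= cG" by (rule osD(3)[OF onD(1)[OF N]])
 show "F x : carrier (ob Fv (H', U'))" if x: "x : carrier (ob Fu (H, U))" for x
 proof -
  obtain a where a: "x = c H U a" "a : fx H" using x unfolding P(2)[symmetric] by (rule imageE)
  show ?thesis unfolding a(1) F[OF a(2)] by (rule Q(3)[OF f(1)[OF a(2)]])
 qed
 show "F (x *.\<^bsub>ob Fu (H, U)\<^esub> y) = F x *.\<^bsub>ob Fv (H', U')\<^esub> F y"
  if x: "x : carrier (ob Fu (H, U))" and y: "y : carrier (ob Fu (H, U))" for x y
 proof -
  obtain a where a: "x = c H U a" "a : fx H" using x unfolding P(2)[symmetric] by (rule imageE)
  obtain b where b: "y = c H U b" "b : fx H" using y unfolding P(2)[symmetric] by (rule imageE)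
  have ab: "a *: b : fx H" by (rule fx_closed(2)[OF Hc a(2) b(2)])
  show ?thesis unfolding a(1) b(1) P(4)[OF a(2) b(2), symmetric] F[OF ab] F[OF a(2)] F[OF b(2)] f(2)[OF a(2) b(2)]
   by (rule Q(4)[OF f(1)[OF a(2)] f(1)[OF b(2)]])
 qed
qed

lemma spec_bE: "X : spec_b G ==> EX H U. X = (H, U) & onorm H U" by (cases X) (simp add: spec_b_def)

lemma spec_rE: "Y : spec_r G (H, U) ==> EX I. Y = (I, U) & onorm I U & I <= H" by (cases Y) (simp add: spec_r_def spec_b_def)

lemma spec_iE: "Y : spec_i G (H, U) ==> EX I V. Y = (I, V) & onorm I V & I <= H & V <= U"
 by (cases Y) (simp add: spec_i_def spec_b_def)

lemma conj_pair_simp [simp]: "conj_pair G g (H, U) = (cs g H, cs g U)" by (simp add: conj_pair_def)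

lemma cs_mono: "I <= H ==> cs g I <= cs g H" unfolding conj_set_def by blast

lemma open_fi: "onorm H U ==> onorm I V ==> I <= H ==> fi H I" by (rule fi_open[OF onD(1) onD(1)])

text \<open>Every element is a class \<open>c H U al\<close>, so each axiom reduces to an identity
  between fixed points: transitivity and equivariance of norms, or composition of the
  action.\<close>

lemma presents_object:
 assumes p: "presents Fu c" shows "fct_object G Fu" unfolding fct_object_def
proof (intro conjI)
 note P = presentsD[OF p]
 have sub: "H <= cG" if "onorm H U" for H U by (rule osD(3)[OF onD(1)[OF that]])
 have rep: "EX al:fx H. a = c H U al" if "onorm H U" "a : carrier (ob Fu (H, U))" for H U a
  using that(2) unfolding P(2)[OF that(1), symmetric] by blast
 have af: "act g al : fx (cs g H)" if "onorm H U" "g : cG" "al : fx H" for g H U al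
  by (rule fx_act[OF that(3,2) sub[OF that(1)]])
 show "ALL X:spec_b G. comm_group (ob Fu X) &
   (ALL g:carrier G. con Fu g X : hom (ob Fu X) (ob Fu (conj_pair G g X))) &
   (ALL Y:spec_r G X. res Fu Y X : hom (ob Fu X) (ob Fu Y)) &
   (ALL Y:spec_i G X. ind Fu X Y : hom (ob Fu Y) (ob Fu X))"
 proof
  fix X assume "X : spec_b G"
  then obtain H U where X: "X = (H, U)" and N: "onorm H U" using spec_bE by blast
  show "comm_group (ob Fu X) &
   (ALL g:carrier G. con Fu g X : hom (ob Fu X) (ob Fu (conj_pair G g X))) &
   (ALL Y:spec_r G X. res Fu Y X : hom (ob Fu X) (ob Fu Y)) &
   (ALL Y:spec_i G X. ind Fu X Y : hom (ob Fu Y) (ob Fu X))" unfolding X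
  proof (intro conjI ballI)
   show "comm_group (ob Fu (H, U))" by (rule P(1)[OF N])
   show "con Fu g (H, U) : hom (ob Fu (H, U)) (ob Fu (conj_pair G g (H, U)))" if g: "g : cG" for g unfolding conj_pair_simp
   by (rule presents_hom[OF p p N onorm_conj[OF N g], where f = "act g"])
   (use af[OF N g] act_cmul[OF g] fxc P(6)[OF N g] in auto)
   show "res Fu Y (H, U) : hom (ob Fu (H, U)) (ob Fu Y)" if Y: "Y : spec_r G (H, U)" for Y
   proof -
   obtain I where I: "Y = (I, U)" "onorm I U" "I <= H" using spec_rE[OF Y] by blast
   show ?thesis unfolding I(1)
   by (rule presents_hom[OF p p N I(2), where f = "%a. a"]) (use fx_mono[OF I(3)] P(7)[OF N I(2,3)] in auto)
   qed
   show "ind Fu (H, U) Y : hom (ob Fu Y) (ob Fu (H, U))" if Y: "Y : spec_i G (H, U)" for Y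
   proof -
   obtain I V where I: "Y = (I, V)" "onorm I V" "I <= H" "V <= U" using spec_iE[OF Y] by blast
   note f = open_fi[OF N I(2,3)]
   show ?thesis unfolding I(1) by (rule presents_hom[OF p p I(2) N, where f = "nrm H I"])
   (use nrm_closed[OF f] nrm_cmul[OF f] P(8)[OF N I(2,3,4)] in auto)
   qed
  qed
 qed
 show "ALL X:spec_b G. ALL a:carrier (ob Fu X). con Fu \<one> X a = a & res Fu X X a = a & ind Fu X X a = a"
 proof (intro ballI)
  fix X a assume "X : spec_b G" and a: "a : carrier (ob Fu X)"
  then obtain H U where X: "X = (H, U)" and N: "onorm H U" using spec_bE by blast
  obtain al where al: "al : fx H" "a = c H U al" using rep[OF N] a unfolding X by blast
  have "cs \<one> H = H" "cs \<one> U = U" using cs_one sub[OF N] osD(3)[OF onD(2)[OF N]] by auto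
  then show "con Fu \<one> X a = a & res Fu X X a = a & ind Fu X X a = a"
   unfolding X al(2) using P(6)[OF N one_closed al(1)] P(7)[OF N N subset_refl al(1)]
   P(8)[OF N N subset_refl subset_refl al(1)] fxc[OF al(1)]
   nrm_self[OF osD(1)[OF onD(1)[OF N]] al(1)] by simp
 qed
 show "ALL X:spec_b G. ALL g:carrier G. ALL h:carrier G. ALL a:carrier (ob Fu X).
   con Fu g (conj_pair G h X) (con Fu h X a) = con Fu (g *. h) X a"
 proof (intro ballI)
  fix X g h a assume "X : spec_b G" and g: "g : cG" and h: "h : cG" and a: "a : carrier (ob Fu X)"
  then obtain H U where X: "X = (H, U)" and N: "onorm H U" using spec_bE by blast
  obtain al where al: "al : fx H" "a = c H U al" using rep[OF N] a unfolding X by blast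
  show "con Fu g (conj_pair G h X) (con Fu h X a) = con Fu (g *. h) X a"
   unfolding X al(2) conj_pair_simp P(6)[OF N h al(1)] P(6)[OF onorm_conj[OF N h] g af[OF N h al(1)]]
   P(6)[OF N m_closed[OF g h] al(1)] cs_conj_set[OF g h sub[OF N]]
   cs_conj_set[OF g h osD(3)[OF onD(2)[OF N]]] act_mult[OF g h fxc[OF al(1)]] ..
 qed
 show "ALL X:spec_b G. ALL Y:spec_r G X. ALL Z:spec_r G Y. ALL a:carrier (ob Fu X). res Fu Z Y (res Fu Y X a) = res Fu Z X a"
 proof (intro ballI)
  fix X Y Z a assume "X : spec_b G" and Y: "Y : spec_r G X" and Z: "Z : spec_r G Y" and a: "a : carrier (ob Fu X)"
  then obtain H U where X: "X = (H, U)" and N: "onorm H U" using spec_bE by blast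
  obtain I where I: "Y = (I, U)" "onorm I U" "I <= H" using spec_rE Y unfolding X by blast
  obtain J where J: "Z = (J, U)" "onorm J U" "J <= I" using spec_rE Z unfolding I(1) by blast
  obtain al where al: "al : fx H" "a = c H U al" using rep[OF N] a unfolding X by blast
  show "res Fu Z Y (res Fu Y X a) = res Fu Z X a"
   unfolding X al(2) I(1) J(1) P(7)[OF N I(2,3) al(1)] P(7)[OF I(2) J(2,3) fx_mono[OF I(3) al(1)]]
   P(7)[OF N J(2) subset_trans[OF J(3) I(3)] al(1)] ..
 qed
 show "ALL X:spec_b G. ALL Y:spec_i G X. ALL Z:spec_i G Y. ALL a:carrier (ob Fu Z). ind Fu X Y (ind Fu Y Z a) = ind Fu X Z a"
 proof (intro ballI)
  fix X Y Z a assume "X : spec_b G" and Y: "Y : spec_i G X" and Z: "Z : spec_i G Y" and a: "a : carrier (ob Fu Z)"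
  then obtain H U where X: "X = (H, U)" and N: "onorm H U" using spec_bE by blast
  obtain I V where I: "Y = (I, V)" "onorm I V" "I <= H" "V <= U" using spec_iE Y unfolding X by blast
  obtain J W where J: "Z = (J, W)" "onorm J W" "J <= I" "W <= V" using spec_iE Z unfolding I(1) by blast
  obtain al where al: "al : fx J" "a = c J W al" using rep[OF J(2)] a unfolding J(1) by blast
  note f = open_fi[OF N I(2,3)] and f' = open_fi[OF I(2) J(2,3)]
  show "ind Fu X Y (ind Fu Y Z a) = ind Fu X Z a"
   unfolding X al(2) I(1) J(1) P(8)[OF I(2) J(2,3,4) al(1)] P(8)[OF N I(2,3,4) nrm_closed[OF f' al(1)]]
   P(8)[OF N J(2) subset_trans[OF J(3) I(3)] subset_trans[OF J(4) I(4)] al(1)] nrm_tower[OF f f' al(1)] ..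
 qed
 show "ALL X:spec_b G. ALL Y:spec_r G X. ALL g:carrier G. ALL a:carrier (ob Fu X).
   con Fu g Y (res Fu Y X a) = res Fu (conj_pair G g Y) (conj_pair G g X) (con Fu g X a)"
 proof (intro ballI)
  fix X Y g a assume "X : spec_b G" and Y: "Y : spec_r G X" and g: "g : cG" and a: "a : carrier (ob Fu X)"
  then obtain H U where X: "X = (H, U)" and N: "onorm H U" using spec_bE by blast
  obtain I where I: "Y = (I, U)" "onorm I U" "I <= H" using spec_rE Y unfolding X by blast
  obtain al where al: "al : fx H" "a = c H U al" using rep[OF N] a unfolding X by blast
  show "con Fu g Y (res Fu Y X a) = res Fu (conj_pair G g Y) (conj_pair G g X) (con Fu g X a)"
   unfolding X al(2) I(1) conj_pair_simp P(7)[OF N I(2,3) al(1)] P(6)[OF I(2) g fx_mono[OF I(3) al(1)]]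
   P(6)[OF N g al(1)]
   P(7)[OF onorm_conj[OF N g] onorm_conj[OF I(2) g] cs_mono[OF I(3)] af[OF N g al(1)]] ..
 qed
 show "ALL X:spec_b G. ALL Y:spec_i G X. ALL g:carrier G. ALL a:carrier (ob Fu Y).
   con Fu g X (ind Fu X Y a) = ind Fu (conj_pair G g X) (conj_pair G g Y) (con Fu g Y a)"
 proof (intro ballI)
  fix X Y g a assume "X : spec_b G" and Y: "Y : spec_i G X" and g: "g : cG" and a: "a : carrier (ob Fu Y)"
  then obtain H U where X: "X = (H, U)" and N: "onorm H U" using spec_bE by blast
  obtain I V where I: "Y = (I, V)" "onorm I V" "I <= H" "V <= U" using spec_iE Y unfolding X by blast
  obtain al where al: "al : fx I" "a = c I V al" using rep[OF I(2)] a unfolding I(1) by blast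
  note f = open_fi[OF N I(2,3)]
  show "con Fu g X (ind Fu X Y a) = ind Fu (conj_pair G g X) (conj_pair G g Y) (con Fu g Y a)"
   unfolding X al(2) I(1) conj_pair_simp P(8)[OF N I(2,3,4) al(1)] P(6)[OF N g nrm_closed[OF f al(1)]]
   P(6)[OF I(2) g al(1)]
   P(8)[OF onorm_conj[OF N g] onorm_conj[OF I(2) g] cs_mono[OF I(3)] cs_mono[OF I(4)]
   af[OF I(2) g al(1)]] nrm_conj[OF f al(1) g] ..
 qed
qed

lemma presents_morphism:
 assumes p: "presents Fu c" and q: "presents Fv c'"
  and et: "!!H U a. onorm H U ==> a : fx H ==> et (H, U) (c H U a) = c' H U a"
 shows "fct_morphism G Fu Fv et" unfolding fct_morphism_def
proof (intro conjI presents_object[OF p] presents_object[OF q])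
 note P = presentsD[OF p] and Q = presentsD[OF q]
 have rep: "EX al:fx H. a = c H U al" if "onorm H U" "a : carrier (ob Fu (H, U))" for H U a
  using that(2) unfolding P(2)[OF that(1), symmetric] by blast
 have af: "act g al : fx (cs g H)" if "onorm H U" "g : cG" "al : fx H" for g H U al
  by (rule fx_act[OF that(3,2) osD(3)[OF onD(1)[OF that(1)]]])
 show "ALL X:spec_b G. et X : hom (ob Fu X) (ob Fv X)"
 proof
  fix X assume "X : spec_b G"
  then obtain H U where X: "X = (H, U)" and N: "onorm H U" using spec_bE by blast
  show "et X : hom (ob Fu X) (ob Fv X)"
   unfolding X by (rule presents_hom[OF p q N N, where f = "%a. a"]) (use et[OF N] in auto)
 qed
 show "ALL X:spec_b G. ALL g:carrier G. ALL a:carrier (ob Fu X). et (conj_pair G g X) (con Fu g X a) = con Fv g X (et X a)"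
 proof (intro ballI)
  fix X g a assume "X : spec_b G" and g: "g : cG" and a: "a : carrier (ob Fu X)"
  then obtain H U where X: "X = (H, U)" and N: "onorm H U" using spec_bE by blast
  obtain al where al: "al : fx H" "a = c H U al" using rep[OF N] a unfolding X by blast
  show "et (conj_pair G g X) (con Fu g X a) = con Fv g X (et X a)"
   unfolding X al(2) conj_pair_simp P(6)[OF N g al(1)] et[OF N al(1)] Q(6)[OF N g al(1)]
   by (rule et[OF onorm_conj[OF N g] af[OF N g al(1)]])
 qed
 show "ALL X:spec_b G. ALL Y:spec_r G X. ALL a:carrier (ob Fu X). et Y (res Fu Y X a) = res Fv Y X (et X a)"
 proof (intro ballI)
  fix X Y a assume "X : spec_b G" and Y: "Y : spec_r G X" and a: "a : carrier (ob Fu X)"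
  then obtain H U where X: "X = (H, U)" and N: "onorm H U" using spec_bE by blast
  obtain I where I: "Y = (I, U)" "onorm I U" "I <= H" using spec_rE Y unfolding X by blast
  obtain al where al: "al : fx H" "a = c H U al" using rep[OF N] a unfolding X by blast
  show "et Y (res Fu Y X a) = res Fv Y X (et X a)"
   unfolding X al(2) I(1) P(7)[OF N I(2,3) al(1)] et[OF N al(1)] Q(7)[OF N I(2,3) al(1)]
   by (rule et[OF I(2) fx_mono[OF I(3) al(1)]])
 qed
 show "ALL X:spec_b G. ALL Y:spec_i G X. ALL a:carrier (ob Fu Y). et X (ind Fu X Y a) = ind Fv X Y (et Y a)"
 proof (intro ballI)
  fix X Y a assume "X : spec_b G" and Y: "Y : spec_i G X" and a: "a : carrier (ob Fu Y)"
  then obtain H U where X: "X = (H, U)" and N: "onorm H U" using spec_bE by blast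
  obtain I V where I: "Y = (I, V)" "onorm I V" "I <= H" "V <= U" using spec_iE Y unfolding X by blast
  obtain al where al: "al : fx I" "a = c I V al" using rep[OF I(2)] a unfolding I(1) by blast
  show "et X (ind Fu X Y a) = ind Fv X Y (et Y a)"
   unfolding X al(2) I(1) P(8)[OF N I(2,3,4) al(1)] et[OF I(2) al(1)] Q(8)[OF N I(2,3,4) al(1)]
   by (rule et[OF N nrm_closed[OF open_fi[OF N I(2,3)] al(1)]])
 qed
qed

text \<open>The inverse takes a representative of a class in the second presentation to its class in
  the first; it is well defined because both identify elements exactly modulo norms.\<close>

lemma presents_isomorphism:
 assumes p: "presents Fu c" and q: "presents Fv c'"
  and et: "!!H U a. onorm H U ==> a : fx H ==> et (H, U) (c H U a) = c' H U a"
 shows "fct_isomorphism G Fu Fv et"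
proof -
 note P = presentsD[OF p] and Q = presentsD[OF q]
 define th where "th = (%(H, U) y. c H U (SOME a. a : fx H & c' H U a = y))"
 have th: "th (H, U) (c' H U a) = c H U a" if N: "onorm H U" and a: "a : fx H" for H U a
 proof -
  let ?a = "SOME b. b : fx H & c' H U b = c' H U a"
  have s: "?a : fx H & c' H U ?a = c' H U a" by (rule someI[of _ a]) (use a in simp)
  then have "?a -. a : Nm H U" using Q(5)[OF N _ a] by blast
  then have "c H U ?a = c H U a" using P(5)[OF N _ a] s by blast
  then show ?thesis unfolding th_def by simp
 qed
 have "fct_morphism G Fv Fu th" by (rule presents_morphism[OF q p th])
 moreover have "ALL X:spec_b G. (ALL a:carrier (ob Fu X). th X (et X a) = a) & (ALL b:carrier (ob Fv X). et X (th X b) = b)"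
 proof
  fix X assume "X : spec_b G"
  then obtain H U where X: "X = (H, U)" and N: "onorm H U" using spec_bE by blast
  show "(ALL a:carrier (ob Fu X). th X (et X a) = a) & (ALL b:carrier (ob Fv X). et X (th X b) = b)"
   unfolding X P(2)[OF N, symmetric] Q(2)[OF N, symmetric] using th[OF N] et[OF N] by simp
 qed
 ultimately show ?thesis unfolding fct_isomorphism_def using presents_morphism[OF p q et] by blast
qed

section \<open>The Tate functor as a quotient of the fixed points\<close>

lemma Nm_coset_eq:
 assumes N: "onorm H U" and "a : fx H" "b : fx H"
 shows "Nm H U #>\<^bsub>ob M H\<^esub> a = Nm H U #>\<^bsub>ob M H\<^esub> b \<longleftrightarrow> a -. b : Nm H U"
proof -
 have Hc: "H <= cG" by (rule osD(3)[OF onD(1)[OF N]])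
 interpret A: comm_group "ob M H" by (rule ob_comm_group[OF Hc])
 show ?thesis
  using A.rcos_eq_iff[OF Nm_subgroup_ob[OF fi_normal[OF N]], of a b] assms(2,3) ob_inv[OF Hc] by (simp add: C.gdiv_def)
qed

text \<open>A norm is a value of the unit element, whose transfer is trivial. \<open>RR_res\<close>,
  with the quotient of C^I by norms as target, then shows that the same element is a norm over
  \<open>I\<close>.\<close>

lemma Nm_res:
 assumes N: "onorm H U" and NI: "onorm I U" and sub: "I <= H" and b: "b : Nm H U"
 shows "b : Nm I U"
proof -
 note U = onD[OF N] and Is = onD[OF NI]
 have Ic: "I <= cG" by (rule osD(3)[OF Is(1)])
 have Hc: "H <= cG" by (rule osD(3)[OF U(1)])
 interpret A: comm_group "ob M I" by (rule ob_comm_group[OF Ic])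
 have sN: "subgroup (Nm I U) (ob M I)" by (rule Nm_subgroup_ob[OF fi_normal[OF NI]])
 have nN: "Nm I U \<lhd> ob M I" by (rule A.subgroup_imp_normal[OF sN])
 let ?A = "ob M I Mod Nm I U" and ?ka = "%a. Nm I U #>\<^bsub>ob M I\<^esub> a"
 define ps where "ps y = ?ka (SOME b. RR I U y b)" for y
 interpret Q: comm_group ?A by (rule A.abelian_FactGroup[OF sN])
 have ka: "?ka : hom (ob M I) ?A" by (rule normal.r_coset_hom_Mod[OF nN])
 have pska: "ps y = ?ka b" if R: "RR I U y b" for y b
 proof -
  have s: "RR I U y (SOME b. RR I U y b)" by (rule someI[where P = "RR I U y", OF R])
  show ?thesis unfolding ps_def Nm_coset_eq[OF NI RR_D(2)[OF s] RR_D(2)[OF R]] by (rule RR_unique[OF NI s R])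
 qed
 have ps: "ps : hom (G(|carrier := I|)) ?A"
 proof (rule homI)
  fix x assume "x : carrier (G(|carrier := I|))"
  then obtain a where a: "RR I U x a" using RR_exists[OF NI] by auto
  show "ps x : carrier ?A" unfolding pska[OF a] using hom_in_carrier[OF ka] RR_D(2)[OF a] by simp
 next
  fix x y assume "x : carrier (G(|carrier := I|))" "y : carrier (G(|carrier := I|))"
  then have xy: "x : I" "y : I" by auto
  obtain a where a: "RR I U x a" using RR_exists[OF NI xy(1)] by blast
  obtain b where b: "RR I U y b" using RR_exists[OF NI xy(2)] by blast
  have "ps (x *. y) = ps x *.\<^bsub>?A\<^esub> ps y" unfolding pska[OF a] pska[OF b] pska[OF RR_mult[OF NI a b]]
   using hom_mult[OF ka, of a b] RR_D(2)[OF a] RR_D(2)[OF b] by simp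
  then show "ps (x *.\<^bsub>G(|carrier := I|)\<^esub> y) = ps x *.\<^bsub>?A\<^esub> ps y" by simp
 qed
 have one_in: "\<one> : U" by (rule osD(5)[OF U(2)])
 have bH: "b : fx H" by (rule Nm_fx[OF N b])
 have R: "RR H U \<one> b" using RR_U[OF N one_in] b by blast
 define t where "t R = (SOME r. r : R)" for R :: "'g set"
 have tR: "t R : R" and Rx: "R #> \<one> = R" and tc: "t R : cG" if "R : rcosets\<^bsub>G(|carrier := H|)\<^esub> I" for R
 proof -
  have "EX y:H. R = I #> y" using that unfolding RCOSETS_def r_coset_def by auto
  then obtain y where y: "y : H" "R = I #> y" by blast
  have yc: "y : cG" using y(1) Hc by blast
  have "y : R" unfolding y(2) by (rule rcos_self[OF yc osD(1)[OF Is(1)]])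
  then show "t R : R" unfolding t_def by (rule someI)
  have Rc: "R <= cG" unfolding y(2) by (rule r_coset_subset_G[OF Ic yc])
  then show "R #> \<one> = R" by (rule coset_mult_one)
  show "t R : cG" using Rc \<open>t R : R\<close> by blast
 qed
 have RI1: "RR I U \<one> oC" using RR_U[OF NI one_in] sg_one[OF Nm_sub[OF NI]] by blast
 have "?ka b = (\<Otimes>\<^bsub>?A\<^esub>R\<in>rcosets\<^bsub>G(|carrier := H|)\<^esub> I. ps (t R *. \<one> *. inv (t (R #> \<one>))))"
  by (rule RR_res[OF N Is(1) sub Is(3) R tR Q.comm_group_axioms ps ka pska])
 also have "... = (\<Otimes>\<^bsub>?A\<^esub>R\<in>rcosets\<^bsub>G(|carrier := H|)\<^esub> I. \<one>\<^bsub>?A\<^esub>)"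
 proof (rule Q.finprod_cong')
  fix R assume R: "R : rcosets\<^bsub>G(|carrier := H|)\<^esub> I"
  have "ps (t R *. \<one> *. inv (t (R #> \<one>))) = ps \<one>" using Rx[OF R] tc[OF R] by simp
  also have "... = \<one>\<^bsub>?A\<^esub>" unfolding pska[OF RI1] using A.coset_mult_one[OF sg_sub[OF sN]] by simp
  finally show "ps (t R *. \<one> *. inv (t (R #> \<one>))) = \<one>\<^bsub>?A\<^esub>" .
 qed (rule refl, rule Pi_I, rule Q.one_closed)
 also have "... = \<one>\<^bsub>?A\<^esub>" by (rule Q.finprod_one)
 finally have "Nm I U #>\<^bsub>ob M I\<^esub> b = Nm I U" by simp
 moreover have "b : Nm I U #>\<^bsub>ob M I\<^esub> b" by (rule A.rcos_self[OF _ sN]) (use fx_mono[OF sub bH] in simp)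
 ultimately show ?thesis by simp
qed

lemma tate_presents: "presents (tate_H0 M) (%H U a. Nm H U #>\<^bsub>ob M H\<^esub> a)" unfolding presents_def
proof (intro conjI allI impI ballI)
 fix H U assume N: "onorm H U"
 note U = onD[OF N]
 have Hc: "H <= cG" and Uc: "U <= cG" using osD(3) U(1,2) by auto
 interpret A: comm_group "ob M H" by (rule ob_comm_group[OF Hc])
 have sN: "subgroup (Nm H U) (ob M H)" by (rule Nm_subgroup_ob[OF fi_normal[OF N]])
 have nN: "Nm H U \<lhd> ob M H" by (rule A.subgroup_imp_normal[OF sN])
 have obT: "ob (tate_H0 M) (H, U) = ob M H Mod Nm H U" by (simp add: tate_H0_def)
 show "comm_group (ob (tate_H0 M) (H, U))" unfolding obT by (rule A.abelian_FactGroup[OF sN])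
 show "(%a. Nm H U #>\<^bsub>ob M H\<^esub> a) ` fx H = carrier (ob (tate_H0 M) (H, U))" unfolding obT by (simp add: carrier_FactGroup)
 show "Nm H U #>\<^bsub>ob M H\<^esub> (a *: b) = (Nm H U #>\<^bsub>ob M H\<^esub> a) *.\<^bsub>ob (tate_H0 M) (H, U)\<^esub> (Nm H U #>\<^bsub>ob M H\<^esub> b)"
  if "a : fx H" "b : fx H" for a b unfolding obT using normal.rcos_sum[OF nN, of a b] that by simp
 show "Nm H U #>\<^bsub>ob M H\<^esub> a = Nm H U #>\<^bsub>ob M H\<^esub> b \<longleftrightarrow> a -. b : Nm H U" if "a : fx H" "b : fx H" for a b
  by (rule Nm_coset_eq[OF N that])
 fix g a assume g: "g : cG" and a: "a : fx H"
 let ?H = "cs g H" and ?U = "cs g U"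
 have ac: "a : cC" by (rule fxc[OF a])
 have c: "con (tate_H0 M) g (H, U) = image (act g)" by (simp add: tate_H0_def fixed_point_functor_def)
 have inv_conj: "cs (inv g) (cs g K) = K" if "K <= cG" for K
  using cs_conj_set[OF inv_closed[OF g] g that] g cs_one[OF that] by simp
 note f' = fi_normal[OF onorm_conj[OF N g]]
 \<comment> \<open>Conjugation acts by taking images of cosets, so the coset must be hit entirely;
   conjugating back by \<open>inv g\<close> supplies the preimages.\<close>
 have pull: "EX m:Nm H U. n = act g m" if n: "n : Nm ?H ?U" for n
 proof (rule bexI)
  show "act (inv g) n : Nm H U" using Nm_conj[OF f' inv_closed[OF g] n] unfolding inv_conj[OF Hc] inv_conj[OF Uc] .
  have "n : cC" by (rule sg_mem[OF Nm_subgroup[OF f'] n])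
  then show "n = act g (act (inv g) n)" using act_inv_cancel[OF inv_closed[OF g], of n] g by simp
 qed
 have mc: "m : cC" if "m : Nm H U" for m by (rule sg_mem[OF Nm_sub[OF N] that])
 show "con (tate_H0 M) g (H, U) (Nm H U #>\<^bsub>ob M H\<^esub> a) = Nm ?H ?U #>\<^bsub>ob M ?H\<^esub> act g a" unfolding c
 proof
  show "act g ` (Nm H U #>\<^bsub>ob M H\<^esub> a) <= Nm ?H ?U #>\<^bsub>ob M ?H\<^esub> act g a"
  proof
   fix z assume "z : act g ` (Nm H U #>\<^bsub>ob M H\<^esub> a)"
   then obtain m where m: "m : Nm H U" "z = act g (m *: a)" unfolding r_coset_def by auto
   have "z = act g m *: act g a" unfolding m(2) by (rule act_cmul[OF g mc[OF m(1)] ac])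
   then show "z : Nm ?H ?U #>\<^bsub>ob M ?H\<^esub> act g a" using Nm_conj[OF fi_normal[OF N] g m(1)] unfolding r_coset_def by auto
  qed
  show "Nm ?H ?U #>\<^bsub>ob M ?H\<^esub> act g a <= act g ` (Nm H U #>\<^bsub>ob M H\<^esub> a)"
  proof
   fix z assume "z : Nm ?H ?U #>\<^bsub>ob M ?H\<^esub> act g a"
   then obtain n where n: "n : Nm ?H ?U" "z = n *: act g a" unfolding r_coset_def by auto
   obtain m where m: "m : Nm H U" "n = act g m" using pull[OF n(1)] by blast
   have "z = act g (m *: a)" unfolding n(2) m(2) by (rule act_cmul[OF g mc[OF m(1)] ac, symmetric])
   moreover have "m *: a : Nm H U #>\<^bsub>ob M H\<^esub> a" unfolding r_coset_def using m(1) by auto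
   ultimately show "z : act g ` (Nm H U #>\<^bsub>ob M H\<^esub> a)" by blast
  qed
 qed
next
 fix H U I a assume N: "onorm H U" and NI: "onorm I U" and sub: "I <= H" and a: "a : fx H"
 have Hc: "H <= cG" and Ic: "I <= cG" using osD(3) onD(1) N NI by auto
 have "induced_map (ob M I) (Nm I U) (%a. a) (Nm H U #>\<^bsub>ob M H\<^esub> a) = Nm I U #>\<^bsub>ob M I\<^esub> a"
 proof (rule induced_map_coset)
  show "group (ob M H)" "group (ob M I)" using ob_comm_group Hc Ic comm_group.axioms(2) by auto
  show "subgroup (Nm H U) (ob M H)" "subgroup (Nm I U) (ob M I)" using Nm_subgroup_ob fi_normal N NI by auto
  show "(%a. a) : hom (ob M H) (ob M I)" using fx_mono[OF sub] by (auto simp: hom_def)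
  show "(%a. a) ` Nm H U <= Nm I U" using Nm_res[OF N NI sub] by blast
 qed (use a in simp)
 moreover have "res (tate_H0 M) (I, U) (H, U) = induced_map (ob M I) (Nm I U) (%a. a)"
  by (simp add: tate_H0_def fixed_point_functor_def)
 ultimately show "res (tate_H0 M) (I, U) (H, U) (Nm H U #>\<^bsub>ob M H\<^esub> a) = Nm I U #>\<^bsub>ob M I\<^esub> a" by simp
next
 fix H U I V a assume N: "onorm H U" and NI: "onorm I V" and sub: "I <= H" "V <= U" and a: "a : fx I"
 have Hc: "H <= cG" and Ic: "I <= cG" using osD(3) onD(1) N NI by auto
 note f = open_fi[OF N NI sub(1)]
 have "induced_map (ob M H) (Nm H U) (nrm H I) (Nm I V #>\<^bsub>ob M I\<^esub> a) = Nm H U #>\<^bsub>ob M H\<^esub> nrm H I a"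
 proof (rule induced_map_coset)
  show "group (ob M H)" "group (ob M I)" using ob_comm_group Hc Ic comm_group.axioms(2) by auto
  show "subgroup (Nm H U) (ob M H)" "subgroup (Nm I V) (ob M I)" using Nm_subgroup_ob fi_normal N NI by auto
  show "nrm H I : hom (ob M I) (ob M H)" by (rule group_hom.homh[OF nrm_group_hom[OF f]])
  show "nrm H I ` Nm I V <= Nm H U" using Nm_ind[OF N NI sub] by blast
 qed (use a in simp)
 moreover have "ind (tate_H0 M) (H, U) (I, V) = induced_map (ob M H) (Nm H U) (nrm H I)" by (simp add: tate_H0_def)
 ultimately show "ind (tate_H0 M) (H, U) (I, V) (Nm I V #>\<^bsub>ob M I\<^esub> a) = Nm H U #>\<^bsub>ob M H\<^esub> nrm H I a" by simp
qed

section \<open>The functor of abelianized quotients, presented by fibres of the reciprocity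
  relation\<close>

abbreviation dq :: "'g set => 'g set => 'g set set" where
 "dq H U == derived (quo H U) (carrier (quo H U))"

text \<open>The fibre of the reciprocity relation over \<open>a\<close>. By \<open>fib_coset\<close>
  it is a coset of the commutator subgroup of H/U, so this is the inverse of the reciprocity
  map.\<close>

definition fib :: "'g set => 'g set => 'c => 'g set set" where
 "fib H U a = {U #> y | y. RR H U y a}"

lemma dq_normal: "onorm H U ==> dq H U \<lhd> quo H U" by (rule group.derived_self_is_normal[OF quo_group])

lemma dq_subgroup: "onorm H U ==> subgroup (dq H U) (quo H U)" by (rule normal_imp_subgroup[OF dq_normal])

lemma mem_fib:
 assumes N: "onorm H U" and y: "y : H" shows "U #> y : fib H U a \<longleftrightarrow> RR H U y a"
proof
 assume "U #> y : fib H U a"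
 then obtain z where z: "U #> y = U #> z" "RR H U z a" unfolding fib_def by auto
 have "z *. inv y : U" using quo_eq_iff[OF N RR_D(1)[OF z(2)] y] z(1) by simp
 then show "RR H U y a" by (rule RR_change[OF N z(2) y])
qed (auto simp: fib_def)

lemma fib_coset:
 assumes N: "onorm H U" and R: "RR H U x a"
 shows "dq H U #>\<^bsub>quo H U\<^esub> (U #> x) = fib H U a"
proof
 note U = onD[OF N] note Hs = osD[OF U(1)]
 have x: "x : H" by (rule RR_D(1)[OF R])
 have ac: "a : cC" by (rule RR_D(3)[OF R])
 show "dq H U #>\<^bsub>quo H U\<^esub> (U #> x) <= fib H U a"
 proof
  fix z assume "z : dq H U #>\<^bsub>quo H U\<^esub> (U #> x)"
  then obtain D where D: "D : dq H U" "z = D *.\<^bsub>quo H U\<^esub> (U #> x)" unfolding r_coset_def by auto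
  have "D : carrier (quo H U)" by (rule sg_mem[OF dq_subgroup[OF N] D(1)])
  then obtain y where y: "y : H" "D = U #> y" unfolding quo_carrier by blast
  have "RR H U y oC" using RR_kernel[OF N y(1)] D(1) y(2) by simp
  then have "RR H U (y *. x) (oC *: a)" by (rule RR_mult[OF N _ R])
  then show "z : fib H U a" unfolding D(2) y(2) quo_mult[OF N y(1) x] fib_def using ac by auto
 qed
 show "fib H U a <= dq H U #>\<^bsub>quo H U\<^esub> (U #> x)"
 proof
  fix z assume "z : fib H U a"
  then obtain y where y: "RR H U y a" "z = U #> y" unfolding fib_def by blast
  have yH: "y : H" by (rule RR_D(1)[OF y(1)])
  have yx: "y *. inv x : H" by (rule Hs(6)[OF yH Hs(7)[OF x]])
  have "RR H U (y *. inv x) (a *: /: a)" by (rule RR_mult[OF N y(1) RR_inv[OF N R]])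
  then have "U #> (y *. inv x) : dq H U" using RR_kernel[OF N yx] ac by simp
  moreover have "z = (U #> (y *. inv x)) *.\<^bsub>quo H U\<^esub> (U #> x)"
   unfolding y(2) quo_mult[OF N yx x] using Hs(4)[OF yH] Hs(4)[OF x] by (simp add: gnorm)
  ultimately show "z : dq H U #>\<^bsub>quo H U\<^esub> (U #> x)" unfolding r_coset_def by blast
 qed
qed

text \<open>Surjectivity makes fibres nonempty; equal fibres thus share an element, and its values
  are unique modulo norms.\<close>

lemma fib_eq_iff:
 assumes N: "onorm H U" and a: "a : fx H" and b: "b : fx H"
 shows "fib H U a = fib H U b \<longleftrightarrow> a -. b : Nm H U"
proof
 have ac: "a : cC" "b : cC" using fxc a b by auto
 assume eq: "fib H U a = fib H U b"
 obtain x where x: "RR H U x a" using RR_surj[OF N] a unfolding RR_surj_def by blast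
 have "RR H U x b" using mem_fib[OF N RR_D(1)[OF x]] x eq by blast
 then show "a -. b : Nm H U" by (rule RR_unique[OF N x])
next
 have ac: "a : cC" "b : cC" using fxc a b by auto
 assume ab: "a -. b : Nm H U"
 have ba: "b -. a : Nm H U" by (rule C.cong_sym[OF Nm_sub[OF N] ac ab])
 have "RR H U y a \<longleftrightarrow> RR H U y b" for y using RR_mod[OF N _ b ba] RR_mod[OF N _ a ab] by blast
 then show "fib H U a = fib H U b" unfolding fib_def by simp
qed

lemma ob_pi: "ob (pi_functor G) (H, U) = quo H U Mod dq H U" by (simp add: pi_functor_def abelianization_def)

lemma fib_image:
 assumes N: "onorm H U" shows "fib H U ` fx H = carrier (ob (pi_functor G) (H, U))"
proof
 show "fib H U ` fx H <= carrier (ob (pi_functor G) (H, U))"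
 proof
  fix X assume "X : fib H U ` fx H"
  then obtain a where a: "a : fx H" "X = fib H U a" by blast
  obtain x where x: "RR H U x a" using RR_surj[OF N] a(1) unfolding RR_surj_def by blast
  show "X : carrier (ob (pi_functor G) (H, U))"
   unfolding a(2) fib_coset[OF N x, symmetric] ob_pi carrier_FactGroup using quo_mem[OF RR_D(1)[OF x]] by blast
 qed
 show "carrier (ob (pi_functor G) (H, U)) <= fib H U ` fx H"
 proof
  fix X assume "X : carrier (ob (pi_functor G) (H, U))"
  then obtain x where x: "x : H" "X = dq H U #>\<^bsub>quo H U\<^esub> (U #> x)" unfolding ob_pi carrier_FactGroup quo_carrier by auto
  obtain a where a: "RR H U x a" using RR_exists[OF N x(1)] by blast
  show "X : fib H U ` fx H" unfolding x(2) fib_coset[OF N a] using RR_D(2)[OF a] by blast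
 qed
qed

lemma fib_mult:
 assumes N: "onorm H U" and a: "a : fx H" and b: "b : fx H"
 shows "fib H U (a *: b) = fib H U a *.\<^bsub>ob (pi_functor G) (H, U)\<^esub> fib H U b"
proof -
 obtain x where x: "RR H U x a" using RR_surj[OF N] a unfolding RR_surj_def by blast
 obtain y where y: "RR H U y b" using RR_surj[OF N] b unfolding RR_surj_def by blast
 show ?thesis
  unfolding fib_coset[OF N x, symmetric] fib_coset[OF N y, symmetric] fib_coset[OF N RR_mult[OF N x y], symmetric]
   ob_pi mult_FactGroup quo_mult[OF N RR_D(1)[OF x] RR_D(1)[OF y], symmetric]
  by (rule normal.rcos_sum[OF dq_normal[OF N] quo_mem[OF RR_D(1)[OF x]] quo_mem[OF RR_D(1)[OF y]], symmetric])
qed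

lemma cs_coset:
 assumes "g : cG" "U <= cG" "y : cG"
 shows "cs g (U #> y) = cs g U #> ce g y"
proof -
 have e: "ce g (u *. y) = ce g u *. ce g y" if "u : U" for u using ce_mult[of g u y] assms that by blast
 have "cs g (U #> y) = (%u. ce g (u *. y)) ` U" unfolding conj_set_def r_coset_def by auto
 also have "... = (%u. ce g u *. ce g y) ` U" by (rule image_cong[OF refl e])
 also have "... = cs g U #> ce g y" unfolding conj_set_def r_coset_def by auto
 finally show ?thesis .
qed

lemma fib_conj:
 assumes N: "onorm H U" and g: "g : cG"
 shows "cs g ` fib H U a <= fib (cs g H) (cs g U) (act g a)"
proof
 note U = onD[OF N]
 fix X assume "X : cs g ` fib H U a"
 then obtain y where y: "RR H U y a" "X = cs g (U #> y)" unfolding fib_def by auto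
 have yc: "y : cG" by (rule osD(4)[OF U(1) RR_D(1)[OF y(1)]])
 show "X : fib (cs g H) (cs g U) (act g a)"
  unfolding y(2) cs_coset[OF g osD(3)[OF U(2)] yc] fib_def using RR_conj[OF N y(1) g] by blast
qed

lemma fib_conj_eq:
 assumes N: "onorm H U" and g: "g : cG" and a: "a : fx H"
 shows "cs g ` fib H U a = fib (cs g H) (cs g U) (act g a)"
proof (rule subset_antisym[OF fib_conj[OF N g]])
 note U = onD[OF N]
 have Hc: "H <= cG" and Uc: "U <= cG" using osD(3) U(1,2) by auto
 let ?H = "cs g H" and ?U = "cs g U"
 note N' = onorm_conj[OF N g]
 have ig: "inv g : cG" using g by simp
 have inv_conj: "cs (inv g) (cs g K) = K" "cs g (cs (inv g) K) = K"
  if "K <= cG" for K using cs_conj_set[OF ig g that] cs_conj_set[OF g ig that] g cs_one[OF that] by simp_all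
 show "fib ?H ?U (act g a) <= cs g ` fib H U a"
 proof
  fix X assume X: "X : fib ?H ?U (act g a)"
  then obtain y where y: "RR ?H ?U y (act g a)" "X = ?U #> y" unfolding fib_def by blast
  have yc: "y : cG" using osD(4)[OF onD(1)[OF N'] RR_D(1)[OF y(1)]] .
  have Xc: "X <= cG" unfolding y(2) by (rule r_coset_subset_G[OF osD(3)[OF onD(2)[OF N']] yc])
  have "cs (inv g) X : fib (cs (inv g) ?H) (cs (inv g) ?U) (act (inv g) (act g a))" using fib_conj[OF N' ig] X by blast
  then have "cs (inv g) X : fib H U a" unfolding inv_conj(1)[OF Hc] inv_conj(1)[OF Uc] act_inv_cancel[OF g fxc[OF a]] .
  then show "X : cs g ` fib H U a" using inv_conj(2)[OF Xc] by (metis imageI)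
 qed
qed

lemma fib_ind:
 assumes N: "onorm H U" and NI: "onorm I V" and sub: "I <= H" "V <= U" and a: "a : fx I"
 shows "ind (pi_functor G) (H, U) (I, V) (fib I V a) = fib H U (nrm H I a)"
proof -
 note U = onD[OF N] and Is = onD[OF NI]
 have Uc: "U <= cG" and Vc: "V <= cG" and Ic: "I <= cG" using osD(3) U(2) Is(1,2) by auto
 let ?f = "induced_map G U (%x. x)"
 have f: "?f (V #> y) = U #> y" if y: "y : I" for y
  using induced_map_coset[OF is_group is_group osD(1)[OF Is(2)] osD(1)[OF U(2)], of "%x. x" y]
   sub(2) subsetD[OF Ic y] by (auto simp: hom_def)
 have fh: "?f : hom (quo I V) (quo H U)"
 proof (rule homI)
  fix X assume "X : carrier (quo I V)"
  then obtain x where x: "x : I" "X = V #> x" unfolding quo_carrier by blast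
  show "?f X : carrier (quo H U)" unfolding x(2) f[OF x(1)] by (rule quo_mem[OF subsetD[OF sub(1) x(1)]])
 next
  fix X Y assume "X : carrier (quo I V)" "Y : carrier (quo I V)"
  then obtain x y where x: "x : I" "X = V #> x" and y: "y : I" "Y = V #> y" unfolding quo_carrier by blast
  have xy: "x *. y : I" by (rule osD(6)[OF Is(1) x(1) y(1)])
  show "?f (X *.\<^bsub>quo I V\<^esub> Y) = ?f X *.\<^bsub>quo H U\<^esub> ?f Y"
   unfolding x(2) y(2) quo_mult[OF NI x(1) y(1)] f[OF xy] f[OF x(1)] f[OF y(1)]
   by (rule quo_mult[OF N subsetD[OF sub(1) x(1)] subsetD[OF sub(1) y(1)], symmetric])
 qed
 have fD: "?f ` dq I V <= dq H U"
 proof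
  fix X assume "X : ?f ` dq I V"
  then obtain Y where Y: "Y : dq I V" "X = ?f Y" by blast
  have "Y : carrier (quo I V)" by (rule sg_mem[OF dq_subgroup[OF NI] Y(1)])
  then obtain y where y: "y : I" "Y = V #> y" unfolding quo_carrier by blast
  have "RR I V y oC" using RR_kernel[OF NI y(1)] Y(1) y(2) by simp
  then have "RR H U y (nrm H I oC)" by (rule RR_ind[OF N NI sub])
  then have "RR H U y oC" using nrm_one[OF open_fi[OF N NI sub(1)]] by simp
  then show "X : dq H U" unfolding Y(2) y(2) f[OF y(1)] using RR_kernel[OF N subsetD[OF sub(1) y(1)]] by simp
 qed
 obtain x where x: "RR I V x a" using RR_surj[OF NI] a unfolding RR_surj_def by blast
 have xI: "x : I" by (rule RR_D(1)[OF x])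
 have "ind (pi_functor G) (H, U) (I, V) = induced_map (quo H U) (dq H U) ?f" by (simp add: pi_functor_def)
 then have "ind (pi_functor G) (H, U) (I, V) (fib I V a) = dq H U #>\<^bsub>quo H U\<^esub> ?f (V #> x)"
  using induced_map_coset[OF quo_group[OF NI] quo_group[OF N] dq_subgroup[OF NI] dq_subgroup[OF N] fh fD quo_mem[OF xI]]
   fib_coset[OF NI x] by simp
 then show ?thesis unfolding f[OF xI] fib_coset[OF N RR_ind[OF N NI sub x]] .
qed

lemma quo_sub:
 assumes "I <= H" shows "(quo H U)(|carrier := carrier (quo I U)|) = quo I U"
 by (simp add: quotient_grp_def FactGroup_def set_mult_def fun_eq_iff)

lemma quo_r_coset: "r_coset (quo H U) = r_coset (quo I U)"
 by (simp add: quotient_grp_def FactGroup_def set_mult_def r_coset_def fun_eq_iff)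

text \<open>\<open>transfer_map\<close> works in H/U with cosets of I/U. The map \<open>bar\<close>
  matches them with cosets of \<open>I\<close> in \<open>H\<close>, and lifting the representatives
  along it turns the product into the one evaluated by \<open>RR_res\<close>.\<close>

lemma fib_res:
 assumes N: "onorm H U" and NI: "onorm I U" and sub: "I <= H" and a: "a : fx H"
 shows "res (pi_functor G) (I, U) (H, U) (fib H U a) = fib I U a"
proof -
 note U = onD[OF N] and Is = onD[OF NI]
 note Hs = osD[OF U(1)] and Us = osD[OF U(2)] and Io = osD[OF Is(1)]
 let ?Q = "quo H U" and ?S = "carrier (quo I U)" and ?A = "quo I U Mod dq I U"
 interpret Q: group ?Q by (rule quo_group[OF N])
 interpret A: comm_group ?A by (rule group.derived_quot_is_comm_group[OF quo_group[OF NI]])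
 define X where "X = (SOME x. x : fib H U a)"
 define t where "t = (%R :: 'g set set. SOME r. r : R)"
 have "EX Z. Z : fib H U a" using RR_surj[OF N] a unfolding RR_surj_def fib_def by blast
 then have "X : fib H U a" unfolding X_def by (rule someI_ex)
 then obtain x where x: "RR H U x a" "X = U #> x" unfolding fib_def by blast
 have xH: "x : H" by (rule RR_D(1)[OF x(1)])
 have xc: "x : cG" by (rule Hs(4)[OF xH])
 let ?F = "%R. dq I U #>\<^bsub>?Q\<^esub> (t R *.\<^bsub>?Q\<^esub> X *.\<^bsub>?Q\<^esub> inv\<^bsub>?Q\<^esub> (t (R #>\<^bsub>?Q\<^esub> X)))"
 have res: "res (pi_functor G) (I, U) (H, U) (fib H U a) = (\<Otimes>\<^bsub>?A\<^esub>R\<in>rcosets\<^bsub>?Q\<^esub> ?S. ?F R)"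
  unfolding pi_functor_def ric_functor.simps prod.case transfer_map_def Let_def quo_sub[OF sub] abelianization_def
   X_def[symmetric] t_def[symmetric] by (rule refl)
 define bar where "bar R = (%z. U #> z) ` R" for R :: "'g set"
 let ?R = "rcosets\<^bsub>G(|carrier := H|)\<^esub> I"
 have RI: "EX y:H. R = I #> y" if "R : ?R" for R using that unfolding RCOSETS_def r_coset_def by auto
 have IR: "I #> y : ?R" if "y : H" for y using that unfolding RCOSETS_def r_coset_def by auto
 have RH: "R <= H" if R: "R : ?R" for R
 proof -
  obtain y where "y : H" "R = I #> y" using RI[OF R] by blast
  then show ?thesis using Hs(6) sub unfolding r_coset_def by auto
 qed
 have self: "y : I #> y" if "y : H" for y by (rule rcos_self[OF Hs(4)[OF that] Io(1)])
 have bar_coset: "bar (I #> y) = ?S #>\<^bsub>?Q\<^esub> (U #> y)" if y: "y : H" for y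
 proof -
  have "U #> (i *. y) = (U #> i) *.\<^bsub>?Q\<^esub> (U #> y)" if "i : I" for i by (rule quo_mult[OF N subsetD[OF sub that] y, symmetric])
  then show ?thesis unfolding bar_def quo_carrier r_coset_def[of _ I] r_coset_def[of ?Q] by auto
 qed
 have bar_mult: "bar (R #> x) = bar R #>\<^bsub>?Q\<^esub> X" if R: "R : ?R" for R
 proof -
  have "U #> (z *. x) = (U #> z) *.\<^bsub>?Q\<^esub> X" if "z : R" for z
   unfolding x(2) by (rule quo_mult[OF N subsetD[OF RH[OF R] that] xH, symmetric])
  then show ?thesis unfolding bar_def r_coset_def[of _ R] r_coset_def[of ?Q] by auto
 qed
 have Rx: "R #> x : ?R" if R: "R : ?R" for R
 proof -
  obtain y where y: "y : H" "R = I #> y" using RI[OF R] by blast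
  have "R #> x = I #> (y *. x)" unfolding y(2) by (rule coset_mult_assoc[OF Io(3) Hs(4)[OF y(1)] xc])
  then show ?thesis using IR[OF Hs(6)[OF y(1) xH]] by simp
 qed
 have bij: "bij_betw bar ?R (rcosets\<^bsub>?Q\<^esub> ?S)" unfolding bij_betw_def
 proof
  show "inj_on bar ?R"
  proof (rule inj_onI)
   fix R R' assume R: "R : ?R" and R': "R' : ?R" and eq: "bar R = bar R'"
   obtain y where y: "y : H" "R = I #> y" using RI[OF R] by blast
   obtain y' where y': "y' : H" "R' = I #> y'" using RI[OF R'] by blast
   have "U #> y : bar R'" unfolding eq[symmetric] unfolding bar_def y(2) using self[OF y(1)] by (rule imageI)
   then obtain z where z: "U #> y = U #> z" "z : R'" unfolding bar_def by (rule imageE)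
   have zH: "z : H" using RH[OF R'] z(2) by blast
   have "y *. inv z : I" using quo_eq_iff[OF N y(1) zH] z(1) Is(3) by blast
   then have "I #> y = I #> z" using rcos_eq_iff[OF Io(1) Hs(4)[OF y(1)] Hs(4)[OF zH]] by simp
   also have "... = I #> y'" using repr_independence[of z I y', OF _ Hs(4)[OF y'(1)] Io(1)] z(2) unfolding y'(2) by simp
   finally show "R = R'" unfolding y(2) y'(2) .
  qed
  show "bar ` ?R = rcosets\<^bsub>?Q\<^esub> ?S"
  proof
   show "bar ` ?R <= rcosets\<^bsub>?Q\<^esub> ?S"
   proof
   fix Z assume "Z : bar ` ?R"
   then obtain R where R: "Z = bar R" "R : ?R" by (rule imageE)
   obtain y where y: "y : H" "R = I #> y" using RI[OF R(2)] by blast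
   show "Z : rcosets\<^bsub>?Q\<^esub> ?S" unfolding R(1) y(2) bar_coset[OF y(1)] RCOSETS_def using quo_mem[OF y(1)] by blast
   qed
   show "rcosets\<^bsub>?Q\<^esub> ?S <= bar ` ?R"
   proof
   fix Z assume "Z : rcosets\<^bsub>?Q\<^esub> ?S"
   then obtain Y where Y: "Y : carrier ?Q" "Z = ?S #>\<^bsub>?Q\<^esub> Y" unfolding RCOSETS_def by blast
   obtain y where y: "y : H" "Y = U #> y" using Y(1) unfolding quo_carrier by blast
   have "Z = bar (I #> y)" unfolding Y(2) y(2) bar_coset[OF y(1)] ..
   then show "Z : bar ` ?R" using IR[OF y(1)] by (rule image_eqI)
   qed
  qed
 qed
 \<comment> \<open>Lifts the representative chosen by \<open>transfer_map\<close> to an element of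
   the corresponding coset in \<open>H\<close>.\<close>
 define t' where "t' R = (SOME y. y : R & U #> y = t (bar R))" for R
 have t': "t' R : R" "U #> t' R = t (bar R)" if R: "R : ?R" for R
 proof -
  obtain y where y: "y : H" "R = I #> y" using RI[OF R] by blast
  have "U #> y : bar R" unfolding bar_def y(2) using self[OF y(1)] by (rule imageI)
  then have "t (bar R) : bar R" unfolding t_def by (rule someI)
  then obtain z where "t (bar R) = U #> z" "z : R" unfolding bar_def by (rule imageE)
  then have "EX z. z : R & U #> z = t (bar R)" by auto
  then have "t' R : R & U #> t' R = t (bar R)" unfolding t'_def by (rule someI_ex)
  then show "t' R : R" "U #> t' R = t (bar R)" by auto
 qed
 define ps where "ps y = dq I U #>\<^bsub>quo I U\<^esub> (U #> y)" for y
 have ps: "ps : hom (G(|carrier := I|)) ?A"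
 proof (rule homI)
  fix y assume "y : carrier (G(|carrier := I|))"
  then show "ps y : carrier ?A" unfolding ps_def carrier_FactGroup using quo_mem by auto
 next
  fix y z assume "y : carrier (G(|carrier := I|))" "z : carrier (G(|carrier := I|))"
  then have yz: "y : I" "z : I" by auto
  have "ps (y *. z) = ps y *.\<^bsub>?A\<^esub> ps z" unfolding ps_def mult_FactGroup quo_mult[OF NI yz, symmetric]
   by (rule normal.rcos_sum[OF dq_normal[OF NI] quo_mem[OF yz(1)] quo_mem[OF yz(2)], symmetric])
  then show "ps (y *.\<^bsub>G(|carrier := I|)\<^esub> z) = ps y *.\<^bsub>?A\<^esub> ps z" by simp
 qed
 have ka: "fib I U : hom (ob M I) ?A" using fib_image[OF NI] fib_mult[OF NI] unfolding ob_pi by (auto simp: hom_def)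
 have pska: "ps y = fib I U b" if "RR I U y b" for y b unfolding ps_def by (rule fib_coset[OF NI that])
 have main: "fib I U a = (\<Otimes>\<^bsub>?A\<^esub>R\<in>?R. ps (t' R *. x *. inv (t' (R #> x))))"
  by (rule RR_res[OF N Is(1) sub Is(3) x(1) t'(1) A.comm_group_axioms ps ka pska])
 have mem: "t' R *. x *. inv (t' (R #> x)) : I" if R: "R : ?R" for R
 proof -
  obtain y where y: "y : H" "R = I #> y" using RI[OF R] by blast
  have yc: "y : cG" by (rule Hs(4)[OF y(1)])
  have e: "R #> x = I #> (y *. x)" unfolding y(2) by (rule coset_mult_assoc[OF Io(3) yc xc])
  obtain i where i: "i : I" "t' R = i *. y" using t'(1)[OF R] unfolding y(2) r_coset_def by blast
  have "t' (R #> x) : I #> (y *. x)" using t'(1)[OF Rx[OF R]] e by simp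
  then have "EX j:I. t' (R #> x) = j *. (y *. x)" unfolding r_coset_def[of G I] by auto
  then obtain j where j: "j : I" "t' (R #> x) = j *. (y *. x)" by blast
  have "t' R *. x *. inv (t' (R #> x)) = i *. inv j"
   unfolding i(2) j(2) using Io(4)[OF i(1)] Io(4)[OF j(1)] yc xc by (simp add: gnorm)
  then show ?thesis using Io(6)[OF i(1) Io(7)[OF j(1)]] by simp
 qed
 have F: "?F (bar R) = ps (t' R *. x *. inv (t' (R #> x)))" if R: "R : ?R" for R
 proof -
  have tH: "t' R : H" "t' (R #> x) : H" using t'(1)[OF R] t'(1)[OF Rx[OF R]] RH[OF R] RH[OF Rx[OF R]] by auto
  have "t (bar R) *.\<^bsub>?Q\<^esub> X *.\<^bsub>?Q\<^esub> inv\<^bsub>?Q\<^esub> (t (bar (R #> x))) = U #> (t' R *. x *. inv (t' (R #> x)))"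
   unfolding t'(2)[OF R, symmetric] t'(2)[OF Rx[OF R], symmetric] x(2)
   quo_inv[OF N tH(2)] quo_mult[OF N tH(1) xH] quo_mult[OF N Hs(6)[OF tH(1) xH] Hs(7)[OF tH(2)]] ..
  then show ?thesis unfolding bar_mult[OF R] ps_def quo_r_coset[of H U I] by simp
 qed
 have Fc: "?F : rcosets\<^bsub>?Q\<^esub> ?S \<rightarrow> carrier ?A"
 proof
  fix Z assume "Z : rcosets\<^bsub>?Q\<^esub> ?S"
  then obtain R where R: "R : ?R" "Z = bar R" using bij unfolding bij_betw_def by blast
  show "?F Z : carrier ?A" unfolding R(2) F[OF R(1)] by (rule hom_in_carrier[OF ps]) (use mem[OF R(1)] in simp)
 qed
 have "(\<Otimes>\<^bsub>?A\<^esub>R\<in>rcosets\<^bsub>?Q\<^esub> ?S. ?F R) = (\<Otimes>\<^bsub>?A\<^esub>R\<in>?R. ?F (bar R))" by (rule A.finprod_bij_betw[OF bij Fc, symmetric])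
 also have "... = (\<Otimes>\<^bsub>?A\<^esub>R\<in>?R. ps (t' R *. x *. inv (t' (R #> x))))"
  by (rule A.finprod_cong'[OF refl _ F]) (use hom_in_carrier[OF ps] mem in auto)
 finally show ?thesis using res main by simp
qed

lemma pi_presents: "presents (pi_functor G) fib" unfolding presents_def
proof (intro conjI allI impI ballI)
 fix H U assume N: "onorm H U"
 show "comm_group (ob (pi_functor G) (H, U))" unfolding ob_pi by (rule group.derived_quot_is_comm_group[OF quo_group[OF N]])
 show "fib H U ` fx H = carrier (ob (pi_functor G) (H, U))" by (rule fib_image[OF N])
 show "con (pi_functor G) g (H, U) (fib H U a) = fib (cs g H) (cs g U) (act g a)"
  if "g : cG" "a : fx H" for g a using fib_conj_eq[OF N that] by (simp add: pi_functor_def)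
qed (rule fib_mult fib_eq_iff fib_res fib_ind; assumption)+

text \<open>The definite description is justified: a Frobenius lift with a prime element exists, and
  by \<open>RR_unique\<close> every admissible choice leads to the norm class of
  \<open>a\<close>.\<close>

lemma fesenko_neukirch_value:
 assumes N: "onorm H U" and a: "a : fx H"
 shows "fesenko_neukirch_morphism P G Om d om M v (H, U) (fib H U a) = Nm H U #>\<^bsub>ob M H\<^esub> a"
proof -
 note U = onD[OF N] note Us = osD[OF U(2)]
 let ?y = "%h al. Nm H U #>\<^bsub>ob M H\<^esub> (nrm H (Sg h U) al [^]\<^bsub>ob M H\<^esub> prime_to_P_part P (Omega_mult Om om (dr H h)))"
 have val: "?y h al = Nm H U #>\<^bsub>ob M H\<^esub> a"
  if f: "frob H U h n" and pe: "prime_element om M v (Sg h U) al" and R: "RR H U h a" for h n al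
 proof -
  have p: "prim U h al" using pe prim_iff[OF f] by simp
  have "Omega_mult Om om (dr H h) = n"
   unfolding Omega_mult_def frobD(8)[OF f] by (rule the_equality) (use frobD(7)[OF f] Om.om_pow_inj in auto)
  then have e: "nrm H (Sg h U) al [^]\<^bsub>ob M H\<^esub> prime_to_P_part P (Omega_mult Om om (dr H h)) = rval H U h n al"
   unfolding rval_def by simp
  show ?thesis unfolding e Nm_coset_eq[OF N rval_closed(1)[OF f p] a] by (rule RR_unique[OF N RR_frob[OF f p] R])
 qed
 show ?thesis unfolding fesenko_neukirch_morphism_def prod.case
 proof (rule the_equality)
  obtain x where x: "RR H U x a" using RR_surj[OF N] a unfolding RR_surj_def by blast
  have xH: "x : H" by (rule RR_D(1)[OF x])
  obtain h n where h: "frob H U h n" "h *. inv x : U" using frob_lift[OF N xH] by blast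
  have hc: "h : cG" "x : cG" using frobD(6)[OF h(1)] osD(4)[OF U(1) xH] by auto
  have "inv (h *. inv x) : U" by (rule Us(7)[OF h(2)])
  then have "x *. inv h : U" using hc by (simp add: inv_mult_group)
  then have R: "RR H U h a" by (rule RR_change[OF N x frobD(5)[OF h(1)]])
  obtain al where "prim U h al" using prim_exists[OF h(1)] by blast
  then have pe: "prime_element om M v (Sg h U) al" using prim_iff[OF h(1)] by simp
  have "h : Frob G Om d om H" unfolding Frob_def using frobD(5,7,8)[OF h(1)] by blast
  moreover have "U #> h : fib H U a" using R unfolding fib_def by blast
  ultimately show "EX h:Frob G Om d om H. EX al. U #> h : fib H U a & prime_element om M v (Sg h U) al &
   Nm H U #>\<^bsub>ob M H\<^esub> a = ?y h al" using val[OF h(1) pe R] pe by metis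
 next
  fix Y assume "EX h:Frob G Om d om H. EX al. U #> h : fib H U a & prime_element om M v (Sg h U) al & Y = ?y h al"
  then obtain h al where h: "h : Frob G Om d om H" "U #> h : fib H U a" "prime_element om M v (Sg h U) al" "Y = ?y h al"
   by blast
  obtain n where n: "h : H" "n > 0" "dr H h = om ^. (n::nat)" using h(1) unfolding Frob_def by blast
  have f: "frob H U h n" using N n unfolding frob_def by simp
  have R: "RR H U h a" using mem_fib[OF N n(1)] h(2) by simp
  show "Y = Nm H U #>\<^bsub>ob M H\<^esub> a" unfolding h(4) by (rule val[OF f h(3) R])
 qed
qed

text \<open>Under the reciprocity relation of the larger quotient H/W the norm group of
  \<open>U\<close> corresponds to U/W. Thus norm groups for several \<open>U\<close> can be compared
  through one relation.\<close>

lemma norm_mem_iff: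
 assumes N: "onorm H U" and W: "onorm H W" and sub: "W <= U" and c: "comm_group (quo H U)"
  and R: "RR H W x a"
 shows "a : Nm H U \<longleftrightarrow> x : U"
proof -
 have aH: "a : fx H" by (rule RR_D(2)[OF R])
 have "RR H U x (nrm H H a)" by (rule RR_ind[OF N W subset_refl sub R])
 then have RU: "RR H U x a" using nrm_self[OF osD(1)[OF onD(1)[OF N]] aH] by simp
 show ?thesis
 proof
  assume "a : Nm H U"
  then have "RR H U x oC" using RR_1_iff[OF N RU] by simp
  then show "x : U" using RR_inj_abelian[OF N c] unfolding RR_inj_def by blast
 next
  assume "x : U"
  then show "a : Nm H U" using RR_U[OF N] RU by blast
 qed
qed

text \<open>All norm groups are read off from the relation for H/W with W the intersection:
  membership of a value becomes membership of \<open>x\<close> in \<open>U\<close>, in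
  \<open>V\<close>, in \<open>?W\<close> or in the product, and the lattice statements become
  obvious.\<close>

lemma norm_lattice:
 assumes N: "onorm H U" "onorm H V" and c: "comm_group (quo H U)" "comm_group (quo H V)"
  and W: "onorm H (U Int V)" "comm_group (quo H (U Int V))"
  and P: "onorm H (U <#>\<^bsub>G\<^esub> V)" "comm_group (quo H (U <#>\<^bsub>G\<^esub> V))"
 shows "Nm H U = Nm H V ==> U = V"
  and "Nm H (U Int V) = Nm H U Int Nm H V"
  and "Nm H (U <#>\<^bsub>G\<^esub> V) = Nm H U <#>\<^bsub>ob M H\<^esub> Nm H V"
proof -
 let ?W = "U Int V"
 note U = onD[OF N(1)] and V = onD[OF N(2)]
 have rep: "EX x. RR H ?W x a" if "a : fx H" for a using RR_surj[OF W(1)] that unfolding RR_surj_def by blast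
 have mU: "a : Nm H U \<longleftrightarrow> x : U" if "RR H ?W x a" for x a by (rule norm_mem_iff[OF N(1) W(1) Int_lower1 c(1) that])
 have mV: "a : Nm H V \<longleftrightarrow> x : V" if "RR H ?W x a" for x a by (rule norm_mem_iff[OF N(2) W(1) Int_lower2 c(2) that])
 have mW: "a : Nm H ?W \<longleftrightarrow> x : ?W" if "RR H ?W x a" for x a by (rule norm_mem_iff[OF W(1) W(1) subset_refl W(2) that])
 have UP: "u *. w : U <#>\<^bsub>G\<^esub> V" if "u : U" "w : V" for u w using that unfolding set_mult_def by blast
 have WP: "?W <= U <#>\<^bsub>G\<^esub> V"
 proof
  fix x assume x: "x : ?W"
  then have "x *. \<one> : U <#>\<^bsub>G\<^esub> V" using UP osD(5)[OF V(2)] by blast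
  then show "x : U <#>\<^bsub>G\<^esub> V" using osD(4)[OF U(2), of x] x by simp
 qed
 have mP: "a : Nm H (U <#>\<^bsub>G\<^esub> V) \<longleftrightarrow> x : U <#>\<^bsub>G\<^esub> V" if "RR H ?W x a" for x a by (rule norm_mem_iff[OF P(1) W(1) WP P(2) that])
 show "U = V" if eq: "Nm H U = Nm H V"
 proof -
  have "x : U \<longleftrightarrow> x : V" if x: "x : H" for x
  proof -
   obtain a where "RR H ?W x a" using RR_exists[OF W(1) x] by blast
   then show ?thesis using mU mV eq by blast
  qed
  then show ?thesis using U(3) V(3) by blast
 qed
 show "Nm H ?W = Nm H U Int Nm H V"
 proof -
  have "a : Nm H ?W \<longleftrightarrow> a : Nm H U Int Nm H V" if a: "a : fx H" for a
  proof -
   obtain x where "RR H ?W x a" using rep[OF a] by blast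
   then show ?thesis using mU mV mW by blast
  qed
  then show ?thesis using Nm_fx[OF W(1)] Nm_fx[OF N(1)] by blast
 qed
 show "Nm H (U <#>\<^bsub>G\<^esub> V) = Nm H U <#>\<^bsub>ob M H\<^esub> Nm H V"
 proof
  show "Nm H (U <#>\<^bsub>G\<^esub> V) <= Nm H U <#>\<^bsub>ob M H\<^esub> Nm H V"
  proof
   fix a assume a: "a : Nm H (U <#>\<^bsub>G\<^esub> V)"
   obtain x where x: "RR H ?W x a" using rep[OF Nm_fx[OF P(1) a]] by blast
   then have "x : U <#>\<^bsub>G\<^esub> V" using mP a by blast
   then obtain u w where uw: "u : U" "w : V" "x = u *. w" unfolding set_mult_def by blast
   obtain al where al: "RR H ?W u al" using RR_exists[OF W(1) subsetD[OF U(3) uw(1)]] by blast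
   obtain bt where bt: "RR H ?W w bt" using RR_exists[OF W(1) subsetD[OF V(3) uw(2)]] by blast
   note cl = RR_D(3)[OF x] RR_D(3)[OF al] RR_D(3)[OF bt]
   have alU: "al : Nm H U" using mU[OF al] uw(1) by simp
   have btV: "bt : Nm H V" using mV[OF bt] uw(2) by simp
   have "RR H ?W x (al *: bt)" unfolding uw(3) by (rule RR_mult[OF W(1) al bt])
   then have "a -. (al *: bt) : Nm H ?W" by (rule RR_unique[OF W(1) x])
   moreover have "Nm H ?W <= Nm H U"
   proof
   fix z assume z: "z : Nm H ?W"
   obtain y where "RR H ?W y z" using rep[OF Nm_fx[OF W(1) z]] by blast
   then show "z : Nm H U" using mW mU z by blast
   qed
   ultimately have "a -. (al *: bt) : Nm H U" by blast
   then have "(a -. (al *: bt)) *: al : Nm H U" by (rule sg_mult[OF Nm_sub[OF N(1)] _ alU])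
   moreover have "a = ((a -. (al *: bt)) *: al) *: bt"
   proof -
   have "((a -. (al *: bt)) *: al) *: bt = (a -. (al *: bt)) *: (al *: bt)" using cl by (simp add: C.m_assoc)
   also have "... = a" using cl by (simp add: C.gdiv_def C.m_assoc del: C.inv_mult)
   finally show ?thesis by simp
   qed
   ultimately show "a : Nm H U <#>\<^bsub>ob M H\<^esub> Nm H V" unfolding set_mult_def using btV by auto
  qed
  show "Nm H U <#>\<^bsub>ob M H\<^esub> Nm H V <= Nm H (U <#>\<^bsub>G\<^esub> V)"
  proof
   fix z assume "z : Nm H U <#>\<^bsub>ob M H\<^esub> Nm H V"
   then obtain al bt where albt: "al : Nm H U" "bt : Nm H V" "z = al *: bt" unfolding set_mult_def by auto
   obtain x where x: "RR H ?W x al" using rep[OF Nm_fx[OF N(1) albt(1)]] by blast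
   obtain y where y: "RR H ?W y bt" using rep[OF Nm_fx[OF N(2) albt(2)]] by blast
   have "x : U" "y : V" using mU[OF x] mV[OF y] albt by auto
   then have "x *. y : U <#>\<^bsub>G\<^esub> V" by (rule UP)
   then show "z : Nm H (U <#>\<^bsub>G\<^esub> V)" unfolding albt(3) using mP[OF RR_mult[OF W(1) x y]] by blast
  qed
 qed
qed

lemma class_field_theory: "class_field_theory G M (fesenko_neukirch_morphism P G Om d om M v)"
 unfolding class_field_theory_def
proof (intro conjI allI impI)
 show "fct_isomorphism G (pi_functor G) (tate_H0 M) (fesenko_neukirch_morphism P G Om d om M v)"
  by (rule presents_isomorphism[OF pi_presents tate_presents fesenko_neukirch_value])
 fix H L assume "osub H" and L: "abelian_lattice G H L"
 have N: "onorm H U" "comm_group (quo H U)" if "U : L" for U using L that unfolding abelian_lattice_def by auto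
 have cl: "U <#>\<^bsub>G\<^esub> V : L" "U Int V : L" if "U : L" "V : L" for U V using L that unfolding abelian_lattice_def by auto
 have lat: "Nm H U = Nm H V ==> U = V" "Nm H (U Int V) = Nm H U Int Nm H V"
   "Nm H (U <#>\<^bsub>G\<^esub> V) = Nm H U <#>\<^bsub>ob M H\<^esub> Nm H V" if UV: "U : L" "V : L" for U V
  by (rule norm_lattice[OF N(1)[OF UV(1)] N(1)[OF UV(2)] N(2)[OF UV(1)] N(2)[OF UV(2)]
   N[OF cl(2)[OF UV]] N[OF cl(1)[OF UV]]]; assumption?)+
 show "ALL U:L. subgroup (Nm H U) (ob M H)" using Nm_subgroup_ob[OF fi_normal[OF N(1)]] by blast
 show "inj_on (norm_subgroup M H) L" by (rule inj_onI) (rule lat(1))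
 show "ALL U:L. ALL V:L. Nm H (U Int V) = Nm H U Int Nm H V & Nm H (U <#>\<^bsub>G\<^esub> V) = Nm H U <#>\<^bsub>ob M H\<^esub> Nm H V"
  using lat(2,3) by blast
qed

end

theorem corollary4p4p22:
  fixes P :: "nat set"
    and G :: "'g top_group"
    and \<Omega> :: "'w top_group"
    and \<omega> :: 'w
    and d :: "'g \<Rightarrow> 'w"
    and C :: "'c monoid"
    and act :: "'g \<Rightarrow> 'c \<Rightarrow> 'c"
    and v :: "'g set \<Rightarrow> 'c \<Rightarrow> 'w"
  defines "M \<equiv> fixed_point_functor G C act"
  assumes "P \<noteq> {}" and "\<forall>p\<in>P. prime p"
    and "pro_P_group P G"
    and "topological_group \<Omega>" and "topologically_isomorphic \<Omega> (Z_P P)"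
    and "topological_generator \<Omega> \<omega>"
    and "d \<in> hom G \<Omega>" and "continuous_map (topol G) (topol \<Omega>) d"
    and "d ` carrier G = carrier \<Omega>"
    and "discrete_module G C act"
    and "v \<in> valuations G \<Omega> d \<omega> M (generate \<Omega> {\<omega>})"
    and "\<And>H U. open_normal G H U \<Longrightarrow> inertia G \<Omega> d H \<subseteq> U \<Longrightarrow> class_field_axiom G M H U"
    and "\<And>H U. open_normal G H U \<Longrightarrow> cyclic_group (quotient_grp G H U) \<Longrightarrow>
           prime (order (quotient_grp G H U)) \<Longrightarrow> inertia_degree \<Omega> d H U = 1 \<Longrightarrow>
           class_field_axiom G M H U"
  shows "fesenko_neukirch_datum G \<Omega> d \<omega> M v \<and>
         class_field_theory G M (fesenko_neukirch_morphism P G \<Omega> d \<omega> M v)"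
proof -
  have G: "topological_group G" "compact_space (topol G)" "Hausdorff_space (topol G)"
    "\<And>N. open_normal G (carrier G) N \<Longrightarrow> prime_factors (order (G Mod N)) \<subseteq> P"
    using assms(4) unfolding pro_P_group_def profinite_group_def by auto
  have \<Omega>g: "group \<Omega>" by (rule topological_group.axioms(1)[OF assms(5)])
  note Z = Z_P_torsion_free_nondivisible[OF \<Omega>g assms(6) assms(3)]
  have top: "topspace (topol G) = carrier G" "topspace (topol \<Omega>) = carrier \<Omega>"
    using topological_group.topspace_eq G(1) assms(5) by auto
  \<comment> \<open>Compactness of Omega is obtained from the surjection \<open>d\<close> instead of
    from the model Z_P.\<close>
  have "compactin (topol \<Omega>) (d ` topspace (topol G))"
    by (rule image_compactin[OF _ assms(9)]) (use G(2) in \<open>simp add: compact_space_def\<close>)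
  then have c\<Omega>: "compact_space (topol \<Omega>)" unfolding compact_space_def top assms(10) .
  have "compact_group G" "compact_group \<Omega>"
    by (intro compact_group.intro top_grp.intro compact_group_axioms.intro G assms(5) c\<Omega> Z(3))+
  then have c: "cft P G \<Omega> \<omega> d C act v"
    by (intro cft.intro cft_module.intro ramification.intro pro_P.intro omega_group.intro pro_P_axioms.intro
        omega_group_axioms.intro ramification_axioms.intro cft_module_axioms.intro cft_axioms.intro)
      (use assms(2,3) G(4) Z(1,2) assms(7-14) in \<open>(assumption | simp add: M_def)+\<close>)
  show ?thesis
    unfolding M_def by (rule conjI[OF cft.fesenko_neukirch_datum[OF c] cft.class_field_theory[OF c]])
qed

end
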